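(* Let $A$ be a finite non-local commutative ring. Then the genus $\gamma(L(EG(A)))$ of the line graph of the essential graph of $A$ is $2$ if and only if $A$ is isomorphic to one of the rings: $\mathbb{F}_4\times\mathbb{Z}_5$, $\mathbb{Z}_3\times\mathbb{Z}_7$, $\mathbb{Z}_2\times\mathbb{F}_9$, $\mathbb{Z}_2\times\mathbb{Z}_2\times\mathbb{Z}_3$.
   Context: All rings have unity $1\neq 0$. $\mathbb{Z}_n$ is the ring of integers modulo $n$ and $\mathbb{F}_n$ the finite field with $n$ elements. A ring is local if it has exactly one maximal ideal. An ideal $I$ of a commutative ring $A$ is essential if $I\cap J\neq 0$ for every non-zero ideal $J$ of $A$ (so $A$ itself is essential). For $s\in A$, $\mathrm{ann}_A(s)=\{r\in A : sr=0\}$. The essential graph $EG(A)$ is the simple undirected graph whose vertices are the non-zero zero-divisors of $A$, two distinct vertices $u,v$ being adjacent if and only if $\mathrm{ann}_A(uv)$ is an essential ideal of $A$. The line graph $L(G)$ of a graph $G$ has the edges of $G$ as vertices, two distinct ones being adjacent exactly when the corresponding edges share an endpoint in $G$. The genus $\gamma(G)$ of a graph $G$ is the minimum integer $k\ge 0$ such that $G$ can be drawn without edge crossings on the orientable surface obtained from the sphere by attaching $k$ handles; planar graphs have genus $0$. *)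

theory Defs
  imports
    "HOL-Algebra.Algebra"
    "HOL-Number_Theory.Residues"
    "HOL-Analysis.Analysis"
    "HOL-Library.Extended_Nat"
begin

section \<open>Rings\<close>

definition local_ring :: "('a, 'b) ring_scheme \<Rightarrow> bool" where
  "local_ring A \<longleftrightarrow> (\<exists>!M. maximalideal M A)"

definition nonzero_zero_divisors :: "('a, 'b) ring_scheme \<Rightarrow> 'a set" where
  "nonzero_zero_divisors A =
     {a \<in> carrier A - {\<zero>\<^bsub>A\<^esub>}. \<exists>b \<in> carrier A - {\<zero>\<^bsub>A\<^esub>}. a \<otimes>\<^bsub>A\<^esub> b = \<zero>\<^bsub>A\<^esub>}"

definition ann :: "('a, 'b) ring_scheme \<Rightarrow> 'a \<Rightarrow> 'a set" where
  "ann A s = {r \<in> carrier A. s \<otimes>\<^bsub>A\<^esub> r = \<zero>\<^bsub>A\<^esub>}"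

definition essential_ideal :: "'a set \<Rightarrow> ('a, 'b) ring_scheme \<Rightarrow> bool" where
  "essential_ideal I A \<longleftrightarrow>
     ideal I A \<and> (\<forall>J. ideal J A \<longrightarrow> J \<noteq> {\<zero>\<^bsub>A\<^esub>} \<longrightarrow> I \<inter> J \<noteq> {\<zero>\<^bsub>A\<^esub>})"

text \<open>Finite fields of equal order are isomorphic, so a ring is a copy of ``the'' field with
  \<open>q\<close> elements exactly if it satisfies the following predicate.\<close>

definition is_finite_field :: "nat \<Rightarrow> ('a, 'b) ring_scheme \<Rightarrow> bool" where
  "is_finite_field q F \<longleftrightarrow> field F \<and> finite (carrier F) \<and> card (carrier F) = q"


section \<open>Graphs\<close>

text \<open>A simple undirected graph is a pair of a vertex set and an edge set; an edge is the
  two-element set of its endpoints.\<close>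

type_synonym 'v ugraph = "'v set \<times> 'v set set"

definition essential_graph :: "('a, 'b) ring_scheme \<Rightarrow> 'a ugraph" where
  "essential_graph A =
     (nonzero_zero_divisors A,
      {{u, v} | u v. u \<in> nonzero_zero_divisors A \<and> v \<in> nonzero_zero_divisors A \<and> u \<noteq> v \<and>
                     essential_ideal (ann A (u \<otimes>\<^bsub>A\<^esub> v)) A})"

definition line_graph :: "'v ugraph \<Rightarrow> 'v set ugraph" where
  "line_graph G = (snd G, {{e, f} | e f. e \<in> snd G \<and> f \<in> snd G \<and> e \<noteq> f \<and> e \<inter> f \<noteq> {}})"


section \<open>Genus\<close>

text \<open>The sphere with \<open>k\<close> handles is realised in three-dimensional space. The sphere is the
  boundary of a box whose top face lies in the plane \<open>z = 0\<close>. For every \<open>i < k\<close>, the two open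
  unit discs of the top face centred at \<open>(8 * i - 2, 0)\<close> and \<open>(8 * i + 2, 0)\<close> are removed, and
  the tube \<open>handle_tube i\<close> is attached along their boundary circles. This tube is the upper half
  of the torus obtained by revolving either of these circles about the line
  \<open>x = 8 * i, z = 0\<close>. Different tubes are disjoint, and each one meets the plane \<open>z = 0\<close>
  in its two boundary circles only.\<close>

definition box_sphere :: "nat \<Rightarrow> (real \<times> real \<times> real) set" where
  "box_sphere k = frontier ({-4 .. 8 * real k + 4} \<times> {-2 .. 2} \<times> {-1 .. 0})"

definition handle_discs :: "nat \<Rightarrow> (real \<times> real \<times> real) set" where
  "handle_discs i =
     {(x, y, z). z = 0 \<and> ((x - (8 * real i - 2))\<^sup>2 + y\<^sup>2 < 1 \<or> (x - (8 * real i + 2))\<^sup>2 + y\<^sup>2 < 1)}"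

definition handle_tube :: "nat \<Rightarrow> (real \<times> real \<times> real) set" where
  "handle_tube i =
     {(x, y, z). z \<ge> 0 \<and> (sqrt ((x - 8 * real i)\<^sup>2 + z\<^sup>2) - 2)\<^sup>2 + y\<^sup>2 = 1}"

definition handle_surface :: "nat \<Rightarrow> (real \<times> real \<times> real) set" where
  "handle_surface k = (box_sphere k - (\<Union>i<k. handle_discs i)) \<union> (\<Union>i<k. handle_tube i)"

text \<open>A drawing without crossings: vertices become distinct points, every edge becomes a simple
  arc joining its endpoints and avoiding all other vertices, and two different arcs meet only in
  the endpoints shared by the two edges.\<close>

definition drawing_on :: "'v ugraph \<Rightarrow> 'p::topological_space set \<Rightarrow>
    ('v \<Rightarrow> 'p) \<Rightarrow> ('v set \<Rightarrow> real \<Rightarrow> 'p) \<Rightarrow> bool" where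
  "drawing_on G S p c \<longleftrightarrow>
     inj_on p (fst G) \<and> p ` fst G \<subseteq> S \<and>
     (\<forall>e \<in> snd G. arc (c e) \<and> path_image (c e) \<subseteq> S \<and>
        {pathstart (c e), pathfinish (c e)} = p ` e \<and>
        path_image (c e) \<inter> p ` fst G = p ` e) \<and>
     (\<forall>e \<in> snd G. \<forall>f \<in> snd G. e \<noteq> f \<longrightarrow>
        path_image (c e) \<inter> path_image (c f) = p ` (e \<inter> f))"

definition drawable_on :: "'v ugraph \<Rightarrow> 'p::topological_space set \<Rightarrow> bool" where
  "drawable_on G S \<longleftrightarrow> (\<exists>p c. drawing_on G S p c)"

text \<open>The infimum is taken in \<^typ>\<open>enat\<close>, so it is a minimum whenever some surface works (as it
  does for every finite graph), and \<open>\<infinity>\<close> otherwise.\<close>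

definition genus :: "'v ugraph \<Rightarrow> enat" where
  "genus G = Inf {enat k | k. drawable_on G (handle_surface k)}"

end

theory Submission
  imports Defs "HOL-Real_Asymp.Real_Asymp"
begin

text \<open>In a finite commutative ring, the annihilator of an element is an essential ideal if and only if the
element is nilpotent (\<open>essential_ann\<close>), so two vertices of the essential graph are adjacent if and
only if their product is nilpotent. A finite ring that is not local contains a nontrivial idempotent
(\<open>nonlocal_idem\<close>) and decomposes into the corners of complementary idempotents. A nonzero nilpotent
element in a corner decides the question: the graph contains the complete tripartite graph with
parts of sizes 1, 2, 4, whose line graph does not embed in the surface of genus 2, or it lies in the
one with parts of sizes 1, 2, 2, whose line graph embeds in the torus (\<open>nilp_genus\<close>). Otherwise the
ring is a product of fields. For two fields of orders \<open>m\<close> and \<open>n\<close> the graph is complete bipartite with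
parts of sizes \<open>m - 1\<close> and \<open>n - 1\<close>; with more factors it contains one of a few small graphs
(\<open>three_factors_genus\<close>). So finitely many line graphs have to be drawn, or shown not to be drawable.

A drawing is given by combinatorial data: the vertices lie on a line in the top face of the box,
the edges consist of segments, tents and passages through the tubes, and all crossings are
excluded by comparisons of integers (\<open>drawable_book\<close>).

The lower bounds rest on Euler's inequality for arbitrary topological drawings, which is reduced
to counting cycles of permutations. The plane \<open>y = 0\<close> cuts the surface with \<open>k\<close> handles into two halves,
and each half is homeomorphic to a union of squares in the plane with \<open>k\<close> holes (\<open>hmap\<close>). Dividing
the squares gives a combinatorial map, that is, a permutation that rotates darts around vertices and
an involution that reverses them, whose Euler characteristic is at least \<open>2 - 2 k\<close>. Every
connected subset of the surface touches a connected set of vertices of the map, and disjoint compact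
sets touch disjoint sets of vertices if the division is fine enough (\<open>touch_conn\<close>,
\<open>touch_disjoint\<close>). Hence a graph drawn on the surface is a minor of such a map. Contracting and deleting
edges does not decrease the Euler characteristic, because a transposition changes the number of
cycles of a permutation by one, so the graph has a rotation system of Euler characteristic at
least \<open>2 - 2 k\<close> (\<open>rotation_of_drawing\<close>).

In a line graph, the neighbours of the vertex \<open>{u, v}\<close> fall into the edges at \<open>u\<close> and those at \<open>v\<close>. If no
two of them from different classes are adjacent, then the rotation changes class at least twice, and
no triangular face fits there. Too many long faces contradict Euler's inequality
(\<open>not_drawable_count\<close>). Two graphs on the torus need a finer argument: the line graph of the complete bipartite
graph with parts of sizes 3 and 4, where a divisibility by 3 fails, and two complete graphs on
five vertices with a common vertex, which have too few short faces by parity.\<close>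

section \<open>Cycles of permutations\<close>

abbreviation swp :: "'a => 'a => 'a => 'a" where
 "swp == Transposition.transpose"

definition orb :: "('a => 'a) => 'a => 'a set" where
 "orb f x = range (%n. (f ^^ n) x)"

definition ncyc :: "('a => 'a) => 'a set => nat" where
 "ncyc f D = card (orb f ` D)"

definition perm_on :: "('a => 'a) => 'a set => bool" where
 "perm_on f D \<longleftrightarrow> finite D & bij_betw f D D"

lemma perm_onD:
 assumes "perm_on f D"
 shows "finite D" "!!x. x:D ==> f x:D" "inj_on f D" "f ` D = D"
 using assms unfolding perm_on_def bij_betw_def by auto

lemma perm_onI:
 assumes "finite D" "!!x. x:D ==> f x:D" "inj_on f D"
 shows "perm_on f D"
 using assms unfolding perm_on_def bij_betw_def
 using endo_inj_surj[of D f] by blast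

lemma self_in_orb [simp]: "x : orb f x"
 unfolding orb_def using rangeI[of "%n. (f ^^ n) x" 0] by simp

lemma orb_step: "y : orb f x ==> f y : orb f x"
proof -
 assume "y : orb f x"
 then obtain n where "y = (f ^^ n) x" unfolding orb_def by auto
 hence "f y = (f ^^ Suc n) x" by simp
 thus ?thesis unfolding orb_def by blast
qed

lemma f_in_orb [simp]: "f x : orb f x"
 by (simp add: orb_step)

lemma orb_subsetI:
 assumes "x:Z" "!!y. y:Z ==> f y:Z"
 shows "orb f x<=Z"
proof -
 have "(f ^^ n) x:Z" for n by (induction n) (use assms in auto)
 thus ?thesis unfolding orb_def by auto
qed

lemma orb_mono_mem: "y : orb f x ==> orb f y <= orb f x"
 by (rule orb_subsetI) (auto intro: orb_step)

lemma orb_trans: "z : orb f y ==> y : orb f x ==> z : orb f x"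
 using orb_mono_mem[of y f x] by blast

lemma orb_subset: "perm_on f D ==> x:D ==> orb f x<=D"
 by (rule orb_subsetI) (auto dest: perm_onD)

lemma perm_on_return:
 assumes p: "perm_on f D" and x: "x:D"
 obtains n where "n > 0" "(f ^^ n) x = x"
proof -
 have inD: "(f ^^ n) x:D" for n by (induction n) (use x perm_onD(2)[OF p] in auto)
 have "~inj (%n. (f ^^ n) x)"
 proof
  assume "inj (%n. (f ^^ n) x)"
  hence "infinite (range (%n. (f ^^ n) x))" by (rule range_inj_infinite)
  moreover have "range (%n. (f ^^ n) x)<=D" using inD by auto
  ultimately show False using perm_onD(1)[OF p] finite_subset by blast
 qed
 then obtain i' j' where ij': "i'~=j'" "(f ^^ i') x = (f ^^ j') x"
  unfolding inj_def by blast
 obtain i j where ij: "i < j" "(f ^^ i) x = (f ^^ j) x"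
  using ij' that[of i' j'] that[of j' i'] by (cases i' j' rule: linorder_cases) auto
 have "(f ^^ (j-i)) x = x"
  using ij
 proof (induction i arbitrary: j)
  case 0 thus ?case by simp
 next
  case (Suc i)
  then obtain j' where j': "j = Suc j'" by (cases j) auto
  have "(f ^^ i) x = (f ^^ j') x"
   using Suc.prems(2) perm_onD(3)[OF p] inD unfolding j' by (auto simp: inj_on_def)
  thus ?case using Suc j' by auto
 qed
 thus ?thesis using that[of "j-i"] ij by auto
qed

lemma orb_sym:
 assumes p: "perm_on f D" and x: "x:D" and y: "y : orb f x"
 shows "x : orb f y"
proof -
 obtain m where m: "y = (f ^^ m) x" using y unfolding orb_def by auto
 obtain n where n: "n > 0" "(f ^^ n) x = x" using perm_on_return[OF p x] .
 have "(f ^^ (n * k)) x = x" for k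
  by (induction k) (auto simp: funpow_add n)
 hence "(f ^^ (n * m)) x = x" .
 moreover have "n * m>=m" using n by simp
 ultimately have "(f ^^ (n * m-m)) y = x"
  unfolding m using funpow_add[of "n * m-m" m f] by simp
 hence "x = (f ^^ (n * m-m)) y" by simp
 thus ?thesis unfolding orb_def by blast
qed

lemma orb_eqI:
 assumes "perm_on f D" "x:D" "y : orb f x"
 shows "orb f y = orb f x"
 using orb_mono_mem[OF assms(3)] orb_mono_mem[OF orb_sym[OF assms]] by (rule subset_antisym)

lemma orb_disjoint:
 assumes "perm_on f D" "x:D" "y:D" "orb f x ~= orb f y"
 shows "orb f x Int orb f y = {}"
 using orb_eqI[OF assms(1,2)] orb_eqI[OF assms(1,3)] assms(4) by blast

lemma sum_orbits:
 assumes p: "perm_on f D"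
 shows "(SUM Z:orb f ` D. card Z) = card D"
proof -
 have "card (\<Union>(orb f ` D)) = (SUM Z:orb f ` D. card Z)"
 proof (rule card_Union_disjoint)
  show "pairwise disjnt (orb f ` D)"
   using orb_disjoint[OF p] unfolding pairwise_def disjnt_def by auto
  fix Z assume "Z : orb f ` D"
  thus "finite Z" using orb_subset[OF p] perm_onD(1)[OF p] finite_subset by blast
 qed
 moreover have "\<Union>(orb f ` D) = D" using orb_subset[OF p] self_in_orb[of _ f] by blast
 ultimately show ?thesis by simp
qed

lemma perm_on_swap:
 assumes p: "perm_on f D" and "a:D" "b:D"
 shows "perm_on (f\<circ>swp a b) D"
proof -
 have "bij_betw (swp a b) D D"
  using assms by (intro bij_betwI[of _ _ _ "swp a b"]) (auto simp: Transposition.transpose_def)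
 thus ?thesis using p unfolding perm_on_def using bij_betw_trans by blast
qed

lemma orb_unaffected:
 assumes "a ~: orb f x" "b ~: orb f x"
 shows "orb (f\<circ>swp a b) x = orb f x"
proof -
 have "((f\<circ>swp a b) ^^ n) x = (f ^^ n) x" for n
 proof (induction n)
  case (Suc n)
  have "(f ^^ n) x : orb f x" unfolding orb_def by auto
  hence "(f ^^ n) x~=a" "(f ^^ n) x~=b" using assms by auto
  thus ?case using Suc by (simp add: Transposition.transpose_def)
 qed simp
 thus ?thesis unfolding orb_def by simp
qed

text \<open>Only the cycles through the two exchanged points change: they are merged, or a common one is split.\<close>

lemma ncyc_swap_le:
 assumes p: "perm_on f D" and a: "a:D" and b: "b:D"
 shows "ncyc f D<=ncyc (f\<circ>swp a b) D+1"
proof -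
 define g where g_def: "g = f\<circ>swp a b"
 have fin: "finite D" using p perm_onD by blast
 have "orb f ` D<={orb f a, orb f b} Un (orb g ` D-{orb g a})"
 proof
  fix Z assume "Z : orb f ` D"
  then obtain x where x: "x:D" "Z = orb f x" by auto
  show "Z:{orb f a, orb f b} Un (orb g ` D-{orb g a})"
  proof (cases "a:Z | b:Z")
   case True
   thus ?thesis using x orb_eqI[OF p x(1), of a] orb_eqI[OF p x(1), of b] by blast
  next
   case False
   hence "Z = orb g x" using orb_unaffected[of a f x b] x unfolding g_def by simp
   moreover have "Z ~= orb g a" using False self_in_orb by metis
   ultimately show ?thesis using x by auto
  qed
 qed
 hence "ncyc f D <= card ({orb f a, orb f b} Un (orb g ` D-{orb g a}))"
  unfolding ncyc_def using fin by (intro card_mono) auto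
 also have "\<dots> <= card {orb f a, orb f b} + card (orb g ` D-{orb g a})"
  by (rule card_Un_le)
 also have "card (orb g ` D-{orb g a}) = ncyc g D-1"
  unfolding ncyc_def using a by simp
 also have "card {orb f a, orb f b}<=2" by (simp add: card_insert_if)
 finally have "ncyc f D<=2+(ncyc g D-1)" by simp
 moreover have "ncyc g D > 0" unfolding ncyc_def using a fin by (auto simp: card_gt_0_iff)
 ultimately show ?thesis unfolding g_def by linarith
qed

lemma orb_swap_merge:
 assumes p: "perm_on f D" and a: "a:D" and b: "b:D" and ab: "b ~: orb f a"
 shows "orb (f\<circ>swp a b) a = orb f a Un orb f b"
proof -
 define g where g_def: "g = f\<circ>swp a b"
 let ?Z = "orb g a"
 have ba: "a ~: orb f b" using ab orb_sym[OF p b] by blast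
 have ga: "g a = f b" and gb: "g b = f a" unfolding g_def by auto
 have bZ: "b:?Z"
 proof (rule ccontr)
  assume nb: "b~:?Z"
  have "(f ^^ Suc i) b:?Z" for i
  proof (induction i)
   case 0 thus ?case using f_in_orb[of g a] unfolding ga by simp
  next
   case (Suc i)
   let ?y = "(f ^^ Suc i) b"
   have "?y~=b" using nb Suc by metis
   moreover have "?y~=a" using ba unfolding orb_def by blast
   ultimately have "g ?y = f ?y" by (simp add: g_def Transposition.transpose_def)
   thus ?case using orb_step[OF Suc] by simp
  qed
  moreover obtain n where "n > 0" "(f ^^ n) b = b" using perm_on_return[OF p b] .
  ultimately show False using nb by (cases n) (simp_all, metis)
 qed
 have cl: "f x:?Z" if "x:?Z" for x
 proof (cases "x = a | x = b")
  case True
  thus ?thesis using orb_step[OF bZ] f_in_orb[of g a] unfolding ga gb by auto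
 next
  case False
  hence "g x = f x" by (simp add: g_def Transposition.transpose_def)
  thus ?thesis using orb_step[OF that] by simp
 qed
 have 1: "orb f a Un orb f b<=?Z"
  using orb_subsetI[of a ?Z f] orb_subsetI[of b ?Z f] bZ cl by auto
 have 2: "?Z <= orb f a Un orb f b"
 proof (rule orb_subsetI)
  fix y assume "y : orb f a Un orb f b"
  thus "g y : orb f a Un orb f b"
   by (cases "y = a | y = b") (auto simp: g_def Transposition.transpose_def intro: orb_step)
 qed simp
 show ?thesis using 1 2 unfolding g_def by blast
qed

lemma ncyc_swap_merge:
 assumes p: "perm_on f D" and a: "a:D" and b: "b:D" and ab: "b ~: orb f a"
 shows "ncyc f D = ncyc (f\<circ>swp a b) D+1"
proof -
 define g where g_def: "g = f\<circ>swp a b"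
 have pg: "perm_on g D" unfolding g_def by (rule perm_on_swap[OF p a b])
 have fin: "finite D" using p perm_onD by blast
 let ?A = "orb f a" and ?B = "orb f b"
 have m: "orb g a = ?A Un ?B" unfolding g_def by (rule orb_swap_merge[OF assms])
 have ne: "?A~=?B" using ab self_in_orb by metis
 have eq: "orb g ` D = insert (?A Un ?B) (orb f ` D-{?A, ?B})"
 proof (intro equalityI subsetI)
  fix Z assume "Z : orb g ` D"
  then obtain x where x: "x:D" "Z = orb g x" by auto
  show "Z:insert (?A Un ?B) (orb f ` D-{?A, ?B})"
  proof (cases "x:?A Un ?B")
   case True
   hence "Z = ?A Un ?B" using orb_eqI[OF pg a, of x] m x by simp
   thus ?thesis by simp
  next
   case False
   have "a ~: orb f x" "b ~: orb f x" using False orb_sym[OF p x(1)] by auto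
   hence "Z = orb f x" using orb_unaffected[of a f x b] x unfolding g_def by simp
   moreover have "orb f x~=?A" "orb f x~=?B" using False self_in_orb[of x f] by blast+
   ultimately show ?thesis using x by auto
  qed
 next
  fix Z assume Z: "Z:insert (?A Un ?B) (orb f ` D-{?A, ?B})"
  show "Z : orb g ` D"
  proof (cases "Z = ?A Un ?B")
   case True thus ?thesis using m a by auto
  next
   case False
   then obtain x where x: "x:D" "Z = orb f x" "Z~=?A" "Z~=?B" using Z by auto
   have "a ~: orb f x" "b ~: orb f x" using x orb_eqI[OF p x(1), of a] orb_eqI[OF p x(1), of b] by blast+
   thus ?thesis using orb_unaffected[of a f x b] x unfolding g_def by auto
  qed
 qed
 have notin: "?A Un ?B ~: orb f ` D-{?A, ?B}"
 proof
  assume "?A Un ?B : orb f ` D-{?A, ?B}"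
  then obtain x where "x:D" "orb f x = ?A Un ?B" "orb f x~=?A" by auto
  thus False using orb_eqI[OF p, of x a] self_in_orb[of a f] by blast
 qed
 have "ncyc g D = Suc (card (orb f ` D-{?A, ?B}))"
  unfolding ncyc_def eq using notin fin by simp
 also have "card (orb f ` D-{?A, ?B}) = card (orb f ` D) - card {?A, ?B}"
  using a b by (intro card_Diff_subset) auto
 also have "card {?A, ?B} = 2" using ne by simp
 finally have *: "ncyc g D = Suc (ncyc f D-2)" unfolding ncyc_def .
 have "card {?A, ?B}<=ncyc f D" unfolding ncyc_def using a b fin by (intro card_mono) auto
 thus ?thesis using * ne unfolding g_def by simp
qed

text \<open>Splitting a cycle is undone by the same transposition, so it reduces to merging.\<close>

lemma ncyc_swap_parity:
 assumes p: "perm_on f D" and a: "a:D" and b: "b:D" and ne: "a~=b"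
 shows "even (ncyc (f\<circ>swp a b) D) \<longleftrightarrow> odd (ncyc f D)"
proof (cases "b : orb f a")
 case False
 thus ?thesis using ncyc_swap_merge[OF p a b] by simp
next
 case True
 define g where g_def: "g = f\<circ>swp a b"
 have pg: "perm_on g D" unfolding g_def by (rule perm_on_swap[OF p a b])
 obtain m where m: "b = (f ^^ m) a" using True unfolding orb_def by auto
 define n where "n = (LEAST n. (f ^^ n) a = b)"
 have n: "(f ^^ n) a = b" unfolding n_def using m by (intro LeastI[of "%n. (f ^^ n) a = b" m]) simp
 have min: "(f ^^ i) a~=b" if "i < n" for i
  using not_less_Least that unfolding n_def by blast
 define Z where "Z = (%i. (f ^^ i) a) ` {1..n}"
 have n0: "n > 0" using n ne by (cases n) auto
 have aZ: "a~:Z"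
 proof
  assume "a:Z"
  then obtain i where i: "1<=i" "i<=n" "(f ^^ i) a = a" unfolding Z_def by auto
  have "(f ^^ n) a = (f ^^ (n-i)) ((f ^^ i) a)"
   using i funpow_add[of "n-i" i f] by simp
  hence "(f ^^ (n-i)) a = b" using i n by simp
  thus False using min[of "n-i"] i n0 by simp
 qed
 have "orb g b<=Z"
 proof (rule orb_subsetI)
  show "b:Z" unfolding Z_def using n n0 by force
  fix y assume "y:Z"
  then obtain i where i: "1<=i" "i<=n" "y = (f ^^ i) a" unfolding Z_def by auto
  show "g y:Z"
  proof (cases "i = n")
   case True
   hence "g y = (f ^^ 1) a" using i n by (simp add: g_def)
   thus ?thesis unfolding Z_def using n0 by force
  next
   case False
   hence "y~=b" using min[of i] i by auto
   moreover have "y~=a" using aZ `y : Z` by auto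
   ultimately have "g y = (f ^^ Suc i) a" using i by (simp add: g_def Transposition.transpose_def)
   moreover have "Suc i:{1..n}" using i False by simp
   ultimately show ?thesis unfolding Z_def by blast
  qed
 qed
 hence "a ~: orb g b" using aZ by auto
 hence "b ~: orb g a" using orb_sym[OF pg a] by blast
 have "g\<circ>swp a b = f" by (auto simp: g_def fun_eq_iff)
 hence "ncyc g D = ncyc f D+1"
  using ncyc_swap_merge[OF pg a b `b ~: orb g a`] by metis
 thus ?thesis unfolding g_def by simp
qed

section \<open>Contracting and deleting edges of combinatorial maps\<close>

text \<open>If \<open>\<sigma>\<close> rotates the darts of a map around their vertices and \<open>tau\<close> reverses darts, the cycles of
\<open>\<sigma> \<circ> flip_on tau Z\<close> are the boundary walks of the ribbon graph with edges \<open>Z\<close>: the vertices of the map for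
empty \<open>Z\<close>, its faces if \<open>Z\<close> contains all darts.\<close>

definition flip_on :: "('a => 'a) => 'a set => 'a => 'a" where
 "flip_on tau Z d = (if d:Z then tau d else d)"

definition pairing :: "('a => 'a) => 'a set => bool" where
 "pairing tau Z \<longleftrightarrow> finite Z & (ALL d:Z. tau d:Z & tau (tau d) = d & tau d~=d)"

lemma pairingD:
 assumes "pairing tau Z"
 shows "finite Z" "!!d. d:Z ==> tau d:Z" "!!d. d:Z ==> tau (tau d) = d"
  "!!d. d:Z ==> tau d~=d"
 using assms unfolding pairing_def by blast+

lemma pairing_remove:
 assumes "pairing tau Z" "d:Z"
 shows "pairing tau (Z-{d, tau d})" "card Z = card (Z-{d, tau d})+2"
proof -
 show "pairing tau (Z-{d, tau d})"
  unfolding pairing_def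
 proof (intro conjI ballI)
  show "finite (Z-{d, tau d})" using pairingD(1)[OF assms(1)] by simp
  fix e assume e: "e:Z-{d, tau d}"
  have z: "e:Z" "e~=d" "e~=tau d" using e by auto
  show "tau (tau e) = e" "tau e~=e" using pairingD[OF assms(1)] z by auto
  have "tau e~=d" using pairingD(3)[OF assms(1) z(1)] z by metis
  moreover have "tau e~=tau d"
   using pairingD(3)[OF assms(1) z(1)] pairingD(3)[OF assms(1) assms(2)] z by metis
  ultimately show "tau e:Z-{d, tau d}" using pairingD(2)[OF assms(1) z(1)] by auto
 qed
 have d: "tau d:Z" "tau d~=d" "finite Z" using pairingD[OF assms(1)] assms(2) by auto
 hence "card (Z-{d, tau d}) = card Z - card {d, tau d}"
  using assms(2) by (intro card_Diff_subset) auto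
 moreover have "card {d, tau d} <= card Z" using d assms(2) by (intro card_mono) auto
 ultimately show "card Z = card (Z-{d, tau d})+2" using d by simp
qed

lemma even_pairing: "pairing tau Z ==> even (card Z)"
proof (induction "card Z" arbitrary: Z rule: less_induct)
 case less
 show ?case
 proof (cases "Z = {}")
  case False
  then obtain d where "d:Z" by auto
  thus ?thesis
   using pairing_remove[OF less.prems, of d] less.hyps[of "Z-{d, tau d}"] by simp
 qed simp
qed

lemma pairing_Un:
 assumes "pairing tau Y" "pairing tau Z"
 shows "pairing tau (Y Un Z)"
 using assms unfolding pairing_def by auto

lemma pairing_subset:
 assumes "pairing tau D" "Z<=D" "!!d. d:Z ==> tau d:Z"
 shows "pairing tau Z"
 using assms unfolding pairing_def by (auto intro: finite_subset)

lemma perm_on_flip: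
 assumes p: "perm_on f D" and "pairing tau Z" "Z<=D"
 shows "perm_on (f\<circ>flip_on tau Z) D"
proof -
 have "bij_betw (flip_on tau Z) D D"
  using assms(3) pairingD[OF assms(2)]
  by (intro bij_betwI[of _ _ _ "flip_on tau Z"]) (auto simp: flip_on_def subset_eq)
 thus ?thesis using p unfolding perm_on_def using bij_betw_trans by blast
qed

lemma flip_on_insert:
 assumes "pairing tau Z" "d~:Z" "tau d~:Z" "tau (tau d) = d" "tau d~=d"
 shows "f\<circ>flip_on tau (insert d (insert (tau d) Z)) = f\<circ>flip_on tau Z\<circ>swp d (tau d)"
 using assms by (auto simp: fun_eq_iff flip_on_def Transposition.transpose_def)

lemma ncyc_flip_le:
 assumes p: "perm_on f D"
 shows "pairing tau Z ==> Z<=D ==> pairing tau Y ==> Y<=D ==> Y Int Z = {} ==>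
 ncyc (f\<circ>flip_on tau (Y Un Z)) D<=ncyc (f\<circ>flip_on tau Y) D + card Z div 2"
proof (induction "card Z" arbitrary: Z rule: less_induct)
 case less
 show ?case
 proof (cases "Z = {}")
  case False
  then obtain d where d: "d:Z" by auto
  define W where "W = Z-{d, tau d}"
  have W: "pairing tau W" "card Z = card W+2"
   unfolding W_def using pairing_remove[OF less.prems(1) d] by auto
  have "W<=D" "Y Int W = {}" using less.prems unfolding W_def by auto
  hence IH: "ncyc (f\<circ>flip_on tau (Y Un W)) D<=ncyc (f\<circ>flip_on tau Y) D + card W div 2"
   using less.hyps[of W] W less.prems by auto
  define g where "g = f\<circ>flip_on tau (Y Un W)"
  have YW: "pairing tau (Y Un W)" "Y Un W<=D"
   using pairing_Un W less.prems `W <= D` by auto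
  have td: "tau d:Z" "tau (tau d) = d" "tau d~=d" using pairingD[OF less.prems(1)] d by auto
  have nd: "d~:Y Un W" "tau d~:Y Un W" unfolding W_def using d td less.prems by auto
  have "Y Un Z = insert d (insert (tau d) (Y Un W))" unfolding W_def using d td by auto
  hence h: "f\<circ>flip_on tau (Y Un Z) = g\<circ>swp d (tau d)"
   using flip_on_insert[OF YW(1) nd td(2,3), of f] unfolding g_def by simp
  have pg: "perm_on g D" unfolding g_def by (rule perm_on_flip[OF p YW])
  have dD: "d:D" "tau d:D" using d td less.prems by auto
  have "g\<circ>swp d (tau d)\<circ>swp d (tau d) = g" by (auto simp: fun_eq_iff)
  hence "ncyc (g\<circ>swp d (tau d)) D<=ncyc g D+1"
   using ncyc_swap_le[OF perm_on_swap[OF pg dD] dD] by metis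
  thus ?thesis unfolding h using IH W(2) unfolding g_def[symmetric] by simp
 qed simp
qed

lemma orb_cong:
 assumes p: "perm_on f D" and "!!x. x:D ==> f x = g x" and x: "x:D"
 shows "orb f x = orb g x"
proof -
 have "(f ^^ n) x = (g ^^ n) x & (f ^^ n) x:D" for n
  by (induction n) (use assms perm_onD(2)[OF p] in auto)
 thus ?thesis unfolding orb_def by simp
qed

lemma ncyc_cong:
 assumes p: "perm_on f D" and "!!x. x:D ==> f x = g x"
 shows "ncyc f D = ncyc g D"
 unfolding ncyc_def using orb_cong[OF assms] by (metis (no_types, lifting) image_cong)

text \<open>The first return to a subset deletes the other darts and keeps the cyclic order of those that remain.\<close>

definition ret :: "('a => 'a) => 'a set => 'a => 'a" where
 "ret f D' x = (f ^^ (LEAST n. n > 0 & (f ^^ n) x:D')) x"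

lemma ret_time:
 assumes p: "perm_on f D" and "D'<=D" and x: "x:D'"
 obtains n where "n > 0" "(f ^^ n) x:D'" "ret f D' x = (f ^^ n) x"
  "!!i. 0 < i ==> i < n ==> (f ^^ i) x~:D'"
proof -
 define n where "n = (LEAST n. n > 0 & (f ^^ n) x:D')"
 obtain m where "m > 0" "(f ^^ m) x = x" using perm_on_return[OF p, of x] assms by blast
 hence "n > 0 & (f ^^ n) x:D'"
  unfolding n_def using x by (intro LeastI[of "%n. n > 0 & (f ^^ n) x:D'" m]) simp
 moreover have "(f ^^ i) x~:D'" if "0 < i" "i < n" for i
  using not_less_Least[of i "%n. n > 0 & (f ^^ n) x:D'"] that unfolding n_def by blast
 ultimately show ?thesis using that[of n] unfolding ret_def n_def by blast
qed

lemma ret_eqI: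
 assumes "n > 0" "(f ^^ n) x:D'" "!!i. 0 < i ==> i < n ==> (f ^^ i) x~:D'"
 shows "ret f D' x = (f ^^ n) x"
proof -
 have "(LEAST n. n > 0 & (f ^^ n) x:D') = n"
  using assms by (intro Least_equality) (auto simp: not_less[symmetric])
 thus ?thesis unfolding ret_def by simp
qed

lemma funpow_in: "perm_on f D ==> x:D ==> (f ^^ n) x:D"
 by (induction n) (auto dest: perm_onD)

lemma funpow_cancel:
 assumes p: "perm_on f D" and "x:D" "y:D" "(f ^^ n) x = (f ^^ n) y"
 shows "x = y"
 using assms(4)
proof (induction n)
 case (Suc n)
 have "f ((f ^^ n) x) = f ((f ^^ n) y)" using Suc.prems by simp
 hence "(f ^^ n) x = (f ^^ n) y"
  using perm_onD(3)[OF p] funpow_in[OF p assms(2)] funpow_in[OF p assms(3)]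
  by (auto dest: inj_onD)
 thus ?case using Suc.IH by simp
qed simp

lemma ret_inj_aux:
 assumes p: "perm_on f D" and s: "D'<=D" and xy: "x:D'" "y:D'"
  and e: "(f ^^ m) x = (f ^^ n) y" and mn: "m<=n" "m > 0"
  and min: "!!i. 0 < i ==> i < n ==> (f ^^ i) y~:D'"
 shows "x = y"
proof -
 have "(f ^^ m) ((f ^^ (n-m)) y) = (f ^^ n) y"
  using funpow_add[of m "n-m" f] mn by simp
 hence *: "x = (f ^^ (n-m)) y"
  using funpow_cancel[OF p, of x "(f ^^ (n-m)) y" m] funpow_in[OF p, of y] xy s e by auto
 show ?thesis
 proof (cases "m = n")
  case False
  thus ?thesis using min[of "n-m"] * xy mn by simp
 qed (use * in simp)
qed

lemma perm_on_ret:
 assumes p: "perm_on f D" and s: "D'<=D"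
 shows "perm_on (ret f D') D'"
proof (rule perm_onI)
 show "finite D'" using perm_onD(1)[OF p] s finite_subset by blast
 show "ret f D' x:D'" if "x:D'" for x
  using ret_time[OF p s that] by metis
 show "inj_on (ret f D') D'"
 proof (rule inj_onI)
  fix x y assume xy: "x:D'" "y:D'" and e: "ret f D' x = ret f D' y"
  obtain m where m: "m > 0" "ret f D' x = (f ^^ m) x" "!!i. 0 < i ==> i < m ==> (f ^^ i) x~:D'"
   using ret_time[OF p s xy(1)] by metis
  obtain n where n: "n > 0" "ret f D' y = (f ^^ n) y" "!!i. 0 < i ==> i < n ==> (f ^^ i) y~:D'"
   using ret_time[OF p s xy(2)] by metis
  have "(f ^^ m) x = (f ^^ n) y" using e m(2) n(2) by simp
  thus "x = y"
   using ret_inj_aux[OF p s xy(1) xy(2), of m n] ret_inj_aux[OF p s xy(2) xy(1), of n m] m n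
   by (cases "m<=n") auto
 qed
qed

lemma orb_ret:
 assumes p: "perm_on f D" and s: "D'<=D" and x: "x:D'"
 shows "orb (ret f D') x = orb f x Int D'"
proof
 have *: "ret f D' y : orb f y" for y unfolding ret_def orb_def by blast
 have **: "ret f D' y:D'" if "y:D'" for y using perm_onD(2)[OF perm_on_ret[OF p s] that] .
 show "orb (ret f D') x <= orb f x Int D'"
 proof (intro orb_subsetI)
  fix y assume "y : orb f x Int D'"
  thus "ret f D' y : orb f x Int D'"
   using orb_trans[OF *[of y], of x] **[of y] by auto
 qed (use x in simp)
 have "(f ^^ n) x:D' ==> (f ^^ n) x : orb (ret f D') x" for n
  using x
 proof (induction n arbitrary: x rule: less_induct)
  case (less n x)
  obtain m where m: "m > 0" "(f ^^ m) x:D'" "ret f D' x = (f ^^ m) x"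
   "!!i. 0 < i ==> i < m ==> (f ^^ i) x~:D'"
   using ret_time[OF p s less.prems(2)] by metis
  show ?case
  proof (cases "n = 0")
   case False
   hence mn: "m<=n" using m(4)[of n] less.prems(1) by (metis gr0I not_less)
   have e: "(f ^^ n) x = (f ^^ (n-m)) ((f ^^ m) x)"
    using funpow_add[of "n-m" m f] mn by simp
   have "(f ^^ (n-m)) ((f ^^ m) x) : orb (ret f D') ((f ^^ m) x)"
    using less.IH[of "n-m" "(f ^^ m) x"] less.prems(1) m e mn False by auto
   thus ?thesis using orb_trans[OF _ f_in_orb[of "ret f D'" x]] e m(3) by metis
  qed simp
 qed
 thus "orb f x Int D' <= orb (ret f D') x" unfolding orb_def[of f] by blast
qed

lemma ncyc_ret:
 assumes p: "perm_on f D" and s: "D'<=D"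
 shows "ncyc (ret f D') D' = card (orb f ` D')"
proof -
 have "orb (ret f D') ` D' = (%Z. Z Int D') ` (orb f ` D')"
  using orb_ret[OF p s] by (auto simp: image_image)
 moreover have "inj_on (%Z. Z Int D') (orb f ` D')"
 proof (rule inj_onI)
  fix A B assume "A : orb f ` D'" "B : orb f ` D'" and e: "A Int D' = B Int D'"
  then obtain x y where x: "x:D'" "A = orb f x" and y: "y:D'" "B = orb f y" by auto
  hence "x : orb f y" using e self_in_orb[of x f] by blast
  thus "A = B" using orb_eqI[OF p, of y x] x y s by auto
 qed
 ultimately show ?thesis unfolding ncyc_def by (simp add: card_image)
qed

text \<open>Adding an edge between different boundary walks merges them. When this is no longer possible, one walk
is left for each value of \<open>beta\<close>, because any other walk could still be joined across a cut. The added
edges form a spanning forest of the classes of \<open>beta\<close>, and each of them has cost exactly one cycle.\<close>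

lemma spanning_forest:
 fixes beta :: "'a => 'v"
 assumes p: "perm_on \<sigma> D" and t: "pairing tau D"
  and beta: "!!d. d:D ==> beta (\<sigma> d) = beta d"
  and cut: "!!v Z. Z<={d:D. beta d = v} ==> Z~={} ==> Z~={d:D. beta d = v} ==>
 (!!d. d:Z ==> \<sigma> d:Z) ==> EX d:Z. beta (tau d) = v & tau d~:Z"
 obtains T where "T<=D" "pairing tau T" "!!d. d:T ==> beta (tau d) = beta d"
  "!!d. d:D ==> orb (\<sigma>\<circ>flip_on tau T) d = {e:D. beta e = beta d}"
  "ncyc \<sigma> D = ncyc (\<sigma>\<circ>flip_on tau T) D + card T div 2"
proof -
 define F where "F T = \<sigma>\<circ>flip_on tau T" for T
 \<comment> \<open>The walks lost are counted exactly, which makes \<open>T\<close> a forest, and no old cycle is torn apart.\<close>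
 define good where "good T \<longleftrightarrow> T<=D & pairing tau T &
 (ALL d:T. beta (tau d) = beta d & tau d : orb (F T) d) &
 ncyc \<sigma> D = ncyc (F T) D + card T div 2 & (ALL d:D. \<sigma> d : orb (F T) d)" for T
 have "F {} = \<sigma>" unfolding F_def flip_on_def by auto
 hence "good {}" unfolding good_def pairing_def by simp
 then obtain T where T: "good T" and min: "!!T'. good T' ==> ncyc (F T) D<=ncyc (F T') D"
  using ex_has_least_nat[of good "{}" "%T. ncyc (F T) D"] by blast
 have TD: "T<=D" and Tp: "pairing tau T" and Tbeta: "!!d. d:T ==> beta (tau d) = beta d"
  and To: "!!d. d:T ==> tau d : orb (F T) d"
  and Tn: "ncyc \<sigma> D = ncyc (F T) D + card T div 2" and Ts: "!!d. d:D ==> \<sigma> d : orb (F T) d"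
  using T unfolding good_def by auto
 have pF: "perm_on (F T) D" unfolding F_def by (rule perm_on_flip[OF p Tp TD])
 have Fbeta: "beta (F T d) = beta d" if "d:D" for d
  using that beta[of d] beta[of "tau d"] Tbeta pairingD(2)[OF t] unfolding F_def flip_on_def by auto
 have single: "orb (F T) d0 = {e:D. beta e = beta d0}" if d0: "d0:D" for d0
 proof (rule ccontr)
  assume ne: "orb (F T) d0~={e:D. beta e = beta d0}"
  have sub: "orb (F T) d0<={e:D. beta e = beta d0}"
   by (rule orb_subsetI) (use d0 Fbeta perm_onD(2)[OF pF] in auto)
  have "EX d:orb (F T) d0. beta (tau d) = beta d0 & tau d ~: orb (F T) d0"
  proof (rule cut[OF sub _ ne])
   show "orb (F T) d0~={}" unfolding orb_def by simp
   fix d assume d: "d : orb (F T) d0"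
   hence "d:D" using orb_subset[OF pF d0] by auto
   thus "\<sigma> d : orb (F T) d0" by (rule orb_trans[OF Ts d])
  qed
  then obtain d where d: "d : orb (F T) d0" "beta (tau d) = beta d0" "tau d ~: orb (F T) d0" by auto
  have dD: "d:D" "beta d = beta d0" using sub d by auto
  have td: "tau d:D" "tau (tau d) = d" "tau d~=d" using pairingD[OF t] dD by auto
  have od: "orb (F T) d = orb (F T) d0" by (rule orb_eqI[OF pF d0 d(1)])
  have n1: "d~:T" using To[of d] d od by auto
  have n2: "tau d~:T" using pairingD(2)[OF Tp, of "tau d"] td n1 by auto
  define T' where "T' = insert d (insert (tau d) T)"
  have F': "F T' = F T\<circ>swp d (tau d)"
   unfolding F_def T'_def by (rule flip_on_insert[OF Tp n1 n2 td(2,3)])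
  have nd: "tau d ~: orb (F T) d" using d od by simp
  have m: "orb (F T') d = orb (F T) d Un orb (F T) (tau d)"
   unfolding F' by (rule orb_swap_merge[OF pF dD(1) td(1) nd])
  have n: "ncyc (F T) D = ncyc (F T') D+1"
   unfolding F' by (rule ncyc_swap_merge[OF pF dD(1) td(1) nd])
  have pF': "perm_on (F T') D" unfolding F' by (rule perm_on_swap[OF pF dD(1) td(1)])
  have mono: "orb (F T) x <= orb (F T') x" if x: "x:D" for x
  proof (cases "d : orb (F T) x | tau d : orb (F T) x")
   case False
   thus ?thesis unfolding F' using orb_unaffected[of d "F T" x "tau d"] by simp
  next
   case True
   hence e: "orb (F T) d = orb (F T) x | orb (F T) (tau d) = orb (F T) x"
    using orb_eqI[OF pF x] by metis
   hence "x : orb (F T') d" using m self_in_orb[of x "F T"] by blast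
   hence "orb (F T') x = orb (F T') d" by (rule orb_eqI[OF pF' dD(1)])
   thus ?thesis using e m by blast
  qed
  have "good T'"
   unfolding good_def
  proof (intro conjI ballI)
   show "T'<=D" unfolding T'_def using TD dD td by auto
   have "pairing tau {d, tau d}" unfolding pairing_def using td by auto
   thus "pairing tau T'" using pairing_Un[OF _ Tp, of "{d, tau d}"] unfolding T'_def by simp
   have "card T' = card T+2" unfolding T'_def using n1 n2 td pairingD(1)[OF Tp] by simp
   thus "ncyc \<sigma> D = ncyc (F T') D + card T' div 2" using Tn n by simp
   fix e assume e: "e:T'"
   show "beta (tau e) = beta e" using e Tbeta dD td d(2) unfolding T'_def by auto
   have 1: "tau d : orb (F T') d" using m by auto
   have 2: "d : orb (F T') (tau d)" by (rule orb_sym[OF pF' dD(1) 1])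
   show "tau e : orb (F T') e"
    using e 1 2 td To mono TD unfolding T'_def by auto
  next
   fix e assume "e:D"
   thus "\<sigma> e : orb (F T') e" using Ts mono by blast
  qed
  thus False using min[of T'] n by simp
 qed
 show ?thesis using that[of T] TD Tp Tbeta Tn single unfolding F_def by blast
qed

lemma orb_transport:
 assumes "inj_on delta A" "p:A" "!!q. q:A ==> rho q:A & delta (rho q) = s (delta q)"
 shows "delta ` orb rho p = orb s (delta p)" "orb rho p<=A"
proof -
 have "delta ((rho ^^ n) p) = (s ^^ n) (delta p) & (rho ^^ n) p:A" for n
  by (induction n) (use assms in auto)
 thus "delta ` orb rho p = orb s (delta p)" "orb rho p<=A" unfolding orb_def by (auto simp: image_image)
qed

lemma ncyc_transport:
 assumes "inj_on delta A" "!!q. q:A ==> rho q:A & delta (rho q) = s (delta q)"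
 shows "ncyc rho A = ncyc s (delta ` A)"
proof -
 have "orb s ` delta ` A = (%Z. delta ` Z) ` (orb rho ` A)"
  using orb_transport(1)[where rho = rho and s = s, OF assms(1) _ assms(2)] by (auto simp: image_image)
 moreover have "inj_on (%Z. delta ` Z) (orb rho ` A)"
 proof (rule inj_onI)
  fix Y Z assume "Y : orb rho ` A" "Z : orb rho ` A" and e: "delta ` Y = delta ` Z"
  hence "Y<=A" "Z<=A" using orb_transport(2)[where rho = rho and s = s, OF assms(1) _ assms(2)] by auto
  thus "Y = Z" using e inj_on_image_eq_iff[OF assms(1)] by blast
 qed
 ultimately show ?thesis unfolding ncyc_def by (simp add: card_image)
qed

text \<open>Contract the spanning forest of the branch sets \<open>{d. beta d = v}\<close> and, by first return, delete all darts but
the chosen ones \<open>delta\<close>. The faces of the result are traces of the boundary walks of the ribbon graph formed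
by the forest and the chosen edges. Every remaining edge of the map, when it is added, changes the
number of walks by at most one, so the Euler characteristic of the minor is not smaller.\<close>

lemma combinatorial_minor:
 fixes beta :: "'a => 'v"
 assumes p: "perm_on \<sigma> D" and t: "pairing tau D"
  and beta: "!!d. d:D ==> beta (\<sigma> d) = beta d" and V: "beta ` D = V"
  and cut: "!!v Z. Z<={d:D. beta d = v} ==> Z~={} ==> Z~={d:D. beta d = v} ==>
 (!!d. d:Z ==> \<sigma> d:Z) ==> EX d:Z. beta (tau d) = v & tau d~:Z"
  and A: "!!u v. (u, v):A ==> (v, u):A & u~=v"
  and iso: "!!u. u:V ==> EX v. (u, v):A"
  and delta: "!!u v. (u, v):A ==> delta (u, v):D & beta (delta (u, v)) = u & tau (delta (u, v)) = delta (v, u)"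
 shows "EX rho. perm_on rho A & (ALL u v. (u, v):A --> orb rho (u, v) = {q:A. fst q = u}) &
 ncyc \<sigma> D+ncyc (\<sigma>\<circ>tau) D + card A div 2 <= card V+ncyc (rho\<circ>prod.swap) A + card D div 2"
proof -
 obtain T where TD: "T<=D" and Tp: "pairing tau T" and Tbeta: "!!d. d:T ==> beta (tau d) = beta d"
  and single: "!!d. d:D ==> orb (\<sigma>\<circ>flip_on tau T) d = {e:D. beta e = beta d}"
  and n\<sigma>: "ncyc \<sigma> D = ncyc (\<sigma>\<circ>flip_on tau T) D + card T div 2"
  using spanning_forest[of \<sigma> D tau beta, OF p t beta cut] by blast
 define f where "f = \<sigma>\<circ>flip_on tau T"
 have pf: "perm_on f D" unfolding f_def by (rule perm_on_flip[OF p Tp TD])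
 have fo: "!!d. d:D ==> orb f d = {e:D. beta e = beta d}" using single unfolding f_def .
 have ncf: "ncyc f D = card V"
 proof -
  have "orb f ` D = (%v. {e:D. beta e = v}) ` V" using fo V by (auto simp: image_image)
  moreover have "inj_on (%v. {e:D. beta e = v}) V" by (rule inj_onI) (use V in blast)
  ultimately show ?thesis unfolding ncyc_def by (simp add: card_image)
 qed
 have deltaD: "delta q:D" "beta (delta q) = fst q" "tau (delta q) = delta (prod.swap q)" if "q:A" for q
  using delta[of "fst q" "snd q"] that by (auto simp: prod.swap_def)
 have swA: "prod.swap q:A" if "q:A" for q using A[of "fst q" "snd q"] that by (auto simp: prod.swap_def)
 have inj: "inj_on delta A"
 proof (rule inj_onI)
  fix q r assume q: "q:A" "r:A" "delta q = delta r"
  hence "fst q = fst r" using deltaD(2) by metis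
  moreover have "fst (prod.swap q) = fst (prod.swap r)"
   using deltaD(2)[OF swA[OF q(1)]] deltaD(2)[OF swA[OF q(2)]] deltaD(3)[OF q(1)] deltaD(3)[OF q(2)] q(3) by metis
  ultimately show "q = r" by (auto simp: prod_eq_iff)
 qed
 define D' where "D' = delta ` A"
 have D'D: "D'<=D" unfolding D'_def using deltaD by auto
 have D'p: "pairing tau D'"
  by (rule pairing_subset[OF t D'D]) (insert deltaD(3) swA, auto simp: D'_def)
 have D'T: "D' Int T = {}"
 proof -
  have "delta q~:T" if q: "q:A" for q
  proof
   assume "delta q:T"
   hence "beta (delta (prod.swap q)) = beta (delta q)" using Tbeta deltaD(3)[OF q] by metis
   hence "fst q = snd q" using deltaD(2)[OF swA[OF q]] deltaD(2)[OF q] by simp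
   thus False using A[of "fst q" "snd q"] q by simp
  qed
  thus ?thesis unfolding D'_def by auto
 qed
 define psi where "psi = \<sigma>\<circ>flip_on tau (T Un D')"
 have TD'p: "pairing tau (T Un D')" by (rule pairing_Un[OF Tp D'p])
 have ppsi: "perm_on psi D" unfolding psi_def by (rule perm_on_flip[OF p TD'p]) (use TD D'D in auto)
 have psif: "psi d = f d" if "d~:D'" for d unfolding psi_def f_def flip_on_def using that by simp
 have psitau: "psi d = f (tau d)" if "d:D'" for d
  using that D'T pairingD(2)[OF D'p that] unfolding psi_def f_def flip_on_def by auto
 \<comment> \<open>This is the rotation of the minor, still on the chosen darts.\<close>
 define s where "s = ret f D'"
 have retpsi: "ret psi D' d = s (tau d)" if d: "d:D'" for d
 proof -
  have td: "tau d:D'" by (rule pairingD(2)[OF D'p d])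
  obtain n where n: "n > 0" "(f ^^ n) (tau d):D'" "ret f D' (tau d) = (f ^^ n) (tau d)"
   "!!i. 0 < i ==> i < n ==> (f ^^ i) (tau d)~:D'"
   using ret_time[OF pf D'D td] by metis
  have *: "Suc i<=n ==> (psi ^^ Suc i) d = (f ^^ Suc i) (tau d)" for i
  proof (induction i)
   case 0 thus ?case using psitau[OF d] by simp
  next
   case (Suc i)
   hence "(psi ^^ Suc i) d = (f ^^ Suc i) (tau d)" "(f ^^ Suc i) (tau d)~:D'"
    using n(4)[of "Suc i"] by auto
   hence "psi ((psi ^^ Suc i) d) = f ((f ^^ Suc i) (tau d))" using psif by metis
   thus ?case by simp
  qed
  have **: "(psi ^^ i) d = (f ^^ i) (tau d)" if "0 < i" "i<=n" for i
   using *[of "i-1"] that by simp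
  have "ret psi D' d = (psi ^^ n) d"
   by (rule ret_eqI) (use n ** in auto)
  thus ?thesis using n(3) **[OF n(1)] unfolding s_def by simp
 qed
 have meet: "EX e:D'. e : orb psi d" if d: "d:D" for d
 proof (rule ccontr)
  assume *: "~?thesis"
  have "orb f d <= orb psi d"
  proof (rule orb_subsetI)
   fix y assume y: "y : orb psi d"
   hence "psi y = f y" using * psif by metis
   thus "f y : orb psi d" using orb_step[OF y] by simp
  qed simp
  moreover obtain v where v: "(beta d, v):A" using iso V d by blast
  hence "delta (beta d, v) : orb f d" using fo[OF d] delta[OF v] by auto
  moreover have "delta (beta d, v):D'" unfolding D'_def using v by auto
  ultimately show False using * by blast
 qed
 have "orb psi ` D <= orb psi ` D'"
 proof
  fix Z assume "Z : orb psi ` D"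
  then obtain d where d: "d:D" "Z = orb psi d" by auto
  obtain e where "e:D'" "e : orb psi d" using meet[OF d(1)] by auto
  thus "Z : orb psi ` D'" using orb_eqI[OF ppsi d(1), of e] d by auto
 qed
 hence "ncyc psi D <= card (orb psi ` D')"
  unfolding ncyc_def using finite_subset[OF D'D perm_onD(1)[OF p]] by (intro card_mono) auto
 also have "\<dots> = ncyc (ret psi D') D'" by (rule ncyc_ret[OF ppsi D'D, symmetric])
 also have "\<dots> = ncyc (s\<circ>tau) D'"
  by (rule ncyc_cong[OF perm_on_ret[OF ppsi D'D]]) (simp add: retpsi)
 finally have npsi: "ncyc psi D<=ncyc (s\<circ>tau) D'" .
 define Z where "Z = D-(T Un D')"
 have Zp: "pairing tau Z"
 proof (rule pairing_subset[OF t])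
  show "Z<=D" unfolding Z_def by auto
  fix d assume d: "d:Z"
  hence "d:D" "d~:T Un D'" unfolding Z_def by auto
  hence "tau d:D" "tau (tau d) = d" using pairingD[OF t] by auto
  moreover have "tau d~:T Un D'"
   using pairingD(2)[OF TD'p, of "tau d"] `d ~: T Un D'` `tau (tau d) = d` by auto
  ultimately show "tau d:Z" unfolding Z_def by auto
 qed
 have un: "T Un D' Un Z = D" unfolding Z_def using TD D'D by auto
 have pD: "perm_on (\<sigma>\<circ>flip_on tau D) D" by (rule perm_on_flip[OF p t]) simp
 have "ncyc (\<sigma>\<circ>tau) D = ncyc (\<sigma>\<circ>flip_on tau D) D"
  by (rule ncyc_cong[OF pD, symmetric]) (simp add: flip_on_def)
 also have "\<dots><=ncyc psi D + card Z div 2"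
  using ncyc_flip_le[OF p Zp _ TD'p] un unfolding psi_def Z_def by fastforce
 finally have nst: "ncyc (\<sigma>\<circ>tau) D<=ncyc psi D + card Z div 2" .
 have finD: "finite D" by (rule perm_onD(1)[OF p])
 have cD: "card D = card T + card D' + card Z"
 proof -
  have fin: "finite T" "finite D'" "finite Z" using finD TD D'D finite_subset unfolding Z_def by auto
  have "card D = card (T Un D') + card Z"
   using card_Un_disjoint[of "T Un D'" Z] fin un unfolding Z_def by auto
  also have "card (T Un D') = card T + card D'"
   using card_Un_disjoint[of T D'] fin D'T by auto
  finally show ?thesis .
 qed
 have cA: "card D' = card A" unfolding D'_def by (rule card_image[OF inj])
 have ps: "perm_on s D'" unfolding s_def by (rule perm_on_ret[OF pf D'D])
 define rho where "rho q = the_inv_into A delta (s (delta q))" for q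
 have rho: "rho q:A & delta (rho q) = s (delta q)" if q: "q:A" for q
 proof -
  have "s (delta q):delta ` A" using perm_onD(2)[OF ps, of "delta q"] q unfolding D'_def by auto
  thus ?thesis unfolding rho_def
   using the_inv_into_into[OF inj _ order_refl] f_the_inv_into_f[OF inj] by auto
 qed
 have finA: "finite A" using finD D'D finite_subset finite_imageD[OF _ inj] unfolding D'_def by blast
 have prho: "perm_on rho A"
 proof (rule perm_onI[OF finA])
  show "inj_on rho A"
  proof (rule inj_onI)
   fix q r assume q: "q:A" "r:A" "rho q = rho r"
   hence "s (delta q) = s (delta r)" using rho by metis
   hence "delta q = delta r" using perm_onD(3)[OF ps] q unfolding D'_def by (auto dest: inj_onD)
   thus "q = r" using inj q by (auto dest: inj_onD)
  qed
 qed (use rho in auto)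
 have orbrho: "orb rho q = {r:A. fst r = fst q}" if q: "q:A" for q
 proof -
  have dq: "delta q:D'" unfolding D'_def using q by auto
  have "delta ` orb rho q = orb s (delta q)" by (rule orb_transport(1)[where rho = rho and s = s, OF inj q rho])
  also have "\<dots> = orb f (delta q) Int D'" unfolding s_def by (rule orb_ret[OF pf D'D dq])
  also have "\<dots> = delta ` {r:A. fst r = fst q}"
   using fo[OF deltaD(1)[OF q]] deltaD(1,2) q unfolding D'_def by auto
  finally have e: "delta ` orb rho q = delta ` {r:A. fst r = fst q}" .
  have "orb rho q<=A" by (rule orb_transport(2)[where rho = rho and s = s, OF inj q rho])
  thus ?thesis using inj_on_image_eq_iff[OF inj, of "orb rho q" "{r:A. fst r = fst q}"] e by auto
 qed
 have "ncyc (rho\<circ>prod.swap) A = ncyc (s\<circ>tau) (delta ` A)"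
  by (rule ncyc_transport[OF inj]) (use rho swA deltaD(3) in auto)
 hence nrho: "ncyc (rho\<circ>prod.swap) A = ncyc (s\<circ>tau) D'" unfolding D'_def .
 have ev: "even (card T)" "even (card D')" "even (card Z)"
  using even_pairing Tp D'p Zp by auto
 have "ncyc \<sigma> D+ncyc (\<sigma>\<circ>tau) D + card A div 2 <= card V+ncyc (rho\<circ>prod.swap) A + card D div 2"
 proof -
  have "card D div 2 = card T div 2 + card D' div 2 + card Z div 2"
   unfolding cD using ev by (auto elim!: evenE)
  thus ?thesis using n\<sigma> ncf nst npsi nrho cA unfolding f_def by linarith
 qed
 thus ?thesis using prho orbrho by (intro exI[of _ rho]) auto
qed

section \<open>Branch sets\<close>

text \<open>Connectedness is stated as the absence of cuts because \<open>spanning_forest\<close> meets branch sets in this form.\<close>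

definition conn :: "('l => 'l => bool) => 'l set => bool" where
 "conn R B \<longleftrightarrow> (ALL L. L<=B --> L~={} --> L~=B --> (EX x:L. EX y:B-L. R x y))"

lemma connD:
 assumes "conn R B" "L<=B" "L~={}" "L~=B"
 obtains x y where "x:L" "y:B" "y~:L" "R x y"
 using assms unfolding conn_def by blast

lemma conn_union:
 assumes B: "conn R B" and P: "!!i. i:I ==> conn R (P i)" "!!i. i:I ==> P i Int B~={}"
 shows "conn R (B Un (UN i:I. P i))"
 unfolding conn_def
proof (intro allI impI)
 fix L assume L: "L<=B Un (UN i:I. P i)" "L~={}" "L~=B Un (UN i:I. P i)"
 show "EX x:L. EX y:B Un (UN i:I. P i)-L. R x y"
 proof (cases "L Int B = {} | L Int B = B")
  case False
  then obtain x y where "x:L Int B" "y:B" "y~:L Int B" "R x y"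
   using connD[OF B, of "L Int B"] by blast
  thus ?thesis by blast
 next
  case True
  have "EX i:I. P i Int L~={} & P i Int L~=P i"
  proof (cases "L Int B = {}")
   case True
   then obtain i where i: "i:I" "P i Int L~={}" using L by blast
   thus ?thesis using P(2)[OF i(1)] True by blast
  next
   case False
   hence "B<=L" using True by blast
   then obtain i where i: "i:I" "P i Int L~=P i" using L by blast
   thus ?thesis using P(2)[OF i(1)] `B <= L` by blast
  qed
  then obtain i where i: "i:I" "P i Int L~={}" "P i Int L~=P i" by blast
  obtain x y where "x:P i Int L" "y:P i" "y~:P i Int L" "R x y"
   using connD[OF P(1)[OF i(1)], of "P i Int L"] i by blast
  thus ?thesis using i by blast
 qed
qed

lemma conn_insert:
 assumes B: "conn R B" and x: "x:B" and R: "R x y" "R y x"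
 shows "conn R (insert y B)"
proof -
 have "conn R {x, y}"
  unfolding conn_def
 proof (intro allI impI)
  fix L assume "L<={x, y}" "L~={}" "L~={x, y}"
  hence "L = {x} & x~=y | L = {y} & x~=y" by auto
  thus "EX a:L. EX b:{x, y}-L. R a b" using R by auto
 qed
 hence "conn R (B Un (UN i:{()}. {x, y}))" using B x by (intro conn_union) auto
 moreover have "B Un (UN i:{()}. {x, y}) = insert y B" using x by auto
 ultimately show ?thesis by simp
qed

text \<open>The witness is the part of \<open>Q\<close> that \<open>x\<close> reaches before entering \<open>K\<close>.\<close>

lemma conn_until:
 assumes sym: "!!a b. R a b ==> R b a"
  and Q: "conn R Q" and x: "x:Q" "x~:K" and QK: "Q Int K~={}"
 obtains P where "P<=Q" "P Int K = {}" "x:P" "conn R P" "EX a:P. EX b:K. R a b"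
proof -
 define P where "P = {y. (%a b. R a b & b:Q-K)\<^sup>*\<^sup>* x y}"
 have step: "b:P" if "a:P" "R a b" "b:Q" "b~:K" for a b
  using that unfolding P_def by (auto intro: rtranclp.rtrancl_into_rtrancl)
 have ind: "y:L" if "y:P" "x:L" "!!a b. a:L ==> a:P ==> R a b ==> b:Q ==> b~:K ==> b:L" for y L
 proof -
  have "(%a b. R a b & b:Q-K)\<^sup>*\<^sup>* x y" using that(1) unfolding P_def by simp
  hence "y:L & y:P"
  proof (induction rule: rtranclp_induct)
   case base show ?case using that(2) unfolding P_def by simp
  next
   case (step a b) thus ?case using that(3)[of a b] `!!a b. a : P ==> R a b ==> b : Q ==> b ~: K ==> b : P`[of a b] by auto
  qed
  thus ?thesis by simp
 qed
 have xP: "x:P" unfolding P_def by simp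
 have sub: "y:Q-K" if "y:P" for y by (rule ind[OF that]) (use x in auto)
 have cP: "conn R P"
  unfolding conn_def
 proof (intro allI impI)
  fix L assume L: "L<=P" "L~={}" "L~=P"
  show "EX a:L. EX b:P-L. R a b"
  proof (rule ccontr)
   assume no: "~?thesis"
   show False
   proof (cases "x:L")
    case True
    have "y:L" if "y:P" for y
     by (rule ind[OF that True]) (use no step L in blast)
    thus False using L by blast
   next
    case False
    have "y:P-L" if "y:P" for y
     by (rule ind[OF that]) (use no step L False xP sym in blast)+
    thus False using L by blast
   qed
  qed
 qed
 have "P~=Q" using sub QK by blast
 then obtain a b where "a:P" "b:Q" "b~:P" "R a b"
  using connD[OF Q, of P] sub xP by blast
 hence "b:K" using step by blast
 thus ?thesis using that[of P] sub xP cP `a : P` `R a b` by blast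
qed

text \<open>Disjoint connected sets can be enlarged, one adjacent vertex at a time, until they cover a connected graph.\<close>

lemma conn_extend:
 fixes B :: "'v => 'l set"
 assumes fin: "finite \<Lambda>" and sym: "!!a b. R a b ==> R b a" and \<Lambda>: "conn R \<Lambda>" and V: "V~={}"
 shows "(!!v. v:V ==> B v<=\<Lambda> & B v~={} & conn R (B v)) ==>
 (!!u v. u:V ==> v:V ==> u~=v ==> B u Int B v = {}) ==>
 EX b. (ALL l:\<Lambda>. b l:V) & (ALL v:V. conn R {l:\<Lambda>. b l = v} & B v<={l:\<Lambda>. b l = v})"
proof (induction "card (\<Lambda>-(UN v:V. B v))" arbitrary: B rule: less_induct)
 case less
 note B = less.prems(1) and disj = less.prems(2)
 show ?case
 proof (cases "(UN v:V. B v) = \<Lambda>")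
  case True
  define b where "b l = (SOME v. v:V & l:B v)" for l
  have b: "b l = v" if "v:V" "l:B v" for l v
  proof -
   have "b l:V & l:B (b l)" unfolding b_def by (rule someI[of _ v]) (use that in simp)
   thus ?thesis using disj[of "b l" v] that by blast
  qed
  have fib: "{l:\<Lambda>. b l = v} = B v" if v: "v:V" for v
  proof
   show "B v<={l:\<Lambda>. b l = v}" using b B v by auto
   show "{l:\<Lambda>. b l = v}<=B v"
   proof
    fix l assume l: "l:{l:\<Lambda>. b l = v}"
    then obtain w where w: "w:V" "l:B w" using True by auto
    thus "l:B v" using b[OF w] l by auto
   qed
  qed
  have "ALL l:\<Lambda>. b l:V" using True b by auto
  thus ?thesis using fib B by (intro exI[of _ b]) auto
 next
  case False
  let ?U = "UN v:V. B v"
  have U: "?U<=\<Lambda>" "?U~={}" using B V by blast+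
  obtain x y where xy: "x:?U" "y:\<Lambda>" "y~:?U" "R x y"
   by (rule connD[OF \<Lambda> U False])
  then obtain w where w: "w:V" "x:B w" by auto
  define B' where "B' v = (if v = w then insert y (B v) else B v)" for v
  have c: "conn R (insert y (B w))" using conn_insert[of R "B w" x y] B[OF w(1)] w xy sym by blast
  have U': "(UN v:V. B' v) = insert y ?U" unfolding B'_def using w by auto
  have "card (\<Lambda>-(UN v:V. B' v)) < card (\<Lambda> - ?U)"
   unfolding U' using fin xy by (intro psubset_card_mono) auto
  moreover have "B' v<=\<Lambda> & B' v~={} & conn R (B' v)" if "v:V" for v
   using B[OF that] c xy unfolding B'_def by auto
  moreover have "B' u Int B' v = {}" if "u:V" "v:V" "u~=v" for u v
   using disj[OF that] xy(3) that unfolding B'_def by auto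
  ultimately obtain b where b: "ALL l:\<Lambda>. b l:V"
   "ALL v:V. conn R {l:\<Lambda>. b l = v} & B' v<={l:\<Lambda>. b l = v}"
   using less.hyps[of B'] by blast
  have "B v<=B' v" for v unfolding B'_def by auto
  thus ?thesis using b by (intro exI[of _ b]) blast
 qed
qed

definition arcs :: "'v set set => ('v\<times>'v) set" where
 "arcs E = {(u, v). {u, v}:E}"

text \<open>An orientation of the edges is fixed. The branch set of \<open>v\<close> is made of \<open>K v\<close> and, for each edge \<open>e\<close> leaving \<open>v\<close>, of
the part of \<open>Q e\<close> before it enters the set of the other end; the step into that set is the dart that
represents \<open>e\<close>. Growing the branch sets until they cover the map leads to \<open>combinatorial_minor\<close>.\<close>

lemma rotation_from_branch_sets:
 fixes lab :: "'a => 'l" and V :: "'v set"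
 assumes p: "perm_on \<sigma> D" and t: "pairing tau D"
  and lab: "!!d. d:D ==> lab (\<sigma> d) = lab d"
  and single: "!!d d'. d:D ==> d':D ==> lab d = lab d' ==> d' : orb \<sigma> d"
  and R: "!!l l'. R l l' \<longleftrightarrow> (EX d:D. lab d = l & lab (tau d) = l')"
  and cD: "conn R (lab ` D)"
  and V: "V~={}" "!!v. v:V ==> EX e:E. v:e"
  and E: "!!e. e:E ==> EX u v. u~=v & e = {u, v} & u:V & v:V"
  and K: "!!v. v:V ==> K v<=lab ` D & K v~={} & conn R (K v)"
  and Kd: "!!u v. u:V ==> v:V ==> u~=v ==> K u Int K v = {}"
  and Q: "!!e. e:E ==> Q e<=lab ` D & conn R (Q e)"
  and Qd: "!!e f. e:E ==> f:E ==> e~=f ==> Q e Int Q f = {}"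
  and QK: "!!e v. e:E ==> v:V ==> Q e Int K v~={} \<longleftrightarrow> v:e"
 shows "EX rho. perm_on rho (arcs E) & (ALL u v. (u, v):arcs E --> orb rho (u, v) = {q:arcs E. fst q = u}) &
 ncyc \<sigma> D+ncyc (\<sigma>\<circ>tau) D + card (arcs E) div 2
 <= card V+ncyc (rho\<circ>prod.swap) (arcs E) + card D div 2"
proof -
 have sym: "R b a" if ab: "R a b" for a b
 proof -
  obtain d where "d:D" "lab d = a" "lab (tau d) = b" using ab unfolding R[of a b] by blast
  thus ?thesis using R[of b a] pairingD(2,3)[OF t] by metis
 qed
 have "EX h. ALL e:E. fst (h e)~=snd (h e) & e = {fst (h e), snd (h e)} & fst (h e):V & snd (h e):V"
  by (intro bchoice ballI) (insert E, metis fst_conv snd_conv)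
 then obtain h where h: "!!e. e:E ==> fst (h e)~=snd (h e) & e = {fst (h e), snd (h e)} & fst (h e):V & snd (h e):V"
  by blast
 define good where "good e P \<longleftrightarrow> P<=Q e & P Int K (snd (h e)) = {} & P Int K (fst (h e))~={} & conn R P &
 (EX a:P. EX b:K (snd (h e)). R a b)" for e P
 have "EX P. good e P" if e: "e:E" for e
 proof -
  have he: "fst (h e)~=snd (h e)" "fst (h e):V" "snd (h e):V" "fst (h e):e" "snd (h e):e"
   using h[OF e] by auto
  obtain x where x: "x:Q e" "x:K (fst (h e))" using QK[OF e he(2)] he by auto
  have nx: "x~:K (snd (h e))" using Kd[OF he(2,3,1)] x by auto
  have QKs: "Q e Int K (snd (h e))~={}" using QK[OF e he(3)] he by auto
  have cQ: "conn R (Q e)" using Q[OF e] by simp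
  obtain P where "P<=Q e" "P Int K (snd (h e)) = {}" "x:P" "conn R P" "EX a:P. EX b:K (snd (h e)). R a b"
   by (rule conn_until[of R "Q e" x "K (snd (h e))", OF sym cQ x(1) nx QKs])
  thus ?thesis unfolding good_def using x by (intro exI[of _ P]) blast
 qed
 hence "EX P. ALL e:E. good e (P e)" by (intro bchoice) blast
 then obtain P where P: "!!e. e:E ==> good e (P e)" by blast
 define B where "B v = K v Un (UN e:{e:E. fst (h e) = v}. P e)" for v
 have B1: "B v<=lab ` D & B v~={} & conn R (B v)" if v: "v:V" for v
 proof (intro conjI)
  show "B v<=lab ` D" unfolding B_def using K[OF v] P Q unfolding good_def by blast
  show "B v~={}" unfolding B_def using K[OF v] by blast
  show "conn R (B v)" unfolding B_def
   by (rule conn_union) (insert K[OF v] P, auto simp: good_def)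
 qed
 have PK: "P e Int K v = {}" if e: "e:E" and v: "v:V" "v~=fst (h e)" for e v
 proof (cases "v = snd (h e)")
  case True thus ?thesis using P[OF e] unfolding good_def by auto
 next
  case False
  hence "v~:e" using h[OF e] v by blast
  thus ?thesis using QK[OF e v(1)] P[OF e] unfolding good_def by blast
 qed
 have B2: "B u Int B v = {}" if uv: "u:V" "v:V" "u~=v" for u v
 proof -
  have "K u Int K v = {}" using Kd uv by blast
  moreover have "P e Int K v = {}" if "e:E" "fst (h e) = u" for e using PK[of e v] that uv by auto
  moreover have "P e Int K u = {}" if "e:E" "fst (h e) = v" for e using PK[of e u] that uv by auto
  moreover have "P e Int P f = {}" if "e:E" "f:E" "fst (h e) = u" "fst (h f) = v" for e f
   using Qd[of e f] P[of e] P[of f] that uv unfolding good_def by blast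
  ultimately show ?thesis unfolding B_def by blast
 qed
 have finL: "finite (lab ` D)" using perm_onD(1)[OF p] by simp
 obtain b where b: "ALL l:lab ` D. b l:V"
  "ALL v:V. conn R {l:lab ` D. b l = v} & B v<={l:lab ` D. b l = v}"
  using conn_extend[of "lab ` D" R V B, OF finL sym cD V(1) B1 B2] by blast
 define beta where "beta d = b (lab d)" for d
 have edge: "EX d:D. beta d = fst (h e) & beta (tau d) = snd (h e)" if e: "e:E" for e
 proof -
  obtain x y where xy: "x:P e" "y:K (snd (h e))" "R x y" using P[OF e] unfolding good_def by blast
  obtain d where d: "d:D" "lab d = x" "lab (tau d) = y" using xy R by blast
  have "x:B (fst (h e))" unfolding B_def using e xy by blast
  moreover have "y:B (snd (h e))" unfolding B_def using xy by blast
  ultimately have "b x = fst (h e)" "b y = snd (h e)" using b(2) h[OF e] by blast+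
  thus ?thesis using d unfolding beta_def by auto
 qed
 hence "EX dd. ALL e:E. dd e:D & beta (dd e) = fst (h e) & beta (tau (dd e)) = snd (h e)"
  by (intro bchoice) blast
 then obtain dd where dd: "!!e. e:E ==> dd e:D & beta (dd e) = fst (h e) & beta (tau (dd e)) = snd (h e)"
  by blast
 define delta where "delta q = (if fst q = fst (h {fst q, snd q}) then dd {fst q, snd q} else tau (dd {fst q, snd q}))" for q
 have beta\<sigma>: "beta (\<sigma> d) = beta d" if "d:D" for d unfolding beta_def using lab[OF that] by simp
 have betaV: "beta ` D = V"
 proof
  show "beta ` D<=V" unfolding beta_def using b by auto
  show "V<=beta ` D"
  proof
   fix v assume v: "v:V"
   obtain l where "l:K v" using K[OF v] by auto
   hence "l:B v" unfolding B_def by simp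
   hence "l:lab ` D" "b l = v" using b(2) v by blast+
   thus "v:beta ` D" unfolding beta_def by auto
  qed
 qed
 have cut: "EX d:Z. beta (tau d) = v & tau d~:Z"
  if Z: "Z<={d:D. beta d = v}" "Z~={}" "Z~={d:D. beta d = v}" "!!d. d:Z ==> \<sigma> d:Z" for v Z
 proof -
  have sat: "d':Z" if "d:Z" "d':D" "lab d = lab d'" for d d'
  proof -
   have "d' : orb \<sigma> d" using single[of d d'] that Z(1) by blast
   moreover have "orb \<sigma> d<=Z" by (rule orb_subsetI) (use that Z(4) in auto)
   ultimately show ?thesis by blast
  qed
  have vV: "v:V" using Z(1,2) betaV by blast
  let ?C = "{l:lab ` D. b l = v}"
  have 1: "lab ` Z<=?C" using Z(1) unfolding beta_def by auto
  have 2: "lab ` Z~=?C"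
  proof
   assume e: "lab ` Z = ?C"
   have "{d:D. beta d = v}<=Z"
   proof
    fix d assume "d:{d:D. beta d = v}"
    hence "d:D" "lab d:lab ` Z" using e unfolding beta_def by auto
    thus "d:Z" using sat by auto
   qed
   thus False using Z by blast
  qed
  obtain x y where xy: "x:lab ` Z" "y:?C" "y~:lab ` Z" "R x y"
   using connD[of R ?C "lab ` Z"] b(2) vV 1 2 Z(2) by blast
  obtain d where d: "d:D" "lab d = x" "lab (tau d) = y" using xy R by blast
  have "d:Z" using xy d sat by auto
  thus ?thesis using xy d unfolding beta_def by (intro bexI[of _ d]) auto
 qed
 have A: "(v, u):arcs E & u~=v" if "(u, v):arcs E" for u v
 proof -
  have e: "{u, v}:E" using that unfolding arcs_def by simp
  obtain a c where "a ~= c" "{u, v} = {a, c}" using E[OF e] by blast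
  thus ?thesis using e unfolding arcs_def by (auto simp: insert_commute)
 qed
 have iso: "EX v. (u, v):arcs E" if u: "u:V" for u
 proof -
  obtain e where e: "e:E" "u:e" using V(2)[OF u] by blast
  then obtain a c where "e = {a, c}" using E by blast
  thus ?thesis using e unfolding arcs_def by (auto simp: insert_commute)
 qed
 have delta: "delta (u, v):D & beta (delta (u, v)) = u & tau (delta (u, v)) = delta (v, u)" if uv: "(u, v):arcs E" for u v
 proof -
  have e: "{u, v}:E" using uv unfolding arcs_def by simp
  have ne: "u~=v" using A[OF uv] by simp
  have hh: "{u, v} = {fst (h {u, v}), snd (h {u, v})}" using h[OF e] by blast
  have d: "dd {u, v}:D" "beta (dd {u, v}) = fst (h {u, v})" "beta (tau (dd {u, v})) = snd (h {u, v})"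
   using dd[OF e] by auto
  have c: "{v, u} = {u, v}" by auto
  have td: "tau (dd {u, v}):D" "tau (tau (dd {u, v})) = dd {u, v}" using pairingD(2,3)[OF t d(1)] by auto
  have "u = fst (h {u, v}) & v = snd (h {u, v}) | v = fst (h {u, v}) & u = snd (h {u, v})"
   using hh ne by (metis doubleton_eq_iff)
  thus ?thesis using d td ne unfolding delta_def by (auto simp: c)
 qed
 show ?thesis
  by (rule combinatorial_minor[of \<sigma> D tau beta V "arcs E" delta, OF p t beta\<sigma> betaV cut A iso delta])
qed

section \<open>The double of a set of lattice squares\<close>

datatype dir = East | North | West | South

primrec lft :: "dir => dir" where
 "lft East = North" | "lft North = West" | "lft West = South" | "lft South = East"

primrec rgt :: "dir => dir" where
 "rgt East = South" | "rgt North = East" | "rgt West = North" | "rgt South = West"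

primrec opp :: "dir => dir" where
 "opp East = West" | "opp North = South" | "opp West = East" | "opp South = North"

lemma dir_simps [simp]: "lft (rgt r) = r" "rgt (lft r) = r" "opp (opp r) = r"
 "lft (opp r) = rgt r" "rgt (opp r) = lft r" "opp (lft r) = rgt r" "opp (rgt r) = lft r"
 "lft (lft r) = opp r" "rgt (rgt r) = opp r"
 by (cases r; simp)+

lemma opp_neq [simp]: "opp r~=r"
 by (cases r) auto

lemma UNIV_dir: "(UNIV :: dir set) = {East, North, West, South}"
 using dir.exhaust by blast

lemma all_dir: "(ALL r. P r) \<longleftrightarrow> P East & P North & P West & P South"
 by (metis dir.exhaust)

primrec quad :: "int\<times>int => dir => int\<times>int" where
 "quad p East = p"
| "quad p North = (fst p-1, snd p)"
| "quad p West = (fst p-1, snd p-1)"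
| "quad p South = (fst p, snd p-1)"

primrec step :: "int\<times>int => dir => int\<times>int" where
 "step p East = (fst p+1, snd p)"
| "step p North = (fst p, snd p+1)"
| "step p West = (fst p-1, snd p)"
| "step p South = (fst p, snd p-1)"

lemma step_opp [simp]: "step (step p r) (opp r) = p"
 by (cases r) auto

lemma quad_step [simp]: "quad (step p r) (opp r) = quad p (rgt r)"
 "quad (step p r) (lft r) = quad p r"
 by (cases r; auto)+

definition fcell :: "bool => int\<times>int => dir => int\<times>int" where
 "fcell s p r = quad p (if s then r else rgt r)"

definition turn :: "bool => dir => dir" where
 "turn s r = (if s then lft r else rgt r)"

text \<open>Two copies (sheets) of a set of unit squares, glued along the boundary, form a closed surface. A dart
\<open>(s, p, r)\<close> starts at the lattice point \<open>p\<close> in direction \<open>r\<close> and belongs to the cell \<open>fcell s p r\<close> of the sheet \<open>s\<close>: the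
cell to its left on one sheet, to its right on the other, which orients the double. At a boundary
edge, one of the two sides has no cell, and reversal and rotation change the sheet.\<close>

type_synonym dart = "bool\<times>(int\<times>int)\<times>dir"

definition darts :: "(int\<times>int) set => dart set" where
 "darts C = {(s, p, r). fcell s p r:C}"

definition gtau :: "(int\<times>int) set => dart => dart" where
 "gtau C = (%(s, p, r). (if fcell (~s) p r:C then s else ~s, step p r, opp r))"

definition gphi :: "dart => dart" where
 "gphi = (%(s, p, r). (s, step p r, turn s r))"

definition gsig :: "(int\<times>int) set => dart => dart" where
 "gsig C = (%(s, p, r). if fcell (~s) p r:C then (s, p, turn (~s) r) else (~s, p, turn s r))"

definition inter :: "(int\<times>int) set => int\<times>int => bool" where
 "inter C p \<longleftrightarrow> (ALL r. quad p r:C)"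

text \<open>The vertex of the double at which a dart starts: the sheet is recorded for interior points only, since
the two copies of a boundary point are glued.\<close>

definition lab :: "(int\<times>int) set => dart => (int\<times>int)\<times>bool" where
 "lab C = (%(s, p, r). (p, inter C p & ~s))"

lemma in_darts [simp]: "(s, p, r):darts C \<longleftrightarrow> fcell s p r:C"
 by (simp add: darts_def)

lemma fcell_rev [simp]: "fcell s (step p r) (opp r) = fcell (~s) p r"
 "fcell s (step p r) (turn s r) = fcell s p r"
 by (cases r; cases s; simp add: fcell_def turn_def)+

lemma finite_darts:
 assumes "finite C"
 shows "finite (darts C)" "card (darts C)<=8 * card C"
proof -
 define pt where "pt c s r = (fst c-fst (fcell s (0, 0) r), snd c-snd (fcell s (0, 0) r))"
  for c :: "int\<times>int" and s r
 have pt: "pt (fcell s p r) s r = p" for s p r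
  unfolding pt_def fcell_def by (cases p; cases r; cases s) auto
 have sub: "darts C<=(%(c, s, r). (s, pt c s r, r)) ` (C\<times>UNIV\<times>UNIV)"
 proof
  fix d assume "d:darts C"
  then obtain s p r where d: "d = (s, p, r)" "fcell s p r:C" unfolding darts_def by auto
  thus "d:(%(c, s, r). (s, pt c s r, r)) ` (C\<times>UNIV\<times>UNIV)"
   using pt by (intro image_eqI[of _ _ "(fcell s p r, s, r)"]) auto
 qed
 have fin: "finite (C\<times>(UNIV :: bool set)\<times>(UNIV :: dir set))" using assms by (simp add: UNIV_dir)
 show "finite (darts C)" using finite_surj[OF fin sub] .
 have "card (darts C) <= card (C\<times>(UNIV :: bool set)\<times>(UNIV :: dir set))"
  by (rule surj_card_le[OF fin sub])
 thus "card (darts C)<=8 * card C" by (simp add: card_cartesian_product UNIV_dir)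
qed

lemma gtau_pairing:
 assumes "finite C"
 shows "pairing (gtau C) (darts C)"
 unfolding pairing_def
proof (intro conjI ballI finite_darts[OF assms])
 fix d assume "d:darts C"
 then obtain s p r where d: "d = (s, p, r)" and c: "fcell s p r:C"
  unfolding darts_def by auto
 show "gtau C d:darts C" "gtau C (gtau C d) = d" using c unfolding d gtau_def by auto
 show "gtau C d~=d" unfolding d gtau_def by auto
qed

lemma gphi_in: "d:darts C ==> gphi d:darts C"
 by (cases d) (simp add: gphi_def)

lemma gphi4: "gphi (gphi (gphi (gphi d))) = d"
proof (cases d)
 case (fields s p r)
 thus ?thesis by (cases r; cases s; simp add: gphi_def turn_def)
qed

lemma perm_gphi:
 assumes "finite C"
 shows "perm_on gphi (darts C)"
proof (rule perm_onI[OF finite_darts(1)[OF assms] gphi_in])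
 show "inj_on gphi (darts C)" by (rule inj_on_inverseI[of _ "%d. gphi (gphi (gphi d))"]) (rule gphi4)
qed

lemma gsig_gtau:
 assumes "d:darts C"
 shows "gsig C (gtau C d) = gphi d"
proof (cases d)
 case (fields s p r)
 thus ?thesis using assms by (cases s) (auto simp: gsig_def gtau_def gphi_def turn_def)
qed

lemma perm_gsig:
 assumes "finite C"
 shows "perm_on (gsig C) (darts C)"
proof -
 note t = pairingD[OF gtau_pairing[OF assms]]
 have e: "gsig C d = gphi (gtau C d)" if "d:darts C" for d
  using gsig_gtau[OF t(2)[OF that]] t(3)[OF that] by simp
 show ?thesis
 proof (rule perm_onI[OF finite_darts(1)[OF assms]])
  show "gsig C d:darts C" if "d:darts C" for d using e t(2) gphi_in that by simp
  show "inj_on (gsig C) (darts C)"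
  proof (rule inj_onI)
   fix d d' assume dd: "d:darts C" "d':darts C" "gsig C d = gsig C d'"
   hence "gtau C d = gtau C d'"
    using e[OF dd(1)] e[OF dd(2)] inj_onD[OF perm_onD(3)[OF perm_gphi[OF assms]]] t(2)[OF dd(1)] t(2)[OF dd(2)] by simp
   thus "d = d'" using t(3)[OF dd(1)] t(3)[OF dd(2)] by metis
  qed
 qed
qed

text \<open>The faces of the double are the copies of the cells.\<close>

lemma ncyc_gphi:
 assumes "finite C"
 shows "card (darts C)<=4 * ncyc (gsig C\<circ>gtau C) (darts C)"
proof -
 have p: "perm_on gphi (darts C)" by (rule perm_gphi[OF assms])
 have "card Z<=4" if Z: "Z : orb gphi ` darts C" for Z
 proof -
  obtain d where d: "d:darts C" "Z = orb gphi d" using Z by blast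
  have "orb gphi d<={d, gphi d, gphi (gphi d), gphi (gphi (gphi d))}"
  proof (rule orb_subsetI)
   fix y assume "y:{d, gphi d, gphi (gphi d), gphi (gphi (gphi d))}"
   thus "gphi y:{d, gphi d, gphi (gphi d), gphi (gphi (gphi d))}" using gphi4[of d] by force
  qed simp
  hence "card Z <= card {d, gphi d, gphi (gphi d), gphi (gphi (gphi d))}"
   unfolding d by (intro card_mono) auto
  also have "\<dots><=4" by (simp add: card_insert_if)
  finally show ?thesis .
 qed
 hence "(SUM Z:orb gphi ` darts C. card Z)<=(SUM Z:orb gphi ` darts C. 4)" by (rule sum_mono)
 hence "card (darts C)<=4 * ncyc gphi (darts C)" unfolding sum_orbits[OF p] ncyc_def by simp
 moreover have "ncyc gphi (darts C) = ncyc (gsig C\<circ>gtau C) (darts C)"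
  by (rule ncyc_cong[OF p]) (simp add: gsig_gtau)
 ultimately show ?thesis by simp
qed

lemma lab_gsig: "lab C (gsig C d) = lab C d" if "d:darts C"
proof (cases d)
 case (fields s p r)
 have "~inter C p" if "fcell (~s) p r~:C" using that unfolding inter_def fcell_def by auto
 thus ?thesis unfolding fields lab_def gsig_def by auto
qed

text \<open>The rotation at a lattice point depends only on which of the four incident cells are present.\<close>

definition nxt :: "(dir => bool) => bool\<times>dir => bool\<times>dir" where
 "nxt q = (%(s, r). if q (if s then rgt r else r) then (s, turn (~s) r) else (~s, turn s r))"

definition qd :: "(dir => bool) => bool\<times>dir => bool" where
 "qd q = (%(s, r). q (if s then r else rgt r))"

definition qfun :: "bool => bool => bool => bool => dir => bool" where
 "qfun a b c d r = (case r of East => a | North => b | West => c | South => d)"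

primrec iterates :: "nat => ('a => 'a) => 'a => 'a list" where
 "iterates 0 f x = [x]"
| "iterates (Suc n) f x = x # iterates n f (f x)"

lemma iterates_orb: "set (iterates n f x) <= orb f x"
proof (induction n arbitrary: x)
 case (Suc n)
 have "orb f (f x) <= orb f x" by (rule orb_mono_mem) simp
 thus ?case using Suc[of "f x"] by auto
qed simp

text \<open>Apart from the two patterns in which cells meet in the point only, all darts at a point lie in a single
cycle, or in one cycle for each sheet if all four cells are present.\<close>

definition local_check :: bool where
 "local_check \<longleftrightarrow> (let bs = [False, True]; ds = List.product bs [East, North, West, South] in
 list_all (%(a, b, c, d). (a & c & ~b & ~d | b & d & ~a & ~c) |
 list_all (%x. ~qd (qfun a b c d) x | list_all (%y. ~qd (qfun a b c d) y | (a & b & c & d & fst x~=fst y) |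
  y:set (iterates 7 (nxt (qfun a b c d)) x)) ds) ds)
 (List.product bs (List.product bs (List.product bs bs))))"

lemma local_check: local_check
 by code_simp

lemma local_orbit:
 assumes np: "~(a & c & ~b & ~d)" "~(b & d & ~a & ~c)"
  and q: "qd (qfun a b c d) x" "qd (qfun a b c d) y" and ne: "~(a & b & c & d & fst x~=fst y)"
 shows "y : orb (nxt (qfun a b c d)) x"
proof -
 define ds where "ds = List.product [False, True] [East, North, West, South]"
 have "r:{East, North, West, South}" for r :: dir using UNIV_dir by blast
 hence in_ds: "x:set ds" "y:set ds" unfolding ds_def set_product by (cases x, cases y, auto)+
 define qs where "qs = List.product [False, True] (List.product [False, True] (List.product [False, True] [False, True]))"
 have in_q: "(a, b, c, d):set qs" unfolding qs_def set_product by (cases a; cases b; cases c; cases d; simp)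
 have "ALL (a, b, c, d):set qs. (a & c & ~b & ~d | b & d & ~a & ~c) |
 (ALL x:set ds. ~qd (qfun a b c d) x | (ALL y:set ds. ~qd (qfun a b c d) y | (a & b & c & d & fst x~=fst y) |
  y:set (iterates 7 (nxt (qfun a b c d)) x)))"
  using local_check unfolding local_check_def Let_def list_all_iff qs_def ds_def .
 from bspec[OF this in_q] np have "ALL x:set ds. ~qd (qfun a b c d) x | (ALL y:set ds. ~qd (qfun a b c d) y | (a & b & c & d & fst x~=fst y) |
  y:set (iterates 7 (nxt (qfun a b c d)) x))" by (simp only: prod.case) argo
 from bspec[OF this in_ds(1)] q(1) have "ALL y:set ds. ~qd (qfun a b c d) y | (a & b & c & d & fst x~=fst y) |
  y:set (iterates 7 (nxt (qfun a b c d)) x)" by argo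
 from bspec[OF this in_ds(2)] q(2) ne have "y:set (iterates 7 (nxt (qfun a b c d)) x)" by argo
 thus ?thesis using iterates_orb by fast
qed

definition nopinch :: "(int\<times>int) set => bool" where
 "nopinch C \<longleftrightarrow> (ALL p r. ~(quad p r:C & quad p (opp r):C & quad p (lft r)~:C & quad p (rgt r)~:C))"

lemma gsig_single:
 assumes np: "nopinch C" and d: "d:darts C" "d':darts C" "lab C d = lab C d'"
 shows "d' : orb (gsig C) d"
proof -
 obtain s p r where dd: "d = (s, p, r)" and c: "fcell s p r:C"
  using d unfolding darts_def by auto
 obtain s' r' where dd': "d' = (s', p, r')" and c': "fcell s' p r':C"
  using d dd unfolding darts_def lab_def by auto
 define q where "q = qfun (quad p East:C) (quad p North:C) (quad p West:C) (quad p South:C)"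
 have q: "q r \<longleftrightarrow> quad p r:C" for r unfolding q_def qfun_def by (cases r) auto
 have nx: "gsig C (s, p, r) = (fst (nxt q (s, r)), p, snd (nxt q (s, r)))" for s r
  unfolding nxt_def gsig_def fcell_def q by auto
 have it: "(gsig C ^^ n) d = (fst ((nxt q ^^ n) (s, r)), p, snd ((nxt q ^^ n) (s, r)))" for n
 proof (induction n)
  case (Suc n)
  obtain u v where uv: "(nxt q ^^ n) (s, r) = (u, v)" by (cases "(nxt q ^^ n) (s, r)") auto
  show ?case using Suc nx[of u v] uv by simp
 qed (simp add: dd)
 have "inter C p \<longleftrightarrow> quad p East:C & quad p North:C & quad p West:C & quad p South:C"
  unfolding inter_def all_dir ..
 hence ne: "~(quad p East:C & quad p North:C & quad p West:C & quad p South:C & s~=s')"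
  using d(3) unfolding dd dd' lab_def by auto
 have qq: "qd q (s, r)" "qd q (s', r')" using c c' unfolding qd_def fcell_def q by auto
 have np': "~(quad p East:C & quad p West:C & quad p North~:C & quad p South~:C)"
  "~(quad p North:C & quad p South:C & quad p East~:C & quad p West~:C)"
  using np[unfolded nopinch_def, rule_format, of p East] np[unfolded nopinch_def, rule_format, of p North] by auto
 have "(s', r') : orb (nxt q) (s, r)"
  unfolding q_def by (rule local_orbit[OF np']) (insert qq ne, simp_all add: q_def)
 hence "EX n. (s', r') = (nxt q ^^ n) (s, r)" unfolding orb_def image_iff by simp
 then obtain n where "(s', r') = (nxt q ^^ n) (s, r)" by blast
 hence "d' = (gsig C ^^ n) d" using it[of n] dd' by (metis fst_conv snd_conv)
 thus ?thesis unfolding orb_def by blast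
qed

definition adj :: "(int\<times>int) set => (int\<times>int)\<times>bool => (int\<times>int)\<times>bool => bool" where
 "adj C l l' \<longleftrightarrow> (EX d:darts C. lab C d = l & lab C (gtau C d) = l')"

definition pl :: "(int\<times>int) set => bool => int\<times>int => (int\<times>int)\<times>bool" where
 "pl C s p = (p, inter C p & ~s)"

definition corners :: "(int\<times>int) set => bool => int\<times>int => ((int\<times>int)\<times>bool) set" where
 "corners C s c = pl C s ` {c, (fst c+1, snd c), (fst c+1, snd c+1), (fst c, snd c+1)}"

lemma adj_step:
 assumes "quad p r:C"
 shows "adj C (pl C s p) (pl C s (step p r)) & adj C (pl C s (step p r)) (pl C s p)"
proof -
 have i: "inter C q ==> quad q r:C" for q r unfolding inter_def by auto
 have iq: "inter C p | inter C (step p r) ==> fcell False p r:C"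
  using i[of p "rgt r"] i[of "step p r" "opp r"] unfolding fcell_def by auto
 have q: "fcell True p r:C" using assms unfolding fcell_def by simp
 have g1: "gtau C (True, p, r) = (fcell False p r:C, step p r, opp r)"
  unfolding gtau_def by simp
 have g2: "gtau C (False, step p r, opp r) = (fcell False p r~:C, p, r)"
  unfolding gtau_def by auto
 have g1': "gtau C (gtau C (True, p, r)) = (True, p, r)" unfolding gtau_def using q by auto
 have g2': "gtau C (gtau C (False, step p r, opp r)) = (False, step p r, opp r)" unfolding gtau_def using q by auto
 have d: "(True, p, r):darts C" "(False, step p r, opp r):darts C"
  "gtau C (True, p, r):darts C" "gtau C (False, step p r, opp r):darts C"
  using q unfolding g1 g2 by (cases "fcell False p r:C"; simp)+
 have l1: "lab C (True, p, r) = pl C True p" "lab C (gtau C (True, p, r)) = pl C True (step p r)"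
  using iq unfolding g1 lab_def pl_def by auto
 have l2: "lab C (False, step p r, opp r) = pl C False (step p r)"
  "lab C (gtau C (False, step p r, opp r)) = pl C False p"
  using iq unfolding g2 lab_def pl_def by auto
 have "adj C (pl C True p) (pl C True (step p r))" unfolding adj_def using d(1) l1 by blast
 moreover have "adj C (pl C True (step p r)) (pl C True p)" unfolding adj_def using d(3) l1 g1' by metis
 moreover have "adj C (pl C False (step p r)) (pl C False p)" unfolding adj_def using d(2) l2 by blast
 moreover have "adj C (pl C False p) (pl C False (step p r))" unfolding adj_def using d(4) l2 g2' by metis
 ultimately show ?thesis by (cases s) auto
qed

text \<open>The four corners of a cell form a cycle of adjacent vertices.\<close>

lemma adj_corners:
 assumes c: "c:C" and L: "!!a b. a:L ==> b : corners C s c ==> adj C a b ==> b:L"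
 shows "corners C s c<=L | corners C s c Int L = {}"
proof -
 obtain x y where xy: "c = (x, y)" by (cases c)
 have 1: "adj C (pl C s (x, y)) (pl C s (x+1, y)) & adj C (pl C s (x+1, y)) (pl C s (x, y))"
  using adj_step[of "(x, y)" East C s] c unfolding xy by simp
 have 2: "adj C (pl C s (x+1, y)) (pl C s (x+1, y+1)) & adj C (pl C s (x+1, y+1)) (pl C s (x+1, y))"
  using adj_step[of "(x+1, y)" North C s] c unfolding xy by simp
 have 3: "adj C (pl C s (x+1, y+1)) (pl C s (x, y+1)) & adj C (pl C s (x, y+1)) (pl C s (x+1, y+1))"
  using adj_step[of "(x+1, y+1)" West C s] c unfolding xy by simp
 have e: "corners C s c = {pl C s (x, y), pl C s (x+1, y), pl C s (x+1, y+1), pl C s (x, y+1)}"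
  unfolding corners_def xy by auto
 have L': "b:L" if "a:L" "b:{pl C s (x, y), pl C s (x+1, y), pl C s (x+1, y+1), pl C s (x, y+1)}" "adj C a b" for a b
  using L that unfolding e by blast
 have "pl C s (x, y):L \<longleftrightarrow> pl C s (x+1, y):L"
  using 1 L'[of "pl C s (x, y)" "pl C s (x+1, y)"] L'[of "pl C s (x+1, y)" "pl C s (x, y)"] by blast
 moreover have "pl C s (x+1, y):L \<longleftrightarrow> pl C s (x+1, y+1):L"
  using 2 L'[of "pl C s (x+1, y)" "pl C s (x+1, y+1)"] L'[of "pl C s (x+1, y+1)" "pl C s (x+1, y)"] by blast
 moreover have "pl C s (x+1, y+1):L \<longleftrightarrow> pl C s (x, y+1):L"
  using 3 L'[of "pl C s (x+1, y+1)" "pl C s (x, y+1)"] L'[of "pl C s (x, y+1)" "pl C s (x+1, y+1)"] by blast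
 ultimately show ?thesis unfolding e by blast
qed

lemma quad_corner: "quad p r = c ==> p:{c, (fst c+1, snd c), (fst c+1, snd c+1), (fst c, snd c+1)}"
 by (cases r; cases p; cases c) auto

lemma corner_quad:
 assumes "p:{c, (fst c+1, snd c), (fst c+1, snd c+1), (fst c, snd c+1)}"
 obtains r where "quad p r = c"
proof -
 have "quad p East = c | quad p North = c | quad p West = c | quad p South = c"
  using assms by (cases p; cases c) auto
 thus ?thesis using that by blast
qed

lemma corners_in_lab:
 assumes "c:C"
 shows "corners C s c<=lab C ` darts C"
proof
 fix l assume "l : corners C s c"
 then obtain p where p: "l = pl C s p" "p:{c, (fst c+1, snd c), (fst c+1, snd c+1), (fst c, snd c+1)}"
  unfolding corners_def by (erule imageE)
 obtain r where r: "quad p r = c" using corner_quad[OF p(2)] .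
 have "(True, p, r):darts C" "(False, p, lft r):darts C"
  "lab C (True, p, r) = pl C True p" "lab C (False, p, lft r) = pl C False p"
  unfolding in_darts fcell_def lab_def pl_def using r assms by simp_all
 thus "l:lab C ` darts C"
  using image_eqI[of "pl C True p" "lab C" "(True, p, r)"] image_eqI[of "pl C False p" "lab C" "(False, p, lft r)"]
  unfolding p(1) by (cases s) metis+
qed

lemma lab_in_corner:
 assumes "l:lab C ` darts C"
 shows "EX s c. c:C & l : corners C s c"
proof -
 obtain s p r where d: "fcell s p r:C" "l = lab C (s, p, r)" using assms unfolding darts_def by auto
 have "p:{c, (fst c+1, snd c), (fst c+1, snd c+1), (fst c, snd c+1)}" if "c = fcell s p r" for c
  using quad_corner[of p _ c] that unfolding fcell_def by blast
 hence "l : corners C s (fcell s p r)" unfolding corners_def d(2) lab_def pl_def by auto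
 thus ?thesis using d by blast
qed

text \<open>The corners of one cell are connected along its edges, so cells linked by common corners have a connected
set of corners.\<close>

lemma conn_cells:
 assumes K: "K = (UN (s, c):Q. corners C s c)" and Q: "!!s c. (s, c):Q ==> c:C"
  and cut: "!!P. P<=Q ==> P~={} ==> P~=Q ==>
 EX (s, c):P. EX (s', c'):Q-P. corners C s c Int corners C s' c'~={}"
 shows "conn (adj C) K"
 unfolding conn_def
proof (intro allI impI)
 fix L assume L: "L<=K" "L~={}" "L~=K"
 show "EX x:L. EX y:K-L. adj C x y"
 proof (rule ccontr)
  assume no: "~?thesis"
  have sub: "corners C s c<=K" if "(s, c):Q" for s c using K that by auto
  have all: "corners C s c<=L | corners C s c Int L = {}" if "(s, c):Q" for s c
   by (rule adj_corners[OF Q[OF that]]) (use no sub[OF that] in blast)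
  define P where "P = {(s, c):Q. corners C s c<=L}"
  have "P~={}"
  proof -
   obtain l where "l:L" using L by auto
   then obtain s c where sc: "(s, c):Q" "l : corners C s c" using L K by blast
   hence "(s, c):P" unfolding P_def using all[OF sc(1)] `l : L` by auto
   thus ?thesis by auto
  qed
  moreover have "P~=Q"
  proof
   assume e: "P = Q"
   have "K<=L" unfolding K using e unfolding P_def by auto
   thus False using L by auto
  qed
  ultimately obtain s c s' c' where *: "(s, c):P" "(s', c'):Q-P" "corners C s c Int corners C s' c'~={}"
   using cut[of P] unfolding P_def by blast
  hence "corners C s c<=L" "(s', c'):Q" "~corners C s' c'<=L" unfolding P_def by auto
  thus False using all[of s' c'] * by blast
 qed
qed

section \<open>A planar region with holes\<close>

definition rend :: "nat => int => int" where
 "rend k N = 8 * int k * N+4 * N"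

definition base_cells :: "nat => int => (int\<times>int) set" where
 "base_cells k N = {- (4 * N) ..< rend k N}\<times>{- N ..< 0}"

definition arch_cells :: "int => int => (int\<times>int) set" where
 "arch_cells b N = {(x, y). b-3 * N<=x & x < b+3 * N & 0<=y & y < 3 * N &
 (y < N --> x < b-N | b+N<=x)}"

lemma arch_sub:
 "arch_cells b N<={b-3 * N ..< b-N}\<times>{0 ..< N} Un {b+N ..< b+3 * N}\<times>{0 ..< N} Un 
 {b-3 * N ..< b+3 * N}\<times>{N ..< 3 * N}"
 unfolding arch_cells_def by auto

lemma finite_arch [simp]: "finite (arch_cells b N)"
 using finite_subset[OF arch_sub] by simp

definition ctr :: "int => nat => int" where
 "ctr N m = 8 * int m * N"

text \<open>A strip with \<open>k\<close> arches standing on it, each enclosing a hole; a unit of length consists of \<open>N\<close> cells.\<close>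

definition poly_cells :: "nat => int => (int\<times>int) set" where
 "poly_cells k N = base_cells k N Un (\<Union>m<k. arch_cells (ctr N m) N)"

lemma finite_poly [simp]: "finite (poly_cells k N)"
 unfolding poly_cells_def base_cells_def by auto

lemma ctr_sep:
 assumes "N > 0" "m < m'"
 shows "ctr N m+8 * N <= ctr N m'"
proof -
 have "(8*(int m+1)) * N<=(8 * int m') * N" using assms by (intro mult_right_mono) auto
 thus ?thesis unfolding ctr_def by (simp add: algebra_simps)
qed

lemma ctr_range:
 assumes "N > 0" "m < k"
 shows "0 <= ctr N m" "ctr N m+12 * N<=rend k N"
 using assms ctr_sep[of N m k] unfolding ctr_def rend_def by auto

lemma rend_ge: "N > 0 ==> 4 * N<=rend k N"
 unfolding rend_def by simp

lemma int_card_rect: "int (card ({a..b}\<times>{c..d})) = max 0 (b-a+1) * max 0 (d - c+1)" for a b c d :: int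
 by (simp add: card_cartesian_product max_def)

lemma card_poly:
 assumes N: "N > 0"
 shows "int (card (poly_cells k N))<=(8 * int k+8) * N * N+int k*(16 * N * N)"
proof -
 have b: "int (card (base_cells k N)) = (8 * int k+8) * N * N"
  unfolding base_cells_def rend_def using N by (simp add: card_cartesian_product algebra_simps)
 have a: "int (card (arch_cells c N))<=16 * N * N" for c
 proof -
  have "card (arch_cells c N) <= card ({c-3 * N ..< c-N}\<times>{0 ..< N} Un {c+N ..< c+3 * N}\<times>{0 ..< N} Un 
 {c-3 * N ..< c+3 * N}\<times>{N ..< 3 * N})"
   by (rule card_mono[OF _ arch_sub]) simp
  also have "\<dots> <= card ({c-3 * N ..< c-N}\<times>{0 ..< N}) + card ({c+N ..< c+3 * N}\<times>{0 ..< N}) +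
 card ({c-3 * N ..< c+3 * N}\<times>{N ..< 3 * N})"
   by (meson card_Un_le add_le_mono1 le_trans)
  finally have le: "int (card (arch_cells c N))<=int (card ({c-3 * N ..< c-N}\<times>{0 ..< N}) + card ({c+N ..< c+3 * N}\<times>{0 ..< N}) +
 card ({c-3 * N ..< c+3 * N}\<times>{N ..< 3 * N}))" by linarith
  also have "\<dots> = 16 * N * N" using N by (simp add: card_cartesian_product algebra_simps)
  finally show ?thesis .
 qed
 have "card (poly_cells k N) <= card (base_cells k N) + card (\<Union>m<k. arch_cells (ctr N m) N)"
  unfolding poly_cells_def by (rule card_Un_le)
 moreover have "card (\<Union>m<k. arch_cells (ctr N m) N)<=(\<Sum>m<k. card (arch_cells (ctr N m) N))"
  by (rule card_UN_le) simp
 moreover have "(\<Sum>m<k. int (card (arch_cells (ctr N m) N)))<=(\<Sum>m<k. 16 * N * N)"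
  by (rule sum_mono) (rule a)
 moreover have "int (\<Sum>m<k. card (arch_cells (ctr N m) N)) = (\<Sum>m<k. int (card (arch_cells (ctr N m) N)))"
  by (rule of_nat_sum)
 moreover have "(\<Sum>m<k. 16 * N * N) = int k*(16 * N * N)" by simp
 ultimately show ?thesis using b by linarith
qed

text \<open>Boundary vertices belong to both sheets, so the double has one vertex for each point in \<open>closed_pts\<close> and
another one for each point in \<open>inner_pts\<close>.\<close>

definition closed_pts :: "nat => int => (int\<times>int) set" where
 "closed_pts k N = {- (4 * N) .. rend k N}\<times>{- N .. 0} Un 
 (\<Union>m<k. {ctr N m-3 * N .. ctr N m-N}\<times>{1 .. N-1} Un {ctr N m+N .. ctr N m+3 * N}\<times>{1 .. N-1} Un 
 {ctr N m-3 * N .. ctr N m+3 * N}\<times>{N .. 3 * N})"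

definition inner_pts :: "nat => int => (int\<times>int) set" where
 "inner_pts k N = {- (4 * N)+1 .. rend k N-1}\<times>{- N+1 .. -1} Un 
 (\<Union>m<k. {ctr N m-3 * N+1 .. ctr N m-N-1}\<times>{0 .. N} Un {ctr N m+N+1 .. ctr N m+3 * N-1}\<times>{0 .. N} Un 
 {ctr N m-3 * N+1 .. ctr N m+3 * N-1}\<times>{N+1 .. 3 * N-1})"

lemma card_three_rects:
 fixes A B C :: "(int\<times>int) set"
 assumes "finite A" "finite B" "finite C" "A Int B = {}" "A Int C = {}" "B Int C = {}"
 shows "int (card (A Un B Un C)) = int (card A)+int (card B)+int (card C)"
 using assms by (simp add: card_Un_disjoint Int_Un_distrib2)

lemma card_arches:
 fixes A :: "nat => (int\<times>int) set"
 assumes N: "N > 0" and A: "!!m. finite (A m) & A m<={ctr N m-3 * N .. ctr N m+3 * N}\<times>UNIV" and c: "!!m. int (card (A m)) = c"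
 shows "int (card (\<Union>m<k. A m)) = int k * c"
proof -
 have "A m Int A m' = {}" if "m~=m'" for m m'
 proof -
  have "ctr N m+8 * N <= ctr N m' | ctr N m'+8 * N <= ctr N m"
   using ctr_sep[OF N] that by (cases m m' rule: linorder_cases) auto
  thus ?thesis using A[of m] A[of m'] N by fastforce
 qed
 hence "card (\<Union>m<k. A m) = (\<Sum>m<k. card (A m))"
  using A by (intro card_UN_disjoint) auto
 thus ?thesis using c by (simp add: of_nat_sum)
qed

lemma card_closed_inner:
 assumes N: "N > 0"
 shows "int (card (closed_pts k N))+int (card (inner_pts k N)) = 2*((8 * int k+8) * N * N+int k*(16 * N * N))+2-2 * int k"
proof -
 define L where "L = (8 * int k+8) * N"
 have L: "L>=8 * N" unfolding L_def using N by (simp add: algebra_simps)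
 have k0: "0<=8 * int k * N" using N by simp
 define A where "A m = {ctr N m-3 * N .. ctr N m-N}\<times>{1 .. N-1} Un {ctr N m+N .. ctr N m+3 * N}\<times>{1 .. N-1} Un 
 {ctr N m-3 * N .. ctr N m+3 * N}\<times>{N .. 3 * N}" for m
 define B where "B m = {ctr N m-3 * N+1 .. ctr N m-N-1}\<times>{0 .. N} Un {ctr N m+N+1 .. ctr N m+3 * N-1}\<times>{0 .. N} Un 
 {ctr N m-3 * N+1 .. ctr N m+3 * N-1}\<times>{N+1 .. 3 * N-1}" for m
 have cA: "int (card (A m)) = 2*((2 * N+1)*(N-1))+(6 * N+1)*(2 * N+1)" for m
  unfolding A_def using N by (subst card_three_rects) (auto simp: int_card_rect max_def)
 have cB: "int (card (B m)) = 2*((2 * N-1)*(N+1))+(6 * N-1)*(2 * N-1)" for m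
  unfolding B_def using N by (subst card_three_rects) (auto simp: int_card_rect max_def)
 have UA: "int (card (\<Union>m<k. A m)) = int k*(2*((2 * N+1)*(N-1))+(6 * N+1)*(2 * N+1))"
  by (rule card_arches[OF N _ cA]) (insert N, auto simp: A_def)
 have UB: "int (card (\<Union>m<k. B m)) = int k*(2*((2 * N-1)*(N+1))+(6 * N-1)*(2 * N-1))"
  by (rule card_arches[OF N _ cB]) (insert N, auto simp: B_def)
 have fin: "finite (\<Union>m<k. A m)" "finite (\<Union>m<k. B m)" unfolding A_def B_def by auto
 have "card (closed_pts k N) = card ({- (4 * N) .. rend k N}\<times>{- N .. 0}) + card (\<Union>m<k. A m)"
 proof -
  have "1<=snd p" if "p:A m" for p m
   using that N unfolding A_def by (elim UnE) (simp_all add: mem_Times_iff)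
  moreover have "snd p<=0" if "p:{- (4 * N) .. rend k N}\<times>{- N .. 0}" for p
   using that by (cases p) simp
  ultimately have "p~:A m" if "p:{- (4 * N) .. rend k N}\<times>{- N .. 0}" for p m
   using that by fastforce
  hence "({- (4 * N) .. rend k N}\<times>{- N .. 0}) Int (\<Union>m<k. A m) = {}" by blast
  thus ?thesis unfolding closed_pts_def A_def[symmetric] using fin by (intro card_Un_disjoint) simp_all
 qed
 moreover have "int (card ({- (4 * N) .. rend k N}\<times>{- N .. 0})) = (L+1)*(N+1)"
  unfolding int_card_rect L_def rend_def using N k0 by (simp add: max_def algebra_simps)
 moreover have "card (inner_pts k N) = card ({- (4 * N)+1 .. rend k N-1}\<times>{- N+1 .. -1}) + card (\<Union>m<k. B m)"
 proof -
  have "0<=snd p" if "p:B m" for p m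
   using that N unfolding B_def by (elim UnE) (simp_all add: mem_Times_iff)
  moreover have "snd p<=-1" if "p:{- (4 * N)+1 .. rend k N-1}\<times>{- N+1 .. -1}" for p
   using that by (cases p) simp
  ultimately have "p~:B m" if "p:{- (4 * N)+1 .. rend k N-1}\<times>{- N+1 .. -1}" for p m
   using that by fastforce
  hence "({- (4 * N)+1 .. rend k N-1}\<times>{- N+1 .. -1}) Int (\<Union>m<k. B m) = {}" by blast
  thus ?thesis unfolding inner_pts_def B_def[symmetric] using fin by (intro card_Un_disjoint) simp_all
 qed
 moreover have "int (card ({- (4 * N)+1 .. rend k N-1}\<times>{- N+1 .. -1})) = (L-1)*(N-1)"
 proof -
  have "rend k N-1-(- (4 * N)+1)+1 = L-1" "-1-(- N+1)+1 = N-1"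
   unfolding L_def rend_def by (simp_all add: algebra_simps)
  thus ?thesis unfolding int_card_rect using L N by simp
 qed
 ultimately have "int (card (closed_pts k N))+int (card (inner_pts k N)) = (L+1)*(N+1)+(L-1)*(N-1) +
 int k*(2*((2 * N+1)*(N-1))+(6 * N+1)*(2 * N+1))+int k*(2*((2 * N-1)*(N+1))+(6 * N-1)*(2 * N-1))"
  using UA UB by simp
 also have "\<dots> = 2*(L * N)+2+int k*(32 * N * N-2)" by (simp add: algebra_simps)
 finally show ?thesis unfolding L_def by (simp add: algebra_simps)
qed

lemma in_base: "(x, y):base_cells k N \<longleftrightarrow>-(4 * N)<=x & x < rend k N &-N<=y & y < 0"
 unfolding base_cells_def by auto

lemma in_arch: "(x, y):arch_cells b N \<longleftrightarrow> b-3 * N<=x & x < b+3 * N & 0<=y & y < 3 * N & (y < N --> x < b-N | b+N<=x)"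
 unfolding arch_cells_def by simp

lemma poly_near:
 assumes N: "N > 0" and m: "m < k" and x: "ctr N m-4 * N<=x" "x < ctr N m+4 * N"
 shows "(x, y):poly_cells k N \<longleftrightarrow>-N<=y & y < 0 | (x, y):arch_cells (ctr N m) N"
proof -
 have u: "m' = m" if "(x, y):arch_cells (ctr N m') N" for m'
 proof (rule ccontr)
  assume "m'~=m"
  hence "ctr N m+8 * N <= ctr N m' | ctr N m'+8 * N <= ctr N m"
   using ctr_sep[OF N] by (cases m m' rule: linorder_cases) auto
  thus False using that x N unfolding in_arch by auto
 qed
 have "- (4 * N)<=x" "x < rend k N"
  using ctr_range[OF N m] x N by auto
 hence b: "(x, y):base_cells k N \<longleftrightarrow>-N<=y & y < 0" unfolding in_base by simp
 show ?thesis unfolding poly_cells_def Un_iff UN_iff b using m u by blast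
qed

lemma poly_nopinch:
 assumes N: "N > 0"
 shows "nopinch (poly_cells k N)"
 unfolding nopinch_def
proof (intro allI)
 fix p :: "int\<times>int" and r
 obtain x y where p: "p = (x, y)" by (cases p)
 let ?C = "poly_cells k N"
 have main: "~((x, y):?C & (x-1, y-1):?C & (x-1, y)~:?C & (x, y-1)~:?C)"
  "~((x-1, y):?C & (x, y-1):?C & (x, y)~:?C & (x-1, y-1)~:?C)"
 proof -
  have "(~((x, y):?C & (x-1, y-1):?C & (x-1, y)~:?C & (x, y-1)~:?C)) &
 ~((x-1, y):?C & (x, y-1):?C & (x, y)~:?C & (x-1, y-1)~:?C)"
  proof (cases "EX m<k. ctr N m-3 * N<=x & x <= ctr N m+3 * N")
   case True
   then obtain m where m: "m < k" "ctr N m-3 * N<=x" "x <= ctr N m+3 * N" by auto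
   have xs: "ctr N m-4 * N<=x" "x < ctr N m+4 * N" "ctr N m-4 * N<=x-1" "x-1 < ctr N m+4 * N"
    using m N by auto
   have near: "(u, v):?C \<longleftrightarrow>-N<=v & v < 0 | (u, v):arch_cells (ctr N m) N" if "u = x | u = x-1" for u v
    using poly_near[OF N m(1), of u v] xs that by blast
   consider "y<=- N" | "- N < y & y<=0" | "0 < y & y < N" | "y = N" | "N < y & y < 3 * N" | "3 * N<=y" by linarith
   hence "(ALL u. u = x | u = x-1 --> (u, y):?C --> (u, y-1):?C) |
 (ALL u. u = x | u = x-1 --> (u, y-1):?C --> (u, y):?C)"
    by cases (insert near N, simp_all add: in_arch)
   thus ?thesis by blast
  next
   case False
   have no: "(x, z)~:arch_cells (ctr N m) N" "(x-1, z)~:arch_cells (ctr N m) N" if "m < k" for z m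
   proof -
    have "~(ctr N m-3 * N<=x & x <= ctr N m+3 * N)" using False that by blast
    thus "(x, z)~:arch_cells (ctr N m) N" "(x-1, z)~:arch_cells (ctr N m) N"
     unfolding in_arch by linarith+
   qed
   have "(x, z):?C \<longleftrightarrow> (x, z):base_cells k N" "(x-1, z):?C \<longleftrightarrow> (x-1, z):base_cells k N" for z
    unfolding poly_cells_def using no by blast+
   thus ?thesis unfolding in_base by auto
  qed
  thus "~((x, y):?C & (x-1, y-1):?C & (x-1, y)~:?C & (x, y-1)~:?C)"
   "~((x-1, y):?C & (x, y-1):?C & (x, y)~:?C & (x-1, y-1)~:?C)" by auto
 qed
 show "~(quad p r:?C & quad p (opp r):?C & quad p (lft r)~:?C & quad p (rgt r)~:?C)"
  using main unfolding p by (cases r) auto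
qed

lemma inter_iff: "inter C (x, y) \<longleftrightarrow> (x, y):C & (x-1, y):C & (x-1, y-1):C & (x, y-1):C"
 unfolding inter_def all_dir by simp

lemma inner_inter:
 assumes N: "N > 0" and p: "p:inner_pts k N"
 shows "inter (poly_cells k N) p"
proof -
 obtain x y where xy: "p = (x, y)" by (cases p)
 consider "- (4 * N)+1<=x" "x<=rend k N-1" "- N+1<=y" "y<=-1"
  | m where "m < k" "0<=y" "y<=N" "ctr N m-3 * N+1<=x & x <= ctr N m-N-1 | ctr N m+N+1<=x & x <= ctr N m+3 * N-1"
  | m where "m < k" "N+1<=y" "y<=3 * N-1" "ctr N m-3 * N+1<=x" "x <= ctr N m+3 * N-1"
  using p unfolding inner_pts_def xy by auto
 thus ?thesis
 proof cases
  case 1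
  thus ?thesis unfolding xy inter_iff poly_cells_def by (auto simp: in_base)
 next
  case (2 m)
  hence xs: "ctr N m-4 * N<=x" "x < ctr N m+4 * N" "ctr N m-4 * N<=x-1" "x-1 < ctr N m+4 * N"
   using N by auto
  show ?thesis unfolding xy inter_iff poly_near[OF N 2(1) xs(1,2)] poly_near[OF N 2(1) xs(3,4)] in_arch
   using N 2 by auto
 next
  case (3 m)
  hence xs: "ctr N m-4 * N<=x" "x < ctr N m+4 * N" "ctr N m-4 * N<=x-1" "x-1 < ctr N m+4 * N"
   using N by auto
  show ?thesis unfolding xy inter_iff poly_near[OF N 3(1) xs(1,2)] poly_near[OF N 3(1) xs(3,4)] in_arch
   using N 3 by auto
 qed
qed

lemma closed_corner:
 assumes N: "N > 0" and p: "p : closed_pts k N"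
 shows "EX r. quad p r:poly_cells k N"
proof -
 obtain x y where xy: "p = (x, y)" by (cases p)
 have "(x, y):poly_cells k N | (x-1, y):poly_cells k N | (x-1, y-1):poly_cells k N | (x, y-1):poly_cells k N"
 proof -
  consider "- (4 * N)<=x" "x<=rend k N" "- N<=y" "y<=0"
   | m where "m < k" "1<=y" "y<=3 * N" "ctr N m-3 * N<=x" "x <= ctr N m+3 * N" "y < N --> x <= ctr N m-N | ctr N m+N<=x"
   using p N unfolding closed_pts_def xy by fastforce
  thus ?thesis
  proof cases
   case 1
   have "((if x < rend k N then x else x-1), (if y < 0 then y else y-1)):base_cells k N"
    using 1 N rend_ge[OF N, of k] unfolding in_base by (cases "x < rend k N"; cases "y < 0") simp_all
   hence "((if x < rend k N then x else x-1), (if y < 0 then y else y-1)):poly_cells k N"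
    unfolding poly_cells_def by blast
   thus ?thesis by (cases "x < rend k N"; cases "y < 0") simp_all
  next
   case (2 m)
   hence "(x, y):arch_cells (ctr N m) N | (x-1, y):arch_cells (ctr N m) N | (x-1, y-1):arch_cells (ctr N m) N | (x, y-1):arch_cells (ctr N m) N"
   proof (cases "x <= ctr N m-N")
    case True
    hence "((if x = ctr N m-3 * N then x else x-1), (if y = 3 * N then y-1 else y)):arch_cells (ctr N m) N |
  ((if x = ctr N m-3 * N then x else x-1), y-1):arch_cells (ctr N m) N"
     using 2 N unfolding in_arch by (cases "x = ctr N m-3 * N"; simp; linarith)
    thus ?thesis by (cases "x = ctr N m-3 * N"; cases "y = 3 * N") auto
   next
    case False
    show ?thesis
    proof (cases "ctr N m+N<=x")
     case True
     hence "((if x = ctr N m+3 * N then x-1 else x), y-1):arch_cells (ctr N m) N"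
      using 2 N unfolding in_arch by (cases "x = ctr N m+3 * N"; simp)
     thus ?thesis by (cases "x = ctr N m+3 * N") simp_all
    next
     case F: False
     hence "(x, (if y = N then y else y-1)):arch_cells (ctr N m) N"
      using 2 N False unfolding in_arch by (cases "y = N"; simp)
     thus ?thesis by (cases "y = N") simp_all
    qed
   qed
   thus ?thesis unfolding poly_cells_def using 2(1) by blast
  qed
 qed
 moreover have "quad p East = (x, y)" "quad p North = (x-1, y)" "quad p West = (x-1, y-1)" "quad p South = (x, y-1)"
  unfolding xy by auto
 ultimately show ?thesis by metis
qed

text \<open>With \<open>C\<close> cells, the double has \<open>2 C\<close> faces and \<open>4 C\<close> edges, so the bound on the number of vertices says that
its Euler characteristic is at least \<open>2 - 2 k\<close>.\<close>

lemma card_labels: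
 assumes N: "N > 0"
 shows "2 * int (card (poly_cells k N))+2<=int (card (lab (poly_cells k N) ` darts (poly_cells k N)))+2 * int k"
proof -
 let ?C = "poly_cells k N"
 have sub: "(%p. (p, False)) ` closed_pts k N Un (%p. (p, True)) ` inner_pts k N<=lab ?C ` darts ?C"
 proof -
  have "(p, False):lab ?C ` darts ?C" if p: "p : closed_pts k N" for p
  proof -
   obtain r where "quad p r:?C" using closed_corner[OF N p] by auto
   hence "(True, p, r):darts ?C" "lab ?C (True, p, r) = (p, False)"
    unfolding in_darts fcell_def lab_def by auto
   thus ?thesis by (metis imageI)
  qed
  moreover have "(p, True):lab ?C ` darts ?C" if p: "p:inner_pts k N" for p
  proof -
   have i: "inter ?C p" by (rule inner_inter[OF N p])
   hence "(False, p, East):darts ?C" "lab ?C (False, p, East) = (p, True)"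
    unfolding in_darts fcell_def lab_def using i[unfolded inter_def, rule_format, of South] by auto
   thus ?thesis by (metis imageI)
  qed
  ultimately show ?thesis by blast
 qed
 have fin: "finite (closed_pts k N)" "finite (inner_pts k N)" unfolding closed_pts_def inner_pts_def by auto
 have "card (closed_pts k N) + card (inner_pts k N) = card ((%p. (p, False)) ` closed_pts k N Un (%p. (p, True)) ` inner_pts k N)"
  using fin by (subst card_Un_disjoint) (auto simp: card_image inj_on_def)
 also have "\<dots> <= card (lab ?C ` darts ?C)"
  using sub finite_darts(1)[OF finite_poly] by (intro card_mono) auto
 finally have le: "card (closed_pts k N) + card (inner_pts k N) <= card (lab ?C ` darts ?C)" .
 define M where "M = (8 * int k+8) * N * N+int k*(16 * N * N)"
 show ?thesis
  using le card_closed_inner[OF N, of k, folded M_def] card_poly[OF N, of k, folded M_def] by linarith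
qed

lemma int_const:
 fixes h :: "int => 'b"
 assumes "a<=b" "!!t. a<=t ==> t < b ==> h t = h (t+1)"
 shows "h a = h b"
 using assms
proof (induction b rule: int_ge_induct)
 case (step i)
 hence "h i = h (i+1)" by simp
 thus ?case using step by simp
qed simp

lemma poly_conn:
 assumes N: "N > 0"
 shows "conn (adj (poly_cells k N)) (lab (poly_cells k N) ` darts (poly_cells k N))"
proof (rule conn_cells[where Q = "(UNIV :: bool set)\<times>poly_cells k N"])
 let ?C = "poly_cells k N"
 show "lab ?C ` darts ?C = (UN (s, c):UNIV\<times>?C. corners ?C s c)"
  using lab_in_corner[of _ ?C] corners_in_lab[of _ ?C] by fast
 show "c:?C" if "(s, c):(UNIV :: bool set)\<times>?C" for s c using that by simp
 fix P :: "(bool\<times>int\<times>int) set" assume P: "P<=UNIV\<times>?C" "P~={}" "P~=UNIV\<times>?C"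
 show "EX (s, c):P. EX (s', c'):UNIV\<times>?C-P. corners ?C s c Int corners ?C s' c'~={}"
 proof (rule ccontr)
  assume no: "~?thesis"
  define g where "g s c \<longleftrightarrow> (s, c):P" for s c
  have g: "g s c = g s' c'" if "c:?C" "c':?C" "corners ?C s c Int corners ?C s' c'~={}" for s c s' c'
   using no that unfolding g_def by blast
  have h: "g s (x, y) = g s (x+1, y)" if "(x, y):?C" "(x+1, y):?C" for s x y
   by (rule g[OF that]) (auto simp: corners_def)
  have v: "g s (x, y) = g s (x, y+1)" if "(x, y):?C" "(x, y+1):?C" for s x y
   by (rule g[OF that]) (auto simp: corners_def)
  have k4: "- (4 * N) < rend k N" using N rend_ge[OF N, of k] by linarith
  have baseC: "(x, y):?C" if "- (4 * N)<=x" "x < rend k N" "- N<=y" "y < 0" for x y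
   unfolding poly_cells_def using that in_base by auto
  have base: "g s (x, y) = g s (- (4 * N), - N)" if xy: "- (4 * N)<=x" "x < rend k N" "- N<=y" "y < 0" for s x y
  proof -
   have "g s (- (4 * N), y) = g s (x, y)"
    by (rule int_const[of _ _ "%t. g s (t, y)"]) (insert xy, auto intro!: h baseC)
   moreover have "g s (- (4 * N), - N) = g s (- (4 * N), y)"
    by (rule int_const[of _ _ "%t. g s (- (4 * N), t)"]) (insert xy k4, auto intro!: v baseC)
   ultimately show ?thesis by simp
  qed
  have nb: "(- (4 * N)-1, y)~:?C" for y
   unfolding poly_cells_def in_base using ctr_range(1)[OF N] in_arch N by (force simp: in_base)
  have "~inter ?C (- (4 * N), - N)" unfolding inter_iff using nb by auto
  hence sheets: "g True (- (4 * N), - N) = g False (- (4 * N), - N)"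
   by (intro g) (insert baseC N k4, auto simp: corners_def pl_def)
  have all: "g s c = g True (- (4 * N), - N)" if c: "c:?C" for s c
  proof -
   obtain x y where xy: "c = (x, y)" by (cases c)
   have "g s (x, y) = g s (- (4 * N), - N)"
   proof (cases "(x, y):base_cells k N")
    case True
    thus ?thesis using base[of x y s] unfolding in_base by blast
   next
    case False
    then obtain m where m: "m < k" "(x, y):arch_cells (ctr N m) N" using c unfolding poly_cells_def xy by auto
    note ar = m(2)[unfolded in_arch]
    have archC: "(x', y'):?C" if "ctr N m-3 * N<=x'" "x' < ctr N m+3 * N" "- N<=y'" "y' < 3 * N"
     "0<=y' & y' < N --> x' < ctr N m-N | ctr N m+N<=x'" for x' y'
    proof -
     have "ctr N m-4 * N<=x'" "x' < ctr N m+4 * N" using that N by auto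
     from poly_near[OF N m(1) this] show ?thesis unfolding in_arch using that by (cases "y' < 0") auto
    qed
    have down: "g s (x', - N) = g s (x', y')" if "ctr N m-3 * N<=x'" "x' < ctr N m+3 * N" "- N<=y'" "y' < 3 * N"
     "x' < ctr N m-N | ctr N m+N<=x'" for x' y'
     by (rule int_const[of _ _ "%t. g s (x', t)"]) (insert that, auto intro!: v archC)
    have bb: "g s (x', - N) = g s (- (4 * N), - N)" if "ctr N m-3 * N<=x'" "x' < ctr N m+3 * N" for x'
     using base[of x' "- N" s] ctr_range[OF N m(1)] that N by auto
    show ?thesis
    proof (cases "y < N")
     case True
     thus ?thesis using down[of x y] bb[of x] ar N by auto
    next
     case False
     have "g s (ctr N m-3 * N, y) = g s (x, y)"
      by (rule int_const[of _ _ "%t. g s (t, y)"]) (insert ar False N, auto intro!: h archC)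
     thus ?thesis using down[of "ctr N m-3 * N" y] bb[of "ctr N m-3 * N"] ar N False by auto
    qed
   qed
   thus ?thesis unfolding xy using sheets by (cases s) auto
  qed
  obtain s c where "(s, c):P" using P by auto
  hence "g True (- (4 * N), - N)" using all[of c s] P unfolding g_def by auto
  hence "(s, c):P" if "c:?C" for s c using all[OF that, of s] unfolding g_def by simp
  thus False using P by auto
 qed
qed

lemma rotation_from_grid:
 fixes V :: "'v set"
 assumes N: "N > 0"
  and V: "V~={}" "!!v. v:V ==> EX e:E. v:e"
  and E: "!!e. e:E ==> EX u v. u~=v & e = {u, v} & u:V & v:V"
  and K: "!!v. v:V ==> K v<=lab (poly_cells k N) ` darts (poly_cells k N) & K v~={} & conn (adj (poly_cells k N)) (K v)"
  and Kd: "!!u v. u:V ==> v:V ==> u~=v ==> K u Int K v = {}"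
  and Q: "!!e. e:E ==> Q e<=lab (poly_cells k N) ` darts (poly_cells k N) & conn (adj (poly_cells k N)) (Q e)"
  and Qd: "!!e f. e:E ==> f:E ==> e~=f ==> Q e Int Q f = {}"
  and QK: "!!e v. e:E ==> v:V ==> Q e Int K v~={} \<longleftrightarrow> v:e"
 shows "EX rho. perm_on rho (arcs E) & (ALL u v. (u, v):arcs E --> orb rho (u, v) = {q:arcs E. fst q = u}) &
 card (arcs E) div 2+2 <= card V+ncyc (rho\<circ>prod.swap) (arcs E)+2 * k"
proof -
 let ?C = "poly_cells k N"
 have fC: "finite ?C" by simp
 obtain rho where rho: "perm_on rho (arcs E)" "ALL u v. (u, v):arcs E --> orb rho (u, v) = {q:arcs E. fst q = u}"
  and n: "ncyc (gsig ?C) (darts ?C)+ncyc (gsig ?C\<circ>gtau ?C) (darts ?C) + card (arcs E) div 2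
 <= card V+ncyc (rho\<circ>prod.swap) (arcs E) + card (darts ?C) div 2"
  using rotation_from_branch_sets[OF perm_gsig[OF fC] gtau_pairing[OF fC] lab_gsig gsig_single[OF poly_nopinch[OF N]] adj_def
   poly_conn[OF N] V E K Kd Q Qd QK] by blast
 have "card (lab ?C ` darts ?C)<=ncyc (gsig ?C) (darts ?C)"
 proof -
  have const: "lab C d = lab C d'" if "d':darts C" "d : orb (gsig C) d'" "finite C" for C d d'
  proof -
   have "orb (gsig C) d'<={d:darts C. lab C d = lab C d'}"
    by (rule orb_subsetI) (use that lab_gsig perm_onD(2)[OF perm_gsig[OF that(3)]] in auto)
   thus ?thesis using that by auto
  qed
  have "lab ?C ` darts ?C<=(%Z. lab ?C (SOME d. d:Z)) ` (orb (gsig ?C) ` darts ?C)"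
  proof
   fix l assume "l:lab ?C ` darts ?C"
   then obtain d where d: "d:darts ?C" "l = lab ?C d" by blast
   have "(SOME d'. d' : orb (gsig ?C) d) : orb (gsig ?C) d" by (rule someI[of _ d]) simp
   hence "l = lab ?C (SOME d'. d' : orb (gsig ?C) d)" using const[OF d(1) _ fC] d by metis
   thus "l:(%Z. lab ?C (SOME d. d:Z)) ` (orb (gsig ?C) ` darts ?C)" using d by blast
  qed
  thus ?thesis unfolding ncyc_def using finite_darts(1)[OF fC]
   by (intro surj_card_le) auto
 qed
 moreover have "card (darts ?C)<=4 * ncyc (gsig ?C\<circ>gtau ?C) (darts ?C)" by (rule ncyc_gphi[OF fC])
 moreover have "card (darts ?C)<=8 * card ?C" by (rule finite_darts(2)[OF fC])
 moreover have "2 * int (card ?C)+2<=int (card (lab ?C ` darts ?C))+2 * int k" by (rule card_labels[OF N])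
 ultimately have "card (arcs E) div 2+2 <= card V+ncyc (rho\<circ>prod.swap) (arcs E)+2 * k"
  using n by linarith
 thus ?thesis using rho by blast
qed

section \<open>The surface as the double of a planar region\<close>

text \<open>The rims of the removed discs are the points of the top face with \<open>\<bar>y\<bar> = etaf k x\<close>.\<close>

definition etaf :: "nat => real => real" where
 "etaf k x = (\<Sum>m<k. sqrt (max 0 (1-(abs(x-8 * real m)-2)\<^sup>2)))"

text \<open>A rescaled distance from the plane \<open>y = 0\<close>: it vanishes in this plane away from the handles and on the rims of
the discs, and equals 2 where \<open>\<bar>y\<bar> = 2\<close>. The factor \<open>1 + z\<close> removes the correction for the discs at the bottom.\<close>

definition depth :: "nat => real\<times>real\<times>real => real" where
 "depth k = (%(x, y, z). 2*(abs(y)-etaf k x*(1+z)) / (2-etaf k x*(1+z)))"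

text \<open>Either half of the box is mapped onto the strip. The level sets of the depth are carried to concentric
rectangles, which shrink by the factor one half as the depth grows from 0 to 2.\<close>

definition box_h :: "nat => real\<times>real\<times>real => real\<times>real" where
 "box_h k = (%(x, y, z). (4 * real k+(1-depth k (x, y, z) / 4)*(x-4 * real k),
 - (1/2)+(1-depth k (x, y, z) / 4)*(z+1/2)))"

text \<open>Projecting a tube along the \<open>y\<close>-axis gives a half annulus; stretching circles to squares turns it into an arch.\<close>

definition tube_h :: "nat => real\<times>real\<times>real => real\<times>real" where
 "tube_h m = (%(x, y, z). (8 * real m+(x-8 * real m)*(sqrt ((x-8 * real m)\<^sup>2+z\<^sup>2) / max \<bar>x-8 * real m\<bar> z),
 z*(sqrt ((x-8 * real m)\<^sup>2+z\<^sup>2) / max \<bar>x-8 * real m\<bar> z)))"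

definition hmap :: "nat => real\<times>real\<times>real => real\<times>real" where
 "hmap k p = (if snd (snd p)<=0 then box_h k p else tube_h (nat \<lfloor>(fst p+4) / 8\<rfloor>) p)"

lemma etaf_term_0: "3<=abs(x-8 * real m) ==> sqrt (max 0 (1-(abs(x-8 * real m)-2)\<^sup>2)) = 0"
proof -
 assume "3<=abs(x-8 * real m)"
 hence "1<=(abs(x-8 * real m)-2)\<^sup>2" by (intro one_le_power) simp
 thus ?thesis by (simp add: max_def)
qed

lemma etaf_near:
 assumes m: "m < k" "abs(x-8 * real m)<=5"
 shows "etaf k x = sqrt (max 0 (1-(abs(x-8 * real m)-2)\<^sup>2))"
proof -
 have "sqrt (max 0 (1-(abs(x-8 * real i)-2)\<^sup>2)) = 0" if "i~=m" for i
 proof (rule etaf_term_0)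
  have "abs(real i-real m)>=1" using that by (simp add: abs_if; linarith)
  thus "3<=abs(x-8 * real i)" using m(2) by linarith
 qed
 hence "etaf k x = (\<Sum>i<k. if i = m then sqrt (max 0 (1-(abs(x-8 * real m)-2)\<^sup>2)) else 0)"
  unfolding etaf_def by (intro sum.cong) auto
 thus ?thesis using m(1) by simp
qed

lemma etaf_far:
 assumes "!!m. m < k ==> 3<=abs(x-8 * real m)"
 shows "etaf k x = 0"
 unfolding etaf_def using etaf_term_0 assms by (intro sum.neutral) auto

lemma etaf_cases:
 obtains "etaf k x = 0" "!!m. m < k ==> 3<=abs(x-8 * real m)"
 | m where "m < k" "abs(x-8 * real m) < 3" "etaf k x = sqrt (max 0 (1-(abs(x-8 * real m)-2)\<^sup>2))"
proof (cases "EX m<k. \<bar>x-8 * real m\<bar> < 3")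
 case True
 then obtain m where "m < k" "abs(x-8 * real m) < 3" by auto
 thus ?thesis using that(2) etaf_near by force
next
 case False
 thus ?thesis using that(1) etaf_far by force
qed

lemma etaf_bounds: "0<=etaf k x" "etaf k x<=1"
proof -
 show "0<=etaf k x" unfolding etaf_def by (intro sum_nonneg) auto
 show "etaf k x<=1"
  by (rule etaf_cases[of k x]) (auto simp: max_def)
qed

lemma continuous_etaf [continuous_intros]: "continuous_on A f ==> continuous_on A (%w. etaf k (f w))"
 unfolding etaf_def by (intro continuous_intros)

lemma box_sphereE:
 assumes "(x, y, z):box_sphere k"
 shows "-4<=x" "x<=8 * real k+4" "abs(y)<=2" "-1<=z" "z<=0"
  "x = -4 | x = 8 * real k+4 | abs(y) = 2 | z = -1 | z = 0"
 using assms unfolding box_sphere_def frontier_def closure_Times interior_Times by auto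

lemma box_sphereI:
 assumes "-4<=x" "x<=8 * real k+4" "abs(y)<=2" "-1<=z" "z<=0"
  "x = -4 | x = 8 * real k+4 | abs(y) = 2 | z = -1 | z = 0"
 shows "(x, y, z):box_sphere k"
 using assms unfolding box_sphere_def frontier_def closure_Times interior_Times by auto

definition box_part :: "nat => (real\<times>real\<times>real) set" where
 "box_part k = box_sphere k-(\<Union>i<k. handle_discs i)"

lemma side_etaf: "x = -4 | x = 8 * real k+4 ==> etaf k x = 0"
proof (rule etaf_far)
 fix m assume "x = -4 | x = 8 * real k+4" "m < k"
 moreover from this have "real m+1<=real k" by simp
 ultimately show "3<=abs(x-8 * real m)" by auto
qed

lemma top_etaf:
 assumes "(x, y, 0):box_part k"
 shows "etaf k x<=abs(y)"
proof (rule etaf_cases[of k x])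
 fix m assume m: "m < k" "etaf k x = sqrt (max 0 (1-(abs(x-8 * real m)-2)\<^sup>2))"
 have "(x, y, 0)~:handle_discs m" using assms m unfolding box_part_def by auto
 hence d: "(x-(8 * real m-2))\<^sup>2+y\<^sup>2>=1" "(x-(8 * real m+2))\<^sup>2+y\<^sup>2>=1"
  unfolding handle_discs_def by auto
 have "1-(abs(x-8 * real m)-2)\<^sup>2<=y\<^sup>2"
 proof (cases "0<=x-8 * real m")
  case True
  hence "(abs(x-8 * real m)-2)\<^sup>2 = (x-(8 * real m+2))\<^sup>2"
   by (simp add: power2_eq_square algebra_simps)
  thus ?thesis using d(2) by simp
 next
  case False
  hence "(abs(x-8 * real m)-2)\<^sup>2 = (x-(8 * real m-2))\<^sup>2"
   by (simp add: power2_eq_square algebra_simps)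
  thus ?thesis using d(1) by simp
 qed
 hence "max 0 (1-(abs(x-8 * real m)-2)\<^sup>2)<=y\<^sup>2" by simp
 from real_sqrt_le_mono[OF this] show ?thesis unfolding m(2) by simp
qed simp

lemma box_partE:
 assumes p: "(x, y, z):box_part k"
 shows "0<=etaf k x*(1+z)" "etaf k x*(1+z)<=abs(y)" "etaf k x*(1+z)<=1"
  "0<=depth k (x, y, z)" "depth k (x, y, z)<=2" "depth k (x, y, z) = 2 \<longleftrightarrow> \<bar>y\<bar> = 2"
  "depth k (x, y, z) = 0 \<longleftrightarrow> \<bar>y\<bar> = etaf k x*(1+z)"
  "abs(y) = depth k (x, y, z)*(2-etaf k x*(1+z)) / 2+etaf k x*(1+z)"
proof -
 have b: "(x, y, z):box_sphere k" using p unfolding box_part_def by auto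
 note bs = box_sphereE[OF b]
 define e where "e = etaf k x*(1+z)"
 show e0: "0<=etaf k x*(1+z)" using bs etaf_bounds(1)[of k x] by auto
 have "etaf k x*(1+z)<=1*1" using etaf_bounds[of k x] bs by (intro mult_mono) auto
 thus e1: "etaf k x*(1+z)<=1" by simp
 show ey: "etaf k x*(1+z)<=abs(y)"
 proof -
  consider "x = -4 | x = 8 * real k+4" | "abs(y) = 2" | "z = -1" | "z = 0" using bs(6) by blast
  thus ?thesis
  proof cases
   case 1 thus ?thesis using side_etaf by simp
  next
   case 2 thus ?thesis using e1 by simp
  next
   case 3 thus ?thesis by simp
  next
   case 4 thus ?thesis using top_etaf p by simp
  qed
 qed
 have dd: "depth k (x, y, z) = 2*(abs(y)-e) / (2-e)" unfolding depth_def e_def by simp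
 have e: "0<=e" "e<=1" "e<=abs(y)" using e0 e1 ey unfolding e_def by auto
 show "0<=depth k (x, y, z)" unfolding dd using e by simp
 show "depth k (x, y, z)<=2" unfolding dd using e bs(3) by (simp add: field_simps)
 show "depth k (x, y, z) = 2 \<longleftrightarrow> \<bar>y\<bar> = 2" unfolding dd using e by (simp add: field_simps)
 show "depth k (x, y, z) = 0 \<longleftrightarrow> \<bar>y\<bar> = etaf k x*(1+z)" unfolding dd e_def[symmetric] using e by (simp add: field_simps)
 show "abs(y) = depth k (x, y, z)*(2-etaf k x*(1+z)) / 2+etaf k x*(1+z)"
  unfolding dd e_def[symmetric] using e by (simp add: field_simps)
qed

lemma tubeE:
 assumes "(x, y, z):handle_tube m"
 defines "rho == sqrt ((x-8 * real m)\<^sup>2+z\<^sup>2)"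
 shows "0<=z" "(rho-2)\<^sup>2+y\<^sup>2 = 1" "1<=rho" "rho<=3" "abs(x-8 * real m)<=rho" "z<=rho"
  "0 < max \<bar>x-8 * real m\<bar> z" "y = 0 \<longleftrightarrow> rho = 1 | rho = 3" "abs(y)<=1"
proof -
 show z: "0<=z" and e: "(rho-2)\<^sup>2+y\<^sup>2 = 1" using assms unfolding handle_tube_def by auto
 have "(rho-2)\<^sup>2<=1" using e by (smt (verit) zero_le_power2)
 hence "abs(rho-2)<=1" by (simp add: abs_square_le_1)
 thus r: "1<=rho" "rho<=3" by auto
 show "abs(x-8 * real m)<=rho" unfolding rho_def by (simp add: real_le_rsqrt)
 show "z<=rho" unfolding rho_def by (simp add: real_le_rsqrt)
 show "0 < max \<bar>x-8 * real m\<bar> z"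
 proof (rule ccontr)
  assume "~?thesis"
  hence "x-8 * real m = 0" "z = 0" using z by (auto simp: max_def split: if_splits)
  thus False using r(1) unfolding rho_def by simp
 qed
 have "y = 0 \<longleftrightarrow> (rho-2)\<^sup>2 = 1" using e by (auto simp: power2_eq_square)
 also have "\<dots> \<longleftrightarrow> rho = 1 | rho = 3" by (auto simp: power2_eq_1_iff)
 finally show "y = 0 \<longleftrightarrow> rho = 1 | rho = 3" .
 have "y\<^sup>2<=1" using e by (smt (verit) zero_le_power2)
 thus "abs(y)<=1" by (simp add: abs_square_le_1)
qed

lemma tube_h_norm:
 assumes p: "(x, y, z):handle_tube m"
 defines "rho == sqrt ((x-8 * real m)\<^sup>2+z\<^sup>2)"
 shows "max \<bar>fst (tube_h m (x, y, z))-8 * real m\<bar> (snd (tube_h m (x, y, z))) = rho"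
  "0<=snd (tube_h m (x, y, z))" "0 < z ==> 0 < snd (tube_h m (x, y, z))"
proof -
 note t = tubeE[OF p, folded rho_def]
 define M where "M = max \<bar>x-8 * real m\<bar> z"
 have M: "0 < M" using t unfolding M_def by simp
 define w where "w = rho / M"
 have w: "0 < w" "M * w = rho" using M t unfolding w_def by auto
 have h: "tube_h m (x, y, z) = (8 * real m+(x-8 * real m) * w, z * w)"
  unfolding tube_h_def rho_def M_def w_def by simp
 have "abs((x-8 * real m) * w) = abs(x-8 * real m) * w" using w by (simp add: abs_mult)
 hence "max \<bar>fst (tube_h m (x, y, z))-8 * real m\<bar> (snd (tube_h m (x, y, z))) = max (abs(x-8 * real m) * w) (z * w)"
  unfolding h by simp
 also have "\<dots> = M * w" unfolding M_def using w(1) by (simp add: max_mult_distrib_right)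
 finally show "max \<bar>fst (tube_h m (x, y, z))-8 * real m\<bar> (snd (tube_h m (x, y, z))) = rho" using w by simp
 show "0<=snd (tube_h m (x, y, z))" unfolding h using t(1) w by simp
 show "0 < snd (tube_h m (x, y, z))" if "0 < z" unfolding h using that w by simp
qed

lemma tube_h_inj:
 assumes p: "(x, y, z):handle_tube m" and q: "(x', y', z'):handle_tube m"
  and e: "tube_h m (x, y, z) = tube_h m (x', y', z')" and s: "0<=y * y'"
 shows "(x, y, z) = (x', y', z')"
proof -
 define u u' where "u = x-8 * real m" and "u' = x'-8 * real m"
 define rho rho' where "rho = sqrt (u\<^sup>2+z\<^sup>2)" and "rho' = sqrt (u'\<^sup>2+z'\<^sup>2)"
 define t t' where "t = rho / max \<bar>u\<bar> z" and "t' = rho' / max \<bar>u'\<bar> z'"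
 note tp = tubeE[OF p, folded u_def, folded rho_def] and tq = tubeE[OF q, folded u'_def, folded rho'_def]
 have rr: "rho = rho'"
  using tube_h_norm(1)[OF p, folded u_def, folded rho_def] tube_h_norm(1)[OF q, folded u'_def, folded rho'_def] unfolding e by simp
 have tt: "0 < t" unfolding t_def by (rule divide_pos_pos[OF _ tp(7)]) (use tp(3) in linarith)
 have tt': "0 < t'" unfolding t'_def by (rule divide_pos_pos[OF _ tq(7)]) (use tq(3) in linarith)
 have "8 * real m+u * t = 8 * real m+u' * t'" "z * t = z' * t'"
  using e unfolding tube_h_def t_def t'_def u_def u'_def rho_def rho'_def by auto
 hence ut: "u * t = u' * t'" "z * t = z' * t'" by auto
 have "(rho * t)\<^sup>2 = (u * t)\<^sup>2+(z * t)\<^sup>2" unfolding rho_def by (simp add: power_mult_distrib algebra_simps)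
 also have "\<dots> = (rho' * t')\<^sup>2" unfolding ut rho'_def by (simp add: power_mult_distrib algebra_simps)
 finally have "rho * t = rho' * t'" using tp(3) tq(3) tt tt' by (intro power2_eq_imp_eq[of "rho * t"]) auto
 hence "t = t'" using rr tp(3) by auto
 hence uz: "u = u'" "z = z'" using ut tt by auto
 have "y\<^sup>2 = y'\<^sup>2" using tp(2) tq(2) rr by simp
 hence "y = y' | y = - y'" by (simp add: power2_eq_iff)
 moreover have "y = y'" if "y = - y'"
 proof -
  have "y' * y'<=0" using s that by simp
  hence "y' = 0" by (metis mult_le_0_iff order_antisym)
  thus ?thesis using that by simp
 qed
 ultimately show ?thesis using uz unfolding u_def u'_def by auto
qed

lemma tube_nat:
 assumes "(x, y, z):handle_tube m"
 shows "nat \<lfloor>(x+4) / 8\<rfloor> = m"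
proof -
 have "abs(x-8 * real m)<=3" using tubeE[OF assms] by linarith
 hence "\<lfloor>(x+4) / 8\<rfloor> = int m" by (intro floor_unique) (auto simp: abs_le_iff field_simps)
 thus ?thesis by simp
qed

lemma tube_z0:
 assumes p: "(x, y, 0):handle_tube m"
 shows "(abs(x-8 * real m)-2)\<^sup>2+y\<^sup>2 = 1" "tube_h m (x, y, 0) = (x, 0)"
 using tubeE(2,7)[OF p] unfolding tube_h_def by auto

lemma box_h_0:
 assumes "depth k (x, y, z) = 0"
 shows "box_h k (x, y, z) = (x, z)"
 using assms unfolding box_h_def by simp

lemma hmap_tube:
 assumes m: "m < k" and p: "p:handle_tube m"
 shows "hmap k p = tube_h m p"
proof -
 obtain x y z where xyz: "p = (x, y, z)" by (metis prod_cases3)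
 show ?thesis
 proof (cases "z<=0")
  case True
  hence z: "z = 0" using tubeE(1)[of x y z m] p xyz by simp
  note t = tube_z0[OF p[unfolded xyz z]]
  have "abs(x-8 * real m)<=5" using tubeE(4,5)[OF p[unfolded xyz]] by linarith
  hence "etaf k x = sqrt (max 0 (1-(abs(x-8 * real m)-2)\<^sup>2))" using etaf_near m by blast
  also have "1-(abs(x-8 * real m)-2)\<^sup>2 = y\<^sup>2" using t(1) by simp
  finally have "etaf k x = abs(y)" by simp
  hence "box_h k p = (x, 0)" unfolding xyz z by (subst box_h_0) (auto simp: depth_def)
  thus ?thesis unfolding hmap_def xyz using t z by simp
 next
  case False
  thus ?thesis using tube_nat[of x y z m] p unfolding hmap_def xyz by simp
 qed
qed

lemma hmap_box:
 assumes "p:box_part k"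
 shows "hmap k p = box_h k p"
proof -
 obtain x y z where "p = (x, y, z)" by (metis prod_cases3)
 thus ?thesis using box_sphereE(5)[of x y z k] assms unfolding hmap_def box_part_def by simp
qed

lemma closed_tube: "closed (handle_tube m)"
proof -
 have "handle_tube m = {p. 0<=snd (snd p) & (sqrt ((fst p-8 * real m)\<^sup>2+(snd (snd p))\<^sup>2)-2)\<^sup>2+(fst (snd p))\<^sup>2 = 1}"
  unfolding handle_tube_def by auto
 also have "closed \<dots>" by (intro closed_Collect_conj closed_Collect_le closed_Collect_eq continuous_intros)
 finally show ?thesis .
qed

lemma continuous_hmap: "continuous_on (handle_surface k) (hmap k)"
proof -
 define W where "W = {p :: real\<times>real\<times>real. -1<=snd (snd p) & snd (snd p)<=0}"
 have cW: "closed W" unfolding W_def by (intro closed_Collect_conj closed_Collect_le continuous_intros)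
 have den: "2-etaf k (fst p)*(1+snd (snd p))~=0" if "p:W" for p
 proof -
  have "etaf k (fst p)*(1+snd (snd p))<=1*1"
   using etaf_bounds[of k "fst p"] that unfolding W_def by (intro mult_mono) auto
  thus ?thesis by simp
 qed
 have "continuous_on W (box_h k)"
  unfolding box_h_def depth_def case_prod_beta
  by (intro continuous_intros) (use den in auto)
 hence 1: "continuous_on W (hmap k)"
  by (rule continuous_on_eq) (auto simp: hmap_def W_def)
 have 2: "continuous_on (handle_tube m) (hmap k)" if "m < k" for m
 proof -
  have "max \<bar>fst p-8 * real m\<bar> (snd (snd p))~=0" if "p:handle_tube m" for p
   using tubeE(7)[of "fst p" "fst (snd p)" "snd (snd p)" m] that by simp
  hence "continuous_on (handle_tube m) (tube_h m)"
   unfolding tube_h_def case_prod_beta by (intro continuous_intros) auto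
  thus ?thesis by (rule continuous_on_eq) (use hmap_tube[OF that] in simp)
 qed
 have "continuous_on (\<Union>m<k. handle_tube m) (hmap k)"
  by (rule continuous_on_closed_Union) (use closed_tube 2 in auto)
 hence "continuous_on (W Un (\<Union>m<k. handle_tube m)) (hmap k)"
  using cW closed_tube by (intro continuous_on_closed_Un 1) auto
 moreover have "handle_surface k<=W Un (\<Union>m<k. handle_tube m)"
  unfolding handle_surface_def W_def using box_sphereE(4,5) by fastforce
 ultimately show ?thesis using continuous_on_subset by blast
qed

lemma surface_cases:
 assumes "p:handle_surface k"
 obtains "p:box_part k" | m where "m < k" "p:handle_tube m"
 using assms unfolding handle_surface_def box_part_def by blast

lemma box_h_inj:
 assumes p: "(x, y, z):box_part k" and q: "(x', y', z'):box_part k"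
  and e: "box_h k (x, y, z) = box_h k (x', y', z')" and s: "0<=y * y'"
 shows "(x, y, z) = (x', y', z')"
proof -
 have bp: "(x, y, z):box_sphere k" and bq: "(x', y', z'):box_sphere k" using p q unfolding box_part_def by auto
 note P = box_partE[OF p] and P' = box_partE[OF q]
 define l l' where "l = 1-depth k (x, y, z) / 4" and "l' = 1-depth k (x', y', z') / 4"
 have l: "1/2<=l" "l<=1" "1/2<=l'" "l'<=1" using P(4,5) P'(4,5) unfolding l_def l'_def by auto
 have h: "l*(x-4 * real k) = l'*(x'-4 * real k)" "l*(z+1/2) = l'*(z'+1/2)"
  using e unfolding box_h_def l_def l'_def by auto
 define g where "g a c = max (abs(a-4 * real k) / (4 * real k+4)) (2 * abs(c+1/2))" for a c :: real
 have k4: "0 < 4 * real k+4" by simp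
 have gh: "l * g x z = l' * g x' z'"
 proof -
  have "l * g x z = max (abs(l*(x-4 * real k)) / (4 * real k+4)) (2 * abs(l*(z+1/2)))"
   unfolding g_def using l by (subst max_mult_distrib_left) (auto simp: abs_mult)
  moreover have "l' * g x' z' = max (abs(l'*(x'-4 * real k)) / (4 * real k+4)) (2 * abs(l'*(z'+1/2)))"
   unfolding g_def using l by (subst max_mult_distrib_left) (auto simp: abs_mult)
  ultimately show ?thesis using h by simp
 qed
 have g1: "g a c<=1 & (abs(b) = 2 | g a c = 1)" if "(a, b, c):box_sphere k" for a b c
 proof -
  note B = box_sphereE[OF that]
  have i: "abs(a-4 * real k) / (4 * real k+4)<=1" using B(1,2) k4 by (simp add: abs_le_iff)
  have j: "2 * abs(c+1/2)<=1" using B(4,5) by (auto simp: abs_if)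
  have "abs(a-4 * real k) / (4 * real k+4) = 1" if "a = -4 | a = 8 * real k+4"
  proof -
   have "abs(a-4 * real k) = 4 * real k+4" using that by auto
   thus ?thesis using k4 by simp
  qed
  moreover have "2 * abs(c+1/2) = 1" if "c = -1 | c = 0" using that by auto
  ultimately have "abs(b) = 2 | abs(a-4 * real k) / (4 * real k+4) = 1 | 2 * abs(c+1/2) = 1"
   using B(6) by blast
  moreover have "max A B<=1 & (abs(b) = 2 | max A B = 1)" if "A<=1" "B<=1" "abs(b) = 2 | A = 1 | B = 1"
   for A B :: real using that by (auto simp: max_def)
  ultimately show ?thesis using i j unfolding g_def by blast
 qed
 note gP = g1[OF bp] and gQ = g1[OF bq]
 have half: "l = 1/2 \<longleftrightarrow> \<bar>y\<bar> = 2" "l' = 1/2 \<longleftrightarrow> \<bar>y'\<bar> = 2" using P(6) P'(6) unfolding l_def l'_def by auto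
 have ll: "l = l'"
 proof (cases "abs(y) = 2")
  case True
  show ?thesis
  proof (cases "abs(y') = 2")
   case False
   hence "l' = l * g x z" using gQ gh by simp
   also have "\<dots><=l*1" using gP l by (intro mult_left_mono) auto
   finally show ?thesis using True half l by linarith
  qed (use True half in simp)
 next
  case False
  hence *: "l = l' * g x' z'" using gP gh by simp
  also have "\<dots><=l'*1" using gQ l by (intro mult_left_mono) auto
  finally have le: "l<=l'" by simp
  show ?thesis
  proof (cases "abs(y') = 2")
   case True thus ?thesis using le half l by linarith
  qed (use * gQ in simp)
 qed
 hence xz: "x = x'" "z = z'" using h l by auto
 have "abs(y) = abs(y')" using P(8) P'(8) ll xz unfolding l_def l'_def by simp
 hence "y = y'" using s by (smt (verit) mult_less_0_iff)
 thus ?thesis using xz by simp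
qed

lemma hmap_inj:
 assumes p: "p:handle_surface k" and q: "q:handle_surface k" and e: "hmap k p = hmap k q"
  and s: "0<=fst (snd p) * fst (snd q)"
 shows "p = q"
proof -
 have cross: False if p: "p:box_part k" "p~:(\<Union>m<k. handle_tube m)" and q: "m < k" "q:handle_tube m"
  and e: "hmap k p = hmap k q" and s: "0<=fst (snd p) * fst (snd q)" for p q :: "real\<times>real\<times>real" and m
 proof -
  obtain x y z where P: "p = (x, y, z)" by (metis prod_cases3)
  obtain x' y' z' where Q: "q = (x', y', z')" by (metis prod_cases3)
  have bp: "(x, y, z):box_sphere k" using p P unfolding box_part_def by auto
  note B = box_sphereE[OF bp] and E = box_partE[OF p(1)[unfolded P]]
  note T = tube_h_norm[OF q(2)[unfolded Q]]
  have h: "box_h k (x, y, z) = tube_h m (x', y', z')" using e hmap_box[OF p(1)] hmap_tube[OF q] P Q by simp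
  have l: "1/2<=1-depth k (x, y, z) / 4" "1-depth k (x, y, z) / 4<=1" using E(4,5) by auto
  have s1: "snd (box_h k (x, y, z)) = - (1/2)+(1-depth k (x, y, z) / 4)*(z+1/2)" unfolding box_h_def by simp
  have "(1-depth k (x, y, z) / 4)*(z+1/2)<=(1-depth k (x, y, z) / 4)*(1/2)" using B l by (intro mult_left_mono) auto
  hence le: "snd (box_h k (x, y, z))<=- depth k (x, y, z) / 8" unfolding s1 by (simp add: algebra_simps)
  hence d0: "depth k (x, y, z) = 0" "snd (box_h k (x, y, z)) = 0" using T(2) E(4) unfolding h by linarith+
  hence hz: "z = 0" "box_h k (x, y, z) = (x, 0)" using box_h_0[OF d0(1)] by auto
  have "z' = 0" using T(3) d0(2) tubeE(1)[of x' y' z' m] q Q unfolding h by force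
  hence tq: "(abs(x'-8 * real m)-2)\<^sup>2+y'\<^sup>2 = 1" "x' = x" using tube_z0[of x' y' m] q Q hz h by auto
  have near: "abs(x-8 * real m)<=5" using tubeE(4,5)[OF q(2)[unfolded Q]] tq(2) by linarith
  have "etaf k x = sqrt (max 0 (1-(abs(x-8 * real m)-2)\<^sup>2))" by (rule etaf_near[OF q(1) near])
  also have "1-(abs(x-8 * real m)-2)\<^sup>2 = y'\<^sup>2" using tq by simp
  finally have "etaf k x = abs(y')" by simp
  hence "abs(y) = abs(y')" using E(7) d0 hz by simp
  hence "y = y'" using s P Q by (smt (verit) mult_less_0_iff fst_conv snd_conv)
  hence "p = q" using P Q hz `z' = 0` tq by simp
  thus False using p(2) q by auto
 qed
 have tubes: "p = q" if p: "m < k" "p:handle_tube m" and q: "m' < k" "q:handle_tube m'"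
  and e: "hmap k p = hmap k q" and s: "0<=fst (snd p) * fst (snd q)" for p q m m'
 proof -
  obtain x y z where P: "p = (x, y, z)" by (metis prod_cases3)
  obtain x' y' z' where Q: "q = (x', y', z')" by (metis prod_cases3)
  have h: "tube_h m (x, y, z) = tube_h m' (x', y', z')" using e hmap_tube[OF p] hmap_tube[OF q] P Q by simp
  have "abs(fst (tube_h m (x, y, z))-8 * real m)<=3"
   using tube_h_norm(1)[of x y z m] tubeE(4)[of x y z m] p P by (metis max.cobounded1 order_trans)
  moreover have "abs(fst (tube_h m (x, y, z))-8 * real m')<=3"
   unfolding h using tube_h_norm(1)[of x' y' z' m'] tubeE(4)[of x' y' z' m'] q Q by (metis max.cobounded1 order_trans)
  ultimately have "abs(real m-real m') < 1" by linarith
  hence "m = m'" by linarith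
  thus ?thesis using tube_h_inj[of x y z m x' y' z'] p q P Q h s by simp
 qed
 have s': "0<=fst (snd q) * fst (snd p)" using s by (simp add: mult.commute)
 show ?thesis
 proof (cases "p:(\<Union>m<k. handle_tube m)")
  case True
  then obtain m where m: "m < k" "p:handle_tube m" by auto
  show ?thesis
  proof (cases "q:(\<Union>m<k. handle_tube m)")
   case True
   thus ?thesis using tubes[OF m _ _ e s] by auto
  next
   case False
   hence "q:box_part k" using q by (auto elim: surface_cases)
   thus ?thesis using cross[OF _ False m e[symmetric] s'] by blast
  qed
 next
  case False
  hence bp: "p:box_part k" using p by (auto elim: surface_cases)
  show ?thesis
  proof (cases "q:(\<Union>m<k. handle_tube m)")
   case True
   thus ?thesis using cross[OF bp False _ _ e s] by auto
  next
   case F: False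
   hence bq: "q:box_part k" using q by (auto elim: surface_cases)
   obtain x y z where P: "p = (x, y, z)" by (metis prod_cases3)
   obtain x' y' z' where Q: "q = (x', y', z')" by (metis prod_cases3)
   show ?thesis using box_h_inj[of x y z k x' y' z'] bp bq e s hmap_box[OF bp] hmap_box[OF bq] P Q by simp
  qed
 qed
qed

section \<open>From drawings to rotation systems\<close>

abbreviation rl :: "int => real" where "rl == real_of_int"

definition incell :: "int => real\<times>real => int\<times>int => bool" where
 "incell N w c \<longleftrightarrow> rl (fst c)<=rl N * fst w & rl N * fst w<=rl (fst c)+1 &
 rl (snd c)<=rl N * snd w & rl N * snd w<=rl (snd c)+1"

definition vfloor :: "int => real\<times>real => int\<times>int" where
 "vfloor N w = (\<lfloor>rl N * fst w\<rfloor>, \<lfloor>rl N * snd w\<rfloor>)"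

lemma vfloor_corner:
 assumes "incell N w c"
 shows "vfloor N w:{c, (fst c+1, snd c), (fst c+1, snd c+1), (fst c, snd c+1)}"
proof -
 have f: "\<lfloor>t\<rfloor> = i | \<lfloor>t\<rfloor> = i+1" if "rl i<=t" "t<=rl i+1" for t :: real and i
  using that by linarith
 have "fst (vfloor N w) = fst c | fst (vfloor N w) = fst c+1" "snd (vfloor N w) = snd c | snd (vfloor N w) = snd c+1"
  using assms f unfolding incell_def vfloor_def by auto
 thus ?thesis by (metis insertCI prod.collapse)
qed

lemma pick:
 assumes "A < B" "rl A<=t" "t<=rl B"
 obtains i where "A<=i" "i < B" "rl i<=t" "t<=rl i+1"
proof
 show "A<=min \<lfloor>t\<rfloor> (B-1)" "min \<lfloor>t\<rfloor> (B-1) < B" using assms by (auto simp: le_floor_iff)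
 show "rl (min \<lfloor>t\<rfloor> (B-1))<=t" using assms by linarith
 show "t<=rl (min \<lfloor>t\<rfloor> (B-1))+1" using assms by linarith
qed

lemma poly_above:
 assumes "N > 0" "0<=j"
 shows "(i, j):poly_cells k N \<longleftrightarrow> (EX m<k. (i, j):arch_cells (ctr N m) N)"
 using assms unfolding poly_cells_def by (auto simp: in_base)

lemma hmap_box_range:
 assumes p: "(x, y, z):box_part k"
 shows "-4<=fst (box_h k (x, y, z))" "fst (box_h k (x, y, z))<=8 * real k+4"
  "-1<=snd (box_h k (x, y, z))" "snd (box_h k (x, y, z))<=0"
  "0 < depth k (x, y, z) ==> -4 < fst (box_h k (x, y, z)) & fst (box_h k (x, y, z)) < 8 * real k+4 &
 -1 < snd (box_h k (x, y, z)) & snd (box_h k (x, y, z)) < 0"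
proof -
 have "(x, y, z):box_sphere k" using p unfolding box_part_def by auto
 note B = box_sphereE[OF this]
 note E = box_partE(4,5)[OF p]
 define l where "l = 1-depth k (x, y, z) / 4"
 have l: "1/2<=l" "l<=1" "0 < depth k (x, y, z) ==> l < 1" using E unfolding l_def by auto
 have h: "box_h k (x, y, z) = (4 * real k+l*(x-4 * real k), - (1/2)+l*(z+1/2))"
  unfolding box_h_def l_def by simp
 define K u c where "K = 4 * real k+4" and "u = x-4 * real k" and "c = z+1/2"
 have u: "- K<=u" "u<=K" "0 < K" "- (1/2) <= c" "c<=1/2" using B unfolding K_def u_def c_def by auto
 have 1: "- (l * K)<=l * u" "l * u<=l * K"
  using mult_left_mono[OF u(1), of l] mult_left_mono[OF u(2), of l] l by auto
 have 2: "- (l*(1/2))<=l * c" "l * c<=l*(1/2)"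
  using mult_left_mono[OF u(4), of l] mult_left_mono[OF u(5), of l] l by auto
 have 3: "l * K<=K" using l u by simp
 have 4: "0 < depth k (x, y, z) ==> l * K < K" using l u by simp
 have h': "box_h k (x, y, z) = (K-4+l * u, - (1/2)+l * c)" unfolding h K_def u_def c_def by simp
 have K8: "8 * real k+4 = 2 * K-4" unfolding K_def by simp
 show "-4<=fst (box_h k (x, y, z))" "fst (box_h k (x, y, z))<=8 * real k+4"
  "-1<=snd (box_h k (x, y, z))" "snd (box_h k (x, y, z))<=0"
  using 1 2 3 l unfolding h' K8 fst_conv snd_conv by linarith+
 show "0 < depth k (x, y, z) ==> -4 < fst (box_h k (x, y, z)) & fst (box_h k (x, y, z)) < 8 * real k+4 &
 -1 < snd (box_h k (x, y, z)) & snd (box_h k (x, y, z)) < 0"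
  using 1 2 4 l unfolding h' K8 fst_conv snd_conv by (intro conjI; linarith)
qed

lemma ctr_real: "rl (ctr N m) = rl N*(8 * real m)"
 unfolding ctr_def by simp

lemma rend_real: "rl (rend k N) = rl N*(8 * real k+4)"
 unfolding rend_def by (simp add: algebra_simps)

lemma scale:
 assumes "N > 0"
 shows "rl N * a<=rl N * b \<longleftrightarrow> a<=b" "rl N * a < rl N * b \<longleftrightarrow> a < b"
 using assms by simp_all

lemma hmap_in_cell:
 assumes N: "N > 0" and p: "p:handle_surface k"
 shows "EX c:poly_cells k N. incell N (hmap k p) c"
 using p
proof (cases rule: surface_cases)
 case 1
 obtain x y z where P: "p = (x, y, z)" by (metis prod_cases3)
 note R = hmap_box_range(1-4)[OF 1[unfolded P]]
 obtain a b where ab: "box_h k (x, y, z) = (a, b)" by (cases "box_h k (x, y, z)")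
 have hp: "hmap k p = (a, b)" using hmap_box[OF 1] P ab by simp
 have "rl (- (4 * N))<=rl N * a" "rl N * a<=rl (rend k N)"
  using R N mult_left_mono[of "-4" a "rl N"] mult_left_mono[of a "8 * real k+4" "rl N"]
  unfolding rend_real ab by auto
 moreover have "- (4 * N) < rend k N" using rend_ge[OF N, of k] N by linarith
 ultimately obtain i where i: "- (4 * N)<=i" "i < rend k N" "rl i<=rl N * a" "rl N * a<=rl i+1"
  using pick[of "- (4 * N)" "rend k N" "rl N * a"] by blast
 have "rl (- N)<=rl N * b" "rl N * b<=rl 0"
  using R N mult_left_mono[of "-1" b "rl N"] mult_left_mono[of b 0 "rl N"] unfolding ab by auto
 then obtain j where j: "- N<=j" "j < 0" "rl j<=rl N * b" "rl N * b<=rl j+1"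
  using pick[of "- N" 0 "rl N * b"] N by auto
 have "(i, j):poly_cells k N" unfolding poly_cells_def using i j in_base by blast
 moreover have "incell N (hmap k p) (i, j)" unfolding hp incell_def using i j by simp
 ultimately show ?thesis by blast
next
 case (2 m)
 obtain x y z where P: "p = (x, y, z)" by (metis prod_cases3)
 note T = tube_h_norm(1,2)[OF 2(2)[unfolded P]] and E = tubeE(3,4)[OF 2(2)[unfolded P]]
 obtain a' b where ab': "tube_h m (x, y, z) = (a', b)" by (cases "tube_h m (x, y, z)")
 have hp: "hmap k p = (a', b)" using hmap_tube[OF 2] P ab' by simp
 define a where "a = a'-8 * real m"
 have mx: "1<=max \<bar>a\<bar> b" "max \<bar>a\<bar> b<=3" "0<=b" using T E unfolding ab' a_def by auto
 have bb: "rl N * b<=rl (3 * N)" "0<=rl N * b"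
  using mx N mult_left_mono[of b 3 "rl N"] by auto
 have Na: "rl N * a' = rl (ctr N m)+rl N * a" unfolding a_def ctr_real by (simp add: algebra_simps)
 have a3: "-3<=a" "a<=3" using mx by auto
 have aa: "- rl (3 * N)<=rl N * a" "rl N * a<=rl (3 * N)"
  using N mult_left_mono[OF a3(2), of "rl N"] mult_left_mono[OF a3(1), of "rl N"] by auto
 have fin: ?thesis if "(i, j):arch_cells (ctr N m) N" "rl i<=rl N * a'" "rl N * a'<=rl i+1"
  "rl j<=rl N * b" "rl N * b<=rl j+1" for i j
 proof -
  have "(i, j):poly_cells k N" unfolding poly_cells_def using that(1) 2(1) by blast
  moreover have "incell N (hmap k p) (i, j)" unfolding hp incell_def using that by simp
  ultimately show ?thesis by blast
 qed
 show ?thesis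
 proof (cases "1<=b")
  case True
  have "rl N<=rl N * b" using True N mult_left_mono[of 1 b "rl N"] by auto
  then obtain j where j: "N<=j" "j < 3 * N" "rl j<=rl N * b" "rl N * b<=rl j+1"
   using pick[of N "3 * N" "rl N * b"] bb N by auto
  obtain i where i: "ctr N m-3 * N<=i" "i < ctr N m+3 * N" "rl i<=rl N * a'" "rl N * a'<=rl i+1"
   using pick[of "ctr N m-3 * N" "ctr N m+3 * N" "rl N * a'"] aa N unfolding Na by auto
  show ?thesis by (rule fin[of i j]) (insert i j N, auto simp: in_arch)
 next
  case False
  hence a1: "1<=a | a<=-1" using mx(1) by (auto simp: max_def abs_if split: if_splits)
  have "rl N * b<=rl N" using False N mult_left_mono[of b 1 "rl N"] by auto
  then obtain j where j: "0<=j" "j < N" "rl j<=rl N * b" "rl N * b<=rl j+1"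
   using pick[of 0 N "rl N * b"] bb N by auto
  show ?thesis
   using a1
  proof
   assume "1<=a"
   hence "rl N<=rl N * a" using N mult_left_mono[of 1 a "rl N"] by auto
   then obtain i where i: "ctr N m+N<=i" "i < ctr N m+3 * N" "rl i<=rl N * a'" "rl N * a'<=rl i+1"
    using pick[of "ctr N m+N" "ctr N m+3 * N" "rl N * a'"] aa N unfolding Na by auto
   show ?thesis by (rule fin[of i j]) (insert i j N, auto simp: in_arch)
  next
   assume "a<=-1"
   hence "rl N * a<=- rl N" using N mult_left_mono[of a "-1" "rl N"] by auto
   then obtain i where i: "ctr N m-3 * N<=i" "i < ctr N m-N" "rl i<=rl N * a'" "rl N * a'<=rl i+1"
    using pick[of "ctr N m-3 * N" "ctr N m-N" "rl N * a'"] aa N unfolding Na by auto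
   show ?thesis by (rule fin[of i j]) (insert i j N, auto simp: in_arch)
  qed
 qed
qed

lemma arch_away:
 assumes N: "N > 0" and m: "m < k" and i: "ctr N m-4 * N<=i" "i < ctr N m+4 * N" and j: "0<=j"
  and "(i, j)~:arch_cells (ctr N m) N"
 shows "(i, j)~:poly_cells k N"
 using poly_near[OF N m i] assms by auto

text \<open>The curves in which the plane \<open>y = 0\<close> cuts the surface lie over the boundary of the region.\<close>

lemma hmap_boundary:
 assumes N: "N > 0" and p: "p:handle_surface k" and y: "fst (snd p) = 0"
 shows "EX c. c~:poly_cells k N & incell N (hmap k p) c"
 using p
proof (cases rule: surface_cases)
 case 1
 obtain x z where P: "p = (x, 0, z)" using y by (metis prod_cases3 fst_conv snd_conv)
 have bs: "(x, 0, z):box_sphere k" using 1 P unfolding box_part_def by auto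
 note B = box_sphereE[OF bs] and E = box_partE[OF 1[unfolded P]]
 have e0: "etaf k x*(1+z) = 0" using E by auto
 have "depth k (x, 0, z) = 0" using E(7) e0 by simp
 hence h: "hmap k p = (x, z)" using hmap_box[OF 1] P box_h_0 by simp
 have rng: "rl (- (4 * N))<=rl N * x" "rl N * x<=rl (rend k N)"
  using B N mult_left_mono[of "-4" x "rl N"] mult_left_mono[of x "8 * real k+4" "rl N"]
  unfolding rend_real by auto
 have rngz: "rl (- N)<=rl N * z" "rl N * z<=rl 0"
  using B N mult_left_mono[of "-1" z "rl N"] mult_left_mono[of z 0 "rl N"] by auto
 have Lr: "- (4 * N) < rend k N" using rend_ge[OF N, of k] N by linarith
 obtain i where i: "- (4 * N)<=i" "i < rend k N" "rl i<=rl N * x" "rl N * x<=rl i+1"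
  using pick[OF Lr rng] by blast
 obtain j where j: "- N<=j" "j < 0" "rl j<=rl N * z" "rl N * z<=rl j+1"
  using pick[OF _ rngz] N by auto
 have below: "(i', j')~:poly_cells k N" if "j' < 0" "j' < - N | i' < - (4 * N) | rend k N<=i'" for i' j'
  using that unfolding poly_cells_def by (auto simp: in_base in_arch)
 consider "x = -4" | "x = 8 * real k+4" | "z = -1" | "z = 0" using B(6) by force
 thus ?thesis
 proof cases
  case 1
  have "incell N (hmap k p) (- (4 * N)-1, j)" unfolding h incell_def using 1 j by simp
  thus ?thesis using below[of j "- (4 * N)-1"] j by (intro exI[of _ "(- (4 * N)-1, j)"]) simp
 next
  case 2
  have "incell N (hmap k p) (rend k N, j)" unfolding h incell_def using 2 j rend_real[of k N] by simp
  thus ?thesis using below[of j "rend k N"] j by (intro exI[of _ "(rend k N, j)"]) simp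
 next
  case 3
  have "incell N (hmap k p) (i, - N-1)" unfolding h incell_def using 3 i by simp
  thus ?thesis using below[of "- N-1" i] N by (intro exI[of _ "(i, - N-1)"]) simp
 next
  case 4
  have ex: ?thesis if "(i', 0)~:poly_cells k N" "rl i'<=rl N * x" "rl N * x<=rl i'+1" for i'
   using that unfolding h 4 by (intro exI[of _ "(i', 0)"]) (simp add: incell_def)
  have eta0: "etaf k x = 0" using e0 4 by simp
  show ?thesis
  proof (cases "EX m<k. \<bar>x-8 * real m\<bar><=4")
   case True
   then obtain m where m: "m < k" "abs(x-8 * real m)<=4" by auto
   have "sqrt (max 0 (1-(abs(x-8 * real m)-2)\<^sup>2)) = 0" using eta0 etaf_near[of m k x] m by auto
   hence "1<=(abs(x-8 * real m)-2)\<^sup>2" by (simp add: max_def split: if_splits)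
   hence "1<=\<bar>\<bar>x-8 * real m\<bar>-2\<bar>" by (metis abs_square_less_1 not_less)
   hence u: "abs(x-8 * real m)<=1 | 3<=abs(x-8 * real m)" by linarith
   define u where "u = rl N*(x-8 * real m)"
   have xu: "rl N * x = rl (ctr N m)+u" unfolding u_def ctr_real by (simp add: algebra_simps)
   have near: "(i', 0)~:poly_cells k N" if "ctr N m-4 * N<=i'" "i' < ctr N m+4 * N" "i' < ctr N m-3 * N | ctr N m+3 * N<=i' | ctr N m-N<=i' & i' < ctr N m+N" for i'
    by (rule arch_away[OF N m(1) that(1,2)]) (insert that N, auto simp: in_arch)
   have NN: "0 < rl N" using N by simp
   have "abs(u) = rl N * abs(x-8 * real m)" unfolding u_def using NN by (simp add: abs_mult)
   hence u3: "abs(u)<=rl N | 3 * rl N<=abs(u)" "abs(u)<=4 * rl N"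
    using u m(2) NN mult_left_mono[of "abs(x-8 * real m)" 1 "rl N"] mult_left_mono[of 3 "abs(x-8 * real m)" "rl N"]
     mult_left_mono[of "abs(x-8 * real m)" 4 "rl N"] by auto
   consider "- rl N<=u" "u<=rl N" | "3 * rl N<=u" "u<=4 * rl N" | "- 4 * rl N<=u" "u<=- 3 * rl N"
    using u3 by linarith
   thus ?thesis
   proof cases
    case 1
    then obtain i' where "ctr N m-N<=i'" "i' < ctr N m+N" "rl i'<=rl N * x" "rl N * x<=rl i'+1"
     using pick[of "ctr N m-N" "ctr N m+N" "rl N * x"] N unfolding xu by auto
    thus ?thesis using ex[of i'] near[of i'] N by auto
   next
    case 2
    then obtain i' where "ctr N m+3 * N<=i'" "i' < ctr N m+4 * N" "rl i'<=rl N * x" "rl N * x<=rl i'+1"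
     using pick[of "ctr N m+3 * N" "ctr N m+4 * N" "rl N * x"] N unfolding xu by auto
    thus ?thesis using ex[of i'] near[of i'] N by auto
   next
    case 3
    then obtain i' where "ctr N m-4 * N<=i'" "i' < ctr N m-3 * N" "rl i'<=rl N * x" "rl N * x<=rl i'+1"
     using pick[of "ctr N m-4 * N" "ctr N m-3 * N" "rl N * x"] N unfolding xu by auto
    thus ?thesis using ex[of i'] near[of i'] N by auto
   qed
  next
   case False
   have "(i, 0)~:arch_cells (ctr N m) N" if m: "m < k" for m
   proof
    assume "(i, 0):arch_cells (ctr N m) N"
    hence "rl (ctr N m-3 * N)<=rl i" "rl (i+1)<=rl (ctr N m+3 * N)"
     unfolding in_arch by linarith+
    hence "rl N*(8 * real m-3)<=rl N * x" "rl N * x<=rl N*(8 * real m+3)"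
     using i unfolding of_int_diff of_int_add ctr_real by (auto simp: algebra_simps)
    hence "abs(x-8 * real m)<=3" unfolding scale[OF N] by (simp add: abs_le_iff)
    thus False using False m by force
   qed
   thus ?thesis using ex[OF _ i(3,4)] poly_above[OF N, of 0 i k] by simp
  qed
 qed
next
 case (2 m)
 obtain x z where P: "p = (x, 0, z)" using y by (metis prod_cases3 fst_conv snd_conv)
 note T = tube_h_norm(1,2)[OF 2(2)[unfolded P]] and E = tubeE(8)[OF 2(2)[unfolded P]]
 obtain a' b where ab': "tube_h m (x, 0, z) = (a', b)" by (cases "tube_h m (x, 0, z)")
 have hp: "hmap k p = (a', b)" using hmap_tube[OF 2] P ab' by simp
 define a where "a = a'-8 * real m"
 have mx: "max \<bar>a\<bar> b = 1 | max \<bar>a\<bar> b = 3" "0<=b" using T E unfolding ab' a_def by auto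
 have Na: "rl N * a' = rl (ctr N m)+rl N * a" unfolding a_def ctr_real by (simp add: algebra_simps)
 have NN: "0 < rl N" using N by simp
 have fin: ?thesis if "(i, j)~:poly_cells k N" "rl i<=rl N * a'" "rl N * a'<=rl i+1"
  "rl j<=rl N * b" "rl N * b<=rl j+1" for i j
  unfolding hp using that by (intro exI[of _ "(i, j)"]) (simp add: incell_def)
 have away: "(i, j)~:poly_cells k N" if "ctr N m-4 * N<=i" "i < ctr N m+4 * N" "0<=j"
  "i < ctr N m-3 * N | ctr N m+3 * N<=i | 3 * N<=j | (j < N & ctr N m-N<=i & i < ctr N m+N)" for i j
  by (rule arch_away[OF N 2(1) that(1,2,3)]) (insert that N, auto simp: in_arch)
 show ?thesis
  using mx(1)
 proof
  assume "max \<bar>a\<bar> b = 1"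
  hence b1: "b<=1" "-1<=a" "a<=1" "b = 1 | a = 1 | a = -1" by (auto simp: max_def abs_if split: if_splits)
  hence bb: "0<=rl N * b" "rl N * b<=rl N" "- rl N<=rl N * a" "rl N * a<=rl N"
   using mx NN mult_left_mono[of b 1 "rl N"] mult_left_mono[of a 1 "rl N"] mult_left_mono[of "-1" a "rl N"] by auto
  obtain j where j: "0<=j" "j < N" "rl j<=rl N * b" "rl N * b<=rl j+1"
   using pick[of 0 N "rl N * b"] bb N by auto
  obtain i where i: "ctr N m-N<=i" "i < ctr N m+N" "rl i<=rl N * a'" "rl N * a'<=rl i+1"
   using pick[of "ctr N m-N" "ctr N m+N" "rl N * a'"] bb N unfolding Na by auto
  show ?thesis by (rule fin[of i j]) (use i j N away in auto)
 next
  assume "max \<bar>a\<bar> b = 3"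
  hence b1: "b<=3" "-3<=a" "a<=3" "b = 3 | a = 3 | a = -3" by (auto simp: max_def abs_if split: if_splits)
  hence bb: "0<=rl N * b" "rl N * b<=3 * rl N" "- 3 * rl N<=rl N * a" "rl N * a<=3 * rl N"
   using mx NN mult_left_mono[of b 3 "rl N"] mult_left_mono[of a 3 "rl N"] mult_left_mono[of "-3" a "rl N"] by auto
  obtain j where j: "0<=j" "j < 3 * N" "rl j<=rl N * b" "rl N * b<=rl j+1"
   using pick[of 0 "3 * N" "rl N * b"] bb N by auto
  obtain i where i: "ctr N m-3 * N<=i" "i < ctr N m+3 * N" "rl i<=rl N * a'" "rl N * a'<=rl i+1"
   using pick[of "ctr N m-3 * N" "ctr N m+3 * N" "rl N * a'"] bb N unfolding Na by auto
  from b1(4) show ?thesis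
  proof (elim disjE)
   assume "b = 3"
   thus ?thesis by (intro fin[of i "3 * N"]) (use i N away in auto)
  next
   assume "a = 3"
   thus ?thesis by (intro fin[of "ctr N m+3 * N" j]) (use j N Na away in auto)
  next
   assume "a = -3"
   thus ?thesis by (intro fin[of "ctr N m-3 * N-1" j]) (use j N Na away in auto)
  qed
 qed
qed

definition region_int :: "nat => (real\<times>real) set" where
 "region_int k = {w. -4 < fst w & fst w < 8 * real k+4 & -1 < snd w & snd w < 0} Un 
 (\<Union>m<k. {w. -1 < snd w & 1 < max \<bar>fst w-8 * real m\<bar> (snd w) & max \<bar>fst w-8 * real m\<bar> (snd w) < 3})"

lemma open_region_int: "open (region_int k)"
 unfolding region_int_def by (intro open_Un open_UN ballI open_Collect_conj open_Collect_less continuous_intros)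

lemma hmap_interior:
 assumes p: "p:handle_surface k" and y: "fst (snd p)~=0"
 shows "hmap k p:region_int k"
 using p
proof (cases rule: surface_cases)
 case 1
 obtain x y z where P: "p = (x, y, z)" by (metis prod_cases3)
 have bs: "(x, y, z):box_sphere k" using 1 P unfolding box_part_def by auto
 note B = box_sphereE[OF bs] and E = box_partE[OF 1[unfolded P]]
 show ?thesis
 proof (cases "0 < depth k (x, y, z)")
  case True
  thus ?thesis using hmap_box_range(5)[OF 1[unfolded P]] hmap_box[OF 1] unfolding region_int_def P by simp
 next
  case False
  hence d0: "depth k (x, y, z) = 0" using E(4) by linarith
  have ye: "abs(y) = etaf k x*(1+z)" using E(7) d0 by blast
  have y0: "0 < abs(y)" using `fst (snd p) ~= 0` P by simp
  have "etaf k x~=0" "z~=-1" using ye y0 by auto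
  moreover have "abs(y)~=2" using ye E(3) by linarith
  ultimately have z: "z = 0" using B(6) side_etaf by blast
  obtain m where m: "m < k" "abs(x-8 * real m) < 3" "etaf k x = sqrt (max 0 (1-(abs(x-8 * real m)-2)\<^sup>2))"
   using etaf_cases[of k x] `etaf k x ~= 0` by metis
  hence "(abs(x-8 * real m)-2)\<^sup>2 < 1" using `etaf k x ~= 0` by (auto simp: max_def split: if_splits)
  hence "\<bar>\<bar>x-8 * real m\<bar>-2\<bar> < 1" by (simp add: abs_square_less_1)
  hence "1 < abs(x-8 * real m)" by linarith
  hence "(x, 0):region_int k" unfolding region_int_def using m(1,2) by auto
  thus ?thesis using hmap_box[OF 1] box_h_0[OF d0] P z by simp
 qed
next
 case (2 m)
 obtain x y z where P: "p = (x, y, z)" by (metis prod_cases3)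
 note T = tube_h_norm(1,2)[OF 2(2)[unfolded P]] and E = tubeE(3,4,8)[OF 2(2)[unfolded P]]
 have "y~=0" using `fst (snd p) ~= 0` P by simp
 hence "1 < sqrt ((x-8 * real m)\<^sup>2+z\<^sup>2)" "sqrt ((x-8 * real m)\<^sup>2+z\<^sup>2) < 3" using E by auto
 hence "-1 < snd (hmap k p)" "1 < max \<bar>fst (hmap k p)-8 * real m\<bar> (snd (hmap k p))"
  "max \<bar>fst (hmap k p)-8 * real m\<bar> (snd (hmap k p)) < 3"
  using T hmap_tube[OF 2] P by auto
 thus ?thesis unfolding region_int_def using 2(1) by blast
qed

lemma vertex_interior:
 assumes N: "N > 0" and v: "(rl x / rl N, rl y / rl N):region_int k"
 shows "inter (poly_cells k N) (x, y)"
proof -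
 have NN: "0 < rl N" using N by simp
 consider "-4 < rl x / rl N" "rl x / rl N < 8 * real k+4" "-1 < rl y / rl N" "rl y / rl N < 0"
  | m where "m < k" "-1 < rl y / rl N" "1 < max \<bar>rl x / rl N-8 * real m\<bar> (rl y / rl N)"
   "max \<bar>rl x / rl N-8 * real m\<bar> (rl y / rl N) < 3"
  using v unfolding region_int_def by auto
 thus ?thesis
 proof cases
  case 1
  have "- (4 * N) < x" "x < rend k N" "- N < y" "y < 0"
  proof -
   have "rl (- (4 * N)) < rl x" using 1(1) NN by (simp add: field_simps)
   thus "- (4 * N) < x" by linarith
   have "rl x < rl (rend k N)" unfolding rend_real using 1(2) NN by (simp add: field_simps)
   thus "x < rend k N" by linarith
   have "rl (- N) < rl y" using 1(3) NN by (simp add: field_simps)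
   thus "- N < y" by linarith
   show "y < 0" using 1(4) NN by (simp add: field_simps)
  qed
  thus ?thesis unfolding inter_iff poly_cells_def by (simp add: in_base)
 next
  case (2 m)
  define u where "u = x - ctr N m"
  have ur: "rl x / rl N-8 * real m = rl u / rl N"
   unfolding u_def using NN by (simp add: ctr_real field_simps)
  have s: "rl a / rl N < rl b \<longleftrightarrow> a < b * N" "rl b < rl a / rl N \<longleftrightarrow> b * N < a" for a b
  proof -
   have "rl a / rl N < rl b \<longleftrightarrow> rl a < rl (b * N)" using NN by (simp add: field_simps)
   thus "rl a / rl N < rl b \<longleftrightarrow> a < b * N" by linarith
   have "rl b < rl a / rl N \<longleftrightarrow> rl (b * N) < rl a" using NN by (simp add: field_simps)
   thus "rl b < rl a / rl N \<longleftrightarrow> b * N < a" by linarith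
  qed
  define r t where "r = rl u / rl N" and "t = rl y / rl N"
  have y1: "- N < y" using 2(2) s(2)[of "-1" y] by simp
  have "abs(r) < 3" "t < 3" using 2(4) unfolding ur r_def[symmetric] t_def[symmetric] by auto
  hence "-3 < r" "r < 3" "t < 3" by auto
  hence u3: "- (3 * N) < u" "u < 3 * N" "y < 3 * N"
   using s(1)[of u 3] s(2)[of "-3" u] s(1)[of y 3] unfolding r_def t_def by auto
  have "1 < abs(r) | 1 < t" using 2(3) unfolding ur r_def[symmetric] t_def[symmetric] by (simp add: less_max_iff_disj)
  hence "1 < r | r < -1 | 1 < t" by linarith
  hence u1: "N < u | u < - N | N < y"
   using s(2)[of 1 u] s(1)[of u "-1"] s(2)[of 1 y] unfolding r_def t_def by auto
  have key: "- N<=y' & y' < 0 | (x', y'):arch_cells (ctr N m) N" if "x' = x | x' = x-1" "y' = y | y' = y-1" for x' y'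
  proof (cases "y' < 0")
   case False
   thus ?thesis using that y1 u3 u1 N unfolding in_arch u_def by (cases "y' < N") auto
  qed (use that y1 in auto)
  have xs: "ctr N m-4 * N<=x" "x < ctr N m+4 * N" "ctr N m-4 * N<=x-1" "x-1 < ctr N m+4 * N"
   using u3 N unfolding u_def by auto
  show ?thesis unfolding inter_iff poly_near[OF N 2(1) xs(1,2)] poly_near[OF N 2(1) xs(3,4)]
   using key by blast
 qed
qed

abbreviation side :: "bool => real\<times>real\<times>real => bool" where
 "side s p == if s then 0<=fst (snd p) else fst (snd p)<=0"

definition touched :: "nat => int => (real\<times>real\<times>real) set => (bool\<times>int\<times>int) set" where
 "touched k N K = {(s, c). c:poly_cells k N & (EX p:K. incell N (hmap k p) c & (side s p))}"

text \<open>A combinatorial thickening of a set: all corners of the cells that its image meets, on the sheet or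
sheets on which its points lie.\<close>

definition touch :: "nat => int => (real\<times>real\<times>real) set => ((int\<times>int)\<times>bool) set" where
 "touch k N K = (UN (s, c):touched k N K. corners (poly_cells k N) s c)"

lemma touch_sub: "touch k N K<=lab (poly_cells k N) ` darts (poly_cells k N)"
proof
 fix l assume "l:touch k N K"
 then obtain s c where "(s, c):touched k N K" "l : corners (poly_cells k N) s c" unfolding touch_def by blast
 thus "l:lab (poly_cells k N) ` darts (poly_cells k N)"
  using corners_in_lab[of c "poly_cells k N" s] unfolding touched_def by blast
qed

lemma touched_point:
 assumes N: "N > 0" and p: "p:handle_surface k" "p:K"
 obtains s c where "(s, c):touched k N K" "incell N (hmap k p) c" "side s p"
proof -
 obtain c where c: "c:poly_cells k N" "incell N (hmap k p) c" using hmap_in_cell[OF N p(1)] by blast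
 have "if (0<=fst (snd p)) then 0<=fst (snd p) else fst (snd p)<=0" by simp
 thus ?thesis using that[of "0<=fst (snd p)" c] c p(2) unfolding touched_def by blast
qed

lemma touched_meet:
 assumes N: "N > 0" and p: "p:handle_surface k"
  and c: "incell N (hmap k p) c" "side s p"
  and c': "incell N (hmap k p) c'" "side s' p"
 shows "corners (poly_cells k N) s c Int corners (poly_cells k N) s' c'~={}"
proof -
 let ?v = "vfloor N (hmap k p)" and ?C = "poly_cells k N"
 have v: "pl ?C s ?v : corners ?C s c" "pl ?C s' ?v : corners ?C s' c'"
  using vfloor_corner[OF c(1)] vfloor_corner[OF c'(1)] unfolding corners_def by blast+
 have "pl ?C s ?v = pl ?C s' ?v"
 proof (cases "s = s'")
  case False
  hence "fst (snd p) = 0" using c(2) c'(2) by (cases s) auto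
  then obtain d where d: "d~:?C" "incell N (hmap k p) d" using hmap_boundary[OF N p] by blast
  obtain r where "quad ?v r = d" using corner_quad[OF vfloor_corner[OF d(2)]] .
  hence "~inter ?C ?v" using d(1) unfolding inter_def by blast
  thus ?thesis unfolding pl_def by simp
 qed simp
 thus ?thesis using v by auto
qed

lemma touch_meet:
 assumes N: "N > 0" and p: "p:handle_surface k" "p:K" "p:K'"
 shows "touch k N K Int touch k N K'~={}"
proof -
 obtain s c where 1: "(s, c):touched k N K" "incell N (hmap k p) c" "side s p"
  using touched_point[OF N p(1,2)] .
 obtain s' c' where 2: "(s', c'):touched k N K'" "incell N (hmap k p) c'" "side s' p"
  using touched_point[OF N p(1,3)] .
 show ?thesis using touched_meet[OF N p(1) 1(2,3) 2(2,3)] 1(1) 2(1) unfolding touch_def by blast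
qed

lemma finite_touched: "finite (touched k N K)"
 by (rule finite_subset[of _ "UNIV\<times>poly_cells k N"]) (auto simp: touched_def)

text \<open>If the touched cells fell into two groups without common corner, they would split the set into two
disjoint relatively closed parts.\<close>

lemma touch_conn:
 assumes N: "N > 0" and K: "K<=handle_surface k" "connected K"
 shows "conn (adj (poly_cells k N)) (touch k N K)"
proof (rule conn_cells[OF touch_def])
 show "c:poly_cells k N" if "(s, c):touched k N K" for s c using that unfolding touched_def by simp
 fix P assume P: "P<=touched k N K" "P~={}" "P~=touched k N K"
 have cont: "continuous_on K (hmap k)" using continuous_hmap continuous_on_subset K(1) by blast
 define F where "F Z = (UN (s, c):Z. {p:K. incell N (hmap k p) c & (side s p)})" for Z
 have cl: "closedin (top_of_set K) {p:K. incell N (hmap k p) c & (side s p)}" for s c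
 proof -
  have "closed {w. incell N w c}" unfolding incell_def
   by (intro closed_Collect_conj closed_Collect_le continuous_intros)
  hence "closedin (top_of_set K) (K Int hmap k -` {w. incell N w c})"
   by (rule continuous_closedin_preimage[OF cont])
  moreover have "closed {p :: real\<times>real\<times>real. side s p}"
   by (cases s) (auto intro!: closed_Collect_le continuous_intros)
  hence "closedin (top_of_set K) (K Int {p. side s p})"
   by (rule closedin_closed_Int)
  ultimately have "closedin (top_of_set K) ((K Int hmap k -` {w. incell N w c}) Int (K Int {p. side s p}))"
   by (rule closedin_Int)
  moreover have "(K Int hmap k -` {w. incell N w c}) Int (K Int {p. side s p}) =
 {p:K. incell N (hmap k p) c & (side s p)}" by auto
  ultimately show ?thesis by simp
 qed
 have clF: "closedin (top_of_set K) (F Z)" if "finite Z" for Z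
  unfolding F_def using that cl by (intro closedin_Union) auto
 have cover: "F P Un F (touched k N K-P) = K"
 proof
  show "F P Un F (touched k N K-P)<=K" unfolding F_def by auto
  show "K<=F P Un F (touched k N K-P)"
  proof
   fix p assume p: "p:K"
   obtain s c where "(s, c):touched k N K" "incell N (hmap k p) c" "side s p"
    using touched_point[OF N _ p] K p by blast
   thus "p:F P Un F (touched k N K-P)" unfolding F_def using p by (cases "(s, c):P") blast+
  qed
 qed
 have ne: "F Z~={}" if Z: "Z<=touched k N K" "Z~={}" for Z
 proof -
  obtain s c where sc: "(s, c):Z" using Z(2) by auto
  hence "(s, c):touched k N K" using Z(1) by blast
  then obtain p where "p:K" "incell N (hmap k p) c" "side s p"
   unfolding touched_def by blast
  thus ?thesis unfolding F_def using sc by blast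
 qed
 have fin: "finite P" "finite (touched k N K-P)" using finite_subset[OF P(1) finite_touched] finite_touched by auto
 have "F P~={}" "F (touched k N K-P)~={}" using ne[of P] ne[of "touched k N K-P"] P by auto
 hence "F P Int F (touched k N K-P)~={}"
  using K(2) clF[OF fin(1)] clF[OF fin(2)] cover unfolding connected_closedin_eq by blast
 then obtain p where "p:F P" "p:F (touched k N K-P)" by blast
 then obtain s c s' c' where sc: "(s, c):P" "(s', c'):touched k N K-P" "p:K"
  "incell N (hmap k p) c" "side s p"
  "incell N (hmap k p) c'" "side s' p"
  unfolding F_def by blast
 have "p:handle_surface k" using sc(3) K by blast
 hence "corners (poly_cells k N) s c Int corners (poly_cells k N) s' c'~={}"
  using touched_meet[OF N _ sc(4-7)] by blast
 thus "EX (s, c):P. EX (s', c'):touched k N K-P. corners (poly_cells k N) s c Int corners (poly_cells k N) s' c'~={}"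
  using sc(1,2) by blast
qed

text \<open>The last alternative reflects that only boundary vertices belong to both sheets.\<close>

lemma touch_common:
 assumes N: "N > 0" and l: "l:touch k N K" "l:touch k N K'"
 obtains p p' v where "p:K" "p':K'" "dist (hmap k p) v<=2 / rl N" "dist (hmap k p') v<=2 / rl N"
  "0<=fst (snd p) * fst (snd p') | v~:region_int k"
proof -
 obtain s c where sc: "(s, c):touched k N K" "l : corners (poly_cells k N) s c" using l(1) unfolding touch_def by blast
 obtain s' c' where sc': "(s', c'):touched k N K'" "l : corners (poly_cells k N) s' c'" using l(2) unfolding touch_def by blast
 obtain p where p: "p:K" "incell N (hmap k p) c" "side s p"
  using sc unfolding touched_def by blast
 obtain p' where p': "p':K'" "incell N (hmap k p') c'" "side s' p'"
  using sc' unfolding touched_def by blast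
 obtain x y b where lxy: "l = ((x, y), b)" by (metis prod.collapse)
 define v where "v = (rl x / rl N, rl y / rl N)"
 have NN: "0 < rl N" using N by simp
 have near: "dist w v<=2 / rl N"
  if "l : corners (poly_cells k N) t d" "incell N w d" for t d w
 proof -
  have "(x, y):{d, (fst d+1, snd d), (fst d+1, snd d+1), (fst d, snd d+1)}"
   using that(1) unfolding lxy corners_def pl_def by blast
  hence xy: "x = fst d | x = fst d+1" "y = snd d | y = snd d+1" by (auto simp: prod_eq_iff)
  have 1: "abs(rl N * fst w-rl x)<=1" "abs(rl N * snd w-rl y)<=1"
   using that(2) xy unfolding incell_def by auto
  have "abs(fst w-fst v) = abs(rl N * fst w-rl x) / rl N"
   "abs(snd w-snd v) = abs(rl N * snd w-rl y) / rl N"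
   unfolding v_def using NN by (auto simp: abs_if field_simps)
  hence "abs(fst w-fst v)<=1 / rl N" "abs(snd w-snd v)<=1 / rl N"
   using 1 NN by (auto simp: divide_right_mono)
  hence "dist (fst w) (fst v)+dist (snd w) (snd v)<=2 / rl N" by (simp add: dist_real_def)
  moreover have "dist w v<=dist (fst w) (fst v)+dist (snd w) (snd v)"
   unfolding dist_prod_def using sqrt_sum_squares_le_sum[of "dist (fst w) (fst v)" "dist (snd w) (snd v)"] by simp
  ultimately show ?thesis by linarith
 qed
 have "0<=fst (snd p) * fst (snd p') | v~:region_int k"
 proof (cases "s = s'")
  case True
  thus ?thesis using p(3) p'(3) by (cases s) (auto simp: mult_nonpos_nonpos)
 next
  case False
  have "b = (inter (poly_cells k N) (x, y) & ~s)" "b = (inter (poly_cells k N) (x, y) & ~s')"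
   using sc(2) sc'(2) unfolding lxy corners_def pl_def by blast+
  hence "~inter (poly_cells k N) (x, y)" using False by blast
  thus ?thesis using vertex_interior[OF N, of x y k] unfolding v_def by blast
 qed
 thus ?thesis using that[OF p(1) p'(1) near[OF sc(2) p(2)] near[OF sc'(2) p'(2)]] by blast
qed

text \<open>Otherwise, points of the two sets with images of distance tending to 0 converge along a subsequence. The limits have the
same image, and they lie in the same closed half of the surface, since a limit point off the plane
\<open>y = 0\<close> has its image in the open interior of the region. As \<open>hmap\<close> is injective on closed halves, the limits coincide.\<close>

lemma touch_disjoint:
 assumes K: "compact K" "K<=handle_surface k" and K': "compact K'" "K'<=handle_surface k" and d: "K Int K' = {}"
 shows "eventually (%n. touch k (int n+1) K Int touch k (int n+1) K' = {}) sequentially"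
proof (rule ccontr)
 assume "~?thesis"
 hence fr: "EX n>=m. touch k (int n+1) K Int touch k (int n+1) K'~={}" for m
  unfolding eventually_sequentially by blast
 define W where "W m p p' v \<longleftrightarrow> p:K & p':K' & dist (hmap k p) v<=2 / (real m+1) & dist (hmap k p') v<=2 / (real m+1) &
 (0<=fst (snd p) * fst (snd p') | v~:region_int k)" for m p p' v
 have "EX p p' v. W m p p' v" for m
 proof -
  obtain n l where n: "m<=n" "l:touch k (int n+1) K" "l:touch k (int n+1) K'" using fr[of m] by blast
  obtain p p' v where *: "p:K" "p':K'" "dist (hmap k p) v<=2 / rl (int n+1)" "dist (hmap k p') v<=2 / rl (int n+1)"
   "0<=fst (snd p) * fst (snd p') | v~:region_int k"
   by (rule touch_common[of "int n+1" l k K K', OF _ n(2,3)]) simp_all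
  have "2 / rl (int n+1)<=2 / (real m+1)" using n(1) by (intro divide_left_mono) auto
  thus ?thesis unfolding W_def using * by (intro exI[of _ p] exI[of _ p'] exI[of _ v]) auto
 qed
 then obtain P P' V where W: "!!m. W m (P m) (P' m) (V m)" by metis
 have P: "P m:K" "P' m:K'" "dist (hmap k (P m)) (V m)<=2 / (real m+1)" "dist (hmap k (P' m)) (V m)<=2 / (real m+1)"
  "0<=fst (snd (P m)) * fst (snd (P' m)) | V m~:region_int k" for m using W[of m] unfolding W_def by auto
 have "compact (K\<times>K')" using K K' compact_Times by blast
 moreover have "ALL m. (P m, P' m):K\<times>K'" using P by auto
 ultimately obtain q r where q: "q:K\<times>K'" "strict_mono r" "((%m. (P m, P' m))\<circ>r) \<longlonglongrightarrow> q"
  unfolding compact_def by meson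
 obtain a a' where qa: "q = (a, a')" by (cases q)
 have aK: "a:K" "a':K'" using q qa by auto
 have lim: "(%m. P (r m)) \<longlonglongrightarrow> a" "(%m. P' (r m)) \<longlonglongrightarrow> a'"
  using tendsto_fst[OF q(3)] tendsto_snd[OF q(3)] unfolding qa o_def by auto
 have hl: "(%m. hmap k (P (r m))) \<longlonglongrightarrow> hmap k a"
  by (rule continuous_on_tendsto_compose[OF continuous_hmap lim(1)]) (insert P K aK, auto intro!: always_eventually)
 have hl': "(%m. hmap k (P' (r m))) \<longlonglongrightarrow> hmap k a'"
  by (rule continuous_on_tendsto_compose[OF continuous_hmap lim(2)]) (insert P K' aK, auto intro!: always_eventually)
 have "(%m. 2 / (real m+1)) \<longlonglongrightarrow> 0" by real_asymp
 hence z: "(%m. 2 / (real (r m)+1)) \<longlonglongrightarrow> 0" using LIMSEQ_subseq_LIMSEQ[OF _ q(2)] unfolding o_def by blast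
 have d0: "(%m. dist (hmap k (P (r m))) (V (r m))) \<longlonglongrightarrow> 0"
  by (rule tendsto_sandwich[OF _ _ tendsto_const z]) (insert P(3), auto intro!: always_eventually)
 have d0': "(%m. dist (hmap k (P' (r m))) (V (r m))) \<longlonglongrightarrow> 0"
  by (rule tendsto_sandwich[OF _ _ tendsto_const z]) (insert P(4), auto intro!: always_eventually)
 have conv: "(%m. V (r m)) \<longlonglongrightarrow> w" if "g \<longlonglongrightarrow> w" "(%m. dist (g m) (V (r m))) \<longlonglongrightarrow> 0" for g w
 proof (rule Lim_transform[OF that(1)])
  show "(%m. V (r m)-g m) \<longlonglongrightarrow> 0"
   by (rule tendsto_norm_zero_cancel) (insert that(2), simp add: dist_norm norm_minus_commute)
 qed
 have Vl: "(%m. V (r m)) \<longlonglongrightarrow> hmap k a" by (rule conv[OF hl d0])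
 have Vl': "(%m. V (r m)) \<longlonglongrightarrow> hmap k a'" by (rule conv[OF hl' d0'])
 have he: "hmap k a = hmap k a'" by (rule LIMSEQ_unique[OF Vl Vl'])
 have "0<=fst (snd a) * fst (snd a')"
 proof (rule ccontr)
  assume neg: "~?thesis"
  have ly: "(%m. fst (snd (P (r m))) * fst (snd (P' (r m)))) \<longlonglongrightarrow> fst (snd a) * fst (snd a')"
   by (intro tendsto_intros lim)
  have "fst (snd a)~=0" using neg by auto
  hence "hmap k a:region_int k" using hmap_interior[of a k] aK K by blast
  hence "eventually (%m. V (r m):region_int k) sequentially"
   using topological_tendstoD[OF Vl open_region_int] by blast
  moreover have "eventually (%m. fst (snd (P (r m))) * fst (snd (P' (r m))) < 0) sequentially"
   using order_tendstoD(2)[OF ly, of 0] neg by simp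
  ultimately have "eventually (%m. False) sequentially"
   by eventually_elim (insert P(5), meson not_le)
  thus False by simp
 qed
 hence "a = a'" using hmap_inj[OF _ _ he] aK K K' by blast
 thus False using aK d by blast
qed

text \<open>The branch set of a vertex comes from the first two fifths of all arcs that leave it, and the connection
of an edge from the middle fifth of its arc. These are compact and connected, and they are disjoint
unless the vertex is an end of the edge.\<close>

theorem rotation_of_drawing:
 fixes V :: "'v set"
 assumes fin: "finite V" "finite E" and V: "V~={}" "!!v. v:V ==> EX e:E. v:e"
  and E: "!!e. e:E ==> EX u v. u~=v & e = {u, v} & u:V & v:V"
  and D: "drawable_on (V, E) (handle_surface k)"
 shows "EX rho. perm_on rho (arcs E) & (ALL u v. (u, v):arcs E --> orb rho (u, v) = {q:arcs E. fst q = u}) &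
 card (arcs E) div 2+2 <= card V+ncyc (rho\<circ>prod.swap) (arcs E)+2 * k"
proof -
 let ?S = "handle_surface k"
 obtain p c where d: "drawing_on (V, E) ?S p c" using D unfolding drawable_on_def by blast
 have inj: "inj_on p V"
  and arc: "!!e. e:E ==> arc (c e)" and cS: "!!e. e:E ==> path_image (c e)<=?S"
  and ends: "!!e. e:E ==> {pathstart (c e), pathfinish (c e)} = p ` e"
  and cross: "!!e f. e:E ==> f:E ==> e~=f ==> path_image (c e) Int path_image (c f) = p ` (e Int f)"
  using d unfolding drawing_on_def by auto
 have eV: "e<=V" if "e:E" for e using E[OF that] by blast
 define por where "por e v = (if pathstart (c e) = p v then c e ` {0..2/5} else c e ` {3/5..1})" for e v
 define mid where "mid e = c e ` {2/5..3/5}" for e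
 have injc: "inj_on (c e) {0..1}" and contc: "continuous_on {0..1} (c e)" if "e:E" for e
  using arc[OF that] unfolding arc_def path_def by auto
 have sub_img: "por e v<=path_image (c e)" "mid e<=path_image (c e)" for e v
  unfolding por_def mid_def path_image_def by (auto intro!: image_mono)
 have comp: "compact (por e v)" "connected (por e v)" "compact (mid e)" "connected (mid e)" if e: "e:E" for e v
 proof -
  have "continuous_on {0..2/5} (c e)" "continuous_on {3/5..1} (c e)" "continuous_on {2/5..3/5} (c e)"
   using continuous_on_subset[OF contc[OF e]] by auto
  thus "compact (por e v)" "connected (por e v)" "compact (mid e)" "connected (mid e)"
   unfolding por_def mid_def by (auto intro!: compact_continuous_image connected_continuous_image)
 qed
 have endpoint: "pathstart (c e) = p v | pathfinish (c e) = p v" if "e:E" "v:e" for e v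
 proof -
  have "p v:{pathstart (c e), pathfinish (c e)}" unfolding ends[OF that(1)] using that(2) by (rule imageI)
  thus ?thesis by auto
 qed
 have start0: "pathstart (c e) = c e 0" "pathfinish (c e) = c e 1" for e by (simp_all add: pathstart_def pathfinish_def)
 have por_v: "p v:por e v" if "e:E" "v:e" for e v
  using endpoint[OF that] unfolding por_def start0 by (auto intro: image_eqI[of _ _ 0] image_eqI[of _ _ 1])
 have por_end: "w = v" if e: "e:E" "v:e" "w:e" and m: "p w:por e v" for e v w
 proof (rule ccontr)
  assume ne: "w~=v"
  have pw: "p w~=p v" using inj e eV[OF e(1)] ne unfolding inj_on_def by blast
  show False
  proof (cases "pathstart (c e) = p v")
   case True
   hence "p w = c e 1" using endpoint[OF e(1,3)] pw unfolding start0 by auto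
   moreover obtain t where "t:{0..2/5}" "p w = c e t" using m True unfolding por_def by auto
   ultimately show False using injc[OF e(1)] unfolding inj_on_def by fastforce
  next
   case False
   hence "p w = c e 0" using endpoint[OF e(1,2)] endpoint[OF e(1,3)] pw unfolding start0 by auto
   moreover obtain t where "t:{3/5..1}" "p w = c e t" using m False unfolding por_def by auto
   ultimately show False using injc[OF e(1)] unfolding inj_on_def by fastforce
  qed
 qed
 have mid_end: "p w~:mid e" if e: "e:E" "w:e" for e w
 proof
  assume "p w:mid e"
  then obtain t where t: "t:{2/5..3/5}" "p w = c e t" unfolding mid_def by auto
  thus False using endpoint[OF e] injc[OF e(1)] unfolding start0 inj_on_def by fastforce
 qed
 define K where "K v = (UN e:{e:E. v:e}. por e v)" for v
 have K1: "compact (K v)" "connected (K v)" "K v<=?S" "K v~={}" if v: "v:V" for v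
 proof -
  show "compact (K v)" unfolding K_def using fin(2) comp by (intro compact_UN) auto
  show "K v<=?S" unfolding K_def using sub_img(1) cS by blast
  obtain e where "e:E" "v:e" using V(2)[OF v] by blast
  thus "K v~={}" unfolding K_def using por_v by blast
  have "(INT e:{e:E. v:e}. por e v)~={}" using por_v by blast
  thus "connected (K v)" unfolding K_def using comp(2)
   by (intro connected_Union) auto
 qed
 have KK: "K u Int K v = {}" if uv: "u:V" "v:V" "u~=v" for u v
 proof -
  have False if e: "e:E" "u:e" "q:por e u" and f: "f:E" "v:f" "q:por f v" for e f q
  proof (cases "e = f")
   case False
   have "q:path_image (c e) Int path_image (c f)" using e f sub_img(1) by blast
   then obtain w where w: "w:e" "w:f" "q = p w" unfolding cross[OF e(1) f(1) False] by blast
   have "w = u" by (rule por_end[OF e(1,2) w(1)]) (use e w in simp)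
   moreover have "w = v" by (rule por_end[OF f(1,2) w(2)]) (use f w in simp)
   ultimately show False using uv by simp
  next
   case True
   have pne: "p u~=p v" using inj uv unfolding inj_on_def by blast
   have "(pathstart (c e) = p u)~=(pathstart (c e) = p v)"
    using endpoint[OF e(1,2)] endpoint[OF e(1), of v] f True pne by auto
   hence "q : c e ` {0..2/5} & q : c e ` {3/5..1}" using e(3) f(3) True unfolding por_def by (auto split: if_splits)
   then obtain s t where "s:{0..2/5}" "t:{3/5..1}" "c e s = c e t" by auto
   thus False using injc[OF e(1)] unfolding inj_on_def by fastforce
  qed
  thus ?thesis unfolding K_def by blast
 qed
 have M1: "mid e<=?S" if "e:E" for e using sub_img(2) cS[OF that] by blast
 have MM: "mid e Int mid f = {}" if e: "e:E" "f:E" "e~=f" for e f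
 proof -
  have "mid e Int mid f<=p ` (e Int f)" using cross[OF e] sub_img(2) by blast
  thus ?thesis using mid_end[OF e(1)] by blast
 qed
 have MK: "mid e Int K v = {}" if e: "e:E" and v: "v:V" "v~:e" for e v
 proof -
  have "mid e Int por f v = {}" if f: "f:E" "v:f" for f
  proof -
   have ne: "e~=f" using f v by auto
   have "mid e Int por f v<=p ` (e Int f)" using cross[OF e f(1) ne] sub_img by blast
   thus ?thesis using mid_end[OF e] by blast
  qed
  thus ?thesis unfolding K_def by blast
 qed
 have MK': "EX q. q:mid e & q:K v" if e: "e:E" "v:e" for e v
 proof (cases "pathstart (c e) = p v")
  case True
  have "c e (2/5):mid e" "c e (2/5):por e v" unfolding mid_def por_def using True by auto
  thus ?thesis unfolding K_def using e by blast
 next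
  case False
  have "c e (3/5):mid e" "c e (3/5):por e v" unfolding mid_def por_def using False by auto
  thus ?thesis unfolding K_def using e by blast
 qed
 let ?P = "%n A B. touch k (int n+1) A Int touch k (int n+1) B = {}"
 have "eventually (%n. u~=v --> ?P n (K u) (K v)) sequentially" if "u:V" "v:V" for u v
  using touch_disjoint[OF K1(1,3)[OF that(1)] K1(1,3)[OF that(2)] KK[OF that]] by (cases "u = v") auto
 hence 1: "eventually (%n. ALL u:V. ALL v:V. u~=v --> ?P n (K u) (K v)) sequentially"
  using fin(1) by (intro eventually_ball_finite ballI) auto
 have "eventually (%n. e~=f --> ?P n (mid e) (mid f)) sequentially" if "e:E" "f:E" for e f
  using touch_disjoint[OF comp(3)[OF that(1)] M1[OF that(1)] comp(3)[OF that(2)] M1[OF that(2)] MM[OF that]] by (cases "e = f") auto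
 hence 2: "eventually (%n. ALL e:E. ALL f:E. e~=f --> ?P n (mid e) (mid f)) sequentially"
  using fin(2) by (intro eventually_ball_finite ballI) auto
 have "eventually (%n. v~:e --> ?P n (mid e) (K v)) sequentially" if "e:E" "v:V" for e v
  using touch_disjoint[OF comp(3)[OF that(1)] M1[OF that(1)] K1(1,3)[OF that(2)] MK[OF that]] by (cases "v:e") auto
 hence 3: "eventually (%n. ALL e:E. ALL v:V. v~:e --> ?P n (mid e) (K v)) sequentially"
  using fin by (intro eventually_ball_finite ballI) auto
 from eventually_happens'[OF sequentially_bot eventually_conj[OF 1 eventually_conj[OF 2 3]]]
 obtain n where nn: "ALL u:V. ALL v:V. u~=v --> ?P n (K u) (K v)"
  "ALL e:E. ALL f:E. e~=f --> ?P n (mid e) (mid f)" "ALL e:E. ALL v:V. v~:e --> ?P n (mid e) (K v)"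
  by (elim exE conjE) (rule that)
 note n = nn(1)[rule_format] nn(2)[rule_format] nn(3)[rule_format]
 define N where "N = int n+1"
 have N: "N > 0" unfolding N_def by simp
 note n = n[folded N_def]
 have T1: "touch k N (K v)<=lab (poly_cells k N) ` darts (poly_cells k N) & touch k N (K v)~={} &
 conn (adj (poly_cells k N)) (touch k N (K v))" if v: "v:V" for v
 proof (intro conjI touch_sub touch_conn[OF N K1(3,2)[OF v]])
  obtain q where "q:K v" using K1(4)[OF v] by blast
  thus "touch k N (K v)~={}" using touch_meet[OF N _ _, of q k "K v" "K v"] K1(3)[OF v] by blast
 qed
 have T2: "touch k N (mid e)<=lab (poly_cells k N) ` darts (poly_cells k N) &
 conn (adj (poly_cells k N)) (touch k N (mid e))" if e: "e:E" for e
  by (intro conjI touch_sub touch_conn[OF N M1[OF e] comp(4)[OF e]])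
 have T3: "touch k N (mid e) Int touch k N (K v)~={} \<longleftrightarrow> v:e" if e: "e:E" and v: "v:V" for e v
 proof
  assume "v:e"
  then obtain q where "q:mid e" "q:K v" using MK'[OF e] by blast
  thus "touch k N (mid e) Int touch k N (K v)~={}" using touch_meet[OF N, of q k "mid e" "K v"] M1[OF e] by blast
 qed (use n(3)[OF e v] in blast)
 show ?thesis
  by (rule rotation_from_grid[where K = "%v. touch k N (K v)" and Q = "%e. touch k N (mid e)", OF N V E T1 n(1) T2 n(2) T3])
qed

section \<open>Counting triangular faces\<close>

definition rotation :: "'v set set => ('v\<times>'v => 'v\<times>'v) => bool" where
 "rotation E rho \<longleftrightarrow> perm_on rho (arcs E) & (ALL u v. (u, v):arcs E --> orb rho (u, v) = {q:arcs E. fst q = u}) &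
 (ALL u. {u}~:E)"

abbreviation face :: "('v\<times>'v => 'v\<times>'v) => 'v\<times>'v => 'v\<times>'v" where
 "face rho == rho\<circ>prod.swap"

lemma arcs_sym: "(u, v):arcs E \<longleftrightarrow> (v, u):arcs E"
 unfolding arcs_def by (simp add: insert_commute)

lemma rotationD:
 assumes "rotation E rho"
 shows "perm_on rho (arcs E)" "!!u v. (u, v):arcs E ==> orb rho (u, v) = {q:arcs E. fst q = u}"
  "!!u v. (u, v):arcs E ==> u~=v" "finite (arcs E)"
 using assms perm_onD(1) unfolding rotation_def arcs_def by auto

lemma perm_on_face:
 assumes "rotation E rho"
 shows "perm_on (face rho) (arcs E)"
proof -
 have "bij_betw prod.swap (arcs E) (arcs E)"
  by (rule bij_betwI[of _ _ _ prod.swap]) (auto simp: arcs_sym)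
 thus ?thesis using rotationD(1)[OF assms] unfolding perm_on_def using bij_betw_trans by blast
qed

lemma rot_arc:
 assumes r: "rotation E rho" and a: "(v, u):arcs E"
 obtains w where "rho (v, u) = (v, w)" "(v, w):arcs E"
proof -
 have "rho (v, u) : orb rho (v, u)" by simp
 hence "rho (v, u):arcs E" "fst (rho (v, u)) = v" unfolding rotationD(2)[OF r a] by auto
 thus ?thesis using that[of "snd (rho (v, u))"] by (metis prod.collapse)
qed

lemma rot_closed:
 assumes r: "rotation E rho" and a: "(v, u):arcs E" "u:P" and b: "(v, w):arcs E" "w~:P"
 obtains u' w' where "(v, u'):arcs E" "u':P" "rho (v, u') = (v, w')" "(v, w'):arcs E" "w'~:P"
proof (rule ccontr)
 assume no: "~thesis"
 have "orb rho (v, u)<={q:arcs E. fst q = v & snd q:P}"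
 proof (rule orb_subsetI)
  fix q assume q: "q:{q:arcs E. fst q = v & snd q:P}"
  hence qa: "(v, snd q):arcs E" "q = (v, snd q)" "snd q:P" by auto
  obtain w' where "rho (v, snd q) = (v, w')" "(v, w'):arcs E" using rot_arc[OF r qa(1)] .
  thus "rho q:{q:arcs E. fst q = v & snd q:P}"
   using no that[OF qa(1,3)] qa(2) by (metis (mono_tags, lifting) fst_conv mem_Collect_eq snd_conv)
 qed (use a in simp)
 moreover have "(v, w) : orb rho (v, u)" unfolding rotationD(2)[OF r a(1)] using b by simp
 ultimately show False using b by auto
qed

lemma rot_fixed:
 assumes r: "rotation E rho" and a: "(v, u):arcs E" and f: "rho (v, u) = (v, u)" and b: "(v, w):arcs E"
 shows "w = u"
proof (rule ccontr)
 assume "w~=u"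
 then obtain u' w' where "u':{u}" "rho (v, u') = (v, w')" "w'~:{u}"
  using rot_closed[OF r a, of "{u}" w] b by blast
 thus False using f by simp
qed

definition deg2 :: "'v set set => bool" where
 "deg2 E \<longleftrightarrow> (ALL u v. (u, v):arcs E --> (EX w. (u, w):arcs E & w~=v))"

lemma face_card:
 assumes r: "rotation E rho" and d2: "deg2 E" and d: "d:arcs E"
 shows "3 <= card (orb (face rho) d)"
proof -
 obtain u v where uv: "d = (u, v)" by (cases d)
 have a: "(u, v):arcs E" using d uv by simp
 obtain w where w: "rho (v, u) = (v, w)" "(v, w):arcs E" using rot_arc[OF r arcs_sym[THEN iffD1, OF a]] .
 have wu: "w~=u"
 proof
  assume "w = u"
  hence f: "rho (v, u) = (v, u)" using w by simp
  obtain w' where "(v, w'):arcs E" "w'~=u" using d2 arcs_sym[THEN iffD1, OF a] unfolding deg2_def by blast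
  thus False using rot_fixed[OF r arcs_sym[THEN iffD1, OF a] f] by blast
 qed
 obtain t where t: "rho (w, v) = (w, t)" "(w, t):arcs E" using rot_arc[OF r arcs_sym[THEN iffD1, OF w(2)]] .
 have f: "face rho d = (v, w)" "face rho (v, w) = (w, t)" using uv w t by auto
 have "(v, w) : orb (face rho) d" using f_in_orb[of "face rho" d] unfolding f .
 moreover have "(w, t) : orb (face rho) d" using orb_step[OF calculation] unfolding f .
 ultimately have "{d, (v, w), (w, t)} <= orb (face rho) d" by simp
 moreover have "finite (orb (face rho) d)"
  using orb_subset[OF perm_on_face[OF r] d] rotationD(4)[OF r] finite_subset by blast
 ultimately have "card {d, (v, w), (w, t)} <= card (orb (face rho) d)" by (intro card_mono)
 moreover have "card {d, (v, w), (w, t)} = 3"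
  using wu rotationD(3)[OF r w(2)] rotationD(3)[OF r a] unfolding uv by simp
 ultimately show ?thesis by simp
qed

lemma triangle_face:
 assumes r: "rotation E rho" and a: "(u, v):arcs E" and c: "card (orb (face rho) (u, v)) = 3" and w: "rho (v, u) = (v, w)"
 shows "(w, u):arcs E" "face rho (v, w) = (w, u)" "(v, w):arcs E"
proof -
 have p: "perm_on (face rho) (arcs E)" by (rule perm_on_face[OF r])
 obtain w0 where "rho (v, u) = (v, w0)" "(v, w0):arcs E" using rot_arc[OF r arcs_sym[THEN iffD1, OF a]] .
 thus vw: "(v, w):arcs E" using w by simp
 obtain t where t: "rho (w, v) = (w, t)" "(w, t):arcs E" using rot_arc[OF r arcs_sym[THEN iffD1, OF vw]] .
 let ?f = "face rho" and ?d = "(u, v)"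
 have f: "?f ?d = (v, w)" "?f (v, w) = (w, t)" using w t by auto
 have "?f (w, t) = ?d"
 proof (rule ccontr)
  assume ne: "?f (w, t)~=?d"
  have ne': "u~=v" "v~=w" "w~=t" using rotationD(3)[OF r] a vw t by auto
  have inj: "inj_on ?f (arcs E)" using perm_onD(3)[OF p] .
  obtain s where s: "rho (t, w) = (t, s)" "(t, s):arcs E" using rot_arc[OF r arcs_sym[THEN iffD1, OF t(2)]] .
  have fs: "?f (w, t) = (t, s)" using s by simp
  have dwt: "?d~=(w, t)"
  proof
   assume "?d = (w, t)"
   hence "?f (v, w) = ?d" using f by simp
   hence "orb ?f ?d<={?d, (v, w)}" by (intro orb_subsetI) (use f in auto)
   hence "card (orb ?f ?d) <= card {?d, (v, w)}" by (intro card_mono) auto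
   also have "\<dots><=2" by (simp add: card_insert_if)
   finally show False using c by simp
  qed
  have "(v, w)~=(t, s)"
  proof
   assume "(v, w) = (t, s)"
   hence "?f ?d = ?f (w, t)" using f fs by simp
   hence "?d = (w, t)" using inj a t(2) unfolding inj_on_def by blast
   thus False using dwt by simp
  qed
  moreover have "(w, t)~=(t, s)" using ne' by auto
  moreover have "?d~=(v, w)" using ne' by auto
  ultimately have "card {?d, (v, w), (w, t), (t, s)} = 4" using ne fs ne' dwt by (auto simp: card_insert_if)
  moreover have "{?d, (v, w), (w, t), (t, s)} <= orb ?f ?d"
  proof -
   have 1: "(v, w) : orb ?f ?d" using f_in_orb[of ?f ?d] unfolding f .
   have 2: "(w, t) : orb ?f ?d" using orb_step[OF 1] unfolding f .
   have "(t, s) : orb ?f ?d" using orb_step[OF 2] unfolding fs .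
   thus ?thesis using 1 2 by simp
  qed
  moreover have "finite (orb ?f ?d)" using orb_subset[OF p a] rotationD(4)[OF r] finite_subset by blast
  ultimately have "4 <= card (orb ?f ?d)" by (metis card_mono)
  thus False using c by simp
 qed
 moreover obtain s where "rho (t, w) = (t, s)" using rot_arc[OF r arcs_sym[THEN iffD1, OF t(2)]] .
 ultimately have "t = u" by simp
 thus "(w, u):arcs E" "face rho (v, w) = (w, u)" using t f by auto
qed

definition bad :: "'v set set => ('v\<times>'v => 'v\<times>'v) => ('v\<times>'v) set" where
 "bad E rho = {d:arcs E. card (orb (face rho) d)~=3}"

text \<open>A face with \<open>l > 3\<close> arcs satisfies \<open>l \<le> 4 (l - 3)\<close>; this is summed over all faces.\<close>

lemma card_bad:
 assumes r: "rotation E rho" and d2: "deg2 E"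
 shows "int (card (bad E rho))<=4*(int (card (arcs E))-3 * int (ncyc (face rho) (arcs E)))"
proof -
 let ?O = "orb (face rho) ` arcs E"
 have p: "perm_on (face rho) (arcs E)" by (rule perm_on_face[OF r])
 have fin: "finite ?O" using rotationD(4)[OF r] by simp
 define B where "B = {Z:?O. card Z~=3}"
 have ge: "3 <= card Z" if "Z:?O" for Z using face_card[OF r d2] that by auto
 have "bad E rho<=\<Union>B" unfolding bad_def B_def by (auto intro: self_in_orb)
 moreover have "finite (\<Union>B)"
  by (rule finite_subset[OF _ rotationD(4)[OF r]]) (insert orb_subset[OF p], auto simp: B_def)
 ultimately have "card (bad E rho) <= card (\<Union>B)" by (intro card_mono)
 also have "\<dots><=(SUM Z:B. card Z)" by (rule card_Union_le_sum_card)
 finally have 1: "int (card (bad E rho))<=(SUM Z:B. int (card Z))" by (simp flip: of_nat_sum)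
 have 2: "(SUM Z:B. int (card Z))<=(SUM Z:B. 4*(int (card Z)-3))"
 proof (rule sum_mono)
  fix Z assume "Z:B"
  hence "3 <= card Z" "card Z~=3" using ge unfolding B_def by auto
  hence "4<=int (card Z)" by simp
  thus "int (card Z)<=4*(int (card Z)-3)" by (simp add: algebra_simps)
 qed
 have 3: "(SUM Z:B. 4*(int (card Z)-3))<=(SUM Z:?O. 4*(int (card Z)-3))"
 proof (rule sum_mono2[OF fin])
  show "B<=?O" unfolding B_def by blast
  show "0<=4*(int (card Z)-3)" if "Z:?O-B" for Z using ge[of Z] that by auto
 qed
 have "(SUM Z:?O. 4*(int (card Z)-3)) = 4*(int (SUM Z:?O. card Z)-3 * int (card ?O))"
  by (simp add: sum_distrib_left[symmetric] sum_subtractf)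
 thus ?thesis using 1 2 3 unfolding ncyc_def sum_orbits[OF p] by linarith
qed

lemma rot_changes:
 assumes r: "rotation E rho" and v: "(v, u):arcs E" "u:P" "(v, w):arcs E" "w~:P"
 obtains u1 w1 w2 u2 where "(v, u1):arcs E" "u1:P" "rho (v, u1) = (v, w1)" "(v, w1):arcs E" "w1~:P"
  "(v, w2):arcs E" "w2~:P" "rho (v, w2) = (v, u2)" "(v, u2):arcs E" "u2:P"
proof -
 obtain u1 w1 where 1: "(v, u1):arcs E" "u1:P" "rho (v, u1) = (v, w1)" "(v, w1):arcs E" "w1~:P"
  using rot_closed[OF r v] .
 obtain w2 u2 where "(v, w2):arcs E" "w2:- P" "rho (v, w2) = (v, u2)" "(v, u2):arcs E" "u2~:- P"
  using rot_closed[OF r v(3), of "- P" u] v by auto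
 thus ?thesis using that[OF 1] by simp
qed

text \<open>The rotation at \<open>v\<close> changes at least twice between the two classes of neighbours, and a triangular face at such a
change would contain an edge between the classes.\<close>

lemma two_bad:
 assumes r: "rotation E rho" and v: "(v, u):arcs E" "u:P" "(v, w):arcs E" "w~:P"
  and no: "!!a b. (v, a):arcs E ==> (v, b):arcs E ==> a:P ==> b~:P ==> (a, b)~:arcs E"
 shows "2 <= card {d:bad E rho. snd d = v}"
proof -
 obtain u1 w1 w2 u2 where 1: "(v, u1):arcs E" "u1:P" "rho (v, u1) = (v, w1)" "(v, w1):arcs E" "w1~:P"
  and 2: "(v, w2):arcs E" "w2~:P" "rho (v, w2) = (v, u2)" "(v, u2):arcs E" "u2:P" by (rule rot_changes[OF r v])
 have b: "(u1, v):bad E rho" "(w2, v):bad E rho"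
  using triangle_face(1)[OF r, of u1 v w1] triangle_face(1)[OF r, of w2 v u2] 1 2
   no[of u1 w1] no[of u2 w2] arcs_sym[of _ _ E] unfolding bad_def by auto
 have "finite (bad E rho)" using rotationD(4)[OF r] unfolding bad_def by simp
 hence "card {(u1, v), (w2, v)} <= card {d:bad E rho. snd d = v}" using b by (intro card_mono) auto
 moreover have "u1~=w2" using 1 2 by auto
 hence "card {(u1, v), (w2, v)} = 2" by simp
 ultimately show ?thesis by simp
qed

text \<open>If both changes of class happened in triangles, these would use the same two neighbours, and the
rotation would visit nothing else.\<close>

lemma one_bad:
 assumes r: "rotation E rho" and v: "(v, u):arcs E" "u:P" "(v, w):arcs E" "w~:P"
  and one: "!!a b. (v, a):arcs E ==> (v, b):arcs E ==> a:P ==> b~:P ==> (a, b):arcs E ==> a = a0 & b = b0"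
  and third: "(v, t):arcs E" "t~=a0" "t~=b0"
 shows "1 <= card {d:bad E rho. snd d = v}"
proof -
 obtain u1 w1 w2 u2 where 1: "(v, u1):arcs E" "u1:P" "rho (v, u1) = (v, w1)" "(v, w1):arcs E" "w1~:P"
  and 2: "(v, w2):arcs E" "w2~:P" "rho (v, w2) = (v, u2)" "(v, u2):arcs E" "u2:P" by (rule rot_changes[OF r v])
 have "(u1, v):bad E rho | (w2, v):bad E rho"
 proof (rule ccontr)
  assume "~?thesis"
  hence "card (orb (face rho) (u1, v)) = 3" "card (orb (face rho) (w2, v)) = 3"
   using 1 2 arcs_sym[of _ _ E] unfolding bad_def by auto
  hence "(w1, u1):arcs E" "(u2, w2):arcs E"
   using triangle_face(1)[OF r, of u1 v w1] triangle_face(1)[OF r, of w2 v u2] 1 2 arcs_sym[of _ _ E] by auto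
  hence e: "u1 = a0" "w1 = b0" "u2 = a0" "w2 = b0"
   using one[of u1 w1] one[of u2 w2] 1 2 arcs_sym[of _ _ E] by auto
  have "orb rho (v, a0)<={(v, a0), (v, b0)}"
   by (rule orb_subsetI) (use 1 2 e in auto)
  moreover have "(v, t) : orb rho (v, a0)" using rotationD(2)[OF r] 1(1) e third by auto
  ultimately show False using third by auto
 qed
 hence ex: "{d:bad E rho. snd d = v}~={}" by (metis (mono_tags, lifting) empty_Collect_eq snd_conv)
 have "finite (bad E rho)" using rotationD(4)[OF r] unfolding bad_def by simp
 hence "finite {d:bad E rho. snd d = v}" by simp
 thus ?thesis using ex by (metis One_nat_def Suc_leI card_gt_0_iff)
qed

subsection \<open>Line graphs of graphs given by lists\<close>

definition share :: "nat\<times>nat => nat\<times>nat => bool" where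
 "share e f \<longleftrightarrow> fst e = fst f | fst e = snd f | snd e = fst f | snd e = snd f"

definition sh :: "(nat\<times>nat) list => nat => nat => bool" where
 "sh es i j \<longleftrightarrow> i~=j & share (es ! i) (es ! j)"

definition ilg :: "(nat\<times>nat) list => nat ugraph" where
 "ilg es = ({..<length es}, {{i, j} | i j. i < length es & j < length es & sh es i j})"

abbreviation larcs :: "(nat\<times>nat) list => (nat\<times>nat) set" where
 "larcs es == arcs (snd (ilg es))"

lemma sh_sym: "sh es i j \<longleftrightarrow> sh es j i"
 unfolding sh_def share_def by auto

lemma arcs_ilg: "(i, j):larcs es \<longleftrightarrow> i < length es & j < length es & sh es i j"
 unfolding arcs_def ilg_def using sh_sym by (auto simp: doubleton_eq_iff)

definition nbrs :: "(nat\<times>nat) list => nat => nat list" where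
 "nbrs es i = filter (sh es i) [0..<length es]"

lemma set_nbrs: "i < length es ==> set (nbrs es i) = {j. (i, j):larcs es}"
 unfolding nbrs_def arcs_ilg by auto

definition arcnum :: "(nat\<times>nat) list => nat" where
 "arcnum es = sum_list (map (%i. length (nbrs es i)) [0..<length es])"

lemma card_arcs_ilg: "card (larcs es) = arcnum es"
proof -
 have e: "larcs es = (SIGMA i:{..<length es}. set (nbrs es i))"
  by (auto simp: arcs_ilg nbrs_def)
 have "card (larcs es) = (\<Sum>i<length es. card (set (nbrs es i)))"
  unfolding e by (rule card_SigmaI) auto
 also have "\<dots> = (\<Sum>i<length es. length (nbrs es i))"
  by (intro sum.cong refl distinct_card) (simp add: nbrs_def)
 also have "\<dots> = arcnum es" unfolding arcnum_def by (simp add: interv_sum_list_conv_sum_set_nat atLeast0LessThan)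
 finally show ?thesis .
qed

text \<open>A lower bound for the number of bad arcs that enter the vertex \<open>i\<close>: its neighbours are divided into the edges
that share the first end of \<open>es ! i\<close> and the others, and \<open>cs\<close> lists the adjacent pairs across.\<close>

definition badnum :: "(nat\<times>nat) list => nat => nat" where
 "badnum es i = (let x = fst (es ! i); ns = nbrs es i;
 P = filter (%j. fst (es ! j) = x | snd (es ! j) = x) ns; Q = filter (%j. ~(fst (es ! j) = x | snd (es ! j) = x)) ns;
 cs = filter (%(a, b). sh es a b) (List.product P Q)
 in if P = [] | Q = [] then 0 else if cs = [] then 2 else if length cs = 1 & 2 < length ns then 1 else 0)"

definition low_ok :: "(nat\<times>nat) list => bool" where
 "low_ok es \<longleftrightarrow> es~=[] & list_all (%i. 2<=length (nbrs es i)) [0..<length es]"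

definition badsum :: "(nat\<times>nat) list => nat" where
 "badsum es = sum_list (map (badnum es) [0..<length es])"

lemma deg2_ilg:
 assumes "low_ok es"
 shows "deg2 (snd (ilg es))"
 unfolding deg2_def
proof (intro allI impI)
 fix u v assume a: "(u, v):larcs es"
 hence u: "u < length es" unfolding arcs_ilg by simp
 have "2<=length (nbrs es u)" using assms u unfolding low_ok_def list_all_iff by auto
 moreover have "distinct (nbrs es u)" unfolding nbrs_def by simp
 ultimately have "2 <= card (set (nbrs es u))" by (simp add: distinct_card)
 hence "~set (nbrs es u)<={v}" by (metis card.empty card_mono card.insert finite.emptyI finite.insertI insert_absorb not_less_eq_eq numeral_2_eq_2 empty_iff)
 thus "EX w. (u, w):larcs es & w~=v" unfolding set_nbrs[OF u] by auto
qed

lemma badnum_le: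
 assumes r: "rotation (snd (ilg es)) rho" and i: "i < length es"
 shows "badnum es i <= card {d:bad (snd (ilg es)) rho. snd d = i}"
proof -
 define P where "P = {j. fst (es ! j) = fst (es ! i) | snd (es ! j) = fst (es ! i)}"
 define ns where "ns = nbrs es i"
 define Ps Qs where "Ps = filter (%j. fst (es ! j) = fst (es ! i) | snd (es ! j) = fst (es ! i)) ns"
  and "Qs = filter (%j. ~(fst (es ! j) = fst (es ! i) | snd (es ! j) = fst (es ! i))) ns"
 define cs where "cs = filter (%(a, b). sh es a b) (List.product Ps Qs)"
 have b: "badnum es i = (if Ps = [] | Qs = [] then 0 else if cs = [] then 2 else if length cs = 1 & 2 < length ns then 1 else 0)"
  unfolding badnum_def Let_def Ps_def Qs_def cs_def ns_def ..
 let ?A = "larcs es"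
 have Ps: "j:set Ps \<longleftrightarrow> (i, j):?A & j:P" and Qs: "j:set Qs \<longleftrightarrow> (i, j):?A & j~:P" for j
  unfolding Ps_def Qs_def ns_def P_def using set_nbrs[OF i] by auto
 have cs: "(x, y):set cs \<longleftrightarrow> x:set Ps & y:set Qs & (x, y):?A" for x y
  unfolding cs_def using Ps Qs by (auto simp: arcs_ilg)
 show ?thesis
 proof (cases "Ps = [] | Qs = []")
  case False
  then obtain u w where "u:set Ps" "w:set Qs" by (meson list.set_sel(1))
  hence uw: "(i, u):?A" "u:P" "(i, w):?A" "w~:P" using Ps Qs by auto
  show ?thesis
  proof (cases "cs = []")
   case True
   have "2 <= card {d:bad (snd (ilg es)) rho. snd d = i}"
    by (rule two_bad[OF r uw]) (use cs Ps Qs True in auto)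
   thus ?thesis unfolding b by simp
  next
   case F: False
   show ?thesis
   proof (cases "length cs = 1 & 2 < length ns")
    case True
    then obtain x y where xy: "cs = [(x, y)]" by (metis One_nat_def length_0_conv length_Suc_conv surj_pair)
    have "~set ns<={x, y}"
    proof
     assume "set ns<={x, y}"
     hence "card (set ns) <= card {x, y}" by (intro card_mono) auto
     also have "\<dots><=2" by (simp add: card_insert_if)
     finally have "card (set ns)<=2" .
     moreover have "card (set ns) = length ns" unfolding ns_def nbrs_def by (rule distinct_card) simp
     ultimately show False using True by simp
    qed
    then obtain t where t: "t:set ns" "t~=x" "t~=y" by auto
    hence ta: "(i, t):?A" using set_nbrs[OF i] unfolding ns_def by auto
    have "1 <= card {d:bad (snd (ilg es)) rho. snd d = i}"
    proof (rule one_bad[OF r uw _ ta t(2,3)])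
     fix a c assume "(i, a):?A" "(i, c):?A" "a:P" "c~:P" "(a, c):?A"
     hence "(a, c):set cs" using cs Ps Qs by simp
     thus "a = x & c = y" using xy by simp
    qed
    thus ?thesis using F True by (auto simp: b)
   qed (insert F, auto simp: b)
  qed
 qed (simp add: b)
qed

lemma rotation_ilg:
 assumes ok: "low_ok es" and d: "drawable_on (ilg es) (handle_surface k)"
 obtains rho where "rotation (snd (ilg es)) rho"
  "arcnum es div 2+2<=length es+ncyc (face rho) (larcs es)+2 * k"
proof -
 have ilg: "ilg es = ({..<length es}, snd (ilg es))" unfolding ilg_def by simp
 have "EX rho. perm_on rho (larcs es) & (ALL u v. (u, v):larcs es --> orb rho (u, v) = {q:larcs es. fst q = u}) &
 card (larcs es) div 2+2 <= card {..<length es}+ncyc (rho\<circ>prod.swap) (larcs es)+2 * k"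
 proof (rule rotation_of_drawing)
  show "finite (snd (ilg es))"
   by (rule finite_subset[of _ "Pow {..<length es}"]) (auto simp: ilg_def)
  show "{..<length es}~={}" using ok unfolding low_ok_def by (auto simp: lessThan_empty_iff)
  show "EX e:snd (ilg es). v:e" if "v:{..<length es}" for v
  proof -
   have "2<=length (nbrs es v)" using ok that unfolding low_ok_def list_all_iff by auto
   then obtain w where "w:set (nbrs es v)" by (cases "nbrs es v") auto
   hence "{v, w}:snd (ilg es)" using set_nbrs[of v es] that unfolding arcs_def by auto
   thus ?thesis by auto
  qed
  show "EX u v. u~=v & e = {u, v} & u:{..<length es} & v:{..<length es}" if "e:snd (ilg es)" for e
   using that unfolding ilg_def sh_def by auto
  show "drawable_on ({..<length es}, snd (ilg es)) (handle_surface k)" using d ilg by simp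
 qed simp
 then obtain rho where rho: "perm_on rho (larcs es)" "ALL u v. (u, v):larcs es --> orb rho (u, v) = {q:larcs es. fst q = u}"
  "card (larcs es) div 2+2 <= card {..<length es}+ncyc (rho\<circ>prod.swap) (larcs es)+2 * k" by blast
 have "{u}~:snd (ilg es)" for u unfolding ilg_def sh_def by (auto simp: doubleton_eq_iff)
 thus ?thesis using that[of rho] rho unfolding rotation_def card_arcs_ilg by auto
qed

lemma card_bad_ilg:
 assumes r: "rotation (snd (ilg es)) rho" and ok: "low_ok es"
  and n: "arcnum es div 2+2<=length es+ncyc (face rho) (larcs es)+2 * k"
 shows "int (card (bad (snd (ilg es)) rho))<=4*(int (arcnum es)-3*(int (arcnum es) div 2+2-int (length es)-2 * int k))"
proof -
 have "int (arcnum es div 2+2)<=int (length es+ncyc (face rho) (larcs es)+2 * k)" using n by (rule of_nat_mono)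
 thus ?thesis using card_bad[OF r deg2_ilg[OF ok]] unfolding card_arcs_ilg by (simp add: zdiv_int)
qed

lemma bad_fibres:
 assumes "rotation (snd (ilg es)) rho"
 shows "card (bad (snd (ilg es)) rho) = (\<Sum>i<length es. card {d:bad (snd (ilg es)) rho. snd d = i})"
proof -
 have "finite (bad (snd (ilg es)) rho)" using rotationD(4)[OF assms] unfolding bad_def by simp
 moreover have "snd ` bad (snd (ilg es)) rho<={..<length es}" unfolding bad_def by (auto simp: arcs_ilg)
 ultimately show ?thesis using sum_card_image[of "{..<length es}"] sum.group[of "bad (snd (ilg es)) rho" "{..<length es}" snd "%_. 1::nat"] by simp
qed

text \<open>Euler's inequality bounds the number of bad arcs from above, the structure of the line graph from below.\<close>

theorem not_drawable_count:
 assumes ok: "low_ok es"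
  and big: "4*(int (arcnum es)-3*(int (arcnum es) div 2+2-int (length es)-2 * int k)) < int (badsum es)" and k': "k'<=k"
 shows "~drawable_on (ilg es) (handle_surface k')"
proof
 assume "drawable_on (ilg es) (handle_surface k')"
 then obtain rho where r: "rotation (snd (ilg es)) rho" and
  n: "arcnum es div 2+2<=length es+ncyc (face rho) (larcs es)+2 * k'"
  using rotation_ilg[OF ok] by blast
 have "badsum es = (\<Sum>i<length es. badnum es i)" unfolding badsum_def by (simp add: interv_sum_list_conv_sum_set_nat atLeast0LessThan)
 also have "\<dots><=(\<Sum>i<length es. card {d:bad (snd (ilg es)) rho. snd d = i})"
  by (rule sum_mono) (use badnum_le[OF r] in auto)
 also have "\<dots> = card (bad (snd (ilg es)) rho)" by (rule bad_fibres[OF r, symmetric])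
 finally have "int (badsum es)<=int (card (bad (snd (ilg es)) rho))" by simp
 define h where "h = int (arcnum es) div 2"
 have "int k'<=int k" using k' by simp
 hence "4*(int (arcnum es)-3*(h+2-int (length es)-2 * int k'))<=4*(int (arcnum es)-3*(h+2-int (length es)-2 * int k))"
  by (intro mult_left_mono diff_left_mono) auto
 thus False using `int (badsum es) <= _` card_bad_ilg[OF r ok n, folded h_def] big[folded h_def] by simp
qed

definition bip :: "nat => nat => (nat\<times>nat) list" where
 "bip m n = List.product [0..<m] [m..<m+n]"

text \<open>The complete tripartite graph with parts \<open>{0}\<close>, \<open>{1, 2}\<close>, \<open>{3, 4, 5, 6}\<close>.\<close>

definition g124 :: "(nat\<times>nat) list" where
 "g124 = [(0, 1), (0, 2), (0, 3), (0, 4), (0, 5), (0, 6), (1, 3), (1, 4), (1, 5), (1, 6), (2, 3), (2, 4), (2, 5), (2, 6)]"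

text \<open>A subgraph of the graph of a product of rings of orders 2, 2, 4. Elements are named after their nonzero
components: \<open>a = 0, b = 1, c = 2, 3, 4, ab = 5, ac = 6, 7, 8, bc = 9, 10, 11\<close>.\<close>

definition g224 :: "(nat\<times>nat) list" where
 "g224 = [(0, 1), (0, 2), (0, 3), (0, 4), (1, 2), (1, 3), (1, 4), (5, 2), (5, 3), (5, 4), (1, 6), (1, 7), (1, 8), (0, 9), (0, 10), (0, 11)]"

text \<open>Likewise for orders 2, 3, 3:
\<open>a = 0, b = 1, 2, c = 3, 4, ab = 5, 6, ac = 7, 8, bc = 9, 10, 11, 12\<close>.\<close>

definition g233 :: "(nat\<times>nat) list" where
 "g233 = [(0, 1), (0, 2), (0, 3), (0, 4), (1, 3), (1, 4), (2, 3), (2, 4), (5, 3), (5, 4), (6, 3), (6, 4), (7, 1), (7, 2), (8, 1), (8, 2), (0, 9), (0, 10), (0, 11), (0, 12)]"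

text \<open>The inequality of \<open>not_drawable_count\<close> without subtraction, to be checked by evaluation.\<close>

definition count_ok :: "(nat\<times>nat) list => nat => bool" where
 "count_ok es k \<longleftrightarrow> low_ok es & 4 * arcnum es+12 * length es+24 * k < badsum es+12*(arcnum es div 2)+24"

lemma not_drawable_ok:
 assumes "count_ok es k" "k'<=k"
 shows "~drawable_on (ilg es) (handle_surface k')"
proof (rule not_drawable_count[OF _ _ assms(2)])
 show "low_ok es" using assms(1) unfolding count_ok_def by simp
 define h where "h = arcnum es div 2"
 have "int (arcnum es) div 2 = int h" unfolding h_def by simp
 moreover have "int (4 * arcnum es+12 * length es+24 * k) < int (badsum es+12 * h+24)"
  using assms(1) unfolding count_ok_def h_def of_nat_less_iff by simp
 ultimately show "4*(int (arcnum es)-3*(int (arcnum es) div 2+2-int (length es)-2 * int k)) < int (badsum es)"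
  by (simp add: algebra_simps)
qed

lemma count_oks: "count_ok (bip 1 9) 2" "count_ok (bip 2 7) 2" "count_ok (bip 3 6) 2" "count_ok (bip 4 4) 2"
 "count_ok g124 2" "count_ok g224 2" "count_ok g233 2" "count_ok (bip 1 8) 1" "count_ok (bip 2 6) 1"
 by code_simp+

subsection \<open>Two borderline cases\<close>

text \<open>On the torus the two bounds on bad arcs coincide, so every vertex has as many bad arcs as required and no
more. The four edges at a vertex of degree 4 form a clique of the line graph. At each vertex of the
clique two of the five angles lead out of the clique; they account for both bad arcs, so the two
angles inside the clique belong to triangles. These are eight angles, which are permuted by the face
permutation in cycles of length 3, but 3 does not divide 8.\<close>

lemma not_drawable_K34:
 assumes k: "k<=1"
 shows "~drawable_on (ilg (bip 3 4)) (handle_surface k)"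
proof
 assume d: "drawable_on (ilg (bip 3 4)) (handle_surface k)"
 define es where "es = bip 3 4"
 let ?E = "snd (ilg es)" and ?A = "larcs es"
 have facts: "low_ok es" "arcnum es = 60" "length es = 12" "badnum es 0 = 2" "badnum es 1 = 2" "badnum es 2 = 2" "badnum es 3 = 2"
  "badsum es = 24" "nbrs es 0 = [1, 2, 3, 4, 8]" "nbrs es 1 = [0, 2, 3, 5, 9]" "nbrs es 2 = [0, 1, 3, 6, 10]" "nbrs es 3 = [0, 1, 2, 7, 11]"
  unfolding es_def by code_simp+
 obtain rho where r: "rotation ?E rho" and n: "arcnum es div 2+2<=length es+ncyc (face rho) ?A+2 * k"
  using rotation_ilg[OF facts(1)] d unfolding es_def by blast
 define b where "b i = card {d:bad ?E rho. snd d = i}" for i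
 have le24: "card (bad ?E rho)<=24" using card_bad_ilg[OF r facts(1) n] k unfolding facts by simp
 have sum_b: "(\<Sum>i<length es. b i)<=24" using le24 unfolding bad_fibres[OF r] b_def .
 have bb: "badnum es i<=b i" if "i < length es" for i unfolding b_def by (rule badnum_le[OF r that])
 have b2: "b i<=badnum es i" if "i < length es" for i
 proof (rule ccontr)
  assume "~?thesis"
  hence "(\<Sum>i<length es. badnum es i) < (\<Sum>i<length es. b i)"
   using bb that by (intro sum_strict_mono_ex1) (auto intro!: bexI[of _ i])
  moreover have "(\<Sum>i<length es. badnum es i) = 24"
   using facts(8) unfolding badsum_def by (simp add: interv_sum_list_conv_sum_set_nat atLeast0LessThan)
  ultimately show False using sum_b by simp
 qed
 define Q where "Q = {..<4 :: nat}"
 have Ai: "(i, j):?A \<longleftrightarrow> j:set (nbrs es i)" if "i < 12" for i j using set_nbrs[of i es] that facts(3) by auto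
 have Q_cases: "v = 0 | v = 1 | v = 2 | v = 3" if "v:Q" for v using that unfolding Q_def by auto
 have b4: "b i = 2" if "i:Q" for i
  using bb[of i] b2[of i] that facts(3-7) Q_cases[OF that] by auto
 have N: "(v, j):?A \<longleftrightarrow> j:Q & j~=v | j = v+4 | j = v+8" if "v:Q" for v j
  using Ai[of v j] Q_cases[OF that] facts(9-12) unfolding Q_def by auto
 have ls: "(u, v):?A ==> (v, u):?A" for u v using arcs_sym by metis
 have Q4: "v+4~:Q" "v+8~:Q" for v unfolding Q_def by auto
 have nb: "EX u w. (v, u):?A & u:Q & (v, w):?A & w~:Q" if v: "v:Q" for v
 proof -
  have "(if v = 0 then 1 else 0):Q" "(if v = 0 then 1 else 0)~=v" unfolding Q_def by auto
  thus ?thesis using N[OF v] Q4[of v] by blast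
 qed
 define Z where "Z = {d:?A. fst d:Q & snd d:Q & snd (face rho d):Q}"
 have finA: "finite ?A" by (rule rotationD(4)[OF r])
 have finbad: "finite (bad ?E rho)" using finA unfolding bad_def by simp
 \<comment> \<open>A triangle does not cross the border of the clique, because a vertex outside has only one neighbour in it.\<close>
 have leave: "(u, v):bad ?E rho" if "v:Q" "(u, v):?A" "rho (v, u) = (v, w)" "u:Q \<longleftrightarrow> w~:Q" for u v w
 proof (rule ccontr)
  assume "(u, v)~:bad ?E rho"
  hence "card (orb (face rho) (u, v)) = 3" using that(2) unfolding bad_def by simp
  note t = triangle_face[OF r that(2) this that(3)]
  have vu: "(v, u):?A" "(v, w):?A" "(u, w):?A" "u~=v" "w~=v" using ls that(2) t(1,3) rotationD(3)[OF r] by metis+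
  show False
  proof (cases "u:Q")
   case True
   thus ?thesis using N[OF that(1), of w] N[OF True, of w] that(1,4) vu unfolding Q_def by auto
  next
   case False
   hence "w:Q" using that(4) by simp
   thus ?thesis using N[OF that(1), of u] N[OF `w : Q`, of u] that(1) False vu ls[of u w] unfolding Q_def by auto
  qed
 qed
 have ch: "EX u1 w1 w2. (v, u1):?A & u1:Q & rho (v, u1) = (v, w1) & w1~:Q & w2~:Q &
 {(u1, v), (w2, v)} = {d:bad ?E rho. snd d = v}" if v: "v:Q" for v
 proof -
  obtain u w where uw: "(v, u):?A" "u:Q" "(v, w):?A" "w~:Q" using nb[OF v] by blast
  obtain u1 w1 w2 u2 where 1: "(v, u1):?A" "u1:Q" "rho (v, u1) = (v, w1)" "(v, w1):?A" "w1~:Q"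
   and 2: "(v, w2):?A" "w2~:Q" "rho (v, w2) = (v, u2)" "(v, u2):?A" "u2:Q" by (rule rot_changes[OF r uw])
  have inbad: "(u1, v):bad ?E rho" "(w2, v):bad ?E rho"
   using leave[OF v ls[OF 1(1)] 1(3)] leave[OF v ls[OF 2(1)] 2(3)] 1 2 by auto
  have "u1~=w2" using 1 2 by auto
  hence c2: "card {(u1, v), (w2, v)} = 2" by simp
  have "{(u1, v), (w2, v)} = {d:bad ?E rho. snd d = v}"
   by (rule card_subset_eq) (insert finbad inbad c2 b4[OF v], auto simp: b_def)
  thus ?thesis using 1 2 by blast
 qed
 have two: "card {d:Z. snd d = v} = 2" if v: "v:Q" for v
 proof -
  obtain u1 w1 w2 where 1: "(v, u1):?A" "u1:Q" "rho (v, u1) = (v, w1)" "w1~:Q" "w2~:Q"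
   and eq: "{(u1, v), (w2, v)} = {d:bad ?E rho. snd d = v}" using ch[OF v] by blast
  have "{d:Z. snd d = v} = {(u, v) | u. u:Q & u~=v & u~=u1}"
  proof (intro equalityI subsetI)
   fix d assume d: "d:{d:Z. snd d = v}"
   then obtain u where u: "d = (u, v)" "(u, v):?A" "u:Q" "snd (rho (v, u)):Q" unfolding Z_def by (cases d) auto
   hence "u~=u1" "u~=v" using 1(3,4) rotationD(3)[OF r u(2)] by auto
   thus "d:{(u, v) | u. u:Q & u~=v & u~=u1}" using u by simp
  next
   fix d assume "d:{(u, v) | u. u:Q & u~=v & u~=u1}"
   then obtain u where u: "d = (u, v)" "u:Q" "u~=v" "u~=u1" by auto
   have vu: "(v, u):?A" using u N[OF v] by simp
   obtain w where w: "rho (v, u) = (v, w)" using rot_arc[OF r vu] by blast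
   have "w:Q"
   proof (rule ccontr)
    assume "w~:Q"
    hence "(u, v):bad ?E rho" using leave[OF v ls[OF vu] w] u by simp
    hence "(u, v):{(u1, v), (w2, v)}" using eq by simp
    thus False using u 1(5) by simp
   qed
   thus "d:{d:Z. snd d = v}" unfolding Z_def using u v ls[OF vu] w by simp
  qed
  also have "\<dots> = (%u. (u, v)) ` (Q-{v, u1})" by auto
  finally have "card {d:Z. snd d = v} = card (Q-{v, u1})" by (simp add: card_image inj_on_def)
  also have "\<dots> = card Q - card {v, u1}" using v 1(2) by (intro card_Diff_subset) auto
  also have "card {v, u1} = 2" using rotationD(3)[OF r 1(1)] by simp
  also have "card Q = 4" unfolding Q_def by simp
  finally show ?thesis by simp
 qed
 have finZ: "finite Z" using finA unfolding Z_def by simp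
 have "card Z = (SUM v:Q. card {d:Z. snd d = v})"
 proof -
  have "snd ` Z<=Q" unfolding Z_def by auto
  thus ?thesis using sum.group[of Z Q snd "%_. 1::nat"] finZ by (simp add: Q_def)
 qed
 also have "\<dots> = (SUM v:Q. 2)" by (intro sum.cong refl two)
 finally have c8: "card Z = 8" unfolding Q_def by simp
 have good: "card (orb (face rho) d) = 3 & face rho d:Z" if dZ: "d:Z" for d
 proof -
  obtain u v where uv: "d = (u, v)" by (cases d)
  have a: "(u, v):?A" "u:Q" "v:Q" using dZ unfolding Z_def uv by auto
  obtain w where w: "rho (v, u) = (v, w)" using rot_arc[OF r arcs_sym[THEN iffD1, OF a(1)]] by blast
  have wQ: "w:Q" using dZ w unfolding Z_def uv by simp
  have "(u, v)~:bad ?E rho"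
  proof
   assume ub: "(u, v):bad ?E rho"
   obtain u1 w1 w2 where 1: "(v, u1):?A" "u1:Q" "rho (v, u1) = (v, w1)" "w1~:Q" "w2~:Q"
    and "{(u1, v), (w2, v)} = {d:bad ?E rho. snd d = v}" using ch[OF a(3)] by blast
   hence "(u, v):{(u1, v), (w2, v)}" using ub by simp
   thus False using 1 a(2) w wQ by auto
  qed
  hence c3: "card (orb (face rho) (u, v)) = 3" using a unfolding bad_def by simp
  note t = triangle_face[OF r a(1) c3 w]
  have "face rho (v, w) = (w, u)" by (rule t(2))
  hence "(v, w):Z" unfolding Z_def using t(3) a wQ by simp
  thus ?thesis using c3 w uv by simp
 qed
 have pZ: "perm_on (face rho) Z"
 proof (rule perm_onI[OF finZ])
  show "inj_on (face rho) Z"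
   by (rule inj_on_subset[OF perm_onD(3)[OF perm_on_face[OF r]]]) (auto simp: Z_def)
 qed (use good in blast)
 have "card Z = (SUM W:orb (face rho) ` Z. card W)" by (rule sum_orbits[OF pZ, symmetric])
 also have "\<dots> = (SUM W:orb (face rho) ` Z. 3)" using good by (intro sum.cong) auto
 finally have "card Z = 3 * card (orb (face rho) ` Z)" by simp
 thus False using c8 by presburger
qed

lemma ncyc_flip_parity:
 assumes p: "perm_on f D"
 shows "pairing tau Z ==> Z<=D ==> even (ncyc (f\<circ>flip_on tau Z) D+ncyc f D + card Z div 2)"
proof (induction "card Z" arbitrary: Z rule: less_induct)
 case less
 show ?case
 proof (cases "Z = {}")
  case True
  have "f\<circ>flip_on tau {} = f" by (auto simp: flip_on_def)
  thus ?thesis using True by simp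
 next
  case False
  then obtain d where d: "d:Z" by auto
  define W where "W = Z-{d, tau d}"
  have W: "pairing tau W" "card Z = card W+2" unfolding W_def using pairing_remove[OF less.prems(1) d] by auto
  have WD: "W<=D" using less.prems unfolding W_def by auto
  have IH: "even (ncyc (f\<circ>flip_on tau W) D+ncyc f D + card W div 2)" using less.hyps[of W] W WD by simp
  have td: "tau d:Z" "tau (tau d) = d" "tau d~=d" using pairingD[OF less.prems(1)] d by auto
  have Zi: "Z = insert d (insert (tau d) W)" unfolding W_def using d td by auto
  have h: "f\<circ>flip_on tau Z = f\<circ>flip_on tau W\<circ>swp d (tau d)"
   unfolding Zi by (rule flip_on_insert[OF W(1) _ _ td(2,3)]) (auto simp: W_def)
  have "even (ncyc (f\<circ>flip_on tau Z) D) \<longleftrightarrow> odd (ncyc (f\<circ>flip_on tau W) D)"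
   unfolding h by (rule ncyc_swap_parity[OF perm_on_flip[OF p W(1) WD]]) (use d td less.prems in auto)
  thus ?thesis using IH W(2) by auto
 qed
qed

text \<open>Reversing the ten edges one after another changes the number of cycles from 5 vertices to the number of faces
by a transposition each, so the number of faces is odd; 20 arcs allow at most six faces.\<close>

lemma K5_faces:
 assumes r: "rotation E rho" and U: "card U = 5" and E: "!!u v. (u, v):arcs E \<longleftrightarrow> u:U & v:U & u~=v"
 shows "ncyc (face rho) (arcs E)<=5"
proof -
 have finU: "finite U" using U by (simp add: card_ge_0_finite)
 have cA: "card (arcs E) = 20"
 proof -
  have "arcs E = (SIGMA u:U. U-{u})" using E by auto
  hence "card (arcs E) = (SUM u:U. card (U-{u}))" using finU by (simp add: card_SigmaI)
  also have "\<dots> = (SUM u:U. 4)" using U finU by (intro sum.cong) auto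
  finally show ?thesis using U by simp
 qed
 have d2: "deg2 E"
  unfolding deg2_def
 proof (intro allI impI)
  fix u v assume "(u, v):arcs E"
  hence "u:U" using E by simp
  have "card {u, v}<=2" by (simp add: card_insert_if)
  hence "~U<={u, v}" using U card_mono[of "{u, v}" U] by auto
  then obtain w where "w:U" "w~=u" "w~=v" by auto
  thus "EX w. (u, w):arcs E & w~=v" using E `u : U` by auto
 qed
 have "3 * ncyc (face rho) (arcs E) <= card (arcs E)"
 proof -
  have "(SUM Z:orb (face rho) ` arcs E. 3)<=(SUM Z:orb (face rho) ` arcs E. card Z)"
   by (rule sum_mono) (use face_card[OF r d2] in auto)
  thus ?thesis unfolding sum_orbits[OF perm_on_face[OF r]] ncyc_def by simp
 qed
 hence le6: "ncyc (face rho) (arcs E)<=6" using cA by simp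
 have pw: "pairing prod.swap (arcs E)"
  unfolding pairing_def using rotationD(3,4)[OF r] by (auto simp: arcs_sym)
 have "ncyc rho (arcs E) = card U"
 proof -
  have ex: "EX v. (u, v):arcs E" if "u:U" for u
  proof -
   have "~U<={u}" using U card_mono[of "{u}" U] by auto
   thus ?thesis using E that by auto
  qed
  have eq: "(%u. {q:arcs E. fst q = u}) ` U = orb rho ` arcs E"
  proof (intro equalityI subsetI)
   fix Z assume "Z:(%u. {q:arcs E. fst q = u}) ` U"
   then obtain u where u: "u:U" "Z = {q:arcs E. fst q = u}" by auto
   obtain v where "(u, v):arcs E" using ex[OF u(1)] by auto
   thus "Z : orb rho ` arcs E" using rotationD(2)[OF r, of u v] u(2) by (intro image_eqI[of _ _ "(u, v)"]) auto
  next
   fix Z assume "Z : orb rho ` arcs E"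
   then obtain u v where "(u, v):arcs E" "Z = orb rho (u, v)" by auto
   thus "Z:(%u. {q:arcs E. fst q = u}) ` U"
    using rotationD(2)[OF r, of u v] E[of u v] by (intro image_eqI[of _ _ u]) auto
  qed
  have inj: "inj_on (%u. {q:arcs E. fst q = u}) U"
  proof (rule inj_onI)
   fix u u' assume u: "u:U" and eq: "{q:arcs E. fst q = u} = {q:arcs E. fst q = u'}"
   obtain v where "(u, v):arcs E" using ex[OF u] by auto
   hence "(u, v):{q:arcs E. fst q = u'}" unfolding eq[symmetric] by simp
   thus "u = u'" by simp
  qed
  show ?thesis using card_image[OF inj] unfolding ncyc_def eq .
 qed
 moreover have "ncyc (rho\<circ>flip_on prod.swap (arcs E)) (arcs E) = ncyc (face rho) (arcs E)"
  by (rule ncyc_cong[OF perm_on_flip[OF rotationD(1)[OF r] pw order_refl]]) (simp add: flip_on_def)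
 ultimately have "even (ncyc (face rho) (arcs E)+5+10)"
  using ncyc_flip_parity[OF rotationD(1)[OF r] pw order_refl] cA U by simp
 hence "ncyc (face rho) (arcs E)~=6" by auto
 thus ?thesis using le6 by simp
qed

text \<open>First return keeps the cyclic order of the remaining arcs.\<close>

lemma rotation_restrict:
 assumes r: "rotation E rho" and F: "F<=E"
 shows "rotation F (ret rho (arcs F))"
  "!!d. d:arcs F ==> rho d:arcs F ==> ret rho (arcs F) d = rho d"
proof -
 have sub: "arcs F<=arcs E" using F unfolding arcs_def by auto
 have p: "perm_on rho (arcs E)" by (rule rotationD(1)[OF r])
 have "orb (ret rho (arcs F)) (u, v) = {q:arcs F. fst q = u}" if uv: "(u, v):arcs F" for u v
 proof -
  have "(u, v):arcs E" using uv sub by blast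
  thus ?thesis unfolding orb_ret[OF p sub uv] rotationD(2)[OF r `(u, v) : arcs E`] using sub by blast
 qed
 thus "rotation F (ret rho (arcs F))"
  using r perm_on_ret[OF p sub] F unfolding rotation_def by auto
 show "ret rho (arcs F) d = rho d" if "d:arcs F" "rho d:arcs F" for d
  using ret_eqI[of 1 rho d "arcs F"] that by simp
qed

text \<open>Two adjacent vertices of degree 5 without common neighbours; the line graph consists of two cliques on
five vertices that share the vertex 0.\<close>

definition dstar :: "(nat\<times>nat) list" where
 "dstar = [(0, 1), (0, 2), (0, 3), (0, 4), (0, 5), (1, 6), (1, 7), (1, 8), (1, 9)]"

lemma arcs_dstar: "(i, j):arcs (snd (ilg dstar)) \<longleftrightarrow> i~=j & (i:{0..4} & j:{0..4} | i:insert 0 {5..8} & j:insert 0 {5..8})"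
proof -
 have "list_all (%i. list_all (%j. sh dstar i j \<longleftrightarrow> i~=j & (i<=4 & j<=4 | (i = 0 | 5<=i) & (j = 0 | 5<=j))) [0..<9]) [0..<9]"
  by code_simp
 moreover have "length dstar = 9" by code_simp
 ultimately show ?thesis unfolding arcs_ilg list_all_iff by (cases "i < 9 & j < 9") auto
qed

text \<open>A face inside the clique is also a face of the rotation system restricted to the clique. At a place where an edge
outside the clique interrupts the rotation of \<open>v\<close>, one of the at most five faces of the clique is lost.\<close>

lemma pure_faces:
 assumes r: "rotation E rho" and U: "card U = 5" and F: "F<=E" "!!u v. (u, v):arcs F \<longleftrightarrow> u:U & v:U & u~=v"
  and x: "(v, x):arcs F" and y: "(v, y):arcs E" "(v, y)~:arcs F"
 shows "card {Z : orb (face rho) ` arcs E. Z<=arcs F}<=4"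
proof -
 define s where "s = ret rho (arcs F)"
 note rs = rotation_restrict[OF r F(1), folded s_def]
 have sub: "arcs F<=arcs E" using F(1) unfolding arcs_def by auto
 have v: "v:U" using x F(2) by simp
 obtain u w where uw: "(v, u):arcs E" "u:U-{v}" "rho (v, u) = (v, w)" "(v, w):arcs E" "w~:U-{v}"
 proof (rule rot_closed[OF r, of v x "U-{v}" y])
  show "(v, x):arcs E" "x:U-{v}" using x sub F(2)[of v x] by auto
  show "y~:U-{v}" using y(2) F(2)[of v y] v by auto
 qed (use y in auto)
 have d: "(u, v):arcs F" "face rho (u, v)~:arcs F" using uw v F(2) rotationD(3)[OF r] by auto
 let ?P = "{Z : orb (face rho) ` arcs E. Z<=arcs F}"
 have eqo: "Z = orb (face s) e" if Z: "Z:?P" "e:Z" for Z e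
 proof -
  obtain e0 where e0: "e0:arcs E" "Z = orb (face rho) e0" using Z by auto
  have Ze: "Z = orb (face rho) e" using orb_eqI[OF perm_on_face[OF r] e0(1), of e] Z(2) unfolding e0(2) by simp
  have st: "face s a = face rho a" if "a:Z" for a
  proof -
   have "a:arcs F" "face rho a:arcs F" using Z that orb_step[of a "face rho" e0] e0 by auto
   thus ?thesis using rs(2)[of "prod.swap a"] arcs_sym[of "fst a" "snd a" F] by (simp add: prod.swap_def)
  qed
  have "((face s) ^^ n) e = ((face rho) ^^ n) e & ((face rho) ^^ n) e:Z" for n
   by (induction n) (insert st Ze orb_step[of _ "face rho" e], auto simp: Z(2))
  thus ?thesis unfolding Ze unfolding orb_def by simp
 qed
 have "?P <= orb (face s) ` arcs F-{orb (face s) (u, v)}"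
 proof
  fix Z assume Z: "Z:?P"
  then obtain e where e: "e:Z" using self_in_orb[of _ "face rho"] by fastforce
  have "Z = orb (face s) e" by (rule eqo[OF Z e])
  moreover have "Z ~= orb (face s) (u, v)"
  proof
   assume "Z = orb (face s) (u, v)"
   hence m: "(u, v):Z" by simp
   obtain e0 where "Z = orb (face rho) e0" using Z by auto
   hence "face rho (u, v):Z" using orb_step[of "(u, v)" "face rho" e0] m by simp
   thus False using Z d by auto
  qed
  moreover have "e:arcs F" using Z e by blast
  ultimately show "Z : orb (face s) ` arcs F-{orb (face s) (u, v)}" by blast
 qed
 hence "card ?P <= card (orb (face s) ` arcs F-{orb (face s) (u, v)})"
  using rotationD(4)[OF rs(1)] by (intro card_mono) auto
 also have "\<dots> = ncyc (face s) (arcs F)-1" unfolding ncyc_def using d(1) by simp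
 also have "\<dots><=4" using K5_faces[OF rs(1) U F(2)] by simp
 finally show ?thesis .
qed

text \<open>A face that enters a clique at the cut vertex \<open>c\<close> can leave it only there, and a closed walk in the clique
has at least three arcs.\<close>

lemma run_three:
 assumes r: "rotation E rho" and d: "(c, y):arcs E" "(c, y):Z" and cl: "!!d. d:Z ==> face rho d:Z"
  and U: "!!u v. (u, v):arcs E ==> u:U-{c} ==> v:U" and y: "y:U" "c:U"
  and d2: "deg2 E"
 obtains a b where "a~=b" "a~=(c, y)" "b~=(c, y)" "{(c, y), a, b}<={d:Z. fst d:U & snd d:U}"
proof -
 have cy: "c~=y" by (rule rotationD(3)[OF r d(1)])
 have nf: "w~=u" if vu: "(v, u):arcs E" "rho (v, u) = (v, w)" for u v w
 proof
  assume "w = u"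
  obtain t where "(v, t):arcs E" "t~=u" using d2 vu(1) unfolding deg2_def by meson
  thus False using rot_fixed[OF r vu(1), of t] vu `w = u` by simp
 qed
 have yc: "(y, c):arcs E" using d(1) arcs_sym by metis
 obtain y2 where y2: "rho (y, c) = (y, y2)" "(y, y2):arcs E" using rot_arc[OF r yc] .
 have y2c: "y2 ~= c" by (rule nf[OF yc y2(1)])
 have y2U: "y2:U" using U[OF y2(2)] y cy by simp
 have y2y: "(y2, y):arcs E" using y2(2) arcs_sym by metis
 obtain y3 where y3: "rho (y2, y) = (y2, y3)" "(y2, y3):arcs E" using rot_arc[OF r y2y] .
 have y3U: "y3:U" using U[OF y3(2)] y2U y2c by simp
 have "face rho (c, y) = (y, y2)" "face rho (y, y2) = (y2, y3)" using y2 y3 by auto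
 hence "(y, y2):Z" "(y2, y3):Z" using cl d(2) by metis+
 moreover have "y~=y2" using rotationD(3)[OF r y2(2)] .
 ultimately show ?thesis using that[of "(y, y2)" "(y2, y3)"] cy y2c d y y2U y3U by auto
qed

text \<open>On the torus there would be at least 11 faces. At most eight of them lie inside one of the cliques, and
they have at least three arcs each; the others visit both cliques and have at least six. This
needs more than the 40 arcs.\<close>

lemma not_drawable_dstar:
 assumes k: "k<=1"
 shows "~drawable_on (ilg dstar) (handle_surface k)"
proof
 assume d: "drawable_on (ilg dstar) (handle_surface k)"
 let ?E = "snd (ilg dstar)" and ?A = "arcs (snd (ilg dstar))"
 have facts: "low_ok dstar" "arcnum dstar = 40" "length dstar = 9" by code_simp+
 obtain rho where r: "rotation ?E rho" and n: "arcnum dstar div 2+2<=length dstar+ncyc (face rho) ?A+2 * k"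
  using rotation_ilg[OF facts(1) d] by blast
 have F11: "11<=ncyc (face rho) ?A" using n k unfolding facts by simp
 have d2: "deg2 ?E" by (rule deg2_ilg[OF facts(1)])
 have p: "perm_on (face rho) ?A" by (rule perm_on_face[OF r])
 define U1 U2 where "U1 = {0..4::nat}" and "U2 = insert 0 {5..8::nat}"
 have A: "(i, j):?A \<longleftrightarrow> i~=j & (i:U1 & j:U1 | i:U2 & j:U2)" for i j
  unfolding U1_def U2_def by (rule arcs_dstar)
 define F1 F2 where "F1 = {e:?E. e<=U1}" and "F2 = {e:?E. e<=U2}"
 have aF: "(u, v):arcs F1 \<longleftrightarrow> u:U1 & v:U1 & u~=v" "(u, v):arcs F2 \<longleftrightarrow> u:U2 & v:U2 & u~=v" for u v
  using A[of u v] unfolding F1_def F2_def arcs_def by auto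
 have cU: "card U1 = 5" "card U2 = 5" unfolding U1_def U2_def by simp_all
 let ?O = "orb (face rho) ` ?A"
 let ?P1 = "{Z:?O. Z<=arcs F1}" and ?P2 = "{Z:?O. Z<=arcs F2}"
 have P1: "card ?P1<=4"
 proof (rule pure_faces[OF r cU(1) _ aF(1), of 0 1 5])
  show "F1<=?E" unfolding F1_def by auto
 qed (unfold A aF, auto simp: U1_def U2_def)
 have P2: "card ?P2<=4"
 proof (rule pure_faces[OF r cU(2) _ aF(2), of 0 5 1])
  show "F2<=?E" unfolding F2_def by auto
 qed (unfold A aF, auto simp: U1_def U2_def)
 have cover: "a:arcs F1 | a:arcs F2" if "a:?A" for a using that A[of "fst a" "snd a"] aF[of "fst a" "snd a"] by auto
 have disj: "a~:arcs F2" if "a:arcs F1" for a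
  using that aF[of "fst a" "snd a"] unfolding U1_def U2_def by auto
 have finO: "finite ?O" using rotationD(4)[OF r] by simp
 have mixed: "6 <= card Z" if Z: "Z:?O" "~Z<=arcs F1" "~Z<=arcs F2" for Z
 proof -
  obtain d0 where d0: "d0:?A" "Z = orb (face rho) d0" using Z by auto
  have ZA: "Z<=?A" unfolding d0 by (rule orb_subset[OF p d0(1)])
  have cl: "face rho a:Z" if "a:Z" for a using that orb_step unfolding d0 by metis
  have enter: "EX y. (0, y):Z & y:U' & y~=0"
   if H: "H = arcs F1 & U' = U2 | H = arcs F2 & U' = U1" for H U'
  proof -
   have "EX a:Z. a:H & face rho a~:H"
   proof (rule ccontr)
    assume no: "~?thesis"
    obtain a where a: "a:Z" "a:H" using Z(2,3) ZA cover H by blast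
    have "orb (face rho) a<=Z Int H" by (rule orb_subsetI) (use a no cl in auto)
    moreover have "orb (face rho) a = Z" unfolding d0(2) by (rule orb_eqI[OF p d0(1)]) (use a d0 in simp)
    ultimately show False using Z(2,3) H by auto
   qed
   then obtain a where a: "a:Z" "a:H" "face rho a~:H" by auto
   obtain x v where xv: "a = (x, v)" by (cases a)
   have va: "(v, x):?A" using a ZA xv arcs_sym by fastforce
   obtain w where w: "rho (v, x) = (v, w)" "(v, w):?A" using rot_arc[OF r va] .
   have fz: "(v, w):Z" "(v, w)~:H" using cl[OF a(1)] a(3) w xv by auto
   have "v = 0 & w:U' & w~=0"
    using H
   proof
    assume h: "H = arcs F1 & U' = U2"
    hence "v:U1" "(v, w):arcs F2" using a(2) fz(2) cover[OF w(2)] aF xv by auto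
    thus ?thesis using h aF(2)[of v w] unfolding U1_def U2_def by auto
   next
    assume h: "H = arcs F2 & U' = U1"
    hence "v:U2" "(v, w):arcs F1" using a(2) fz(2) cover[OF w(2)] aF xv by auto
    thus ?thesis using h aF(1)[of v w] unfolding U1_def U2_def by auto
   qed
   thus ?thesis using fz(1) by auto
  qed
  obtain y where y: "(0, y):Z" "y:U2" "y~=0" using enter[of "arcs F1" U2] by auto
  obtain y' where y': "(0, y'):Z" "y':U1" "y'~=0" using enter[of "arcs F2" U1] by auto
  have z0: "0:U1" "0:U2" unfolding U1_def U2_def by auto
  obtain a b where ab: "a~=b" "a~=(0, y)" "b~=(0, y)" "{(0, y), a, b}<={d:Z. fst d:U2 & snd d:U2}"
  proof (rule run_three[OF r _ y(1) cl _ y(2) z0(2) d2])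
   show "(0, y):?A" using y ZA by blast
   show "v:U2" if "(u, v):?A" "u:U2-{0}" for u v using that A[of u v] unfolding U1_def U2_def by auto
  qed
  obtain a' b' where ab': "a'~=b'" "a'~=(0, y')" "b'~=(0, y')" "{(0, y'), a', b'}<={d:Z. fst d:U1 & snd d:U1}"
  proof (rule run_three[OF r _ y'(1) cl _ y'(2) z0(1) d2])
   show "(0, y'):?A" using y' ZA by blast
   show "v:U1" if "(u, v):?A" "u:U1-{0}" for u v using that A[of u v] unfolding U1_def U2_def by auto
  qed
  have in2: "{(0, y), a, b}<=Z Int arcs F2"
  proof
   fix d assume "d:{(0, y), a, b}"
   hence d: "d:Z" "fst d:U2" "snd d:U2" using ab(4) by auto
   hence "fst d~=snd d" using ZA A[of "fst d" "snd d"] by auto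
   thus "d:Z Int arcs F2" using d aF(2)[of "fst d" "snd d"] by simp
  qed
  have in1: "{(0, y'), a', b'}<=Z Int arcs F1"
  proof
   fix d assume "d:{(0, y'), a', b'}"
   hence d: "d:Z" "fst d:U1" "snd d:U1" using ab'(4) by auto
   hence "fst d~=snd d" using ZA A[of "fst d" "snd d"] by auto
   thus "d:Z Int arcs F1" using d aF(1)[of "fst d" "snd d"] by simp
  qed
  have "card ({(0, y), a, b} Un {(0, y'), a', b'}) = card {(0, y), a, b} + card {(0, y'), a', b'}"
  proof (rule card_Un_disjoint)
   show "{(0, y), a, b} Int {(0, y'), a', b'} = {}" using in1 in2 disj by blast
  qed auto
  also have "\<dots> = 6" using ab(1-3) ab'(1-3) by simp
  finally have "card ({(0, y), a, b} Un {(0, y'), a', b'}) = 6" .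
  moreover have "finite Z" using ZA rotationD(4)[OF r] finite_subset by blast
  moreover have "{(0, y), a, b} Un {(0, y'), a', b'}<=Z" using in1 in2 by blast
  ultimately show ?thesis using card_mono[of Z "{(0, y), a, b} Un {(0, y'), a', b'}"] by linarith
 qed
 define M where "M = {Z:?O. ~Z<=arcs F1 & ~Z<=arcs F2}"
 have "?O = ?P1 Un ?P2 Un M" unfolding M_def by auto
 hence "card ?O <= card ?P1 + card ?P2 + card M"
  by (metis (no_types, lifting) card_Un_le add_le_mono1 order_trans)
 hence M3: "3 <= card M" using F11 P1 P2 unfolding ncyc_def by linarith
 have "(SUM Z:?O. 3+(if Z:M then 3 else 0))<=(SUM Z:?O. card Z)"
 proof (rule sum_mono)
  fix Z assume Z: "Z:?O"
  thus "3+(if Z:M then 3 else 0) <= card Z"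
   using face_card[OF r d2] mixed[of Z] unfolding M_def by auto
 qed
 also have "(SUM Z:?O. card Z) = 40" unfolding sum_orbits[OF p] card_arcs_ilg facts ..
 also have "(SUM Z:?O. 3+(if Z:M then 3 else 0)) = 3 * card ?O+3 * card M"
 proof -
  have "(SUM Z:?O. (if Z:M then 3 else 0)) = (SUM Z:?O Int M. (3::nat))"
   using sum.inter_restrict[OF finO, of "%_. 3::nat" M] by simp
  moreover have "?O Int M = M" unfolding M_def by auto
  ultimately show ?thesis by (simp add: sum.distrib)
 qed
 finally show False using M3 F11 unfolding ncyc_def by linarith
qed

section \<open>Subdivisions\<close>

fun steps :: "'a list => 'a set set" where
 "steps (a # b # r) = insert {a, b} (steps (b # r))"
| "steps _ = {}"

lemma steps_subset: "e:steps r ==> e<=set r"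
 by (induction r rule: steps.induct) auto

lemma card_steps: "distinct r ==> e:steps r ==> card e = 2"
 by (induction r rule: steps.induct) auto

lemma steps_cover: "2<=length r ==> \<Union>(steps r) = set r"
proof (induction r rule: steps.induct)
 case (1 a b r)
 show ?case
 proof (cases r)
  case (Cons c r')
  thus ?thesis using 1 by auto
 qed auto
qed auto

lemma drawingD:
 assumes "drawing_on G S p c"
 shows "inj_on p (fst G)" "p ` fst G<=S"
  "!!e. e:snd G ==> arc (c e)" "!!e. e:snd G ==> path_image (c e)<=S"
  "!!e. e:snd G ==> {pathstart (c e), pathfinish (c e)} = p ` e"
  "!!e. e:snd G ==> path_image (c e) Int p ` fst G = p ` e"
  "!!e f. e:snd G ==> f:snd G ==> e~=f ==> path_image (c e) Int path_image (c f) = p ` (e Int f)"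
 using assms unfolding drawing_on_def by blast+

lemma arc_along_path:
 assumes d: "drawing_on H S p c"
 shows "2<=length r ==> distinct r ==> steps r<=snd H ==>
 EX g. arc g & pathstart g = p (hd r) & pathfinish g = p (last r) & path_image g = (UN e:steps r. path_image (c e))"
proof (induction r rule: steps.induct)
 case (1 a b r)
 have ab: "{a, b}:snd H" using 1 by simp
 have "EX g. arc g & pathstart g = p a & pathfinish g = p b & path_image g = path_image (c {a, b})"
 proof -
  have "{pathstart (c {a, b}), pathfinish (c {a, b})} = {p a, p b}" using drawingD(5)[OF d ab] by simp
  then consider "pathstart (c {a, b}) = p a" "pathfinish (c {a, b}) = p b" | "pathstart (c {a, b}) = p b" "pathfinish (c {a, b}) = p a"
   by (auto simp: doubleton_eq_iff)
  thus ?thesis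
  proof cases
   case 1
   thus ?thesis using drawingD(3)[OF d ab] by blast
  next
   case 2
   thus ?thesis using drawingD(3)[OF d ab] by (intro exI[of _ "reversepath (c {a, b})"]) (simp add: arc_reversepath)
  qed
 qed
 then obtain g where g: "arc g" "pathstart g = p a" "pathfinish g = p b" "path_image g = path_image (c {a, b})" by blast
 show ?case
 proof (cases r)
  case Nil
  thus ?thesis using g by auto
 next
  case (Cons b' r')
  obtain h where h: "arc h" "pathstart h = p b" "pathfinish h = p (last (b # r))" "path_image h = (UN e:steps (b # r). path_image (c e))"
   using 1 Cons by auto
  have "path_image g Int path_image h<={pathstart h}"
  proof
   fix x assume x: "x:path_image g Int path_image h"
   then obtain e where e: "e:steps (b # r)" "x:path_image (c e)" unfolding h by auto
   have a: "a~:e" using steps_subset[OF e(1)] 1(3) by auto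
   hence "x:p ` ({a, b} Int e)" using drawingD(7)[OF d ab, of e] 1(4) e x unfolding g by fastforce
   thus "x:{pathstart h}" using a h by auto
  qed
  hence "arc (g +++ h)" using arc_join[OF g(1) h(1)] g h by simp
  moreover have "path_image (g +++ h) = path_image g Un path_image h" using path_image_join[of g h] g h by simp
  ultimately show ?thesis using g h Cons by (intro exI[of _ "g +++ h"]) simp
 qed
qed auto

text \<open>A graph can be drawn as soon as a graph containing a subdivision of it can be drawn: the arcs
 along a path join to one arc. Paths with a single edge give the case of a subgraph.\<close>

theorem drawable_subdivision:
 assumes d: "drawable_on H S" and f: "inj_on f (fst G)" "f ` fst G<=fst H"
  and H: "!!e. e:snd H ==> e<=fst H"
  and e2: "!!e. e:snd G ==> e<=fst G & card e = 2"
  and P: "!!e. e:snd G ==> 2<=length (P e) & distinct (P e) & steps (P e)<=snd H & {hd (P e), last (P e)} = f ` e &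
 set (P e) Int f ` fst G = f ` e"
  and PP: "!!e e'. e:snd G ==> e':snd G ==> e~=e' ==> set (P e) Int set (P e') = f ` (e Int e')"
 shows "drawable_on G S"
proof -
 obtain p c where d: "drawing_on H S p c" using d unfolding drawable_on_def by blast
 have "ALL e:snd G. EX g. arc g & pathstart g = p (hd (P e)) & pathfinish g = p (last (P e)) & path_image g = (UN a:steps (P e). path_image (c a))"
  using arc_along_path[OF d] P by simp
 then obtain g where g: "!!e. e:snd G ==> arc (g e) & pathstart (g e) = p (hd (P e)) & pathfinish (g e) = p (last (P e)) &
 path_image (g e) = (UN a:steps (P e). path_image (c a))" by metis
 have PH: "set (P e)<=fst H" if "e:snd G" for e
 proof -
  have "\<Union>(steps (P e))<=fst H" using P[OF that] H by blast
  thus ?thesis using steps_cover[of "P e"] P[OF that] by simp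
 qed
 have vert: "path_image (g e) Int p ` fst H = p ` set (P e)" if "e:snd G" for e
 proof -
  have "path_image (g e) Int p ` fst H = (UN a:steps (P e). path_image (c a) Int p ` fst H)" using g[OF that] by auto
  also have "\<dots> = (UN a:steps (P e). p ` a)" using drawingD(6)[OF d] P[OF that] by (intro SUP_cong refl) blast
  also have "\<dots> = p ` set (P e)" using steps_cover[of "P e"] P[OF that] by (metis image_Union)
  finally show ?thesis .
 qed
 have pinj: "p ` A Int p ` B = p ` (A Int B)" if "A<=fst H" "B<=fst H" for A B
  using inj_on_image_Int[OF drawingD(1)[OF d] that] by simp
 have "drawing_on G S (p\<circ>f) g"
  unfolding drawing_on_def
 proof (intro conjI ballI impI)
  show "inj_on (p\<circ>f) (fst G)" using f drawingD(1)[OF d] by (meson comp_inj_on inj_on_subset)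
  show "(p\<circ>f) ` fst G<=S" using f drawingD(2)[OF d] by auto
  fix e assume e: "e:snd G"
  show "arc (g e)" using g[OF e] by simp
  show "path_image (g e)<=S" using g[OF e] P[OF e] drawingD(4)[OF d] by auto
  show "{pathstart (g e), pathfinish (g e)} = (p\<circ>f) ` e" 
  proof -
   have "{pathstart (g e), pathfinish (g e)} = p ` {hd (P e), last (P e)}" using g[OF e] by simp
   also have "{hd (P e), last (P e)} = f ` e" using P[OF e] by simp
   finally show ?thesis by (simp add: image_comp)
  qed
  have "path_image (g e) Int p ` f ` fst G = (path_image (g e) Int p ` fst H) Int p ` f ` fst G" using f by auto
  also have "\<dots> = p ` f ` e" unfolding vert[OF e] using pinj[OF PH[OF e] f(2)] P[OF e] by simp
  finally show "path_image (g e) Int (p\<circ>f) ` fst G = (p\<circ>f) ` e" by (simp add: image_comp)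
  fix e' assume e': "e':snd G" "e~=e'"
  have "path_image (g e) Int path_image (g e')<=p ` fst H"
  proof
   fix x assume "x:path_image (g e) Int path_image (g e')"
   then obtain a b where ab: "a:steps (P e)" "x:path_image (c a)" "b:steps (P e')" "x:path_image (c b)"
    using g[OF e] g[OF e'(1)] by auto
   have "a~=b"
   proof
    assume "a = b"
    hence "a<=set (P e) Int set (P e')" using steps_subset[OF ab(1)] steps_subset[OF ab(3)] by simp
    hence "a<=f ` (e Int e')" unfolding PP[OF e e'] .
    moreover have fin: "finite e" "finite e'" by (rule card_ge_0_finite, use e2[OF e] e2[OF e'(1)] in simp)+
    ultimately have "card a <= card (e Int e')" by (meson card_image_le card_mono finite_Int finite_imageI order_trans)
    moreover have "card a = 2" using card_steps[of "P e" a] P[OF e] ab(1) by simp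
    ultimately have "2 <= card (e Int e')" by simp
    hence "card e <= card (e Int e')" "card e' <= card (e Int e')" using e2[OF e] e2[OF e'(1)] by simp_all
    hence "e Int e' = e" "e Int e' = e'" using card_seteq[OF fin(1) Int_lower1] card_seteq[OF fin(2) Int_lower2] by simp_all
    thus False using e' by simp
   qed
   hence "x:p ` (a Int b)" using drawingD(7)[OF d, of a b] P[OF e] P[OF e'(1)] ab by blast
   thus "x:p ` fst H" using steps_subset[OF ab(1)] PH[OF e] by auto
  qed
  hence "path_image (g e) Int path_image (g e') = (path_image (g e) Int p ` fst H) Int (path_image (g e') Int p ` fst H)" by auto
  also have "\<dots> = p ` f ` (e Int e')" unfolding vert[OF e] vert[OF e'(1)] pinj[OF PH[OF e] PH[OF e'(1)]] PP[OF e e'] ..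
  finally show "path_image (g e) Int path_image (g e') = (p\<circ>f) ` (e Int e')" by (simp add: image_comp)
 qed
 thus ?thesis unfolding drawable_on_def by blast
qed

lemma drawable_subgraph:
 assumes d: "drawable_on H S" and f: "inj_on f (fst G)" "f ` fst G<=fst H"
  and H: "!!e. e:snd H ==> e<=fst H"
  and e2: "!!e. e:snd G ==> e<=fst G & card e = 2" and fe: "!!e. e:snd G ==> f ` e:snd H"
 shows "drawable_on G S"
proof -
 have "EX P. ALL e:snd G. EX u v. e = {u, v} & u~=v & P e = [f u, f v]"
 proof -
  have "ALL e:snd G. EX l. EX u v. e = {u, v} & u~=v & l = [f u, f v]"
  proof
   fix e assume "e:snd G"
   then obtain u v where "e = {u, v}" "u~=v" using e2[of e] unfolding card_2_iff by blast
   thus "EX l. EX u v. e = {u, v} & u~=v & l = [f u, f v]" by blast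
  qed
  thus ?thesis by (rule bchoice)
 qed
 then obtain P where P0: "ALL e:snd G. EX u v. e = {u, v} & u~=v & P e = [f u, f v]" by (rule exE)
 note P = bspec[OF P0]
 have sP: "set (P e) = f ` e" if "e:snd G" for e using P[OF that] by auto
 show ?thesis
 proof (rule drawable_subdivision[OF d f H e2, where P = P])
  fix e assume e: "e:snd G"
  obtain u v where uv: "e = {u, v}" "u~=v" "P e = [f u, f v]" using P[OF e] by blast
  have "f u~=f v" using f(1) uv e2[OF e] unfolding inj_on_def by auto
  moreover have "{f u, f v}:snd H" using fe[OF e] uv by simp
  moreover have "f ` e<=f ` fst G" using e2[OF e] by blast
  ultimately show "2<=length (P e) & distinct (P e) & steps (P e)<=snd H & {hd (P e), last (P e)} = f ` e & set (P e) Int f ` fst G = f ` e"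
   using uv by auto
  fix e' assume e': "e':snd G" "e~=e'"
  show "set (P e) Int set (P e') = f ` (e Int e')"
   unfolding sP[OF e] sP[OF e'(1)] using inj_on_image_Int[OF f(1)] e2[OF e] e2[OF e'(1)] by metis
 qed
qed

section \<open>Pieces of arcs on the surface\<close>

text \<open>Drawings use the vertices \<open>(x, 0, 0)\<close> and the ports \<open>(s, 1, 0)\<close> and \<open>(s, -1, 0)\<close>. A fan is a segment from a vertex to a
port, a tent connects ports on the same side of the discs and is bent away from the line \<open>y = 0\<close>, and a
tube passage keeps the constant distance \<open>r\<close> from the axis of the handle except for short spokes
at its ends. Passages with different \<open>r\<close> are disjoint; \<open>r \<noteq> 2\<close> keeps the spokes nondegenerate.\<close>

definition fan :: "real => real => real => real => real\<times>real\<times>real" where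
 "fan x s \<sigma> t = (x+t*(s-x), t * \<sigma>, 0)"

definition tent :: "real => real => real => real => real => real\<times>real\<times>real" where
 "tent kappa a b \<sigma> t = (a+t*(b-a), \<sigma>*(1+kappa * min (t*(b-a)) ((1-t)*(b-a))), 0)"

definition tube :: "real => real => real => real => real\<times>real\<times>real" where
 "tube c r \<sigma> t =
 (c-r * cos (pi * min 1 (max 0 (3 * t-1))),
 \<sigma>*(sqrt (1-(r-2)\<^sup>2)+(1-sqrt (1-(r-2)\<^sup>2)) * max (1-3 * t) (max 0 (3 * t-2))),
 r * sin (pi * min 1 (max 0 (3 * t-1))))"

lemma sign_cases: "abs(\<sigma>) = 1 ==> \<sigma> = 1 | \<sigma> = (-1::real)" by auto

lemma arc_fan:
 assumes "abs(\<sigma>) = 1"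
 shows "arc (fan x s \<sigma>)" "pathstart (fan x s \<sigma>) = (x, 0, 0)" "pathfinish (fan x s \<sigma>) = (s, \<sigma>, 0)"
proof -
 have "continuous_on {0..1} (fan x s \<sigma>)" unfolding fan_def by (intro continuous_intros)
 moreover have "inj_on (fan x s \<sigma>) {0..1}" using assms unfolding fan_def inj_on_def by auto
 ultimately show "arc (fan x s \<sigma>)" unfolding arc_def path_def by simp
qed (simp_all add: fan_def pathstart_def pathfinish_def)

lemma fanD:
 assumes "(u, y, z):path_image (fan x s \<sigma>)" "abs(\<sigma>) = 1"
 shows "z = 0" "0<=\<sigma> * y" "\<sigma> * y<=1" "u = x+\<sigma> * y*(s-x)" "min x s<=u" "u<=max x s"
proof -
 obtain t where t: "0<=t" "t<=1" "u = x+t*(s-x)" "y = t * \<sigma>" "z = 0"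
  using assms(1) unfolding path_image_def fan_def by auto
 have ty: "\<sigma> * y = t" using t(4) sign_cases[OF assms(2)] by auto
 have "0<=\<sigma> * y" "\<sigma> * y<=1" "u = x+\<sigma> * y*(s-x)" unfolding ty using t by simp_all
 thus "z = 0" "0<=\<sigma> * y" "\<sigma> * y<=1" "u = x+\<sigma> * y*(s-x)" using t(5) by simp_all
 have u: "u = (1-t) * x+t * s" using t(3) by (simp add: algebra_simps)
 have "(1-t) * min x s+t * min x s<=u" "u<=(1-t) * max x s+t * max x s"
  unfolding u using t by (auto intro!: add_mono mult_left_mono)
 thus "min x s<=u" "u<=max x s" by (auto simp: algebra_simps)
qed

lemma arc_tent:
 assumes "a < b"
 shows "arc (tent kappa a b \<sigma>)" "pathstart (tent kappa a b \<sigma>) = (a, \<sigma>, 0)" "pathfinish (tent kappa a b \<sigma>) = (b, \<sigma>, 0)"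
proof -
 have "continuous_on {0..1} (tent kappa a b \<sigma>)" unfolding tent_def by (intro continuous_intros)
 moreover have "inj_on (tent kappa a b \<sigma>) {0..1}" using assms unfolding tent_def inj_on_def by auto
 ultimately show "arc (tent kappa a b \<sigma>)" unfolding arc_def path_def by simp
qed (insert assms, simp_all add: tent_def pathstart_def pathfinish_def)

lemma tentD:
 assumes "(u, y, z):path_image (tent kappa a b \<sigma>)" "a < b"
 shows "z = 0" "a<=u" "u<=b" "y = \<sigma>*(1+kappa * min (u-a) (b-u))"
proof -
 obtain t where t: "0<=t" "t<=1" "u = a+t*(b-a)" "y = \<sigma>*(1+kappa * min (t*(b-a)) ((1-t)*(b-a)))" "z = 0"
  using assms(1) unfolding path_image_def tent_def by auto
 show "z = 0" by fact
 show "a<=u" using t assms(2) by simp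
 have "b-u = (1-t)*(b-a)" using t(3) by (simp add: algebra_simps)
 thus "y = \<sigma>*(1+kappa * min (u-a) (b-u))" using t by simp
 show "u<=b" using `b - u = _` t assms(2) mult_nonneg_nonneg[of "1-t" "b-a"] by linarith
qed

lemma rho_bounds:
 assumes "1 < r" "r < 3" "r~=(2::real)"
 shows "0 < sqrt (1-(r-2)\<^sup>2)" "sqrt (1-(r-2)\<^sup>2) < 1"
proof -
 have "abs(r-2) < 1" "abs(r-2) > 0" using assms by auto
 hence "(r-2)\<^sup>2 < 1" "0 < (r-2)\<^sup>2" by (simp_all add: abs_square_less_1)
 thus "0 < sqrt (1-(r-2)\<^sup>2)" "sqrt (1-(r-2)\<^sup>2) < 1" by simp_all
qed

lemma arc_tube:
 assumes r: "1 < r" "r < 3" "r~=2" and s: "abs(\<sigma>) = 1"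
 shows "arc (tube c r \<sigma>)" "pathstart (tube c r \<sigma>) = (c-r, \<sigma>, 0)" "pathfinish (tube c r \<sigma>) = (c+r, \<sigma>, 0)"
proof -
 have "continuous_on {0..1} (tube c r \<sigma>)" unfolding tube_def by (intro continuous_intros)
 moreover have "inj_on (tube c r \<sigma>) {0..1}"
 proof (rule inj_onI)
  fix t t' :: real assume t: "t:{0..1}" "t':{0..1}" and e: "tube c r \<sigma> t = tube c r \<sigma> t'"
  have "cos (pi * min 1 (max 0 (3 * t-1))) = cos (pi * min 1 (max 0 (3 * t'-1)))" using e r unfolding tube_def by simp
  hence "pi * min 1 (max 0 (3 * t-1)) = pi * min 1 (max 0 (3 * t'-1))"
  proof (rule cos_inj_pi[rotated 4])
   have m: "0<=min 1 (max 0 (3 * t-1))" "min 1 (max 0 (3 * t-1))<=1" for t :: real by auto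
   show "0<=pi * min 1 (max 0 (3 * t-1))" "0<=pi * min 1 (max 0 (3 * t'-1))" using m by simp_all
   show "pi * min 1 (max 0 (3 * t-1))<=pi" "pi * min 1 (max 0 (3 * t'-1))<=pi" using m by (simp_all add: mult_left_le)
  qed
  hence 1: "min 1 (max 0 (3 * t-1)) = min 1 (max 0 (3 * t'-1))" by simp
  have "\<sigma>~=0" using s by auto
  hence 2: "max (1-3 * t) (max 0 (3 * t-2)) = max (1-3 * t') (max 0 (3 * t'-2))"
   using e rho_bounds[OF r] unfolding tube_def by simp
  show "t = t'" using 1 2 t unfolding min_def max_def by (simp split: if_splits)
 qed
 ultimately show "arc (tube c r \<sigma>)" unfolding arc_def path_def by simp
qed (simp_all add: tube_def pathstart_def pathfinish_def)

lemma tubeD: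
 assumes m: "(u, y, z):path_image (tube c r \<sigma>)" and r: "1 < r" "r < 3" "r~=2" and s: "abs(\<sigma>) = 1"
 shows "0<=z" "(u - c)\<^sup>2+z\<^sup>2 = r\<^sup>2" "sqrt (1-(r-2)\<^sup>2)<=\<sigma> * y" "\<sigma> * y<=1"
  "\<sigma> * y = sqrt (1-(r-2)\<^sup>2) | z = 0 & abs(u - c) = r" "\<sigma> * y = 1 ==> z = 0 & abs(u - c) = r"
proof -
 obtain t where t: "0<=t" "t<=1" "(u, y, z) = tube c r \<sigma> t" using m unfolding path_image_def by auto
 define q where "q = sqrt (1-(r-2)\<^sup>2)"
 have q: "0 < q" "q < 1" using rho_bounds[OF r] unfolding q_def by auto
 define theta where "theta = pi * min 1 (max 0 (3 * t-1))"
 define h where "h = max (1-3 * t) (max 0 (3 * t-2))"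
 have e: "u = c-r * cos theta" "y = \<sigma>*(q+(1-q) * h)" "z = r * sin theta"
  using t(3) unfolding tube_def theta_def h_def q_def by auto
 have theta: "0<=theta" "theta<=pi" unfolding theta_def by (auto simp: mult_le_cancel_left1)
 show "0<=z" using e(3) r sin_ge_zero[OF theta] by simp
 have "(u - c)\<^sup>2+z\<^sup>2 = r\<^sup>2*((cos theta)\<^sup>2+(sin theta)\<^sup>2)" unfolding e by (simp add: power_mult_distrib distrib_left del: sin_cos_squared_add sin_cos_squared_add2)
 thus "(u - c)\<^sup>2+z\<^sup>2 = r\<^sup>2" by (simp only: sin_cos_squared_add2 mult_1_right)
 have h: "0<=h" "h<=1" using t unfolding h_def by auto
 have sy: "\<sigma> * y = q+(1-q) * h" using e(2) sign_cases[OF s] by auto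
 have le: "0<=(1-q) * h" "(1-q) * h<=1-q" using h q mult_left_le[of h "1-q"] by auto
 show "sqrt (1-(r-2)\<^sup>2)<=\<sigma> * y" "\<sigma> * y<=1" using le sy unfolding q_def[symmetric] by auto
 have "h = 0 | theta = 0 | theta = pi" unfolding h_def theta_def by (auto simp: max_def min_def)
 moreover have "z = 0 & abs(u - c) = r" if "theta = 0 | theta = pi" using that e r by auto
 ultimately show "\<sigma> * y = sqrt (1-(r-2)\<^sup>2) | z = 0 & abs(u - c) = r" using sy unfolding q_def[symmetric] by auto
 thus "z = 0 & abs(u - c) = r" if "\<sigma> * y = 1" using that q unfolding q_def[symmetric] by auto
qed

lemma top_in_surface:
 assumes "-4<=x" "x<=8 * real k+4" "abs(y)<=2"
  "!!i. i < k ==> 1<=(x-(8 * real i-2))\<^sup>2+y\<^sup>2 & 1<=(x-(8 * real i+2))\<^sup>2+y\<^sup>2"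
 shows "(x, y, 0):handle_surface k"
proof -
 have "(x, y, 0):box_sphere k" using assms by (intro box_sphereI) auto
 moreover have "(x, y, 0)~:handle_discs i" if "i < k" for i using assms(4)[OF that] unfolding handle_discs_def by auto
 ultimately show ?thesis unfolding handle_surface_def by auto
qed

lemma sq_ge_1: "1<=abs(x) ==> 1<=x\<^sup>2+(y::real)\<^sup>2"
 using abs_le_square_iff[of 1 x] by (simp add: add_increasing2)

section \<open>Book drawings\<close>

text \<open>Coordinates are measured in hundredths, so that the checks compute with integers.\<close>

datatype piece = Fan int int int | Tent int int int | Tube nat int int

definition pt :: "int\<times>int => real\<times>real\<times>real" where
 "pt l = (of_int (fst l) / 100, of_int (snd l), 0)"

text \<open>The slope of a tent keeps it in the top face, whatever its length.\<close>

fun curve :: "nat => piece => real => real\<times>real\<times>real" where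
 "curve k (Fan x s g) = fan (of_int x / 100) (of_int s / 100) (of_int g)"
| "curve k (Tent a b g) = tent (1 / (4 * real k+4)) (of_int a / 100) (of_int b / 100) (of_int g)"
| "curve k (Tube m r g) = tube (8 * real m) (of_int r / 100) (of_int g)"

fun ends :: "piece => (int\<times>int)\<times>(int\<times>int)" where
 "ends (Fan x s g) = ((x, 0), (s, g))"
| "ends (Tent a b g) = ((a, g), (b, g))"
| "ends (Tube m r g) = ((800 * int m-r, g), (800 * int m+r, g))"

definition sgn_ok :: "int => bool" where "sgn_ok g \<longleftrightarrow> g = 1 | g = -1"

fun piece_ok :: "nat => piece => bool" where
 "piece_ok k (Fan x s g) \<longleftrightarrow> sgn_ok g & -400<=min x s & max x s<=800 * int k+400 &
 list_all (%i. max x s<=800 * int i-300 | 800 * int i-100<=min x s & max x s<=800 * int i+100 | 800 * int i+300<=min x s) [0..<k]"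
| "piece_ok k (Tent a b g) \<longleftrightarrow> sgn_ok g & a < b & -400<=a & b<=800 * int k+400"
| "piece_ok k (Tube m r g) \<longleftrightarrow> sgn_ok g & m < k & 100 < r & r < 300 & r~=200"

text \<open>Fans from different vertices have to lie over disjoint intervals; tents on one side are disjoint or nested.\<close>

fun compat :: "piece => piece => bool" where
 "compat (Fan x s g) (Fan x' s' g') \<longleftrightarrow> x = x' | max x s < min x' s' | max x' s' < min x s"
| "compat (Tent a b g) (Tent a' b' g') \<longleftrightarrow> g~=g' | b < a' | b' < a | a < a' & b' < b | a' < a & b < b'"
| "compat _ _ \<longleftrightarrow> True"

abbreviation eset :: "piece => (int\<times>int) set" where
 "eset p == {fst (ends p), snd (ends p)}"

lemma pt_inj: "pt l = pt l' \<longleftrightarrow> l = l'"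
 unfolding pt_def by (auto simp: prod_eq_iff)

lemma sgn_abs: "sgn_ok g ==> abs(rl g) = 1"
 unfolding sgn_ok_def by auto

lemma hundredths: "of_int a / 100 < (of_int b / 100 :: real) \<longleftrightarrow> a < b" "of_int a / 100<=(of_int b / 100 :: real) \<longleftrightarrow> a<=b"
 "of_int a / 100 = (of_int b / 100 :: real) \<longleftrightarrow> a = b"
 by auto

lemma piece_tube:
 assumes "piece_ok k (Tube m r g)"
 shows "1 < of_int r / (100::real)" "of_int r / 100 < (3::real)" "of_int r / 100~=(2::real)" "abs(rl g) = 1" "m < k"
proof -
 have r: "100 < r" "r < 300" "r~=200" using assms by auto
 have "(100::real) < of_int r" "of_int r < (300::real)" "of_int r~=(200::real)" using r by linarith+
 thus "1 < of_int r / (100::real)" "of_int r / 100 < (3::real)" "of_int r / 100~=(2::real)" by auto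
 show "abs(rl g) = 1" "m < k" using assms sgn_abs by auto
qed

lemma piece_arc:
 assumes "piece_ok k p"
 shows "arc (curve k p)" "pathstart (curve k p) = pt (fst (ends p))" "pathfinish (curve k p) = pt (snd (ends p))"
proof -
 have "arc (curve k p) & pathstart (curve k p) = pt (fst (ends p)) & pathfinish (curve k p) = pt (snd (ends p))"
 proof (cases p)
  case (Fan x s g)
  thus ?thesis using arc_fan[of "of_int g"] sgn_abs assms by (simp add: pt_def)
 next
  case (Tent a b g)
  have "of_int a / 100 < (of_int b / 100 :: real)" using assms Tent by simp
  from arc_tent[OF this] show ?thesis using Tent by (simp add: pt_def)
 next
  case (Tube m r g)
  show ?thesis using arc_tube[OF piece_tube(1-4)[OF assms[unfolded Tube]]] Tube by (simp add: pt_def diff_divide_distrib add_divide_distrib)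
 qed
 thus "arc (curve k p)" "pathstart (curve k p) = pt (fst (ends p))" "pathfinish (curve k p) = pt (snd (ends p))" by auto
qed

lemma fan_clear:
 assumes ok: "piece_ok k (Fan a s g)" and u: "min (of_int a / 100) (of_int s / 100)<=u" "u<=max (of_int a / 100) (of_int s / (100::real))" and i: "i < k"
 shows "u<=8 * real i-3 | 8 * real i-1<=u & u<=8 * real i+1 | 8 * real i+3<=u"
proof -
 have "max a s<=800 * int i-300 | 800 * int i-100<=min a s & max a s<=800 * int i+100 | 800 * int i+300<=min a s"
  using ok i by (auto simp: list_all_iff)
 thus ?thesis
 proof (elim disjE)
  assume "max a s<=800 * int i-300"
  hence "rl a<=800 * real i-300" "rl s<=800 * real i-300" by linarith+
  thus ?thesis using u(2) by auto
 next
  assume "800 * int i-100<=min a s & max a s<=800 * int i+100"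
  hence "800 * real i-100<=rl a" "800 * real i-100<=rl s"
   "rl a<=800 * real i+100" "rl s<=800 * real i+100" by linarith+
  thus ?thesis using u by auto
 next
  assume "800 * int i+300<=min a s"
  hence "800 * real i+300<=rl a" "800 * real i+300<=rl s" by linarith+
  thus ?thesis using u(1) by auto
 qed
qed

lemma piece_surface:
 assumes ok: "piece_ok k p"
 shows "path_image (curve k p)<=handle_surface k"
proof
 fix w assume w: "w:path_image (curve k p)"
 obtain u y z where uyz: "w = (u, y, z)" by (cases w) auto
 show "w:handle_surface k"
 proof (cases p)
  case (Fan a s g)
  have g: "abs(rl g) = 1" using ok Fan sgn_abs by simp
  have m: "(u, y, z):path_image (fan (of_int a / 100) (of_int s / 100) (of_int g))" using w uyz Fan by simp
  note F = fanD[OF m g]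
  have "-400<=a" "-400<=s" "a<=800 * int k+400" "s<=800 * int k+400" using ok Fan by auto
  hence b: "-400<=rl a" "-400<=rl s" "rl a<=800 * real k+400" "rl s<=800 * real k+400" by linarith+
  have y: "abs(y)<=1" using F(2,3) sign_cases[OF g] by auto
  have "(u, y, 0):handle_surface k"
  proof (rule top_in_surface)
   show "-4<=u" "u<=8 * real k+4" using F(5,6) b by auto
   show "abs(y)<=2" using y by simp
   fix i assume "i < k"
   from fan_clear[OF ok[unfolded Fan] F(5,6) this]
   show "1<=(u-(8 * real i-2))\<^sup>2+y\<^sup>2 & 1<=(u-(8 * real i+2))\<^sup>2+y\<^sup>2"
    by (intro conjI sq_ge_1) auto
  qed
  thus ?thesis using uyz F(1) by simp
 next
  case (Tent a b g)
  have g: "abs(rl g) = 1" using ok Tent sgn_abs by simp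
  have lt: "of_int a / 100 < (of_int b / 100 :: real)" using ok Tent by simp
  have m: "(u, y, z):path_image (tent (1 / (4 * real k+4)) (of_int a / 100) (of_int b / 100) (of_int g))" using w uyz Tent by simp
  note T = tentD[OF m lt]
  have "-400<=a" "b<=800 * int k+400" using ok Tent by auto
  hence b: "-400<=rl a" "rl b<=800 * real k+400" by linarith+
  have u: "-4<=u" "u<=8 * real k+4" using T(2,3) b by auto
  define h where "h = min (u - of_int a / 100) (of_int b / 100-u)"
  have h: "0<=h" "h<=4 * real k+4" using T(2,3) b unfolding h_def by auto
  have y: "abs(y) = 1+1 / (4 * real k+4) * h" using T(4) g h(1) unfolding h_def[symmetric] by (simp add: abs_mult)
  have "(u, y, 0):handle_surface k"
  proof (rule top_in_surface[OF u])
   show "abs(y)<=2" using y h by simp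
   have "1<=abs(y)" using y h(1) by simp
   thus "1<=(u-(8 * real i-2))\<^sup>2+y\<^sup>2 & 1<=(u-(8 * real i+2))\<^sup>2+y\<^sup>2" for i
    using sq_ge_1[of y] add.commute[of _ "y\<^sup>2"] by metis
  qed
  thus ?thesis using uyz T(1) by simp
 next
  case (Tube m r g)
  note R = piece_tube[OF ok[unfolded Tube]]
  have pm: "(u, y, z):path_image (tube (8 * real m) (of_int r / 100) (of_int g))" using w uyz Tube by simp
  define q where "q = of_int r / (100::real)"
  define rho where "rho = sqrt (1-(q-2)\<^sup>2)"
  note T = tubeD[OF pm R(1-4), folded q_def, folded rho_def]
  note R' = R(1-4)[folded q_def]
  have rho: "0 < rho" "rho < 1" using rho_bounds[OF R'(1-3)] unfolding rho_def by auto
  have sqrho: "rho\<^sup>2 = 1-(q-2)\<^sup>2"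
  proof -
   have "abs(q-2)<=1" using R'(1,2) by auto
   thus ?thesis unfolding rho_def by (simp add: abs_square_le_1)
  qed
  have ya: "rho<=abs(y)" "abs(y)<=1" using T(3,4) rho sign_cases[OF R(4)] by auto
  have y2: "(rl g * y)\<^sup>2 = y\<^sup>2" using sign_cases[OF R(4)] by (auto simp: power_mult_distrib)
  show ?thesis
  proof (cases "z = 0 & abs(u-8 * real m) = q")
   case True
   have yrho: "rho\<^sup>2<=y\<^sup>2" using ya rho by (metis abs_of_pos abs_le_square_iff)
   have mk: "real m+1<=real k" using R(5) by simp
   have "(u, y, 0):handle_surface k"
   proof (rule top_in_surface)
    show "-4<=u" "u<=8 * real k+4" using True R'(1,2) mk by auto
    show "abs(y)<=2" using ya by simp
    fix i assume i: "i < k"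
    show "1<=(u-(8 * real i-2))\<^sup>2+y\<^sup>2 & 1<=(u-(8 * real i+2))\<^sup>2+y\<^sup>2"
    proof (cases "i = m")
     case True
     have "u = 8 * real m+q | u = 8 * real m-q" using `z = 0 & _` by auto
     hence "u-(8 * real m+2) = q-2 | 1<=abs(u-(8 * real m+2))"
      "u-(8 * real m-2) = - (q-2) | 1<=abs(u-(8 * real m-2))"
      using R'(1) by auto
     hence 1: "(u-(8 * real m+2))\<^sup>2 = (q-2)\<^sup>2 | 1<=abs(u-(8 * real m+2))"
      "(u-(8 * real m-2))\<^sup>2 = (q-2)\<^sup>2 | 1<=abs(u-(8 * real m-2))"
      by (metis power2_minus)+
     have "1<=(q-2)\<^sup>2+y\<^sup>2" using yrho sqrho by simp
     thus ?thesis using 1 sq_ge_1 True by metis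
    next
     case False
     hence "real i+1<=real m | real m+1<=real i" by linarith
     thus ?thesis using `z = 0 & _` R'(1,2) by (intro conjI sq_ge_1) auto
    qed
   qed
   thus ?thesis using True uyz by simp
  next
   case False
   hence sy: "rl g * y = rho" using T(5) by blast
   hence "y\<^sup>2 = rho\<^sup>2" using y2 by simp
   moreover have "sqrt ((u-8 * real m)\<^sup>2+z\<^sup>2) = q" unfolding T(2) using R'(1) by simp
   ultimately have "(u, y, z):handle_tube m" unfolding handle_tube_def using T(1) sqrho by simp
   thus ?thesis using R(5) uyz unfolding handle_surface_def by auto
  qed
 qed
qed

lemma same_sign:
 assumes "abs(a) = 1" "abs(b) = 1" "0 < a * y" "0 < b*(y::real)"
 shows "a = b"
 using sign_cases[OF assms(1)] sign_cases[OF assms(2)] assms(3,4) by auto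

lemma tent_height:
 assumes ok: "piece_ok k (Tent a b g)" and m: "(u, y, z):path_image (curve k (Tent a b g))"
 shows "1 <= of_int g * y" "of_int g * y<=1 ==> u = of_int a / 100 | u = of_int b / 100"
proof -
 have g: "abs(rl g) = 1" using ok sgn_abs by simp
 have lt: "of_int a / 100 < (of_int b / 100 :: real)" using ok by simp
 note T = tentD[OF m[simplified] lt]
 define h where "h = min (u - of_int a / 100) (of_int b / 100-u)"
 have h: "0<=h" using T(2,3) unfolding h_def by auto
 have y: "of_int g * y = 1+1 / (4 * real k+4) * h" using T(4) sign_cases[OF g] unfolding h_def by auto
 show "1 <= of_int g * y" using y h by simp
 assume "of_int g * y<=1"
 hence "1 / (4 * real k+4) * h<=0" using y by linarith
 hence "h<=0" by (simp add: divide_le_0_iff)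
 thus "u = of_int a / 100 | u = of_int b / 100" using h T(2,3) unfolding h_def by (auto simp: min_def split: if_splits)
qed

lemma fan_fan:
 assumes ok: "piece_ok k (Fan a s g)" "piece_ok k (Fan a' s' g')" and c: "compat (Fan a s g) (Fan a' s' g')" and ne: "(s, g)~=(s', g')"
  and m: "(u, y, z):path_image (curve k (Fan a s g))" "(u, y, z):path_image (curve k (Fan a' s' g'))"
 shows "a = a' & (u, y, z) = pt (a, 0)"
proof -
 have g: "abs(rl g) = 1" "abs(rl g') = 1" using ok sgn_abs by auto
 note F = fanD[OF m(1)[simplified] g(1)] and F' = fanD[OF m(2)[simplified] g(2)]
 have aa: "a = a'"
 proof (rule ccontr)
  assume "a~=a'"
  hence "max a s < min a' s' | max a' s' < min a s" using c by simp
  thus False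
  proof
   assume "max a s < min a' s'"
   hence "max (of_int a / 100) (of_int s / 100) < (min (of_int a' / 100) (of_int s' / 100) :: real)"
    unfolding max_less_iff_conj min_less_iff_conj hundredths by simp
   thus False using F(6) F'(5) by linarith
  next
   assume "max a' s' < min a s"
   hence "max (of_int a' / 100) (of_int s' / 100) < (min (of_int a / 100) (of_int s / 100) :: real)"
    unfolding max_less_iff_conj min_less_iff_conj hundredths by simp
   thus False using F'(6) F(5) by linarith
  qed
 qed
 have "y = 0"
 proof (rule ccontr)
  assume "y~=0"
  hence "0 < rl g * y" "0 < rl g' * y" using F(2) F'(2) g by (auto simp: less_le)
  hence gg: "rl g = rl g'" using same_sign g by blast
  have "rl g * y*(of_int s / 100 - of_int a / 100) = rl g * y*(of_int s' / 100 - of_int a / 100)"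
   using F(4) F'(4) unfolding gg aa by linarith
  hence "of_int s / 100 - of_int a / 100 = (of_int s' / 100 - of_int a / 100 :: real)"
   by (rule mult_left_cancel[THEN iffD1, rotated]) (rule less_imp_neq[OF `0 < rl g * y`, symmetric])
  hence "s = s'" by simp
  thus False using ne gg by simp
 qed
 thus ?thesis using aa F(1,4) unfolding pt_def by simp
qed

lemma tent_tent:
 assumes ok: "piece_ok k (Tent a b g)" "piece_ok k (Tent a' b' g')" and c: "compat (Tent a b g) (Tent a' b' g')"
  and m: "(u, y, z):path_image (curve k (Tent a b g))" "(u, y, z):path_image (curve k (Tent a' b' g'))"
 shows False
proof -
 have g: "abs(rl g) = 1" "abs(rl g') = 1" using ok sgn_abs by auto
 have lt: "of_int a / 100 < (of_int b / 100 :: real)" "of_int a' / 100 < (of_int b' / 100 :: real)" using ok by auto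
 note T = tentD[OF m(1)[simplified] lt(1)] and T' = tentD[OF m(2)[simplified] lt(2)]
 have "rl g = rl g'"
  by (rule same_sign[OF g, of y]) (use tent_height(1)[OF ok(1) m(1)] tent_height(1)[OF ok(2) m(2)] in auto)
 hence gg: "g = g'" by simp
 define h where "h = min (u - of_int a / 100) (of_int b / 100-u)"
 define h' where "h' = min (u - of_int a' / 100) (of_int b' / 100-u)"
 have "rl g*(1+1 / (4 * real k+4) * h) = rl g*(1+1 / (4 * real k+4) * h')"
  using T(4) T'(4) unfolding h_def[symmetric] h'_def[symmetric] gg by linarith
 hence "1+1 / (4 * real k+4) * h = 1+1 / (4 * real k+4) * h'" using g(1) by (metis abs_zero mult_left_cancel zero_neq_one)
 hence hh: "h = h'" by simp
 have "b < a' | b' < a | a < a' & b' < b | a' < a & b < b'" using c gg by simp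
 hence "of_int b / 100 < (of_int a' / 100 :: real) | of_int b' / 100 < (of_int a / 100 :: real) |
 of_int a / 100 < (of_int a' / 100 :: real) & of_int b' / 100 < (of_int b / 100 :: real) |
 of_int a' / 100 < (of_int a / 100 :: real) & of_int b / 100 < (of_int b' / 100 :: real)"
  unfolding hundredths .
 thus False using T(2,3) T'(2,3) hh unfolding h_def h'_def by (auto simp: min_def split: if_splits)
qed

lemma fan_tent:
 assumes ok: "piece_ok k (Fan x s g)" "piece_ok k (Tent a b g')"
  and m: "(u, y, z):path_image (curve k (Fan x s g))" "(u, y, z):path_image (curve k (Tent a b g'))"
 shows "(u, y, z) = pt (s, g) & g = g' & (s = a | s = b)"
proof -
 have g: "abs(rl g) = 1" "abs(rl g') = 1" using ok sgn_abs by auto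
 note F = fanD[OF m(1)[simplified] g(1)] and T = tent_height[OF ok(2) m(2)]
 have y: "y~=0" "1<=abs(y)" using T(1) sign_cases[OF g(2)] by auto
 have gy: "rl g * y = 1" using F(2,3) y sign_cases[OF g(1)] by auto
 have gg: "rl g = rl g'" by (rule same_sign[OF g, of y]) (use gy T(1) in auto)
 have u: "u = of_int s / 100" using F(4) gy by simp
 have "of_int s / 100 = (of_int a / 100 :: real) | of_int s / 100 = (of_int b / 100 :: real)" using T(2) gg gy u by auto
 moreover have "y = rl g" using gy sign_cases[OF g(1)] by auto
 ultimately show ?thesis using u F(1) gg unfolding hundredths pt_def by simp
qed

lemma fan_tube:
 assumes ok: "piece_ok k (Fan x s g)" "piece_ok k (Tube n r g')"
  and m: "(u, y, z):path_image (curve k (Fan x s g))" "(u, y, z):path_image (curve k (Tube n r g'))"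
 shows False
proof -
 have g: "abs(rl g) = 1" using ok sgn_abs by auto
 note F = fanD[OF m(1)[simplified] g]
 note R = piece_tube[OF ok(2)]
 note T = tubeD[OF m(2)[simplified] R(1-4)]
 have "(u-8 * real n)\<^sup>2 = (of_int r / 100)\<^sup>2" using T(2) F(1) by simp
 hence "u-8 * real n = of_int r / 100 | u-8 * real n = - (of_int r / 100)" unfolding power2_eq_iff .
 thus False using fan_clear[OF ok(1) F(5,6) R(5)] R(1,2) by linarith
qed

lemma tent_tube:
 assumes ok: "piece_ok k (Tent a b g)" "piece_ok k (Tube n r g')"
  and m: "(u, y, z):path_image (curve k (Tent a b g))" "(u, y, z):path_image (curve k (Tube n r g'))"
 shows "EX l. (u, y, z) = pt l & l:eset (Tent a b g) & l:eset (Tube n r g')"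
proof -
 have g: "abs(rl g) = 1" using ok sgn_abs by auto
 note T = tent_height[OF ok(1) m(1)]
 note R = piece_tube[OF ok(2)]
 note U = tubeD[OF m(2)[simplified] R(1-4)]
 have gp: "0 < rl g' * y" using U(3) rho_bounds[OF R(1-3)] by linarith
 have gg: "rl g = rl g'" by (rule same_sign[OF g R(4), of y]) (use gp T(1) in auto)
 have gy: "rl g' * y = 1" using T(1) U(4) gg by simp
 have z: "z = 0" "abs(u-8 * real n) = of_int r / 100" using U(6)[OF gy] by auto
 have y: "y = rl g" using gy gg sign_cases[OF g] by auto
 have "u = of_int a / 100 | u = of_int b / 100" using T(2) gy gg by simp
 then obtain c where c: "c = a | c = b" "u = of_int c / 100" by blast
 have "rl c = 800 * real n + of_int r | rl c = 800 * real n - of_int r" using z(2) c(2) by (auto simp: abs_if split: if_splits)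
 hence "c = 800 * int n+r | c = 800 * int n-r" by linarith
 thus ?thesis using c z y gg by (intro exI[of _ "(c, g)"]) (auto simp: pt_def)
qed

lemma tube_tube:
 assumes ok: "piece_ok k (Tube n r g)" "piece_ok k (Tube n' r' g')"
  and m: "(u, y, z):path_image (curve k (Tube n r g))" "(u, y, z):path_image (curve k (Tube n' r' g'))"
 shows "Tube n r g = Tube n' r' g'"
proof -
 note R = piece_tube[OF ok(1)] and R' = piece_tube[OF ok(2)]
 note T = tubeD[OF m(1)[simplified] R(1-4)] and T' = tubeD[OF m(2)[simplified] R'(1-4)]
 have "0 < rl g * y" "0 < rl g' * y" using T(3) T'(3) rho_bounds[OF R(1-3)] rho_bounds[OF R'(1-3)] by linarith+
 hence gg: "rl g = rl g'" by (rule same_sign[OF R(4) R'(4), of y])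
 have ab: "abs(u-8 * real n) < 3" "abs(u-8 * real n') < 3"
 proof -
  have "(u-8 * real n)\<^sup>2<=(of_int r / 100)\<^sup>2" "(u-8 * real n')\<^sup>2<=(of_int r' / 100)\<^sup>2" using T(2) T'(2) zero_le_power2[of z] by linarith+
  thus "abs(u-8 * real n) < 3" "abs(u-8 * real n') < 3" using R(1,2) R'(1,2) by (auto dest!: abs_le_square_iff[THEN iffD2])
 qed
 have nn: "n = n'"
 proof (rule ccontr)
  assume "n~=n'"
  hence "real n+1<=real n' | real n'+1<=real n" by linarith
  thus False using ab by auto
 qed
 have "(of_int r / 100 :: real)\<^sup>2 = (of_int r' / 100)\<^sup>2" using T(2) T'(2) nn by simp
 hence "of_int r / 100 = (of_int r' / 100 :: real)" using R(1) R'(1) by (simp add: power2_eq_iff)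
 thus ?thesis using gg nn by simp
qed

lemma piece_inter:
 assumes ok: "piece_ok k p" "piece_ok k q" and c: "compat p q" "compat q p" and ne: "p~=q" "eset p~=eset q"
 shows "path_image (curve k p) Int path_image (curve k q)<=pt ` (eset p Int eset q)"
proof
 fix w assume w: "w:path_image (curve k p) Int path_image (curve k q)"
 obtain u y z where uyz: "w = (u, y, z)" by (cases w) auto
 have m: "(u, y, z):path_image (curve k p)" "(u, y, z):path_image (curve k q)" using w uyz by auto
 have "EX l. w = pt l & l:eset p & l:eset q"
 proof (cases p)
  case p: (Fan a s g)
  show ?thesis
  proof (cases q)
   case q: (Fan a' s' g')
   have "(s, g)~=(s', g') | a~=a'" using ne p q by auto
   show ?thesis
   proof (cases "(s, g) = (s', g')")
    case False
    thus ?thesis using fan_fan[OF ok[unfolded p q] c(1)[unfolded p q] _ m[unfolded p q]] p q uyz by (intro exI[of _ "(a, 0)"]) auto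
   next
    case True
    thus ?thesis using c(1) `_ | a ~= a'` p q by auto
   qed
  next
   case q: (Tent a' b' g')
   show ?thesis using fan_tent[OF ok[unfolded p q] m[unfolded p q]] p q uyz by (intro exI[of _ "(s, g)"]) auto
  next
   case q: (Tube n r g')
   show ?thesis using fan_tube[OF ok[unfolded p q] m[unfolded p q]] by blast
  qed
 next
  case p: (Tent a b g)
  show ?thesis
  proof (cases q)
   case q: (Fan a' s' g')
   show ?thesis using fan_tent[OF ok(2,1)[unfolded p q] m(2,1)[unfolded p q]] p q uyz by (intro exI[of _ "(s', g')"]) auto
  next
   case q: (Tent a' b' g')
   show ?thesis using tent_tent[OF ok[unfolded p q] c(1)[unfolded p q] m[unfolded p q]] by blast
  next
   case q: (Tube n r g')
   show ?thesis using tent_tube[OF ok[unfolded p q] m[unfolded p q]] unfolding p q uyz .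
  qed
 next
  case p: (Tube n r g)
  show ?thesis
  proof (cases q)
   case q: (Fan a' s' g')
   show ?thesis using fan_tube[OF ok(2,1)[unfolded p q] m(2,1)[unfolded p q]] by blast
  next
   case q: (Tent a' b' g')
   show ?thesis using tent_tube[OF ok(2,1)[unfolded p q] m(2,1)[unfolded p q]] unfolding p q uyz by blast
  next
   case q: (Tube n' r' g')
   show ?thesis using tube_tube[OF ok[unfolded p q] m[unfolded p q]] ne p q by blast
  qed
 qed
 thus "w:pt ` (eset p Int eset q)" by blast
qed

lemma drawing_of_pieces:
 assumes ok': "!!p. p:P' ==> piece_ok k p" and c': "!!p q. p:P' ==> q:P' ==> p~=q ==> compat p q"
 shows "drawable_on (\<Union>(eset ` P'), eset ` P') (handle_surface k)"
proof -
 obtain P where P: "P<=P'" "inj_on eset P" "eset ` P' = eset ` P" 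
 proof -
  have "EX Q. Q<=P' & inj_on eset Q & eset ` P' = eset ` Q" using subset_image_inj[of "eset ` P'" eset P'] by simp
  thus ?thesis using that by (elim exE conjE)
 qed
 note ok = ok'[OF subsetD[OF P(1)]] and c = c'[OF subsetD[OF P(1)] subsetD[OF P(1)]] and inj = P(2)
 define sel where "sel = the_inv_into P eset"
 have sel: "sel e:P" "eset (sel e) = e" if "e:eset ` P" for e
  using the_inv_into_into[OF inj that order_refl] f_the_inv_into_f[OF inj that] unfolding sel_def by auto
 have inter: "path_image (curve k p) Int path_image (curve k q) = pt ` (eset p Int eset q)" if pq: "p:P" "q:P" "p~=q" for p q
 proof
  have "eset p~=eset q" using inj pq unfolding inj_on_def by blast
  thus "path_image (curve k p) Int path_image (curve k q)<=pt ` (eset p Int eset q)"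
   using piece_inter[OF ok[OF pq(1)] ok[OF pq(2)] c c] pq by simp
  have "pt ` eset a<=path_image (curve k a)" if "a:P" for a
   using piece_arc[OF ok[OF that]] pathstart_in_path_image[of "curve k a"] pathfinish_in_path_image[of "curve k a"] by auto
  thus "pt ` (eset p Int eset q)<=path_image (curve k p) Int path_image (curve k q)" using pq by blast
 qed
 have ends_in: "pt ` eset a<=path_image (curve k a)" if "a:P" for a
  using piece_arc[OF ok[OF that]] pathstart_in_path_image[of "curve k a"] pathfinish_in_path_image[of "curve k a"] by auto
 have "drawing_on (\<Union>(eset ` P), eset ` P) (handle_surface k) pt (%e. curve k (sel e))"
  unfolding drawing_on_def fst_conv snd_conv
 proof (intro conjI ballI impI)
  show "inj_on pt (\<Union>(eset ` P))" unfolding inj_on_def by (simp add: pt_inj)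
  show "pt ` (\<Union>(eset ` P))<=handle_surface k" using ends_in piece_surface[OF ok] by blast
  fix e assume e: "e:eset ` P"
  note s = sel[OF e]
  show "arc (curve k (sel e))" by (rule piece_arc(1)[OF ok[OF s(1)]])
  show "path_image (curve k (sel e))<=handle_surface k" by (rule piece_surface[OF ok[OF s(1)]])
  have "{pathstart (curve k (sel e)), pathfinish (curve k (sel e))} = pt ` eset (sel e)"
   using piece_arc[OF ok[OF s(1)]] by simp
  thus "{pathstart (curve k (sel e)), pathfinish (curve k (sel e))} = pt ` e" unfolding s(2) .
  show "path_image (curve k (sel e)) Int pt ` (\<Union>(eset ` P)) = pt ` e"
  proof
   show "pt ` e<=path_image (curve k (sel e)) Int pt ` (\<Union>(eset ` P))" using ends_in[OF s(1)] e unfolding s(2) by blast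
   show "path_image (curve k (sel e)) Int pt ` (\<Union>(eset ` P))<=pt ` e"
   proof
    fix w assume w: "w:path_image (curve k (sel e)) Int pt ` (\<Union>(eset ` P))"
    then obtain q l where q: "q:P" "l:eset q" "w = pt l" by blast
    show "w:pt ` e"
    proof (cases "q = sel e")
     case True
     thus ?thesis using q s(2) by blast
    next
     case False
     have "w:path_image (curve k q)" using ends_in[OF q(1)] q by blast
     hence "w:pt ` (eset (sel e) Int eset q)" using inter[OF s(1) q(1)] False w by blast
     thus ?thesis unfolding s(2) by blast
    qed
   qed
  qed
  fix f assume f: "f:eset ` P" "e~=f"
  note t = sel[OF f(1)]
  have "sel e~=sel f" using s(2) t(2) f(2) by metis
  thus "path_image (curve k (sel e)) Int path_image (curve k (sel f)) = pt ` (e Int f)"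
   using inter[OF s(1) t(1)] unfolding s(2) t(2) by blast
 qed
 thus ?thesis unfolding drawable_on_def P(3) by blast
qed

subsection \<open>Checking book drawings\<close>

text \<open>A strand \<open>(u, w, g, ps)\<close> is the edge from \<open>u\<close> to \<open>w\<close>, drawn on the side \<open>g\<close> through the ports \<open>ps\<close>. After the first fan,
tents and tube passages alternate.\<close>

type_synonym strand = "nat\<times>nat\<times>int\<times>int list"

fun mid :: "int => int list => piece list" where
 "mid g (a # b # ps) = Tent (min a b) (max a b) g #
 (case ps of [] => [] | c # _ => Tube (nat ((b + c) div 1600)) \<bar>b-800*((b + c) div 1600)\<bar> g # mid g ps)"
| "mid g _ = []"

fun labels :: "int list => strand => (int\<times>int) list" where
 "labels xs (u, w, g, ps) = (xs ! u, 0) # map (%s. (s, g)) ps @ [(xs ! w, 0)]"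

fun pieces :: "int list => strand => piece list" where
 "pieces xs (u, w, g, ps) = Fan (xs ! u) (hd ps) g # mid g ps @ [Fan (xs ! w) (last ps) g]"

fun chain :: "(int\<times>int) list => piece list => bool" where
 "chain (l # l' # ls) (q # qs) \<longleftrightarrow> (ends q = (l, l') | ends q = (l', l)) & chain (l' # ls) qs"
| "chain (l # l' # ls) [] \<longleftrightarrow> False"
| "chain _ _ \<longleftrightarrow> True"

lemma chain_steps: "chain ls qs ==> steps ls<=eset ` set qs"
proof (induction ls qs rule: chain.induct)
 case (1 l l' ls q qs)
 have "{l, l'} = eset q" using 1 by auto
 thus ?case using 1 by auto
qed auto

definition book_ok :: "nat => (nat\<times>nat) list => int list => strand list => bool" where
 "book_ok k es xs ss \<longleftrightarrow> length xs = length es & distinct xs &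
 distinct (concat (map (%(u, w, g, ps). map (%s. (s, g)) ps) ss)) &
 map (%(u, w, g, ps). (u, w)) ss =
 filter (%(i, j). i < j & sh es i j) (List.product [0..<length es] [0..<length es]) &
 list_all (%i. list_ex (%(u, w, g, ps). u = i | w = i) ss) [0..<length es] &
 list_all (%(u, w, g, ps). sgn_ok g & chain (labels xs (u, w, g, ps)) (pieces xs (u, w, g, ps))) ss &
 list_all (piece_ok k) (concat (map (pieces xs) ss)) &
 sorted_wrt (%p q. compat p q & compat q p) (concat (map (pieces xs) ss))"

lemma sorted_wrt_sym:
 assumes "sorted_wrt (%p q. R p q & R q p) xs" "p:set xs" "q:set xs" "p~=q"
 shows "R p q"
 using assms by (induction xs) auto

lemma concat_disjoint: "distinct (concat L) ==> i < length L ==> j < length L ==> i~=j ==> set (L ! i) Int set (L ! j) = {}"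
proof (induction L arbitrary: i j)
 case (Cons a L)
 have a: "set a Int set (L ! m) = {}" if "m < length L" for m using Cons.prems(1) nth_mem[OF that] by auto
 show ?case
 proof (cases i; cases j)
  fix m n assume "i = Suc m" "j = Suc n"
  thus ?thesis using Cons by simp
 qed (use a Cons.prems in auto)
qed simp

lemma insert2_Int:
 assumes "A Int B = {}" "a~:B" "b~:B" "c~:A" "d~:A"
 shows "insert a (insert b A) Int insert c (insert d B) = {a, b} Int {c, d}"
 using assms by blast

text \<open>The pieces form a drawing of a graph on vertices and ports, in which the strands are paths.\<close>

theorem drawable_book:
 assumes ok: "book_ok k es xs ss"
 shows "drawable_on (ilg es) (handle_surface k)"
proof -
 let ?n = "length es"
 define P where "P = set (concat (map (pieces xs) ss))"
 define f where "f i = (xs ! i, 0 :: int)" for i :: nat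
 have len: "length xs = ?n" and dx: "distinct xs"
  and dp: "distinct (concat (map (%(u, w, g, ps). map (%s. (s, g)) ps) ss))"
  and es: "map (%(u, w, g, ps). (u, w)) ss = filter (%(i, j). i < j & sh es i j) (List.product [0..<?n] [0..<?n])"
  and cov: "!!i. i < ?n ==> EX (u, w, g, ps):set ss. u = i | w = i"
  and ch: "!!u w g ps. (u, w, g, ps):set ss ==> sgn_ok g & chain (labels xs (u, w, g, ps)) (pieces xs (u, w, g, ps))"
  and pok: "!!p. p:P ==> piece_ok k p"
  and com: "sorted_wrt (%p q. compat p q & compat q p) (concat (map (pieces xs) ss))"
  using ok unfolding book_ok_def list_all_iff list_ex_iff P_def by auto
 have H: "drawable_on (\<Union>(eset ` P), eset ` P) (handle_surface k)"
  by (rule drawing_of_pieces[OF pok sorted_wrt_sym[OF com]]) (auto simp: P_def)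
 have st: "u < ?n & w < ?n & u < w & sh es u w" if "(u, w, g, ps):set ss" for u w g ps
 proof -
  have "(u, w):set (map (%(u, w, g, ps). (u, w)) ss)" using that by force
  thus ?thesis unfolding es by auto
 qed
 have finj: "f i = f j \<longleftrightarrow> i = j" if "i < ?n" "j < ?n" for i j
  unfolding f_def using nth_eq_iff_index_eq[OF dx] len that by simp
 have ex: "EX s. s:set ss & e = {fst s, fst (snd s)}" if e: "e:snd (ilg es)" for e
 proof -
  obtain i j where ij: "e = {i, j}" "i < ?n" "j < ?n" "sh es i j" using e unfolding ilg_def by auto
  define a b where "a = min i j" and "b = max i j"
  have "a < b" "sh es a b" "a < ?n" "b < ?n" "e = {a, b}" using ij sh_sym[of es i j] unfolding a_def b_def by (auto simp: sh_def min_def max_def)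
  hence "(a, b):set (map (%(u, w, g, ps). (u, w)) ss)" unfolding es by simp
  thus ?thesis using `e = {a, b}` by force
 qed
 define str where "str e = (SOME s. s:set ss & e = {fst s, fst (snd s)})" for e :: "nat set"
 have str: "str e:set ss" "e = {fst (str e), fst (snd (str e))}" if "e:snd (ilg es)" for e
  using someI_ex[OF ex[OF that]] unfolding str_def by auto
 have pieces_P: "set (pieces xs s)<=P" if "s:set ss" for s using that unfolding P_def by auto
 have steps_P: "steps (labels xs s)<=eset ` P" if s: "s:set ss" for s
 proof -
  obtain u w g ps where "s = (u, w, g, ps)" by (cases s) auto
  hence "chain (labels xs s) (pieces xs s)" using ch s by blast
  thus ?thesis using chain_steps pieces_P[OF s] by blast
 qed
 have lab2: "2<=length (labels xs s)" for s by (cases s) auto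
 show ?thesis
 proof (rule drawable_subdivision[OF H, where f = f and P = "%e. labels xs (str e)"])
  show "inj_on f (fst (ilg es))" unfolding inj_on_def ilg_def using finj by simp
  show "f ` fst (ilg es)<=fst (\<Union>(eset ` P), eset ` P)"
  proof
   fix l assume "l:f ` fst (ilg es)"
   then obtain i where i: "i < ?n" "l = f i" unfolding ilg_def by auto
   obtain s where s: "s:set ss" "fst s = i | fst (snd s) = i" using cov[OF i(1)] by auto
   have "f i:set (labels xs s)" using s(2) unfolding f_def by (cases s) auto
   hence "f i:\<Union>(steps (labels xs s))" unfolding steps_cover[OF lab2] .
   thus "l:fst (\<Union>(eset ` P), eset ` P)" using steps_P[OF s(1)] i by auto
  qed
  show "e<=fst (\<Union>(eset ` P), eset ` P)" if "e:snd (\<Union>(eset ` P), eset ` P)" for e using that by auto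
  show "e<=fst (ilg es) & card e = 2" if "e:snd (ilg es)" for e using that unfolding ilg_def sh_def by (auto simp: card_2_iff)
  fix e assume e: "e:snd (ilg es)"
  obtain u w g ps where s: "str e = (u, w, g, ps)" by (cases "str e") auto
  have sin: "(u, w, g, ps):set ss" and euw: "e = {u, w}" using str[OF e] unfolding s by auto
  note uw = st[OF sin]
  have g: "g~=0" using ch[OF sin] unfolding sgn_ok_def by auto
  have dps: "distinct ps"
  proof -
   have "distinct (map (%s. (s, g)) ps)" using dp sin unfolding distinct_concat_iff by (force simp: distinct_map)
   thus ?thesis by (simp add: distinct_map)
  qed
  have fne: "f u~=f w" using uw finj by simp
  have setl: "set (labels xs (str e)) = insert (f u) (insert (f w) ((%s. (s, g)) ` set ps))" unfolding s f_def by auto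
  show "2<=length (labels xs (str e)) & distinct (labels xs (str e)) & steps (labels xs (str e))<=snd (\<Union>(eset ` P), eset ` P) &
 {hd (labels xs (str e)), last (labels xs (str e))} = f ` e & set (labels xs (str e)) Int f ` fst (ilg es) = f ` e"
  proof (intro conjI)
   show "2<=length (labels xs (str e))" by (rule lab2)
   show "distinct (labels xs (str e))" using dps fne g unfolding s f_def by (auto simp: distinct_map inj_on_def)
   show "steps (labels xs (str e))<=snd (\<Union>(eset ` P), eset ` P)" using steps_P[OF str(1)[OF e]] by simp
   show "{hd (labels xs (str e)), last (labels xs (str e))} = f ` e" unfolding s unfolding euw f_def by simp
   show "set (labels xs (str e)) Int f ` fst (ilg es) = f ` e"
    unfolding setl unfolding euw using g uw by (auto simp: f_def ilg_def)
  qed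
  fix e' assume e': "e':snd (ilg es)" "e~=e'"
  obtain u' w' g' ps' where s': "str e' = (u', w', g', ps')" by (cases "str e'") auto
  have sin': "(u', w', g', ps'):set ss" and euw': "e' = {u', w'}" using str[OF e'(1)] unfolding s' by auto
  note uw' = st[OF sin']
  have g': "g'~=0" using ch[OF sin'] unfolding sgn_ok_def by auto
  have setl': "set (labels xs (str e')) = insert (f u') (insert (f w') ((%s. (s, g')) ` set ps'))" unfolding s' f_def by auto
  have dj: "(%s. (s, g)) ` set ps Int (%s. (s, g')) ` set ps' = {}"
  proof -
   obtain a b where ab: "a < length ss" "ss ! a = (u, w, g, ps)" "b < length ss" "ss ! b = (u', w', g', ps')"
    using sin sin' unfolding in_set_conv_nth by blast
   have "a~=b" using ab e' euw euw' by auto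
   let ?L = "map (%(u, w, g, ps). map (%s. (s, g)) ps) ss"
   have "set (?L ! a) Int set (?L ! b) = {}" by (rule concat_disjoint[OF dp]) (use ab `a ~= b` in auto)
   thus ?thesis using ab by auto
  qed
  have fs: "f i~:(%s. (s, h)) ` R" if "h~=0" for i h R using that unfolding f_def by auto
  have "set (labels xs (str e)) Int set (labels xs (str e')) = {f u, f w} Int {f u', f w'}"
   unfolding setl setl' by (rule insert2_Int) (use dj fs[OF g] fs[OF g'] in simp_all)
  also have "\<dots> = f ` {u, w} Int f ` {u', w'}" by simp
  also have "\<dots> = f ` ({u, w} Int {u', w'})"
   by (rule inj_on_image_Int[of f "{..<?n}", symmetric]) (insert finj uw uw', auto simp: inj_on_def)
  finally show "set (labels xs (str e)) Int set (labels xs (str e')) = f ` (e Int e')" unfolding euw euw' .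
 qed
qed

section \<open>The drawings\<close>

definition g122 :: "(nat\<times>nat) list" where
 "g122 = [(0, 1), (0, 2), (0, 3), (0, 4), (1, 3), (1, 4), (2, 3), (2, 4)]"

text \<open>The graph of a product of rings of orders 2, 2, 3, numbered by nonzero components:
\<open>a = 0, b = 1, c = 2, 3, ab = 4, ac = 5, 6, bc = 7, 8\<close>.\<close>

definition g223 :: "(nat\<times>nat) list" where
 "g223 = [(0, 1), (0, 2), (0, 3), (1, 2), (1, 3), (2, 4), (3, 4), (0, 7), (0, 8), (1, 5), (1, 6)]"

lemma drawable_K17: "drawable_on (ilg (bip 1 7)) (handle_surface 1)"
 by (rule drawable_book[where xs = "[-79,1,-339,321,-387,-363,-39]" and ss =
  "[(0,1,1,[-99,-285,285,-9]),(0,2,1,[-79,-345]),(0,3,1,[-89,-295,295,301]),(0,4,-1,[-89,-255,255,-375]),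
 (0,5,-1,[-99,-245,245,-369]),(0,6,1,[-69,-59]),(1,2,-1,[1,-345]),(1,3,1,[-19,311]),(1,4,-1,[-9,-275,275,-387]),
 (1,5,-1,[11,-363]),(1,6,-1,[-19,-49]),(2,3,-1,[-333,-295,295,301]),(2,4,-1,[-339,-285,285,-393]),
 (2,5,-1,[-351,-357]),(2,6,1,[-351,-49]),(3,4,-1,[311,-399]),(3,5,1,[331,-363]),(3,6,1,[321,-29]),
 (4,5,1,[-399,-369]),(4,6,-1,[-381,265,-265,-59]),(5,6,1,[-357,-39])]"])
  code_simp

lemma drawable_K24: "drawable_on (ilg (bip 2 4)) (handle_surface 1)"
 by (rule drawable_book[where xs = "[-359,-371,-347,-89,-335,-379,311,-391]" and ss =
  "[(0,1,1,[-363,-375]),(0,2,-1,[-359,-355]),(0,3,-1,[-363,255,-255,-99]),(0,4,1,[-359,-339]),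
 (1,2,-1,[-371,275,-275,-347]),(1,3,-1,[-367,265,-265,-89]),(1,5,-1,[-375,-379]),(2,3,-1,[-351,-79]),
 (2,6,-1,[-343,-285,285,311]),(3,7,1,[-99,-295,295,-395]),(4,5,1,[-335,-379]),(4,6,-1,[-339,-295,295,301]),
 (4,7,1,[-331,-391]),(5,6,-1,[-383,321]),(5,7,1,[-383,-387]),(6,7,1,[301,-399])]"])
  code_simp

lemma drawable_K33: "drawable_on (ilg (bip 3 3)) (handle_surface 1)"
 by (rule drawable_book[where xs = "[311,-89,-349,401,-389,-364,361,-374,331]" and ss =
  "[(0,1,-1,[311,285,-285,-99]),(0,2,-1,[301,295,-295,-344]),(0,3,1,[301,391]),(0,6,1,[311,361]),(1,2,-1,[-89,-349]),
 (1,4,1,[-89,-275,275,-389]),(1,7,1,[-99,-265,265,-374]),(2,5,-1,[-359,-364]),(2,8,-1,[-354,321]),(3,4,1,[411,-399]),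
 (3,5,1,[401,295,-295,-364]),(3,6,1,[381,371]),(4,5,1,[-394,285,-285,-369]),(4,7,1,[-384,-379]),(5,8,-1,[-369,331]),
 (6,7,-1,[351,-379]),(6,8,1,[351,321]),(7,8,-1,[-374,341])]"])
  code_simp

lemma drawable_W4: "drawable_on (ilg (g122)) (handle_surface 1)"
 by (rule drawable_book[where xs = "[-79,-374,341,381,311,-349,-359,-389]" and ss =
  "[(0,1,1,[-99,-265,265,-369]),(0,2,-1,[-89,331]),(0,3,-1,[-99,371]),(0,4,-1,[-79,301]),(0,5,-1,[-69,295,-295,-344]),
 (1,2,1,[-374,351]),(1,3,1,[-379,361]),(1,6,-1,[-374,-364]),(1,7,-1,[-379,-384]),(2,3,-1,[341,361]),
 (2,4,1,[331,321]),(2,6,1,[341,275,-275,-364]),(3,5,-1,[381,-349]),(3,7,-1,[391,-399]),(4,5,1,[301,295,-295,-354]),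
 (4,6,1,[311,285,-285,-359]),(5,7,-1,[-354,-394]),(6,7,-1,[-359,-389])]"])
  code_simp

lemma drawable_K18: "drawable_on (ilg (bip 1 8)) (handle_surface 2)"
 by (rule drawable_book[where xs = "[6,34,-36,721,761,-78,-379,321]" and ss =
  "[(0,1,1,[6,20]),(0,2,-1,[-8,-15]),(0,3,-1,[13,275,-275,721]),(0,4,1,[-1,545,1055,771]),(0,5,1,[-8,-64]),
 (0,6,-1,[6,285,-285,-369]),(0,7,-1,[-1,311]),(1,2,-1,[27,255,-255,-50]),(1,3,-1,[20,265,-265,711]),
 (1,4,1,[27,535,1065,761]),(1,5,1,[48,285,-285,-99]),(1,6,1,[41,295,-295,-389]),(1,7,1,[34,301]),(2,3,-1,[-43,701]),
 (2,4,-1,[-36,515,1085,751]),(2,5,-1,[-57,-99]),(2,6,-1,[-29,505,1095,-399]),(2,7,-1,[-22,321]),(3,4,1,[721,741]),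
 (3,5,1,[701,-78]),(3,6,-1,[731,-379]),(3,7,1,[711,1085,515,321]),(4,5,1,[781,1045,555,-71]),(4,6,-1,[741,-389]),
 (4,7,1,[751,1075,525,311]),(5,6,1,[-92,-399]),(5,7,1,[-85,1095,505,331]),(6,7,-1,[-359,-295,295,301])]"])
  code_simp

lemma drawable_K34: "drawable_on (ilg (bip 3 4)) (handle_surface 2)"
 by (rule drawable_book[where xs = "[1151,1121,-19,746,710,321,1181,1211,782,818,-59,-89]" and ss =
  "[(0,1,1,[1141,1131]),(0,2,1,[1151,-245,245,-29]),(0,3,-1,[1151,-255,255,728]),(0,4,-1,[1161,-265,265,719]),
 (0,8,-1,[1141,-245,245,764]),(1,2,1,[1121,-235,235,-19]),(1,3,1,[1111,755]),(1,5,1,[1101,1095,505,301]),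
 (1,9,-1,[1101,827]),(2,3,1,[-9,225,-225,746]),(2,6,1,[-39,255,-255,1171]),(2,10,-1,[-39,-49]),
 (3,7,1,[728,285,-285,1211]),(3,11,1,[737,-99]),(4,5,-1,[701,321]),(4,6,-1,[710,275,-275,1171]),
 (4,7,1,[710,295,-295,1221]),(4,8,1,[701,515,1085,764]),(5,6,-1,[311,285,-285,1181]),(5,7,-1,[301,295,-295,1211]),
 (5,9,-1,[331,505,1095,836]),(6,7,-1,[1191,1201]),(6,10,1,[1181,-265,265,-59]),(7,11,1,[1201,-275,275,-89]),
 (8,9,-1,[773,235,-235,818]),(8,10,-1,[791,-59]),(8,11,-1,[782,225,-225,-99]),(9,10,-1,[800,-69]),
 (9,11,-1,[809,-89]),(10,11,1,[-69,-79])]"])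
  code_simp

lemma drawable_G11: "drawable_on (ilg (g223)) (handle_surface 2)"
 by (rule drawable_book[where xs = "[1131,-27,18,711,351,-54,331,-90,311,-72,1181]" and ss =
  "[(0,1,-1,[1111,1085,515,-27]),(0,2,-1,[1141,-285,285,27]),(0,3,1,[1101,1095,505,721]),(0,4,-1,[1101,1095,505,361]),
 (0,7,-1,[1131,-90]),(0,8,-1,[1151,-295,295,301]),(0,9,-1,[1121,-81]),(0,10,1,[1111,1161]),(1,2,-1,[-18,-9]),
 (1,3,-1,[-36,701]),(1,5,-1,[-45,-54]),(1,7,1,[-36,285,-285,-99]),(1,8,1,[-45,311]),(2,4,-1,[0,351]),
 (2,6,-1,[9,321]),(2,7,-1,[36,275,-275,-99]),(2,8,-1,[18,311]),(3,4,1,[701,525,1075,361]),(3,5,-1,[711,-63]),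
 (3,9,-1,[721,-72]),(3,10,1,[711,515,1085,1171]),(4,6,-1,[341,331]),(4,9,1,[341,-72]),(4,10,1,[351,1181]),
 (5,6,1,[-63,321]),(7,8,1,[-90,-295,295,301]),(9,10,1,[-81,1191])]"])
  code_simp

lemma drawable_K26: "drawable_on (ilg (bip 2 6)) (handle_surface 2)"
 by (rule drawable_book[where xs = "[311,-379,-59,-89,1261,-19,1171,1211,751,791,1121,721]" and ss =
  "[(0,1,-1,[301,295,-295,-369]),(0,2,1,[301,-69]),(0,3,1,[311,-79]),(0,4,1,[321,1241]),(0,5,-1,[311,-19]),
 (0,6,-1,[321,505,1095,1161]),(1,2,1,[-389,-295,295,-59]),(1,3,-1,[-389,-99]),(1,4,1,[-399,1281]),
 (1,5,-1,[-379,-285,285,-9]),(1,7,-1,[-399,1201]),(2,3,-1,[-69,-79]),(2,4,1,[-49,285,-285,1271]),(2,5,-1,[-49,-39]),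
 (2,8,-1,[-59,525,1075,751]),(3,4,1,[-89,1251]),(3,5,1,[-99,-265,265,-29]),(3,9,-1,[-89,535,1065,781]),
 (4,5,1,[1261,-275,275,-39]),(4,10,1,[1231,505,1095,1101]),(5,11,-1,[-29,515,1085,721]),(6,7,1,[1161,1191]),
 (6,8,1,[1151,545,1055,751]),(6,9,-1,[1181,555,1045,801]),(6,10,-1,[1151,1101]),(6,11,-1,[1171,711]),
 (7,8,1,[1201,535,1065,741]),(7,9,-1,[1191,545,1055,791]),(7,10,1,[1221,515,1085,1111]),(7,11,1,[1211,525,1075,711]),
 (8,9,-1,[761,771]),(8,10,1,[761,1045,555,1141]),(8,11,-1,[741,731]),(9,10,1,[771,1035,565,1131]),
 (9,11,-1,[811,1035,565,701]),(10,11,1,[1121,701])]"])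
  code_simp

section \<open>Line graphs and genus\<close>

lemma genus_eq_2: "genus G = 2 \<longleftrightarrow> drawable_on G (handle_surface 2) & ~drawable_on G (handle_surface 0) & ~drawable_on G (handle_surface 1)"
proof -
 let ?S = "{enat k | k. drawable_on G (handle_surface k)}"
 have two: "(2::enat) = enat 2" by (simp add: numeral_eq_enat)
 have le: "genus G<=enat k" if "drawable_on G (handle_surface k)" for k unfolding genus_def by (rule Inf_lower) (use that in auto)
 have "drawable_on G (handle_surface k)" if "genus G = enat k" for k
 proof -
  have "?S~={}"
  proof
   assume "?S = {}"
   hence "genus G = Inf {}" unfolding genus_def by simp
   thus False using that by (simp add: Inf_enat_def)
  qed
  hence "Inf ?S:?S" unfolding Inf_enat_def using LeastI_ex[of "%x. x:?S"] by auto
  thus ?thesis using that unfolding genus_def by auto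
 qed
 moreover have "EX k. genus G = enat k" if "drawable_on G (handle_surface 2)" using le[OF that] by (cases "genus G") auto
 ultimately have dr: "genus G = enat k ==> drawable_on G (handle_surface k)"
  and ex: "drawable_on G (handle_surface 2) ==> EX k. genus G = enat k" for k by blast+
 show ?thesis
  unfolding two
 proof
  assume g: "genus G = enat 2"
  show "drawable_on G (handle_surface 2) & ~drawable_on G (handle_surface 0) & ~drawable_on G (handle_surface 1)"
   using dr[OF g] le[of 0] le[of 1] g by auto
 next
  assume d: "drawable_on G (handle_surface 2) & ~drawable_on G (handle_surface 0) & ~drawable_on G (handle_surface 1)"
  then obtain m where m: "genus G = enat m" using ex by blast
  have "m<=2" using le[of 2] d m by simp
  moreover have "m~=0" "m~=1" using dr[OF m] d by (metis, metis)
  ultimately have "m = 2" by linarith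
  thus "genus G = enat 2" using m by simp
 qed
qed

definition graph_like :: "'v ugraph => bool" where
 "graph_like G \<longleftrightarrow> (ALL e:snd G. e<=fst G & card e = 2)"

lemma line_graph_simps:
 "e:snd (line_graph G) ==> e<=fst (line_graph G) & card e = 2" "fst (line_graph G) = snd G"
 unfolding line_graph_def by (auto simp: card_2_iff)

lemma ilg_simps:
 "e:snd (ilg es) ==> e<=fst (ilg es) & card e = 2" "fst (ilg es) = {..<length es}"
 unfolding ilg_def sh_def by (auto simp: card_2_iff)

text \<open>Listed edges that share an endpoint are mapped to edges of \<open>G\<close> that do, so \<open>ilg es\<close> is a subgraph of the
line graph of \<open>G\<close>.\<close>

lemma ilg_from_line_graph:
 assumes d: "drawable_on (line_graph G) S"
  and e: "!!i. i < length es ==> {g (fst (es ! i)), g (snd (es ! i))}:snd G"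
  and inj: "inj_on (%i. {g (fst (es ! i)), g (snd (es ! i))}) {..<length es}"
 shows "drawable_on (ilg es) S"
proof (rule drawable_subgraph[OF d])
 let ?F = "%i. {g (fst (es ! i)), g (snd (es ! i))}"
 show "inj_on ?F (fst (ilg es))" unfolding ilg_simps(2) by (rule inj)
 show "?F ` fst (ilg es)<=fst (line_graph G)" unfolding ilg_simps(2) line_graph_simps(2) using e by blast
 show "e<=fst (line_graph G)" if "e:snd (line_graph G)" for e using line_graph_simps(1)[OF that] by simp
 show "e<=fst (ilg es) & card e = 2" if "e:snd (ilg es)" for e by (rule ilg_simps(1)[OF that])
 show "?F ` e:snd (line_graph G)" if ein: "e:snd (ilg es)" for e
 proof -
  obtain i j where ij: "e = {i, j}" "i < length es" "j < length es" "sh es i j" using ein unfolding ilg_def by auto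
  have "?F i~=?F j" using inj ij unfolding inj_on_def sh_def by blast
  moreover have "?F i Int ?F j~={}" using ij(4) unfolding sh_def share_def by auto
  ultimately have "{?F i, ?F j}:snd (line_graph G)" unfolding line_graph_def snd_conv using e[OF ij(2)] e[OF ij(3)] by blast
  thus ?thesis using ij by simp
 qed
qed

lemma line_graph_from_ilg:
 assumes d: "drawable_on (ilg es) S" and G: "graph_like G" and f: "inj_on f (fst G)"
  and e: "!!e. e:snd G ==> EX (a, b):set es. f ` e = {a, b}"
 shows "drawable_on (line_graph G) S"
proof -
 have "ALL e:snd G. EX i. i < length es & f ` e = {fst (es ! i), snd (es ! i)}"
 proof
  fix x assume "x:snd G"
  then obtain p where p: "p:set es" "f ` x = {fst p, snd p}" using e by fastforce
  thus "EX i. i < length es & f ` x = {fst (es ! i), snd (es ! i)}" by (metis in_set_conv_nth)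
 qed
 then obtain h where h: "!!e. e:snd G ==> h e < length es & f ` e = {fst (es ! h e), snd (es ! h e)}" by metis
 have sub: "x<=fst G" if "x:snd G" for x using G that unfolding graph_like_def by blast
 have hinj: "x = y" if "x:snd G" "y:snd G" "h x = h y" for x y
 proof -
  have "f ` x = f ` y" using h that by metis
  thus ?thesis using inj_on_image_eq_iff[OF f sub[OF that(1)] sub[OF that(2)]] by simp
 qed
 show ?thesis
 proof (rule drawable_subgraph[OF d, where f = h])
  show "inj_on h (fst (line_graph G))" unfolding line_graph_simps(2) inj_on_def using hinj by blast
  show "h ` fst (line_graph G)<=fst (ilg es)" unfolding line_graph_simps(2) ilg_simps(2) using h by auto
  show "e<=fst (ilg es)" if "e:snd (ilg es)" for e using ilg_simps(1)[OF that] by simp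
  show "e<=fst (line_graph G) & card e = 2" if "e:snd (line_graph G)" for e by (rule line_graph_simps(1)[OF that])
  show "h ` e:snd (ilg es)" if ein: "e:snd (line_graph G)" for e
  proof -
   obtain x y where xy: "e = {x, y}" "x:snd G" "y:snd G" "x~=y" "x Int y~={}" using ein unfolding line_graph_def by auto
   obtain v where "v:x" "v:y" using xy(5) by blast
   hence "f v:{fst (es ! h x), snd (es ! h x)}" "f v:{fst (es ! h y), snd (es ! h y)}" using h[OF xy(2)] h[OF xy(3)] by blast+
   hence "share (es ! h x) (es ! h y)" unfolding share_def by auto
   moreover have "h x~=h y" using hinj xy by blast
   ultimately show ?thesis using h[OF xy(2)] h[OF xy(3)] unfolding xy(1) ilg_def sh_def by auto
  qed
 qed
qed

lemma length_bip: "length (bip m n) = m * n"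
 unfolding bip_def by simp

lemma nth_bip: "i < m * n ==> bip m n ! i = (i div n, m+i mod n)"
proof -
 assume i: "i < m * n"
 hence "0 < n" by (cases n) auto
 hence d: "i div n < m" "i mod n < n" using i by (auto simp: less_mult_imp_div_less)
 have "bip m n ! i = ([0..<m] ! (i div length [m..<m+n]), [m..<m+n] ! (i mod length [m..<m+n]))"
  unfolding bip_def by (rule List.product_nth) (use i in simp)
 thus ?thesis using d by simp
qed

lemma set_bip: "set (bip m n) = {0..<m}\<times>{m..<m+n}"
 unfolding bip_def by simp

lemma bip_from_line_graph:
 assumes d: "drawable_on (line_graph G) S" and fin: "finite P" "finite Q" and dj: "P Int Q = {}"
  and mn: "m <= card P" "n <= card Q" and e: "!!p q. p:P ==> q:Q ==> {p, q}:snd G"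
 shows "drawable_on (ilg (bip m n)) S"
proof -
 obtain f where f: "f ` {..<m}<=P" "inj_on f {..<m}" using card_le_inj[of "{..<m}" P] fin mn by auto
 obtain h where h: "h ` {..<n}<=Q" "inj_on h {..<n}" using card_le_inj[of "{..<n}" Q] fin mn by auto
 define g where "g i = (if i < m then f i else h (i-m))" for i
 have gi: "g (fst (bip m n ! i)) = f (i div n)" "g (snd (bip m n ! i)) = h (i mod n)" "i div n < m" "i mod n < n" if i: "i < m * n" for i
 proof -
  have "0 < n" using i by (cases n) auto
  thus "i div n < m" "i mod n < n" using i by (auto simp: less_mult_imp_div_less)
  thus "g (fst (bip m n ! i)) = f (i div n)" "g (snd (bip m n ! i)) = h (i mod n)" unfolding nth_bip[OF i] g_def by auto
 qed
 show ?thesis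
 proof (rule ilg_from_line_graph[OF d, where g = g])
  show "{g (fst (bip m n ! i)), g (snd (bip m n ! i))}:snd G" if "i < length (bip m n)" for i
  proof -
   have i: "i < m * n" using that unfolding length_bip .
   have "f (i div n):P" "h (i mod n):Q" using gi(3,4)[OF i] f(1) h(1) by auto
   thus ?thesis unfolding gi(1,2)[OF i] by (rule e)
  qed
  show "inj_on (%i. {g (fst (bip m n ! i)), g (snd (bip m n ! i))}) {..<length (bip m n)}"
  proof (rule inj_onI)
   fix i j assume "i:{..<length (bip m n)}" "j:{..<length (bip m n)}"
    and eq: "{g (fst (bip m n ! i)), g (snd (bip m n ! i))} = {g (fst (bip m n ! j)), g (snd (bip m n ! j))}"
   hence ij: "i < m * n" "j < m * n" unfolding length_bip by auto
   note gi = gi[OF ij(1)] and gj = gi[OF ij(2)]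
   have in_PQ: "f (i div n):P" "f (j div n):P" "h (i mod n):Q" "h (j mod n):Q" using gi gj f(1) h(1) by auto
   have "f (i div n) = f (j div n)" "h (i mod n) = h (j mod n)"
    using eq in_PQ dj unfolding gi(1,2) gj(1,2) doubleton_eq_iff by auto
   hence "i div n = j div n" "i mod n = j mod n" using f(2) h(2) gi gj unfolding inj_on_def by auto
   thus "i = j" by (metis div_mult_mod_eq)
  qed
 qed
qed

lemma line_graph_from_bip:
 assumes d: "drawable_on (ilg (bip m n)) S" and G: "graph_like G" and fin: "finite P" "finite Q" and dj: "P Int Q = {}"
  and V: "fst G<=P Un Q" and mn: "card P<=m" "card Q<=n" and e: "!!e. e:snd G ==> EX p:P. EX q:Q. e = {p, q}"
 shows "drawable_on (line_graph G) S"
proof -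
 obtain f where f: "f ` P<={..<m}" "inj_on f P" using card_le_inj[of P "{..<m}"] fin mn by auto
 obtain h where h: "h ` Q<={..<n}" "inj_on h Q" using card_le_inj[of Q "{..<n}"] fin mn by auto
 define g where "g x = (if x:P then f x else m+h x)" for x
 have gP: "g x = f x" "g x < m" if "x:P" for x using that f(1) unfolding g_def by auto
 have gQ: "g x = m+h x" "h x < n" if "x:Q" for x using that h(1) dj unfolding g_def by auto
 show ?thesis
 proof (rule line_graph_from_ilg[OF d G, where f = g])
  have "inj_on g (P Un Q)"
  proof (rule inj_onI)
   fix x y assume "x:P Un Q" "y:P Un Q" "g x = g y"
   thus "x = y" using gP[of x] gP[of y] gQ[of x] gQ[of y] f(2) h(2) unfolding inj_on_def by (metis Un_iff add_left_imp_eq not_add_less1)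
  qed
  thus "inj_on g (fst G)" using V inj_on_subset by blast
  show "EX (a, b):set (bip m n). g ` e = {a, b}" if "e:snd G" for e
  proof -
   obtain p q where "p:P" "q:Q" "e = {p, q}" using e[OF `e : snd G`] by blast
   thus ?thesis using gP[of p] gQ[of q] unfolding set_bip by (intro bexI[of _ "(g p, g q)"]) auto
  qed
 qed
qed

text \<open>Any line graph with at most seven vertices is a subgraph of the one of a star with seven edges, a clique.\<close>

lemma drawable_few_edges:
 assumes "length es<=7"
 shows "drawable_on (ilg es) (handle_surface 1)"
proof (rule drawable_subgraph[OF drawable_K17, where f = id])
 have l7: "length (bip 1 7) = 7" unfolding length_bip by simp
 have sh: "sh (bip 1 7) i j" if "i~=j" "i < 7" "j < 7" for i j
  using that unfolding sh_def share_def by (simp add: nth_bip)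
 show "id ` fst (ilg es)<=fst (ilg (bip 1 7))" unfolding ilg_simps(2) l7 using assms by auto
 show "e<=fst (ilg (bip 1 7))" if "e:snd (ilg (bip 1 7))" for e using ilg_simps(1)[OF that] by simp
 show "e<=fst (ilg es) & card e = 2" if "e:snd (ilg es)" for e by (rule ilg_simps(1)[OF that])
 show "id ` e:snd (ilg (bip 1 7))" if e: "e:snd (ilg es)" for e
 proof -
  obtain i j where ij: "e = {i, j}" "i < length es" "j < length es" "sh es i j" using e unfolding ilg_def by auto
  hence "sh (bip 1 7) i j" "i < 7" "j < 7" using sh[of i j] assms by (auto simp: sh_def)
  thus ?thesis unfolding ij(1) ilg_def l7 by auto
 qed
qed simp

section \<open>Nilpotent elements and idempotents\<close>

locale finite_cring = cring R for R (structure) +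
 assumes finite_carrier: "finite (carrier R)" and one_not_zero: "\<one>~=\<zero>"
begin

definition nilp :: "'a => bool" where
 "nilp x \<longleftrightarrow> (EX n::nat. x [^] n = \<zero>)"

abbreviation idem :: "'a => bool" where
 "idem e == e : carrier R & e\<otimes>e = e"

lemma nilp_zero: "nilp \<zero>"
 unfolding nilp_def by (rule exI[of _ 1]) simp

lemma pow_ge: "x : carrier R ==> x [^] (m+n :: nat) = x [^] m\<otimes>x [^] n"
 by (simp add: nat_pow_mult)

lemma nilp_mult: "x : carrier R ==> y : carrier R ==> nilp x ==> nilp (x\<otimes>y)"
 unfolding nilp_def by (metis l_null nat_pow_closed nat_pow_distrib)

lemma idem_pow: "idem e ==> 0 < n ==> e [^] (n::nat) = e"
proof (induction n)
 case (Suc n)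
 thus ?case by (cases "n = 0") auto
qed simp

lemma nilp_idem: "idem e ==> nilp e ==> e = \<zero>"
proof -
 assume e: "idem e" and "nilp e"
 then obtain n :: nat where n: "e [^] n = \<zero>" unfolding nilp_def by blast
 hence "0 < n" using one_not_zero by (cases n) auto
 thus ?thesis using idem_pow[OF e] n by simp
qed

text \<open>The powers of an element repeat, so they contain an idempotent.\<close>

lemma idem_power:
 assumes x: "x : carrier R"
 obtains n :: nat where "0 < n" "idem (x [^] n)"
proof -
 let ?f = "%n::nat. x [^] (n+1)"
 have "~inj_on ?f UNIV"
  using finite_imageD[of ?f UNIV] finite_subset[of "range ?f" "carrier R"] finite_carrier x by auto
 then obtain i j where "?f i = ?f j" "i~=j" unfolding inj_on_def by blast
 then obtain i p :: nat where ip: "0 < i" "0 < p" "x [^] i = x [^] (i+p)"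
 proof (cases i j rule: linorder_cases)
  case less
  thus ?thesis using that[of "i+1" "j-i"] `?f i = ?f j` by simp
 next
  case greater
  thus ?thesis using that[of "j+1" "i-j"] `?f i = ?f j` by simp
 qed simp
 have step: "x [^] (n+p) = x [^] n" if "i<=n" for n
 proof -
  have "n+p = (i+p)+(n-i)" using that by simp
  hence "x [^] (n+p) = x [^] (i+p)\<otimes>x [^] (n-i)" using pow_ge[OF x] by metis
  also have "\<dots> = x [^] (i+(n-i))" unfolding ip(3)[symmetric] using pow_ge[OF x] by metis
  finally show ?thesis using that by simp
 qed
 have steps: "x [^] (i * p+k * p) = x [^] (i * p)" for k
 proof (induction k)
  case (Suc k)
  have "i<=i * p+k * p" using ip by (simp add: trans_le_add1)
  moreover have "i * p+Suc k * p = (i * p+k * p)+p" by simp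
  ultimately show ?case using step Suc by metis
 qed simp
 have "x [^] (i * p)\<otimes>x [^] (i * p) = x [^] (i * p)" using steps[of i] pow_ge[OF x] by metis
 thus ?thesis using that[of "i * p"] ip x by simp
qed

lemma ann_ideal: assumes s: "s : carrier R" shows "ideal (ann R s) R"
proof (rule idealI[OF ring_axioms])
 show "subgroup (ann R s) (add_monoid R)"
 proof (rule add.subgroupI)
  show "ann R s~={}" unfolding ann_def using s by auto
  show "\<ominus>a:ann R s" if "a:ann R s" for a using that s unfolding ann_def by (auto simp: r_minus)
  show "a\<oplus>b:ann R s" if "a:ann R s" "b:ann R s" for a b using that s unfolding ann_def by (auto simp: r_distr)
 qed (auto simp: ann_def)
 show "x\<otimes>a:ann R s" if "a:ann R s" "x : carrier R" for a x
  using that s m_lcomm[of s x a] unfolding ann_def by auto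
 thus "a\<otimes>x:ann R s" if "a:ann R s" "x : carrier R" for a x
  using that m_comm[of a x] unfolding ann_def by auto
qed

lemma nilp_meets:
 assumes s: "s : carrier R" "nilp s" and J: "ideal J R" "J~={\<zero>}"
 obtains z where "z:J" "z~=\<zero>" "s\<otimes>z = \<zero>"
proof -
 interpret J: ideal J R by (rule J(1))
 obtain y where y: "y:J" "y~=\<zero>" using J(2) J.a_closed additive_subgroup.zero_closed[OF J.is_additive_subgroup] by blast
 have yc: "y : carrier R" using y J.a_Hcarr by blast
 obtain n :: nat where n: "s [^] n = \<zero>" using s unfolding nilp_def by blast
 define k where "k = (LEAST n::nat. s [^] n\<otimes>y = \<zero>)"
 have k: "s [^] k\<otimes>y = \<zero>" unfolding k_def by (rule LeastI[of _ n]) (use n yc in simp)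
 have "k~=0" using k y yc by (auto intro: ccontr)
 then obtain l where l: "k = Suc l" by (cases k) auto
 have "s [^] l\<otimes>y~=\<zero>" using not_less_Least[of l "%n. s [^] n\<otimes>y = \<zero>"] l unfolding k_def by auto
 moreover have "s [^] l\<otimes>y:J" using J.I_l_closed[OF y(1)] s by simp
 moreover have "s\<otimes>(s [^] l\<otimes>y) = \<zero>" using k s yc unfolding l by (simp add: m_assoc[symmetric] m_comm)
 ultimately show ?thesis using that by blast
qed

text \<open>A non-nilpotent element has a nonzero idempotent power, and the ideal generated by this power misses the
annihilator. If \<open>s\<close> is nilpotent, a nonzero element of an ideal is multiplied by the last power of \<open>s\<close> that does not kill it.\<close>

lemma essential_ann: assumes s: "s : carrier R" shows "essential_ideal (ann R s) R \<longleftrightarrow> nilp s"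
proof
 assume n: "nilp s"
 show "essential_ideal (ann R s) R"
  unfolding essential_ideal_def
 proof (intro conjI allI impI)
  show "ideal (ann R s) R" by (rule ann_ideal[OF s])
  fix J assume J: "ideal J R" "J~={\<zero>}"
  obtain z where "z:J" "z~=\<zero>" "s\<otimes>z = \<zero>" using nilp_meets[OF s n J] .
  moreover have "z : carrier R" using `z : J` J(1) ideal.Icarr by metis
  ultimately have "z:ann R s Int J" unfolding ann_def by simp
  thus "ann R s Int J~={\<zero>}" using `z ~= \<zero>` by blast
 qed
next
 assume e: "essential_ideal (ann R s) R"
 show "nilp s"
 proof (rule ccontr)
  assume nn: "~nilp s"
  obtain n :: nat where n: "0 < n" "idem (s [^] n)" using idem_power[OF s] .
  let ?e = "s [^] n"
  have e0: "?e~=\<zero>" using nn unfolding nilp_def by blast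
  have "?e:PIdl ?e" using cgenideal_self n by simp
  hence "PIdl ?e~={\<zero>}" using e0 by blast
  then obtain y where y: "y:ann R s" "y:PIdl ?e" "y~=\<zero>"
   using e cgenideal_ideal[of ?e] n additive_subgroup.zero_closed[OF ideal.axioms(1)[OF ann_ideal[OF s]]]
    additive_subgroup.zero_closed[OF ideal.axioms(1)[OF cgenideal_ideal]]
   unfolding essential_ideal_def by blast
  obtain r where r: "r : carrier R" "y = r\<otimes>?e" using y(2) unfolding cgenideal_def by blast
  have sy: "s\<otimes>y = \<zero>" using y(1) unfolding ann_def by simp
  obtain m where m: "n = Suc m" using n(1) by (cases n) auto
  have "y = r\<otimes>(?e\<otimes>?e)" using r n by simp
  also have "\<dots> = y\<otimes>?e" using r n by (simp add: m_assoc)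
  also have "\<dots> = s [^] m\<otimes>(s\<otimes>y)" unfolding m using s r n by (simp add: m_ac)
  finally have "y = \<zero>" using sy s by simp
  thus False using y by simp
 qed
qed

lemma nilp_add: assumes x: "x : carrier R" "nilp x" and y: "y : carrier R" "nilp y" shows "nilp (x\<oplus>y)"
proof -
 have xy: "x\<oplus>y : carrier R" using x y by simp
 have "essential_ideal (ann R (x\<oplus>y)) R"
  unfolding essential_ideal_def
 proof (intro conjI allI impI)
  show "ideal (ann R (x\<oplus>y)) R" by (rule ann_ideal[OF xy])
  fix J assume J: "ideal J R" "J~={\<zero>}"
  have I: "ideal (ann R x Int J) R" by (rule i_intersect[OF ann_ideal[OF x(1)] J(1)])
  have "ann R x Int J~={\<zero>}" using essential_ann[OF x(1)] x J unfolding essential_ideal_def by blast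
  from nilp_meets[OF y I this] obtain z where z: "z:ann R x Int J" "z~=\<zero>" "y\<otimes>z = \<zero>" .
  hence "(x\<oplus>y)\<otimes>z = \<zero>" using x y unfolding ann_def by (simp add: l_distr)
  hence "z:ann R (x\<oplus>y) Int J" using z unfolding ann_def by simp
  thus "ann R (x\<oplus>y) Int J~={\<zero>}" using z(2) by blast
 qed
 thus ?thesis using essential_ann[OF xy] by simp
qed

text \<open>Without a nontrivial idempotent, every element is nilpotent or a unit, and the nilpotent elements form
the only maximal ideal.\<close>

lemma nonlocal_idem:
 assumes nl: "~local_ring R"
 shows "EX e. idem e & e~=\<zero> & e~=\<one>"
proof (rule ccontr)
 assume no: "~?thesis"
 have triv: "e = \<zero> | e = \<one>" if e: "idem e" for e
 using no e ccontr by auto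
 define N where "N = {x : carrier R. nilp x}"
 have unit: "x:Units R" if x: "x : carrier R" "~nilp x" for x
 proof -
  obtain n :: nat where n: "0 < n" "idem (x [^] n)" using idem_power[OF x(1)] .
  have "x [^] n = \<one>" using triv[OF n(2)] x(2) unfolding nilp_def by blast
  moreover obtain m where m: "n = Suc m" using n(1) by (cases n) auto
  ultimately have "x [^] m\<otimes>x = \<one>" by simp
  moreover have "x\<otimes>x [^] m = \<one>" using calculation x m_comm by simp
  ultimately show ?thesis using x unfolding Units_def by auto
 qed
 have one: "~nilp \<one>" unfolding nilp_def using one_not_zero by simp
 have N: "ideal N R"
 proof (rule idealI[OF ring_axioms])
  show "subgroup N (add_monoid R)"
  proof (rule add.subgroupI)
   show "N~={}" using nilp_zero unfolding N_def by auto
   show "\<ominus>a:N" if "a:N" for a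
   proof -
    have "\<ominus>a = a\<otimes>\<ominus> \<one>" using that unfolding N_def by (simp add: r_minus)
    thus ?thesis using that nilp_mult[of a "\<ominus>\<one>"] unfolding N_def by simp
   qed
   show "a\<oplus>b:N" if "a:N" "b:N" for a b using that nilp_add unfolding N_def by simp
  qed (auto simp: N_def)
  show "x\<otimes>a:N" if "a:N" "x : carrier R" for a x
   using that nilp_mult[of a x] m_comm[of a x] unfolding N_def by simp
  show "a\<otimes>x:N" if "a:N" "x : carrier R" for a x
   using that nilp_mult[of a x] unfolding N_def by simp
 qed
 have sub: "I<=N" if I: "ideal I R" "I ~= carrier R" for I
 proof
  fix x assume x: "x:I"
  have xc: "x : carrier R" using x I(1) ideal.Icarr by metis
  show "x:N"
  proof (rule ccontr)
   assume "x~:N"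
   hence "x:Units R" using unit xc unfolding N_def by simp
   hence "inv x\<otimes>x = \<one>" "inv x : carrier R" by simp_all
   hence "\<one>:I" using ideal.I_l_closed[OF I(1) x] by metis
   thus False using ideal.one_imp_carrier[OF I(1)] I(2) by simp
  qed
 qed
 have Nc: "N ~= carrier R" using one one_closed unfolding N_def by blast
 have "maximalideal N R"
 proof (rule maximalidealI[OF N])
  show "carrier R~=N" using Nc by simp
  fix J assume J: "ideal J R" "N<=J" "J <= carrier R"
  show "J = N | J = carrier R" using sub[OF J(1)] J(2) by blast
 qed
 moreover have "M = N" if M: "maximalideal M R" for M
 proof -
  interpret M: maximalideal M R by (rule M)
  have "M<=N" by (rule sub[OF M.is_ideal]) (use M.I_notcarr in simp)
  thus ?thesis using M.I_maximal[OF N] Nc by (auto simp: N_def)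
 qed
 ultimately have "local_ring R" unfolding local_ring_def by blast
 thus False using nl by simp
qed

section \<open>The essential graph\<close>

abbreviation EG where "EG == essential_graph R"

lemma EG_edge:
 "e:snd EG \<longleftrightarrow> (EX u v. e = {u, v} & u:fst EG & v:fst EG & u~=v & nilp (u\<otimes>v))"
proof -
 have c: "u : carrier R" if "u:fst EG" for u using that unfolding essential_graph_def nonzero_zero_divisors_def by simp
 have "e:snd EG \<longleftrightarrow> (EX u v. e = {u, v} & u:fst EG & v:fst EG & u~=v & essential_ideal (ann R (u\<otimes>v)) R)"
  unfolding essential_graph_def by auto
 thus ?thesis using essential_ann c by (metis m_closed)
qed

lemma EG_vertex: "u:fst EG \<longleftrightarrow> u : carrier R & u~=\<zero> & (EX v:carrier R. v~=\<zero> & u\<otimes>v = \<zero>)"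
 unfolding essential_graph_def nonzero_zero_divisors_def by auto

lemma EG_edgeI:
 assumes "u : carrier R" "v : carrier R" "u~=v" "u\<otimes>v = \<zero>" "u~=\<zero>" "v~=\<zero>"
 shows "{u, v}:snd EG"
proof -
 have "v\<otimes>u = \<zero>" using assms m_comm by simp
 hence "u:fst EG" "v:fst EG" using assms unfolding EG_vertex by blast+
 thus ?thesis unfolding EG_edge using assms nilp_zero by metis
qed

section \<open>Corners\<close>

definition corner :: "'a => 'a set" where
 "corner e = {x : carrier R. e\<otimes>x = x}"

lemma cornerD: "x : corner e ==> x : carrier R" "x : corner e ==> e\<otimes>x = x"
 unfolding corner_def by auto

lemma cornerI: "idem e ==> x : carrier R ==> e\<otimes>x : corner e"
 unfolding corner_def by (simp add: m_assoc[symmetric])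

lemma corner_closed:
 assumes e: "e : carrier R" and x: "x : corner e" and y: "y : corner e"
 shows "x\<otimes>y : corner e" "x\<oplus>y : corner e" "\<ominus>x : corner e" "\<zero> : corner e"
 using assms unfolding corner_def by (auto simp: m_assoc[symmetric] r_distr r_minus)

lemma corner_mult:
 assumes "e : carrier R" "x : corner e" "y : carrier R"
 shows "x\<otimes>y : corner e"
 using assms unfolding corner_def by (auto simp: m_assoc[symmetric])

lemma corner_unit: "idem e ==> e : corner e" unfolding corner_def by simp

lemma finite_corner: "finite (corner e)"
 unfolding corner_def using finite_carrier by simp

lemma corner_orth:
 assumes "e : carrier R" "f : carrier R" "e\<otimes>f = \<zero>" "x : corner e" "y : corner f"
 shows "x\<otimes>y = \<zero>"
proof -
 have "x\<otimes>y = (e\<otimes>x)\<otimes>(f\<otimes>y)" using assms cornerD by metis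
 also have "\<dots> = (e\<otimes>f)\<otimes>(x\<otimes>y)" using assms(1,2) cornerD(1)[OF assms(4)] cornerD(1)[OF assms(5)] by (simp add: m_ac)
 also have "\<dots> = \<zero>" unfolding assms(3) using assms cornerD[of x e] cornerD[of y f] by simp
 finally show ?thesis .
qed

text \<open>The ideal \<open>e R\<close> with the unit \<open>e\<close>, as a ring.\<close>

definition cring_at where
 "cring_at e = R\<lparr>carrier := corner e, one := e\<rparr>"

lemma cring_at_simps [simp]:
 "carrier (cring_at e) = corner e" "x\<otimes>\<^bsub>cring_at e\<^esub> y = x\<otimes>y" "\<one>\<^bsub>cring_at e\<^esub> = e"
 "\<zero>\<^bsub>cring_at e\<^esub> = \<zero>" "x\<oplus>\<^bsub>cring_at e\<^esub> y = x\<oplus>y"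
 unfolding cring_at_def by simp_all

lemma cring_cring_at: assumes e: "idem e" shows "cring (cring_at e)"
proof (rule cringI)
 have ec: "e : carrier R" using e by simp
 note cl = corner_closed[OF ec]
 have c: "x : carrier R" "e\<otimes>x = x" "x\<otimes>e = x" if "x : corner e" for x
  using cornerD[OF that] m_comm[of x e] e by auto
 show "abelian_group (cring_at e)"
 proof (rule abelian_groupI)
  show "EX y:carrier (cring_at e). y\<oplus>\<^bsub>cring_at e\<^esub> x = \<zero>\<^bsub>cring_at e\<^esub>" if "x : carrier (cring_at e)" for x
   by (rule bexI[of _ "\<ominus>x"]) (insert that cl(3)[of x x] cornerD[of x e], auto simp: l_neg)
  show "\<zero>\<^bsub>cring_at e\<^esub> : carrier (cring_at e)" using cl(4)[OF corner_unit[OF e] corner_unit[OF e]] by simp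
 qed (auto simp: c cl(2) a_ac)
 show "comm_monoid (cring_at e)"
  by (rule comm_monoidI) (auto simp: c cl(1) corner_unit[OF e] m_ac)
qed (auto simp: corner_def l_distr)

section \<open>Complementary idempotents\<close>

definition orth3 :: "'a => 'a => 'a => bool" where
 "orth3 a b c \<longleftrightarrow> idem a & idem b & idem c & a\<otimes>b = \<zero> & a \<otimes> c = \<zero> & b \<otimes> c = \<zero> & a\<oplus>b \<oplus> c = \<one>"

lemma orth3_perm: assumes "orth3 a b c" shows "orth3 b a c" "orth3 a c b"
 using assms unfolding orth3_def by (auto simp: a_ac m_comm)

definition el :: "'a => 'a => 'a => 'a" where "el x y z = x\<oplus>y\<oplus>z"

text \<open>Every element is uniquely a sum of elements of the three corners, and one computes
 with the summands separately.\<close>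

context
 fixes a b c
 assumes o: "orth3 a b c"
begin

lemma o_facts: "idem a" "idem b" "idem c" "a\<otimes>b = \<zero>" "a \<otimes> c = \<zero>" "b \<otimes> c = \<zero>"
 "b\<otimes>a = \<zero>" "c\<otimes>a = \<zero>" "c\<otimes>b = \<zero>" "a\<oplus>b \<oplus> c = \<one>"
 using o unfolding orth3_def by (auto simp: m_comm)

lemma el_closed: "x : corner a ==> y : corner b ==> z : corner c ==> el x y z : carrier R"
 unfolding el_def using cornerD(1) by simp

lemma orth_prods:
 assumes "x : corner a" "y : corner b" "z : corner c"
 shows "x\<otimes>y = \<zero>" "x\<otimes>z = \<zero>" "y\<otimes>z = \<zero>" "y\<otimes>x = \<zero>" "z\<otimes>x = \<zero>" "z\<otimes>y = \<zero>"
 using assms o_facts corner_orth[of a b x y] corner_orth[of a c x z] corner_orth[of b c y z]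
  corner_orth[of b a y x] corner_orth[of c a z x] corner_orth[of c b z y] by simp_all

lemma el_proj:
 assumes "x : corner a" "y : corner b" "z : corner c"
 shows "a\<otimes>el x y z = x" "b\<otimes>el x y z = y" "c\<otimes>el x y z = z"
 using orth_prods[OF corner_unit[OF o_facts(1)] assms(2,3)] orth_prods[OF assms(1) corner_unit[OF o_facts(2)] assms(3)]
  orth_prods[OF assms(1,2) corner_unit[OF o_facts(3)]] assms cornerD o_facts
 unfolding el_def by (simp_all add: r_distr)

lemma el_eq:
 assumes "x : corner a" "y : corner b" "z : corner c" "x' : corner a" "y' : corner b" "z' : corner c"
 shows "el x y z = el x' y' z' \<longleftrightarrow> x = x' & y = y' & z = z'"
 using el_proj[OF assms(1-3)] el_proj[OF assms(4-6)] by auto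

lemma el_zero: "el \<zero> \<zero> \<zero> = \<zero>" unfolding el_def by simp

lemma zero_corners: "\<zero> : corner a" "\<zero> : corner b" "\<zero> : corner c"
 unfolding corner_def using o_facts by auto

lemma el_eq_zero:
 assumes "x : corner a" "y : corner b" "z : corner c"
 shows "el x y z = \<zero> \<longleftrightarrow> x = \<zero> & y = \<zero> & z = \<zero>"
 using el_eq[OF assms zero_corners] el_zero by simp

lemma el_mult:
 assumes "x : corner a" "y : corner b" "z : corner c" "x' : corner a" "y' : corner b" "z' : corner c"
 shows "el x y z\<otimes>el x' y' z' = el (x\<otimes>x') (y\<otimes>y') (z\<otimes>z')"
 using orth_prods[OF assms(1) assms(5,6)] orth_prods[OF assms(4) assms(2,3)] orth_prods[OF assms(1,2) assms(6)]
  orth_prods[OF assms(4) assms(5) assms(3)] assms cornerD(1)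
 unfolding el_def by (simp add: l_distr r_distr)

lemma el_decomp: assumes r: "r : carrier R" shows "r = el (a\<otimes>r) (b\<otimes>r) (c\<otimes>r)"
proof -
 have "r = (a\<oplus>b \<oplus> c)\<otimes>r" using r o_facts by simp
 also have "\<dots> = el (a\<otimes>r) (b\<otimes>r) (c\<otimes>r)" unfolding el_def using r o_facts(1-3) by (simp add: l_distr)
 finally show ?thesis .
qed

lemma el_cases:
 assumes r: "r : carrier R"
 obtains x y z where "x : corner a" "y : corner b" "z : corner c" "r = el x y z"
 using that[of "a\<otimes>r" "b\<otimes>r" "c\<otimes>r"] el_decomp[OF r] cornerI[OF o_facts(1) r] cornerI[OF o_facts(2) r] cornerI[OF o_facts(3) r] by simp

lemma nilp_el:
 assumes "x : corner a" "y : corner b" "z : corner c"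
 shows "nilp (el x y z) \<longleftrightarrow> nilp x & nilp y & nilp z"
proof
 assume n: "nilp (el x y z)"
 have e: "el x y z : carrier R" by (rule el_closed[OF assms])
 have "nilp (el x y z\<otimes>a)" "nilp (el x y z\<otimes>b)" "nilp (el x y z \<otimes> c)"
  using nilp_mult[OF e _ n] o_facts by simp_all
 moreover have "el x y z\<otimes>a = x" "el x y z\<otimes>b = y" "el x y z \<otimes> c = z"
  using el_proj[OF assms] m_comm[OF e] o_facts by simp_all
 ultimately show "nilp x & nilp y & nilp z" by simp
next
 assume "nilp x & nilp y & nilp z"
 thus "nilp (el x y z)" unfolding el_def using assms cornerD(1) by (auto intro!: nilp_add)
qed

lemma split3_iso: "(%r. (a\<otimes>r, (b\<otimes>r, c\<otimes>r))):ring_iso R (RDirProd (cring_at a) (RDirProd (cring_at b) (cring_at c)))"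
proof (rule ring_iso_memI)
 let ?h = "%r. (a\<otimes>r, (b\<otimes>r, c\<otimes>r))"
 let ?T = "RDirProd (cring_at a) (RDirProd (cring_at b) (cring_at c))"
 have dist: "e\<otimes>(x\<otimes>y) = (e\<otimes>x)\<otimes>(e\<otimes>y)" if "idem e" "x : carrier R" "y : carrier R" for e x y
 proof -
  have "(e\<otimes>x)\<otimes>(e\<otimes>y) = (e\<otimes>e)\<otimes>(x\<otimes>y)" using that(1)[THEN conjunct1] that(2,3) by (simp add: m_ac)
  thus ?thesis using that by simp
 qed
 have cT: "carrier ?T = corner a \<times> corner b \<times> corner c" by (simp add: RDirProd_carrier)
 show "?h x : carrier ?T" if "x : carrier R" for x unfolding cT using that cornerI o_facts by simp
 show "?h (x\<otimes>y) = ?h x\<otimes>\<^bsub>?T\<^esub> ?h y" if "x : carrier R" "y : carrier R" for x y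
  using dist o_facts(1-3) that by (simp add: RDirProd_def DirProd_def monoid.defs)
 show "?h (x\<oplus>y) = ?h x\<oplus>\<^bsub>?T\<^esub> ?h y" if "x : carrier R" "y : carrier R" for x y
  using o_facts(1-3) that by (simp add: RDirProd_def DirProd_def monoid.defs r_distr)
 show "?h \<one> = \<one>\<^bsub>?T\<^esub>" using o_facts by (simp add: RDirProd_def DirProd_def monoid.defs)
 show "bij_betw ?h (carrier R) (carrier ?T)"
  unfolding cT
 proof (rule bij_betwI[where g = "%(x, y, z). el x y z"])
  show "?h : carrier R \<rightarrow> corner a \<times> corner b \<times> corner c" using cornerI o_facts by auto
  show "(%(x, y, z). el x y z) : corner a \<times> corner b \<times> corner c \<rightarrow> carrier R" using el_closed by auto
  show "(case ?h x of (x, y, z) => el x y z) = x" if "x : carrier R" for x using el_decomp[OF that] by simp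
  show "?h (case y of (x, y, z) => el x y z) = y" if "y : corner a \<times> corner b \<times> corner c" for y using el_proj that by auto
 qed
qed

end

lemma orth_pair: assumes "idem e" shows "orth3 e (\<one>\<ominus>e) \<zero>"
proof -
 have e: "e : carrier R" "e\<otimes>e = e" using assms by auto
 have 1: "e\<otimes>(\<one>\<ominus>e) = \<zero>" using e by (simp add: minus_eq r_distr r_minus r_neg)
 have "(\<one>\<ominus>e)\<otimes>(\<one>\<ominus>e) = (\<one>\<ominus>e)\<ominus>e\<otimes>(\<one>\<ominus>e)" using e by (simp add: minus_eq l_distr l_minus)
 hence "(\<one>\<ominus>e)\<otimes>(\<one>\<ominus>e) = \<one>\<ominus>e" unfolding 1 using e by (simp add: minus_eq)
 moreover have "e\<oplus>(\<one>\<ominus>e)\<oplus>\<zero> = \<one>" using e by (simp add: minus_eq a_lcomm[of e] r_neg)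
 ultimately show ?thesis unfolding orth3_def using e 1 by simp
qed

lemma corner_zero: "corner \<zero> = {\<zero>}" unfolding corner_def by auto

lemma split2_iso:
 assumes o: "orth3 a b \<zero>"
 shows "(%r. (a\<otimes>r, b\<otimes>r)):ring_iso R (RDirProd (cring_at a) (cring_at b))"
proof -
 have id1: "(%r. r):ring_iso (cring_at a) (cring_at a)" by (rule ring_iso_memI) (auto simp: bij_betw_def)
 have "(%(x, z). x):ring_iso (RDirProd (cring_at b) (cring_at \<zero>)) (cring_at b)"
  by (rule ring_iso_memI) (auto simp: RDirProd_def DirProd_def monoid.defs corner_zero bij_betw_def inj_on_def)
 from ring_iso_set_trans[OF split3_iso[OF o] RDirProd_iso6[OF id1 this]]
 show ?thesis by (simp add: comp_def)
qed

definition noz :: "'a set => bool" where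
 "noz K \<longleftrightarrow> (ALL x:K. ALL y:K. x\<otimes>y = \<zero> --> x = \<zero> | y = \<zero>)"

definition reduced :: bool where "reduced \<longleftrightarrow> (ALL x:carrier R. nilp x --> x = \<zero>)"

lemma noz_nilp:
 assumes e: "idem e" and n: "noz (corner e)" and x: "x : corner e" "nilp x"
 shows "x = \<zero>"
proof -
 obtain k :: nat where k: "x [^] k = \<zero>" using x(2) unfolding nilp_def by blast
 have pc: "x [^] Suc m : corner e" for m :: nat
  by (induction m) (use x corner_closed(1)[of e] e cornerD(1)[OF x(1)] in auto)
 have "x [^] Suc m = \<zero> ==> x = \<zero>" for m :: nat
 proof (induction m)
  case (Suc m)
  hence "x [^] Suc m\<otimes>x = \<zero>" by simp
  thus ?case using n pc[of m] x(1) Suc.IH unfolding noz_def by blast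
 qed (use cornerD(1)[OF x(1)] in simp)
 thus ?thesis using k one_not_zero by (cases k) auto
qed

lemma reduced_noz:
 assumes o: "orth3 a b c" and "noz (corner a)" "noz (corner b)" "noz (corner c)"
 shows reduced
 unfolding reduced_def
proof (intro ballI impI)
 fix r assume r: "r : carrier R" "nilp r"
 obtain x y z where xyz: "x : corner a" "y : corner b" "z : corner c" "r = el x y z" by (rule el_cases[OF o r(1)])
 hence "nilp x & nilp y & nilp z" using nilp_el[OF o xyz(1-3)] r by simp
 thus "r = \<zero>" using noz_nilp xyz assms o_facts(1-3)[OF o] el_zero by metis
qed

text \<open>An element of the corner has an idempotent power. In a reduced ring this power is nonzero for a nonzero element, and if it is the
unit of the corner, the element is not a zero-divisor.\<close>

lemma noz_or_split:
 assumes r: reduced and e: "idem e"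
 shows "noz (corner e) | (EX f. idem f & f : corner e & f~=\<zero> & f~=e)"
proof (rule disjCI)
 assume no: "~(EX f. idem f & f : corner e & f~=\<zero> & f~=e)"
 show "noz (corner e)"
  unfolding noz_def
 proof (intro ballI impI)
  fix x y assume x: "x : corner e" and y: "y : corner e" and xy: "x\<otimes>y = \<zero>"
  have xc: "x : carrier R" "y : carrier R" using cornerD x y by auto
  obtain n :: nat where n: "0 < n" "idem (x [^] n)" using idem_power[OF xc(1)] .
  obtain m where m: "n = Suc m" using n(1) by (cases n) auto
  have "x [^] n : corner e" unfolding m
   by (induction m) (use x corner_closed(1)[of e] e xc in auto)
  hence "x [^] n = \<zero> | x [^] n = e" using no n(2) by blast
  thus "x = \<zero> | y = \<zero>"
  proof
   assume "x [^] n = \<zero>"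
   thus ?thesis using r xc unfolding reduced_def nilp_def by blast
  next
   assume "x [^] n = e"
   hence "y = x [^] m\<otimes>x\<otimes>y" using cornerD[OF y] unfolding m by simp
   thus ?thesis using xy xc by (simp add: m_assoc)
  qed
 qed
qed

lemma card_corner_ge2: assumes "idem e" "e~=\<zero>" shows "2 <= card (corner e)"
proof -
 have "{\<zero>, e} <= corner e" using assms unfolding corner_def by auto
 from card_mono[OF finite_corner this] show ?thesis using assms(2) by simp
qed

lemma field_cring_at:
 assumes e: "idem e" "e~=\<zero>" and n: "noz (corner e)"
 shows "field (cring_at e)"
proof -
 interpret C: cring "cring_at e" by (rule cring_cring_at[OF e(1)])
 have "Units (cring_at e) = carrier (cring_at e)-{\<zero>\<^bsub>cring_at e\<^esub>}"
 proof (intro equalityI subsetI)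
  fix x assume x: "x:Units (cring_at e)"
  then obtain y where y: "y : corner e" "y\<otimes>x = e" "x : corner e" unfolding Units_def by auto
  hence "x~=\<zero>" using e(2) cornerD[OF y(1)] by auto
  thus "x : carrier (cring_at e)-{\<zero>\<^bsub>cring_at e\<^esub>}" using y by simp
 next
  fix x assume "x : carrier (cring_at e)-{\<zero>\<^bsub>cring_at e\<^esub>}"
  hence x: "x : corner e" "x~=\<zero>" by auto
  have xc: "x : carrier R" using cornerD x by auto
  obtain k :: nat where k: "0 < k" "idem (x [^] k)" using idem_power[OF xc] .
  obtain m where m: "k = Suc m" using k(1) by (cases k) auto
  have pc: "x [^] k : corner e" unfolding m
   by (induction m) (use x corner_closed(1)[of e] e xc in auto)
  have "x [^] k\<otimes>(e\<ominus>x [^] k) = \<zero>"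
   using k(2) e(1) cornerD[OF pc] m_comm[of e "x [^] k"] by (simp add: minus_eq r_distr r_minus r_neg)
  moreover have "e\<ominus>x [^] k : corner e" unfolding minus_eq
   using corner_closed(2)[OF _ corner_unit[OF e(1)] corner_closed(3)[OF _ pc pc]] e(1) by simp
  moreover have "x [^] k~=\<zero>" using noz_nilp[OF e(1) n x(1)] x(2) unfolding nilp_def by blast
  ultimately have "e\<ominus>x [^] k = \<zero>" using n pc unfolding noz_def by blast
  hence ek: "x [^] k = e" using e(1) k(2) r_right_minus_eq by auto
  define y where "y = e\<otimes>x [^] m"
  have y: "y : corner e" unfolding y_def by (rule cornerI[OF e(1)]) (use xc in simp)
  have "y\<otimes>x = e\<otimes>x [^] k" unfolding y_def m using e(1) xc by (simp add: m_assoc)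
  hence "y\<otimes>x = e" using ek e(1) by simp
  moreover have "x\<otimes>y = y\<otimes>x" using m_comm xc cornerD(1)[OF y] by blast
  ultimately show "x:Units (cring_at e)" unfolding Units_def using x(1) y by auto
 qed
 thus ?thesis by (rule C.cring_fieldI)
qed

text \<open>Idempotents and corners correspond under an isomorphism.\<close>

lemma iso_corner:
 assumes g: "g:ring_iso W R" and W: "ring W" and w: "w : carrier W" "w\<otimes>\<^bsub>W\<^esub> w = w"
 shows "corner (g w) = g ` {y : carrier W. w\<otimes>\<^bsub>W\<^esub> y = y}"
  "card (corner (g w)) = card {y : carrier W. w\<otimes>\<^bsub>W\<^esub> y = y}"
  "(!!x y. x : carrier W ==> y : carrier W ==> w\<otimes>\<^bsub>W\<^esub> x = x ==> w\<otimes>\<^bsub>W\<^esub> y = y ==> x\<otimes>\<^bsub>W\<^esub> y = \<zero>\<^bsub>W\<^esub> ==> x = \<zero>\<^bsub>W\<^esub> | y = \<zero>\<^bsub>W\<^esub>) ==> noz (corner (g w))"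
proof -
 interpret W: ring W by (rule W)
 have hm: "g:ring_hom W R" and bij: "bij_betw g (carrier W) (carrier R)" using g unfolding ring_iso_def by auto
 have inj: "inj_on g (carrier W)" and im: "g ` carrier W = carrier R" using bij unfolding bij_betw_def by auto
 have mul: "g (x\<otimes>\<^bsub>W\<^esub> y) = g x\<otimes>g y" if "x : carrier W" "y : carrier W" for x y using ring_hom_mult[OF hm that] .
 have z: "g \<zero>\<^bsub>W\<^esub> = \<zero>" using ring_hom_zero[OF hm W ring_axioms] .
 have geq: "g x = g y \<longleftrightarrow> x = y" if "x : carrier W" "y : carrier W" for x y using inj that unfolding inj_on_def by blast
 let ?K = "{y : carrier W. w\<otimes>\<^bsub>W\<^esub> y = y}"
 show c: "corner (g w) = g ` ?K"
 proof (intro equalityI subsetI)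
  fix x assume x: "x : corner (g w)"
  then obtain y where y: "y : carrier W" "x = g y" using cornerD(1)[OF x] im by auto
  hence "g (w\<otimes>\<^bsub>W\<^esub> y) = g y" using cornerD(2)[OF x] mul w by simp
  thus "x:g ` ?K" using y w geq by simp
 next
  fix x assume "x:g ` ?K"
  then obtain y where y: "y : carrier W" "w\<otimes>\<^bsub>W\<^esub> y = y" "x = g y" by auto
  thus "x : corner (g w)" unfolding corner_def using mul[OF w(1) y(1)] im by auto
 qed
 show "card (corner (g w)) = card ?K" unfolding c by (rule card_image) (rule inj_on_subset[OF inj], auto)
 assume nz: "!!x y. x : carrier W ==> y : carrier W ==> w\<otimes>\<^bsub>W\<^esub> x = x ==> w\<otimes>\<^bsub>W\<^esub> y = y ==> x\<otimes>\<^bsub>W\<^esub> y = \<zero>\<^bsub>W\<^esub> ==> x = \<zero>\<^bsub>W\<^esub> | y = \<zero>\<^bsub>W\<^esub>"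
 show "noz (corner (g w))"
  unfolding noz_def c
 proof (intro ballI impI)
  fix x y assume "x:g ` ?K" "y:g ` ?K" and xy: "x\<otimes>y = \<zero>"
  then obtain x' y' where p: "x' : carrier W" "w\<otimes>\<^bsub>W\<^esub> x' = x'" "x = g x'" "y' : carrier W" "w\<otimes>\<^bsub>W\<^esub> y' = y'" "y = g y'" by blast
  have "g (x'\<otimes>\<^bsub>W\<^esub> y') = g \<zero>\<^bsub>W\<^esub>" using xy p mul z by simp
  hence "x'\<otimes>\<^bsub>W\<^esub> y' = \<zero>\<^bsub>W\<^esub>" using geq p by simp
  thus "x = \<zero> | y = \<zero>" using nz p z by metis
 qed
qed

lemma iso_orth3:
 assumes g: "g:ring_iso W R" and W: "ring W" and w: "u : carrier W" "v : carrier W" "w : carrier W"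
  "u\<otimes>\<^bsub>W\<^esub> u = u" "v\<otimes>\<^bsub>W\<^esub> v = v" "w\<otimes>\<^bsub>W\<^esub> w = w"
  "u\<otimes>\<^bsub>W\<^esub> v = \<zero>\<^bsub>W\<^esub>" "u\<otimes>\<^bsub>W\<^esub> w = \<zero>\<^bsub>W\<^esub>" "v\<otimes>\<^bsub>W\<^esub> w = \<zero>\<^bsub>W\<^esub>" "u\<oplus>\<^bsub>W\<^esub> v\<oplus>\<^bsub>W\<^esub> w = \<one>\<^bsub>W\<^esub>"
 shows "orth3 (g u) (g v) (g w)"
proof -
 interpret W: ring W by (rule W)
 have hm: "g:ring_hom W R" using g unfolding ring_iso_def by auto
 have z: "g \<zero>\<^bsub>W\<^esub> = \<zero>" using ring_hom_zero[OF hm W ring_axioms] .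
 have "g (u\<oplus>\<^bsub>W\<^esub> v\<oplus>\<^bsub>W\<^esub> w) = g (u\<oplus>\<^bsub>W\<^esub> v)\<oplus>g w" by (rule ring_hom_add[OF hm]) (use w(1-3) in simp_all)
 also have "g (u\<oplus>\<^bsub>W\<^esub> v) = g u\<oplus>g v" by (rule ring_hom_add[OF hm w(1,2)])
 finally have "g u\<oplus>g v\<oplus>g w = \<one>" unfolding w(10) ring_hom_one[OF hm] by (rule sym)
 thus ?thesis unfolding orth3_def
  using w z ring_hom_one[OF hm] ring_hom_closed[OF hm] ring_hom_mult[OF hm, symmetric] by simp
qed

end

section \<open>Rings of prime order and small fields\<close>

lemma prime_order_iso:
 assumes S: "cring S" and p: "Factorial_Ring.prime p" "card (carrier S) = p"
 shows "EX h. h:ring_iso (residue_ring (int p)) S"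
proof -
 interpret S: cring S by (rule S)
 define G where "G = add_monoid S"
 interpret G: comm_group G unfolding G_def by (rule S.a_comm_group)
 have fin: "finite (carrier S)" using p by (metis card.infinite not_prime_0)
 have G: "carrier G = carrier S" "\<one>\<^bsub>G\<^esub> = \<zero>\<^bsub>S\<^esub>" "Coset.order G = p" "!!x y. x\<otimes>\<^bsub>G\<^esub> y = x\<oplus>\<^bsub>S\<^esub> y" unfolding G_def Coset.order_def using p by simp_all
 have one: "\<one>\<^bsub>S\<^esub>~=\<zero>\<^bsub>S\<^esub>"
 proof
  assume "\<one>\<^bsub>S\<^esub> = \<zero>\<^bsub>S\<^esub>"
  hence "carrier S = {\<zero>\<^bsub>S\<^esub>}" using S.one_zeroD by simp
  hence "p = 1" using p by simp
  thus False using prime_gt_1_nat[OF p(1)] by simp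
 qed
 define h where "h k = \<one>\<^bsub>S\<^esub> [^]\<^bsub>G\<^esub> (k::int)" for k
 have h_add_pow: "h k = add_pow S k \<one>\<^bsub>S\<^esub>" for k unfolding h_def G_def add_pow_def ..
 have one_in: "\<one>\<^bsub>S\<^esub> : carrier G" using G by simp
 have ord: "group.ord G \<one>\<^bsub>S\<^esub> = p"
 proof -
  have "group.ord G \<one>\<^bsub>S\<^esub> dvd p" using G.ord_dvd_group_order[OF one_in] G by simp
  moreover have "group.ord G \<one>\<^bsub>S\<^esub>~=1" using G.ord_eq_1[OF one_in] one G by simp
  ultimately show ?thesis using p(1) unfolding prime_nat_iff by blast
 qed
 have h_closed: "h k : carrier S" for k using G.int_pow_closed[OF one_in, of k] unfolding h_def G .
 have h_add: "h (i+j) = h i\<oplus>\<^bsub>S\<^esub> h j" for i j unfolding h_def G.int_pow_mult[OF one_in] G ..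
 have h_zero: "h k = \<zero>\<^bsub>S\<^esub> \<longleftrightarrow> int p dvd k" for k unfolding h_def using G.int_pow_eq_id[OF one_in, of k] unfolding ord G .
 have h_mod: "h (k mod int p) = h k" for k
 proof -
  have "h k = h (k div int p * int p)\<oplus>\<^bsub>S\<^esub> h (k mod int p)" unfolding h_add[symmetric] by simp
  also have "h (k div int p * int p) = \<zero>\<^bsub>S\<^esub>" unfolding h_zero by simp
  finally show ?thesis using h_closed by simp
 qed
 have h_mult: "h (i * j) = h i\<otimes>\<^bsub>S\<^esub> h j" for i j
 proof -
  have "h i\<otimes>\<^bsub>S\<^esub> h j = add_pow S i (h j)" unfolding h_add_pow[of i] using S.add_pow_ldistr_int[of "\<one>\<^bsub>S\<^esub>" "h j" i] h_closed by simp
  also have "\<dots> = h (i * j)" unfolding h_def G_def add_pow_def[symmetric] unfolding add_pow_def G_def[symmetric]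
   using G.int_pow_pow[OF one_in, of j i] by (simp add: mult.commute)
  finally show ?thesis by simp
 qed
 have inj: "inj_on h {0..int p-1}"
 proof (rule inj_onI)
  fix i j assume ij: "i:{0..int p-1}" "j:{0..int p-1}" "h i = h j"
  have "h i = h (i-j)\<oplus>\<^bsub>S\<^esub> h j" unfolding h_add[symmetric] by simp
  hence "h (i-j) = \<zero>\<^bsub>S\<^esub>" using ij(3) h_closed S.add.r_cancel_one'[of "h j" "h (i-j)"] by simp
  hence "int p dvd i-j" unfolding h_zero .
  thus "i = j" using ij(1,2) zdvd_imp_le[of "int p" "i-j"] zdvd_imp_le[of "int p" "j-i"]
   by (metis atLeastAtMost_iff diff_ge_0_iff_ge mod_pos_pos_trivial mod_eq_dvd_iff zle_diff1_eq)
 qed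
 have "card (h ` {0..int p-1}) = p" using card_image[OF inj] by simp
 hence im: "h ` {0..int p-1} = carrier S" by (intro card_subset_eq[OF fin]) (use h_closed p in auto)
 have "h:ring_iso (residue_ring (int p)) S"
 proof (rule ring_iso_memI)
  show "bij_betw h (carrier (residue_ring (int p))) (carrier S)" using inj im unfolding bij_betw_def residue_ring_def by simp
  show "h \<one>\<^bsub>residue_ring (int p)\<^esub> = \<one>\<^bsub>S\<^esub>" unfolding residue_ring_def h_def using G.int_pow_1[OF one_in] by simp
 qed (insert h_closed h_mult h_add h_mod, simp_all add: residue_ring_def)
 thus ?thesis by blast
qed

text \<open>By Sylow's theorem there are nonzero elements of additive orders 2 and 3, and then 2 and 3 vanish in the field.\<close>

lemma order6_not_field:
 assumes F: "field F" and c: "card (carrier F) = 6"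
 shows False
proof -
 interpret F: field F by (rule F)
 have Gg: "group (add_monoid F)" by (rule F.a_group)
 have fin: "finite (carrier F)" using c by (metis card.infinite zero_neq_numeral)
 have tors: "add_pow F (q::nat) \<one>\<^bsub>F\<^esub> = \<zero>\<^bsub>F\<^esub>" if q: "Factorial_Ring.prime q" "6 = q ^ 1 * m" for q m
 proof -
  obtain H where H: "subgroup H (add_monoid F)" "card H = q"
   using sylow_thm[OF q(1) Gg, of 1 m] q(2) c fin unfolding Coset.order_def by auto
  have "\<zero>\<^bsub>F\<^esub>:H" using subgroup.one_closed[OF H(1)] by simp
  moreover have "~H<={\<zero>\<^bsub>F\<^esub>}" using H(2) prime_gt_1_nat[OF q(1)] card_mono[of "{\<zero>\<^bsub>F\<^esub>}" H] by auto
  ultimately obtain x where x: "x:H" "x~=\<zero>\<^bsub>F\<^esub>" by blast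
  have xc: "x : carrier F" using subgroup.mem_carrier[OF H(1) x(1)] by simp
  interpret H: group "(add_monoid F)\<lparr>carrier := H\<rparr>" by (rule subgroup.subgroup_is_group[OF H(1) Gg])
  have oH: "Coset.order ((add_monoid F)\<lparr>carrier := H\<rparr>) = q" using H(2) unfolding Coset.order_def by simp
  have xH: "x : carrier ((add_monoid F)\<lparr>carrier := H\<rparr>)" using x(1) by simp
  have "x [^]\<^bsub>(add_monoid F)\<lparr>carrier := H\<rparr>\<^esub> q = \<one>\<^bsub>(add_monoid F)\<lparr>carrier := H\<rparr>\<^esub>" using H.pow_order_eq_1[OF xH] unfolding oH .
  hence a: "add_pow F q x = \<zero>\<^bsub>F\<^esub>" unfolding add_pow_def  monoid.nat_pow_consistent[OF group.is_monoid[OF Gg], of x q H, symmetric] by simp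
  have "add_pow F q x = add_pow F q \<one>\<^bsub>F\<^esub>\<otimes>\<^bsub>F\<^esub> x" using F.add_pow_ldistr[of "\<one>\<^bsub>F\<^esub>" x q] xc by simp
  hence "add_pow F q \<one>\<^bsub>F\<^esub>\<otimes>\<^bsub>F\<^esub> x = \<zero>\<^bsub>F\<^esub>" using a by simp
  moreover have "add_pow F q \<one>\<^bsub>F\<^esub> : carrier F" by simp
  ultimately show ?thesis using F.integral[OF _ _ xc] x by blast
 qed
 have 2: "add_pow F (2::nat) \<one>\<^bsub>F\<^esub> = \<zero>\<^bsub>F\<^esub>" by (rule tors[of 2 3]) auto
 have 3: "add_pow F (3::nat) \<one>\<^bsub>F\<^esub> = \<zero>\<^bsub>F\<^esub>" by (rule tors[of 3 2]) auto
 have "add_pow F (3::nat) \<one>\<^bsub>F\<^esub> = add_pow F (2::nat) \<one>\<^bsub>F\<^esub>\<oplus>\<^bsub>F\<^esub> \<one>\<^bsub>F\<^esub>"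
  unfolding add_pow_def nat_pow_def by (simp add: numeral_3_eq_3 numeral_2_eq_2)
 thus False using 2 3 by simp
qed

text \<open>The structure is transported along an enumeration of the elements.\<close>

lemma field_as_int_ring:
 assumes F: "field F" and c: "finite (carrier F)" "card (carrier F) = q"
 shows "EX K :: int ring. is_finite_field q K & (EX h. h:ring_iso F K)"
proof -
 interpret F: field F by (rule F)
 obtain f where f: "bij_betw f (carrier F) {0..<q}" using ex_bij_betw_finite_nat[OF c(1)] c(2) by blast
 define g where "g x = int (f x)" for x
 have inj: "inj_on g (carrier F)" using f unfolding g_def bij_betw_def inj_on_def by simp
 have "is_finite_field q (image_ring g F)"
  unfolding is_finite_field_def image_ring_carrier using F.inj_imp_image_ring_is_field[OF inj] c card_image[OF inj] by simp
 thus ?thesis using inj_imp_image_ring_iso[OF inj] by blast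
qed

lemma residue_ring_noz:
 assumes p: "Factorial_Ring.prime (p::nat)" and x: "x : carrier (residue_ring (int p))" "y : carrier (residue_ring (int p))"
  and xy: "x\<otimes>\<^bsub>residue_ring (int p)\<^esub> y = \<zero>\<^bsub>residue_ring (int p)\<^esub>"
 shows "x = 0 | y = 0"
proof -
 have "int p dvd x * y" using xy unfolding residue_ring_def by auto
 moreover have "Factorial_Ring.prime (int p)" using p by simp
 ultimately have "int p dvd x | int p dvd y" by (simp add: prime_dvd_mult_iff)
 moreover have "0<=x" "x < int p" "0<=y" "y < int p" using x unfolding residue_ring_def by auto
 ultimately show ?thesis using zdvd_not_zless by (metis order_le_less)
qed

lemma residue_ring_facts:
 assumes "1 < (p::nat)"
 shows "cring (residue_ring (int p))" "card (carrier (residue_ring (int p))) = p" "\<zero>\<^bsub>residue_ring (int p)\<^esub> = 0" "\<one>\<^bsub>residue_ring (int p)\<^esub> = 1"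
proof -
 interpret residues "int p" "residue_ring (int p)" by unfold_locales (use assms in auto)
 show "cring (residue_ring (int p))" by (rule cring)
 show "card (carrier (residue_ring (int p))) = p" "\<zero>\<^bsub>residue_ring (int p)\<^esub> = 0" "\<one>\<^bsub>residue_ring (int p)\<^esub> = 1" unfolding residue_ring_def by auto
qed

section \<open>Line graphs of essential graphs\<close>

definition simple_edges :: "nat => (nat\<times>nat) list => bool" where
 "simple_edges n es \<longleftrightarrow> list_all (%(p, q). p < n & q < n & p~=q) es & distinct (map (%(p, q). (min p q, max p q)) es)"

lemma residue_field: assumes "Factorial_Ring.prime p" shows "field (residue_ring (int p))"
proof -
 interpret residues_prime p "residue_ring (int p)" by unfold_locales (use assms in auto)
 show ?thesis by (rule is_field)
qed

context finite_cring
begin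

abbreviation LG where "LG == line_graph EG"

abbreviation LG_on where "LG_on k == drawable_on LG (handle_surface k)"

lemma EG_graph_like: "graph_like EG"
 unfolding graph_like_def
proof
 fix e assume "e:snd EG"
 then obtain u v where "e = {u, v}" "u:fst EG" "v:fst EG" "u~=v" unfolding EG_edge by blast
 thus "e<=fst EG & card e = 2" by simp
qed

lemma ilg_from_LG:
 assumes d: "drawable_on LG S" and vs: "distinct vs" "set vs<=fst EG" and es: "simple_edges (length vs) es"
  and n: "!!p q. (p, q):set es ==> nilp (vs ! p\<otimes>vs ! q)"
 shows "drawable_on (ilg es) S"
proof (rule ilg_from_line_graph[OF d, where g = "%i. vs ! i"])
 have sm: "fst (es ! i) < length vs" "snd (es ! i) < length vs" "fst (es ! i)~=snd (es ! i)" if "i < length es" for i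
  using es nth_mem[OF that] unfolding simple_edges_def list_all_iff by (auto simp: split_beta)
 have ds: "distinct (map (%(p, q). (min p q, max p q)) es)" using es unfolding simple_edges_def by blast
 have eq: "vs ! p = vs ! q \<longleftrightarrow> p = q" if "p < length vs" "q < length vs" for p q using nth_eq_iff_index_eq[OF vs(1) that] .
 show "{vs ! fst (es ! i), vs ! snd (es ! i)}:snd EG" if i: "i < length es" for i
 proof -
  have "vs ! fst (es ! i):fst EG" "vs ! snd (es ! i):fst EG" using vs(2) nth_mem sm[OF i] by blast+
  moreover have "nilp (vs ! fst (es ! i)\<otimes>vs ! snd (es ! i))" by (rule n) (use nth_mem[OF i] in simp)
  ultimately show ?thesis unfolding EG_edge using eq sm[OF i] by blast
 qed
 show "inj_on (%i. {vs ! fst (es ! i), vs ! snd (es ! i)}) {..<length es}"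
 proof (rule inj_onI)
  fix i j assume ij: "i:{..<length es}" "j:{..<length es}" and e: "{vs ! fst (es ! i), vs ! snd (es ! i)} = {vs ! fst (es ! j), vs ! snd (es ! j)}"
  have i: "i < length es" "j < length es" using ij by auto
  have "fst (es ! i) = fst (es ! j) & snd (es ! i) = snd (es ! j) | fst (es ! i) = snd (es ! j) & snd (es ! i) = fst (es ! j)"
   using e unfolding doubleton_eq_iff using eq sm[OF i(1)] sm[OF i(2)] by blast
  hence "map (%(p, q). (min p q, max p q)) es ! i = map (%(p, q). (min p q, max p q)) es ! j"
   using i by (auto simp: split_beta min.commute max.commute)
  thus "i = j" using nth_eq_iff_index_eq[OF ds] i by simp
 qed
qed

subsection \<open>Nilpotent elements\<close>

lemma not_drawable_124:
 assumes vs: "distinct [h, p1, p2, q1, q2, q3, q4]" "{h, p1, p2, q1, q2, q3, q4}<=fst EG"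
  and hub: "!!v. v:{p1, p2, q1, q2, q3, q4} ==> nilp (h\<otimes>v)"
  and pq: "!!p q. p:{p1, p2} ==> q:{q1, q2, q3, q4} ==> nilp (p\<otimes>q)"
 shows "~LG_on 2"
proof
 assume d: "LG_on 2"
 have "drawable_on (ilg g124) (handle_surface 2)"
 proof (rule ilg_from_LG[OF d vs(1)])
  show "set [h, p1, p2, q1, q2, q3, q4]<=fst EG" using vs(2) by simp
  have l: "length [h, p1, p2, q1, q2, q3, q4] = 7" by simp
  show "simple_edges (length [h, p1, p2, q1, q2, q3, q4]) g124" unfolding l by code_simp
  have "list_all (%(p, q). nilp ([h, p1, p2, q1, q2, q3, q4] ! p\<otimes>[h, p1, p2, q1, q2, q3, q4] ! q)) g124"
   unfolding g124_def using hub pq by simp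
  then    show "nilp ([h, p1, p2, q1, q2, q3, q4] ! p\<otimes>[h, p1, p2, q1, q2, q3, q4] ! q)" if "(p, q):set g124" for p q
   using that unfolding list_all_iff by blast
 qed
 thus False using not_drawable_ok[OF count_oks(5), of 2] by simp
qed

lemma corner_ideal: assumes "idem e" shows "ideal (corner e) R"
proof (rule idealI[OF ring_axioms])
 have e: "e : carrier R" using assms by simp
 show "subgroup (corner e) (add_monoid R)"
  by (rule add.subgroupI) (use corner_closed[OF e] corner_unit[OF assms] cornerD(1) in auto)
 show "a\<otimes>x : corner e" if "a : corner e" "x : carrier R" for a x by (rule corner_mult[OF e that])
 thus "x\<otimes>a : corner e" if "a : corner e" "x : carrier R" for a x using that m_comm cornerD(1) by metis
qed

context
 fixes a b c
 assumes o: "orth3 a b c"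
begin

lemma EG_vertex_zero:
 assumes "x : corner a" "y : corner b" "z : corner c" "el x y z~=\<zero>"
  and "x = \<zero> & a~=\<zero> | y = \<zero> & b~=\<zero> | z = \<zero> & c~=\<zero>"
 shows "el x y z:fst EG"
proof -
 have e: "el x y z : carrier R" by (rule el_closed[OF o assms(1-3)])
 have "el x y z\<otimes>a = x" "el x y z\<otimes>b = y" "el x y z \<otimes> c = z"
  using el_proj[OF o assms(1-3)] m_comm[OF e] o_facts[OF o] by simp_all
 thus ?thesis unfolding EG_vertex using e assms(4,5) o_facts[OF o] by blast
qed

lemma EG_vertex_nilp:
 assumes "x : corner a" "y : corner b" "z : corner c" "el x y z~=\<zero>" and y: "nilp y" "b~=\<zero>"
 shows "el x y z:fst EG"
proof -
 have e: "el x y z : carrier R" by (rule el_closed[OF o assms(1-3)])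
 have b: "idem b" using o_facts[OF o] by simp
 have "corner b~={\<zero>}" using corner_unit[OF b] y(2) by blast
 from nilp_meets[OF cornerD(1)[OF assms(2)] y(1) corner_ideal[OF b] this]
 obtain w where w: "w : corner b" "w~=\<zero>" "y\<otimes>w = \<zero>" .
 have xw: "x\<otimes>w = \<zero>" "z\<otimes>w = \<zero>" using orth_prods[OF o assms(1) w(1) assms(3)] by auto
 have "el x y z\<otimes>w = \<zero>" unfolding el_def using w xw assms(1-3) cornerD(1) by (simp add: l_distr)
 thus ?thesis unfolding EG_vertex using e assms(4) w cornerD(1) by blast
qed

lemma el_prod_zero:
 assumes "x : corner a" "y : corner b" "z : corner c" "x' : corner a" "y' : corner b" "z' : corner c"
  and z: "el x y z\<otimes>el x' y' z' = \<zero>"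
 shows "x\<otimes>x' = \<zero>" "y\<otimes>y' = \<zero>" "z\<otimes>z' = \<zero>"
 using z[unfolded el_mult[OF o assms(1-6)]] o_facts[OF o] el_eq_zero[OF o corner_closed(1)[OF _ assms(1,4)]
  corner_closed(1)[OF _ assms(2,5)] corner_closed(1)[OF _ assms(3,6)]] by auto

lemma EG_vertexE:
 assumes v: "v:fst EG"
 obtains x y z x' y' z' where "x : corner a" "y : corner b" "z : corner c" "v = el x y z"
  "x' : corner a" "y' : corner b" "z' : corner c" "x\<otimes>x' = \<zero>" "y\<otimes>y' = \<zero>" "z\<otimes>z' = \<zero>"
  "~(x = \<zero> & y = \<zero> & z = \<zero>)" "~(x' = \<zero> & y' = \<zero> & z' = \<zero>)"
proof -
 obtain w where w: "v : carrier R" "v~=\<zero>" "w : carrier R" "w~=\<zero>" "v\<otimes>w = \<zero>" using v unfolding EG_vertex by auto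
 obtain x y z where xy: "x : corner a" "y : corner b" "z : corner c" "v = el x y z" by (rule el_cases[OF o w(1)])
 obtain x' y' z' where xy': "x' : corner a" "y' : corner b" "z' : corner c" "w = el x' y' z'" by (rule el_cases[OF o w(3)])
 show ?thesis using that[OF xy xy'(1-3)] el_prod_zero[OF xy(1-3) xy'(1-3)] w xy(4) xy'(4) el_zero[OF o] by auto
qed

end

lemma nilp_minus: "x : carrier R ==> nilp x ==> nilp (\<ominus>x)"
 using nilp_mult[of x "\<ominus>\<one>"] by (simp add: r_minus)

lemma idem_not_nilp_add:
 assumes "idem b" "b~=\<zero>" "n : carrier R" "nilp n"
 shows "~nilp (b\<oplus>n)"
proof
 assume bn: "nilp (b\<oplus>n)"
 have "nilp ((b\<oplus>n)\<oplus>\<ominus> n)" by (rule nilp_add[OF _ bn _ nilp_minus]) (use assms in auto)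
 moreover have "(b\<oplus>n)\<oplus>\<ominus> n = b" using assms by (simp add: a_assoc r_neg)
 ultimately show False using nilp_idem[OF assms(1)] assms(2) by simp
qed

text \<open>A nilpotent element is adjacent to all other vertices, so it can be the hub of a complete tripartite graph
with parts of sizes 1, 2 and 4. The other two parts consist of elements whose component in the corner of \<open>a\<close> is zero and
of elements whose component in the corner of \<open>b\<close> is nilpotent. These parts are
large enough unless both corners are as small as possible, of orders 2 and 4.\<close>

lemma nilp_genus:
 assumes o: "orth3 a b \<zero>" and ab: "a~=\<zero>" "b~=\<zero>" and n: "n : corner b" "n~=\<zero>" "nilp n"
 shows "~LG_on 2 | LG_on 1"
proof -
 note F = o_facts[OF o]
 have cn: "n : carrier R" using cornerD n by blast
 have za: "\<zero> : corner a" "\<zero> : corner b" "\<zero> : corner \<zero>" "a : corner a" "b : corner b"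
  using zero_corners[OF o] corner_unit F by auto
 define E where "E x y = el x y \<zero>" for x y
 have Eeq: "E x y = E x' y' \<longleftrightarrow> x = x' & y = y'" if "x : corner a" "y : corner b" "x' : corner a" "y' : corner b" for x y x' y'
  unfolding E_def using el_eq[OF o that(1,2) za(3) that(3,4) za(3)] by simp
 have E0: "E x y = \<zero> \<longleftrightarrow> x = \<zero> & y = \<zero>" if "x : corner a" "y : corner b" for x y
  unfolding E_def using el_eq_zero[OF o that za(3)] by simp
 have Enil: "nilp (E x y\<otimes>E x' y') \<longleftrightarrow> nilp (x\<otimes>x') & nilp (y\<otimes>y')"
  if "x : corner a" "y : corner b" "x' : corner a" "y' : corner b" for x y x' y'
  unfolding E_def el_mult[OF o that(1,2) za(3) that(3,4) za(3)]
  using nilp_el[OF o corner_closed(1)[OF _ that(1,3)] corner_closed(1)[OF _ that(2,4)], of "\<zero>\<otimes>\<zero>"] F za(3) nilp_zero by simp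
 have V0: "E \<zero> y:fst EG" if "y : corner b" "y~=\<zero>" for y
  unfolding E_def by (rule EG_vertex_zero[OF o za(1) that(1) za(3)]) (insert E0[OF za(1) that(1)] that ab, auto simp: E_def)
 have Vn: "E x y:fst EG" if "x : corner a" "y : corner b" "x~=\<zero>" "nilp y" for x y
  unfolding E_def by (rule EG_vertex_nilp[OF o that(1,2) za(3)]) (insert E0[OF that(1,2)] that ab, auto simp: E_def)
 define u where "u = b\<oplus>n"
 have u: "u : corner b" unfolding u_def by (rule corner_closed(2)[OF _ za(5) n(1)]) (use F in simp)
 have u_nn: "~nilp u" unfolding u_def by (rule idem_not_nilp_add) (use F ab cn n in auto)
 have b_nn: "~nilp b" using nilp_idem[of b] F ab by blast
 have u_ne: "u~=\<zero>" "u~=n" "u~=b" "b~=n" using u_nn b_nn n nilp_zero cn F unfolding u_def by auto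
 have nil_mult: "nilp (x\<otimes>y)" "nilp (y\<otimes>x)" if "nilp x" "x : corner b" "y : corner b" for x y
  using nilp_mult[of x y] that cornerD(1) m_comm[of y x] by auto
 have clb: "x\<oplus>y : corner b" if "x : corner b" "y : corner b" for x y by (rule corner_closed(2)) (use that F in auto)
 show ?thesis
 proof (cases "EX j:corner b. nilp j & j~=\<zero> & j~=n")
  case True
  then obtain j where j: "j : corner b" "nilp j" "j~=\<zero>" "j~=n" by blast
  have cj: "j : carrier R" using cornerD j by blast
  define w where "w = b\<oplus>j"
  have w: "w : corner b" unfolding w_def by (rule clb[OF za(5) j(1)])
  have w_nn: "~nilp w" unfolding w_def by (rule idem_not_nilp_add) (use F ab cj j in auto)
  have w_ne: "w~=\<zero>" "w~=n" "w~=b" "w~=u" "w~=j" using w_nn n nilp_zero cn F j cj unfolding w_def u_def by auto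
  have jb: "j~=b" "j~=u" using j(2) b_nn u_nn by auto
  have "~LG_on 2"
  proof (rule not_drawable_124[of "E \<zero> n" "E a \<zero>" "E a n" "E \<zero> j" "E \<zero> b" "E \<zero> u" "E \<zero> w"])
   show "distinct [E \<zero> n, E a \<zero>, E a n, E \<zero> j, E \<zero> b, E \<zero> u, E \<zero> w]"
    using j w u_ne w_ne jb n ab za u by (auto simp: Eeq)
   show "{E \<zero> n, E a \<zero>, E a n, E \<zero> j, E \<zero> b, E \<zero> u, E \<zero> w}<=fst EG"
    using V0 Vn n j za ab u u_ne w w_ne nilp_zero by simp
  qed (insert j w za n u nilp_zero F cornerD(1), auto simp: Enil nil_mult)
  thus ?thesis by blast
 next
  case J: False
  have nil_b: "y = \<zero> | y = n" if "y : corner b" "nilp y" for y using J that by blast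
  have nn2: "n\<oplus>n = \<zero>"
  using nilp_add n cn nil_b clb n(2) by force
  have "n\<otimes>n = \<zero> | n\<otimes>n = n" by (rule nil_b) (use n nil_mult corner_closed(1)[of b n n] F in auto)
  hence nsq: "n\<otimes>n = \<zero>" using nilp_idem[of n] n cn by auto
  show ?thesis
  proof (cases "EX y:corner b. y~:{\<zero>, n, b, u}")
   case True
   then obtain y where y: "y : corner b" "y~=\<zero>" "y~=n" "y~=b" "y~=u" by blast
   have cy: "y : carrier R" "u : carrier R" "b : carrier R" using cornerD y u za by blast+
   define w where "w = y\<oplus>n"
   have w: "w : corner b" unfolding w_def by (rule clb[OF y(1) n(1)])
   have wn: "w\<oplus>n = y" unfolding w_def using cy cn nn2 by (simp add: a_assoc)
   have "w~=\<zero>" "w~=n" "w~=b" "w~=u"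
   using wn y cn nn2 cy unfolding u_def by (auto simp: a_assoc)
   moreover have "w~=y" using wn n(2) cy cn unfolding w_def by auto
   ultimately have w_ne: "w~=\<zero>" "w~=n" "w~=b" "w~=u" "w~=y" by auto
   have "~LG_on 2"
   proof (rule not_drawable_124[of "E \<zero> n" "E a \<zero>" "E a n" "E \<zero> b" "E \<zero> u" "E \<zero> y" "E \<zero> w"])
    show "distinct [E \<zero> n, E a \<zero>, E a n, E \<zero> b, E \<zero> u, E \<zero> y, E \<zero> w]"
     using y w u_ne w_ne n ab za u by (auto simp: Eeq)
    show "{E \<zero> n, E a \<zero>, E a n, E \<zero> b, E \<zero> u, E \<zero> y, E \<zero> w}<=fst EG"
     using V0 Vn n y za ab u u_ne w w_ne nilp_zero by simp
   qed (insert y w za n u nilp_zero F cornerD(1), auto simp: Enil nil_mult)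
   thus ?thesis by blast
  next
   case False
   hence cb: "y = \<zero> | y = n | y = b | y = u" if "y : corner b" for y using that by blast
   show ?thesis
   proof (cases "EX x:corner a. x~=\<zero> & x~=a")
    case True
    then obtain x where x: "x : corner a" "x~=\<zero>" "x~=a" by blast
    have "~LG_on 2"
    proof (rule not_drawable_124[of "E \<zero> n" "E \<zero> b" "E \<zero> u" "E a \<zero>" "E a n" "E x \<zero>" "E x n"])
     show "distinct [E \<zero> n, E \<zero> b, E \<zero> u, E a \<zero>, E a n, E x \<zero>, E x n]"
      using x u_ne n ab za u by (auto simp: Eeq)
     show "{E \<zero> n, E \<zero> b, E \<zero> u, E a \<zero>, E a n, E x \<zero>, E x n}<=fst EG"
      using V0 Vn n x za ab u u_ne nilp_zero by simp
    qed (insert x za n u nilp_zero F cornerD(1), auto simp: Enil nil_mult)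
    thus ?thesis by blast
   next
    case False
    hence ca: "x = \<zero> | x = a" if "x : corner a" for x using that by blast
    define D where "D = [(\<zero>, n), (a, \<zero>), (a, n), (\<zero>, b), (\<zero>, u)]"
    have inD: "EX p<5. v = (case D ! p of (x, y) => E x y)" if v: "v:fst EG" for v
    proof -
     obtain x y z x' y' z' where xy: "x : corner a" "y : corner b" "z : corner \<zero>" "v = el x y z"
      "x' : corner a" "y' : corner b" "z' : corner \<zero>" and pr: "x\<otimes>x' = \<zero>" "y\<otimes>y' = \<zero>"
      and ne: "~(x = \<zero> & y = \<zero> & z = \<zero>)" "~(x' = \<zero> & y' = \<zero> & z' = \<zero>)" by (rule EG_vertexE[OF o v])
     have z: "z = \<zero>" "z' = \<zero>" using xy(3,7) unfolding corner_zero by auto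
     have vE: "v = E x y" using xy z unfolding E_def by auto
     have "~(x = a & (y = b | y = u))"
     proof
      assume h: "x = a & (y = b | y = u)"
      hence x'0: "x' = \<zero>" using pr(1) cornerD[OF xy(5)] by simp
      have cy': "y' : carrier R" "b\<otimes>y' = y'" using cornerD[OF xy(6)] by auto
      have "y' = \<zero>"
      proof (cases "y = b")
       case True
       thus ?thesis using pr(2) cy' by simp
      next
       case False
       hence "y'\<oplus>n\<otimes>y' = \<zero>" using h pr(2) cy' F cn unfolding u_def by (simp add: l_distr)
       hence yn: "y' =\<ominus>(n\<otimes>y')" using cy' cn by (metis m_closed minus_equality minus_minus a_comm)
       have "nilp (n\<otimes>y')" by (rule nil_mult[OF n(3,1) xy(6)])
       hence "nilp y'" using nilp_minus[of "n\<otimes>y'"] cn cy' yn by simp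
       hence "y' = \<zero> | y' = n" using nil_b xy(6) by blast
       thus ?thesis using yn nsq by auto
      qed
      thus False using ne(2) x'0 z by simp
     qed
     hence "(x, y):set D" using ca[OF xy(1)] cb[OF xy(2)] ne(1) z unfolding D_def by auto
     then obtain p where "p < length D" "D ! p = (x, y)" unfolding in_set_conv_nth by blast
     thus ?thesis using vE unfolding D_def by (intro exI[of _ p]) simp
    qed
    hence "ALL v:fst EG. EX p. p < 5 & v = (case D ! p of (x, y) => E x y)" by (intro ballI) (rule inD)
    hence "EX f. ALL v:fst EG. f v < 5 & v = (case D ! f v of (x, y) => E x y)" by (rule bchoice)
    then obtain f where f0: "ALL v:fst EG. f v < 5 & v = (case D ! f v of (x, y) => E x y)" by (rule exE)
    note f = bspec[OF f0]
    have finj: "inj_on f (fst EG)" by (rule inj_onI) (use f in metis)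
    have "LG_on 1"
    proof (rule line_graph_from_ilg[OF drawable_W4 EG_graph_like finj])
     fix e assume "e:snd EG"
     then obtain v w where vw: "e = {v, w}" "v:fst EG" "w:fst EG" "v~=w" "nilp (v\<otimes>w)" unfolding EG_edge by blast
     have fne: "f v~=f w" using finj vw unfolding inj_on_def by blast
     have bu: "b\<otimes>u = u" "u\<otimes>b = u" "a\<otimes>a = a" using cornerD[OF u] m_comm[of u b] F by auto
     have a_nn: "~nilp a" using nilp_idem[of a] F ab by blast
     have n1: "~(f v:{1, 2} & f w:{1, 2})"
     proof
      assume "f v:{1, 2} & f w:{1, 2}"
      hence "EX y:corner b. v = E a y" "EX y:corner b. w = E a y" using f[OF vw(2)] f[OF vw(3)] za n unfolding D_def by auto
      then obtain y y' where "y : corner b" "v = E a y" "y' : corner b" "w = E a y'" by blast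
      thus False using vw(5) Enil[of a y a y'] za bu a_nn by simp
     qed
     have n2: "~(f v:{3, 4} & f w:{3, 4})"
     using f[OF vw(2)] f[OF vw(3)] fne vw(5) Enil[of \<zero> b \<zero> u] Enil[of \<zero> u \<zero> b] za u bu u_nn unfolding D_def by auto
     define i j where "i = min (f v) (f w)" and "j = max (f v) (f w)"
     have ij: "f ` e = {i, j}" unfolding vw(1) i_def j_def by (auto simp: min_def max_def)
     have f5: "f v < 5" "f w < 5" using f[OF vw(2)] f[OF vw(3)] by blast+
     have "i < j & j < 5 & ~(i = 1 & j = 2) & ~(i = 3 & j = 4)"
     proof (cases "f v < f w")
      case True
      hence "i = f v" "j = f w" unfolding i_def j_def by auto
      thus ?thesis using True f5 n1 n2 by auto
     next
      case False
      hence "i = f w" "j = f v" unfolding i_def j_def by auto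
      thus ?thesis using False fne f5 n1 n2 by auto
     qed
     moreover have "ALL i<5. ALL j<5. i < j & ~(i = 1 & j = 2) & ~(i = 3 & j = 4) --> (i, j):set g122"
      unfolding g122_def by (simp add: All_less_Suc numeral_eq_Suc)
     ultimately have "(i, j):set g122" by auto
     thus "EX (p, q):set g122. f ` e = {p, q}" using ij by blast
    qed
    thus ?thesis by blast
   qed
  qed
 qed
qed

subsection \<open>Two fields\<close>

definition two_fields :: "nat => nat => bool" where
 "two_fields m n \<longleftrightarrow> (EX a b. orth3 a b \<zero> & a~=\<zero> & b~=\<zero> & noz (corner a) & noz (corner b) & card (corner a) = m & card (corner b) = n)"

lemma two_fields_bip:
 assumes tf: "two_fields m n"
 obtains P Q where "finite P" "finite Q" "P Int Q = {}" "card P = m-1" "card Q = n-1" "fst EG<=P Un Q"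
  "!!p q. p:P ==> q:Q ==> {p, q}:snd EG" "!!e. e:snd EG ==> EX p:P. EX q:Q. e = {p, q}"
proof -
 obtain a b where ab: "orth3 a b \<zero>" "a~=\<zero>" "b~=\<zero>" "noz (corner a)" "noz (corner b)" "card (corner a) = m" "card (corner b) = n"
  using tf unfolding two_fields_def by blast
 note o = ab(1) and F = o_facts[OF ab(1)]
 have za: "\<zero> : corner a" "\<zero> : corner b" "\<zero> : corner \<zero>" using zero_corners[OF o] by auto
 have red: reduced by (rule reduced_noz[OF o ab(4,5)]) (simp add: noz_def corner_zero)
 define P Q where "P = corner a-{\<zero>}" and "Q = corner b-{\<zero>}"
 have PQ0: "p\<otimes>q = \<zero>" if "p:P" "q:Q" for p q
  using orth_prods(1)[OF o _ _ za(3)] that unfolding P_def Q_def by blast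
 have dj: "P Int Q = {}"
 proof -
  have "x = \<zero>" if "x : corner a" "x : corner b" for x
  proof -
   have "x = a\<otimes>(b\<otimes>x)" using cornerD[OF that(1)] cornerD[OF that(2)] by simp
   also have "\<dots> = (a\<otimes>b)\<otimes>x" using F(1,2) cornerD(1)[OF that(1)] by (simp add: m_assoc)
   finally show ?thesis using F cornerD(1)[OF that(1)] by simp
  qed
  thus ?thesis unfolding P_def Q_def by blast
 qed
 have V: "fst EG<=P Un Q"
 proof
  fix v assume v: "v:fst EG"
  obtain x y z x' y' z' where xy: "x : corner a" "y : corner b" "z : corner \<zero>" "v = el x y z"
   "x' : corner a" "y' : corner b" "z' : corner \<zero>" and pr: "x\<otimes>x' = \<zero>" "y\<otimes>y' = \<zero>"
   and ne: "~(x = \<zero> & y = \<zero> & z = \<zero>)" "~(x' = \<zero> & y' = \<zero> & z' = \<zero>)" by (rule EG_vertexE[OF o v])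
  have z: "z = \<zero>" "z' = \<zero>" using xy(3,7) unfolding corner_zero by auto
  have "x = \<zero> | x' = \<zero>" "y = \<zero> | y' = \<zero>" using pr ab(4,5) xy unfolding noz_def by blast+
  hence "~(x~=\<zero> & y~=\<zero>)" "~(x = \<zero> & y = \<zero>)" using ne z by auto
  moreover have "x : carrier R" "y : carrier R" using cornerD xy by blast+
  ultimately show "v:P Un Q" using xy z unfolding P_def Q_def el_def by auto
 qed
 have c: "p : carrier R" "p~=\<zero>" if "p:P Un Q" for p using that cornerD(1) unfolding P_def Q_def by auto
 show ?thesis
 proof (rule that[of P Q])
  show "finite P" "finite Q" using finite_corner unfolding P_def Q_def by auto
  show "card P = m-1" "card Q = n-1" using ab(6,7) za finite_corner unfolding P_def Q_def by simp_all
  show "{p, q}:snd EG" if "p:P" "q:Q" for p q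
   by (rule EG_edgeI) (use PQ0[OF that] c[of p] c[of q] that dj in auto)
  show "EX p:P. EX q:Q. e = {p, q}" if e: "e:snd EG" for e
  proof -
   obtain v w where vw: "e = {v, w}" "v:fst EG" "w:fst EG" "nilp (v\<otimes>w)" using e unfolding EG_edge by blast
   hence "v:P Un Q" "w:P Un Q" using V by auto
   moreover have "v\<otimes>w = \<zero>" using red vw(4) c[OF calculation(1)] c[OF calculation(2)] unfolding reduced_def by simp
   moreover have "~(v:P & w:P)" "~(v:Q & w:Q)"
    using calculation(3) ab(4,5) unfolding noz_def P_def Q_def by blast+
   ultimately show ?thesis using vw(1) by (metis Un_iff insert_commute)
  qed
 qed (rule dj, rule V)
qed

lemma two_fields_lower:
 assumes "two_fields m n" "p < m" "q < n" "drawable_on LG S"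
 shows "drawable_on (ilg (bip p q)) S"
 by (rule two_fields_bip[OF assms(1)], rule bip_from_line_graph[OF assms(4)]) (use assms(2,3) in auto)

lemma two_fields_upper:
 assumes "two_fields m n" "m<=p+1" "n<=q+1" "drawable_on (ilg (bip p q)) S"
 shows "drawable_on LG S"
 by (rule two_fields_bip[OF assms(1)], rule line_graph_from_bip[OF assms(4) EG_graph_like]) (use assms(2,3) in auto)

lemma two_fields_sym: "two_fields m n ==> two_fields n m"
 unfolding two_fields_def using orth3_perm(1) by blast

lemma two_fields_bounds:
 assumes "two_fields m n" shows "2<=m" "2<=n" "m~=6" "n~=6"
proof -
 obtain a b where ab: "orth3 a b \<zero>" "a~=\<zero>" "b~=\<zero>" "noz (corner a)" "noz (corner b)" "card (corner a) = m" "card (corner b) = n"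
  using assms unfolding two_fields_def by blast
 note F = o_facts[OF ab(1)]
 show "2<=m" "2<=n" using card_corner_ge2[of a] card_corner_ge2[of b] ab F by auto
 show "m~=6" "n~=6" using order6_not_field[OF field_cring_at[OF F(1) ab(2,4)]] order6_not_field[OF field_cring_at[OF F(2) ab(3,5)]] ab(6,7) by auto
qed

text \<open>The graphs grow with the orders, so four graphs that do not embed in the surface of genus 2 and three that
embed in the torus leave only a few pairs; there is no field of order 6.\<close>

lemma two_fields_genus:
 assumes tf: "two_fields m n" and g: "genus LG = 2" and mn: "m<=n"
 shows "m = 4 & n = 5 | m = 3 & n = 7 | m = 2 & n = 9"
proof -
 have d2: "LG_on 2" and d1: "~LG_on 1" using g unfolding genus_eq_2 by auto
 note b = two_fields_bounds[OF tf]
 note low = two_fields_lower[OF tf _ _ d2] and up = two_fields_upper[OF tf]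
 have 1: "~(1 < m & 9 < n)" using low[of 1 9] not_drawable_ok[OF count_oks(1), of 2] by auto
 have 2: "~(2 < m & 7 < n)" using low[of 2 7] not_drawable_ok[OF count_oks(2), of 2] by auto
 have 3: "~(3 < m & 6 < n)" using low[of 3 6] not_drawable_ok[OF count_oks(3), of 2] by auto
 have 4: "~(4 < m & 4 < n)" using low[of 4 4] not_drawable_ok[OF count_oks(4), of 2] by auto
 have 5: "~(m<=2 & n<=8)" using up[OF _ _ drawable_K17] d1 by auto
 have 6: "~(m<=3 & n<=5)" using up[OF _ _ drawable_K24] d1 by auto
 have 7: "~(m<=4 & n<=4)" using up[OF _ _ drawable_K33] d1 by auto
 consider "m = 2" | "m = 3" | "m = 4" | "5<=m" using b(1) by linarith
 thus ?thesis
 proof cases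
  assume "m = 2"
  thus ?thesis using 1 5 by simp
 next
  assume "m = 3"
  thus ?thesis using 2 6 b(4) by simp
 next
  assume "m = 4"
  thus ?thesis using 3 7 b(4) by simp
 next
  assume "5<=m"
  thus ?thesis using 4 mn by simp
 qed
qed

lemma two_fields_genus_2:
 assumes "two_fields 4 5 | two_fields 3 7 | two_fields 2 9"
 shows "genus LG = 2"
proof -
 have "LG_on 2 & ~LG_on 0 & ~LG_on 1"
  using assms
 proof (elim disjE)
  assume tf: "two_fields 4 5"
  have "~LG_on k" if "k<=1" for k
   using two_fields_lower[OF tf, of 3 4 "handle_surface k"] not_drawable_K34[OF that] by auto
  thus ?thesis using two_fields_upper[OF tf _ _ drawable_K34] by simp
 next
  assume tf: "two_fields 3 7"
  have "~LG_on k" if "k<=1" for k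
   using two_fields_lower[OF tf, of 2 6 "handle_surface k"] not_drawable_ok[OF count_oks(9) that] by auto
  thus ?thesis using two_fields_upper[OF tf _ _ drawable_K26] by simp
 next
  assume tf: "two_fields 2 9"
  have "~LG_on k" if "k<=1" for k
   using two_fields_lower[OF tf, of 1 8 "handle_surface k"] not_drawable_ok[OF count_oks(8) that] by auto
  thus ?thesis using two_fields_upper[OF tf _ _ drawable_K18] by simp
 qed
 thus ?thesis unfolding genus_eq_2 .
qed

subsection \<open>Three factors\<close>

lemma g224_contained:
 assumes o: "orth3 a b c" and ab: "a~=\<zero>" "b~=\<zero>" "c~=\<zero>" and c4: "4 <= card (corner c)"
 shows "~LG_on 2"
proof
 assume d: "LG_on 2"
 note F = o_facts[OF o]
 have za: "\<zero> : corner a" "\<zero> : corner b" "\<zero> : corner c" "a : corner a" "b : corner b"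
  using zero_corners[OF o] corner_unit F by auto
 have "3 <= card (corner c-{\<zero>})" using c4 za(3) finite_corner by simp
 then obtain C where "C <= corner c-{\<zero>}" "card C = 3" by (meson obtain_subset_with_card_n)
 then obtain c1 c2 c3 where c: "c1 : corner c" "c2 : corner c" "c3 : corner c" "c1~=\<zero>" "c2~=\<zero>" "c3~=\<zero>"
  "c1 ~= c2" "c1 ~= c3" "c2 ~= c3" by (auto simp: card_3_iff)
 have cc: "c1 : carrier R" "c2 : carrier R" "c3 : carrier R" using c cornerD(1) by blast+
 let ?vs = "[el a \<zero> \<zero>, el \<zero> b \<zero>, el \<zero> \<zero> c1, el \<zero> \<zero> c2, el \<zero> \<zero> c3, el a b \<zero>, el a \<zero> c1, el a \<zero> c2, el a \<zero> c3,
 el \<zero> b c1, el \<zero> b c2, el \<zero> b c3]"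
 have l: "length ?vs = 12" by simp
 have "drawable_on (ilg g224) (handle_surface 2)"
 proof (rule ilg_from_LG[OF d, where vs = ?vs])
  show "distinct ?vs" using c ab za by (simp add: el_eq[OF o])
  show "set ?vs<=fst EG" using c ab za by (auto intro!: EG_vertex_zero[OF o] simp: el_eq_zero[OF o])
  show "simple_edges (length ?vs) g224" unfolding l by code_simp
  have "list_all (%(p, q). nilp (?vs ! p\<otimes>?vs ! q)) g224"
   unfolding g224_def using c cc ab za F(1-3) by (simp add: el_mult[OF o] el_zero[OF o] nilp_zero)
  thus "nilp (?vs ! p\<otimes>?vs ! q)" if "(p, q):set g224" for p q using that unfolding list_all_iff by blast
 qed
 thus False using not_drawable_ok[OF count_oks(6), of 2] by simp
qed

lemma g233_contained:
 assumes o: "orth3 a b c" and ab: "a~=\<zero>" "b~=\<zero>" "c~=\<zero>" and b3: "3 <= card (corner b)" and c3: "3 <= card (corner c)"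
 shows "~LG_on 2"
proof
 assume d: "LG_on 2"
 note F = o_facts[OF o]
 have za: "\<zero> : corner a" "\<zero> : corner b" "\<zero> : corner c" "a : corner a"
  using zero_corners[OF o] corner_unit F by auto
 have "2 <= card (corner c-{\<zero>})" "2 <= card (corner b-{\<zero>})" using b3 c3 za finite_corner by simp_all
 then obtain B C where "C <= corner c-{\<zero>}" "card C = 2" "B <= corner b-{\<zero>}" "card B = 2" by (meson obtain_subset_with_card_n)
 then obtain b1 b2 c1 c2 where c: "c1 : corner c" "c2 : corner c" "c1~=\<zero>" "c2~=\<zero>" "c1 ~= c2"
  "b1 : corner b" "b2 : corner b" "b1~=\<zero>" "b2~=\<zero>" "b1~=b2" by (auto simp: card_2_iff)
 have cc: "c1 : carrier R" "c2 : carrier R" "b1 : carrier R" "b2 : carrier R" using c cornerD(1) by blast+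
 let ?vs = "[el a \<zero> \<zero>, el \<zero> b1 \<zero>, el \<zero> b2 \<zero>, el \<zero> \<zero> c1, el \<zero> \<zero> c2, el a b1 \<zero>, el a b2 \<zero>, el a \<zero> c1, el a \<zero> c2,
 el \<zero> b1 c1, el \<zero> b1 c2, el \<zero> b2 c1, el \<zero> b2 c2]"
 have l: "length ?vs = 13" by simp
 have "drawable_on (ilg g233) (handle_surface 2)"
 proof (rule ilg_from_LG[OF d, where vs = ?vs])
  show "distinct ?vs" using c ab za by (simp add: el_eq[OF o])
  show "set ?vs<=fst EG" using c ab za by (auto intro!: EG_vertex_zero[OF o] simp: el_eq_zero[OF o])
  show "simple_edges (length ?vs) g233" unfolding l by code_simp
  have "list_all (%(p, q). nilp (?vs ! p\<otimes>?vs ! q)) g233"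
   unfolding g233_def using c cc ab za F(1-3) by (simp add: el_mult[OF o] el_zero[OF o] nilp_zero)
  thus "nilp (?vs ! p\<otimes>?vs ! q)" if "(p, q):set g233" for p q using that unfolding list_all_iff by blast
 qed
 thus False using not_drawable_ok[OF count_oks(7), of 2] by simp
qed

text \<open>The edges at the vertices \<open>a\<close> and \<open>b\<close> contain the double star.\<close>

lemma dstar_contained:
 assumes o: "orth3 a b c" and ab: "a~=\<zero>" "b~=\<zero>" "c~=\<zero>" and c3: "3 <= card (corner c)" and k: "k<=1"
 shows "~LG_on k"
proof
 assume d: "LG_on k"
 note F = o_facts[OF o]
 have za: "\<zero> : corner a" "\<zero> : corner b" "\<zero> : corner c" "a : corner a" "b : corner b"
  using zero_corners[OF o] corner_unit F by auto
 have "2 <= card (corner c-{\<zero>})" using c3 za finite_corner by simp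
 then obtain C where "C <= corner c-{\<zero>}" "card C = 2" by (meson obtain_subset_with_card_n)
 then obtain c1 c2 where c: "c1 : corner c" "c2 : corner c" "c1~=\<zero>" "c2~=\<zero>" "c1 ~= c2" by (auto simp: card_2_iff)
 have cc: "c1 : carrier R" "c2 : carrier R" using c cornerD(1) by blast+
 let ?vs = "[el a \<zero> \<zero>, el \<zero> b \<zero>, el \<zero> \<zero> c1, el \<zero> \<zero> c2, el \<zero> b c1, el \<zero> b c2, el \<zero> \<zero> c1, el \<zero> \<zero> c2, el a \<zero> c1, el a \<zero> c2]"
 have V: "set ?vs<=fst EG" using c ab za by (auto intro!: EG_vertex_zero[OF o] simp: el_eq_zero[OF o])
 have e: "list_all (%(p, q). ?vs ! p~=?vs ! q & nilp (?vs ! p\<otimes>?vs ! q)) dstar"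
  unfolding dstar_def using c cc ab za F(1-3) by (simp add: el_mult[OF o] el_eq[OF o] el_zero[OF o] nilp_zero)
 have ln: "length dstar = 9" "length ?vs = 10" by (simp_all add: dstar_def)
 have bound: "list_all (%(p, q). p < 10 & q < 10) dstar" by code_simp
 have "drawable_on (ilg dstar) (handle_surface k)"
 proof (rule ilg_from_line_graph[OF d, where g = "%i. ?vs ! i"])
  show "{?vs ! fst (dstar ! i), ?vs ! snd (dstar ! i)}:snd EG" if i: "i < length dstar" for i
  proof -
   have b: "fst (dstar ! i) < length ?vs" "snd (dstar ! i) < length ?vs"
    using bound nth_mem[OF i] unfolding ln(2) list_all_iff by (auto simp: split_beta)
   have "?vs ! fst (dstar ! i):fst EG" "?vs ! snd (dstar ! i):fst EG" using subsetD[OF V nth_mem[OF b(1)]] subsetD[OF V nth_mem[OF b(2)]] .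
   moreover have "?vs ! fst (dstar ! i)~=?vs ! snd (dstar ! i) & nilp (?vs ! fst (dstar ! i)\<otimes>?vs ! snd (dstar ! i))"
    using e nth_mem[OF i] unfolding list_all_iff split_beta by blast
   ultimately show ?thesis unfolding EG_edge by blast
  qed
  have "distinct (map (%(p, q). {?vs ! p, ?vs ! q}) dstar)"
   unfolding dstar_def using c ab za by (simp add: el_eq[OF o] doubleton_eq_iff)
  thus "inj_on (%i. {?vs ! fst (dstar ! i), ?vs ! snd (dstar ! i)}) {..<length dstar}"
   unfolding distinct_conv_nth inj_on_def by (auto simp: split_beta)
 qed
 thus False using not_drawable_dstar[OF k] by blast
qed

definition g222 :: "(nat\<times>nat) list" where
 "g222 = [(0, 1), (0, 2), (1, 2), (2, 4), (0, 7), (1, 5)]"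

text \<open>The case \<open>d = c\<close> treats a third factor of order two; the numbers 3, 6, 8, which involve \<open>d\<close>, are then not used.\<close>

lemma triple_upper:
 assumes o: "orth3 a b c" and ab: "a~=\<zero>" "b~=\<zero>" "c~=\<zero>" and red: reduced
  and ca: "corner a = {\<zero>, a}" and cb: "corner b = {\<zero>, b}" and cc: "corner c = {\<zero>, c, d}" and d: "d~=\<zero>"
  and es: "es = (if d = c then g222 else g223)" and S: "drawable_on (ilg es) S"
 shows "drawable_on LG S"
proof -
 note F = o_facts[OF o]
 have za: "\<zero> : corner a" "\<zero> : corner b" "\<zero> : corner c" "a : corner a" "b : corner b" "c : corner c" "d : corner c"
  using ca cb cc by auto
 have dc: "d : carrier R" "c\<otimes>d = d" "d \<otimes> c = d" using cornerD[OF za(7)] F m_comm[of d c] by auto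
 have dd: "d\<otimes>d~=\<zero>"
 proof
  assume "d\<otimes>d = \<zero>"
  hence "d [^] (2::nat) = \<zero>" using dc by (simp add: numeral_2_eq_2)
  thus False using red d dc(1) unfolding reduced_def nilp_def by blast
 qed
 define D where "D = [(a, \<zero>, \<zero>), (\<zero>, b, \<zero>), (\<zero>, \<zero>, c), (\<zero>, \<zero>, d), (a, b, \<zero>), (a, \<zero>, c), (a, \<zero>, d), (\<zero>, b, c), (\<zero>, b, d)]"
 define E where "E p = (case D ! p of (x, y, z) => el x y z)" for p
 have inD: "EX p. p < 9 & (d = c --> p~:{3, 6, 8}) & v = E p" if v: "v:fst EG" for v
 proof -
  obtain x y z x' y' z' where xy: "x : corner a" "y : corner b" "z : corner c" "v = el x y z"
   "x' : corner a" "y' : corner b" "z' : corner c" and pr: "x\<otimes>x' = \<zero>" "y\<otimes>y' = \<zero>" "z\<otimes>z' = \<zero>"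
   and ne: "~(x = \<zero> & y = \<zero> & z = \<zero>)" "~(x' = \<zero> & y' = \<zero> & z' = \<zero>)" by (rule EG_vertexE[OF o v])
  have "x = \<zero> | x' = \<zero>" "y = \<zero> | y' = \<zero>" using pr xy ab F(1-3) unfolding ca cb by auto
  moreover have "z = \<zero> | z' = \<zero>" using pr(3) xy(3,7) ab F(3) dc dd d unfolding cc by auto
  ultimately have "(x, y, z):set (map ((!) D) (if d = c then [0, 1, 2, 4, 5, 7] else [0..<9]))"
   using xy(1-3) ne unfolding ca cb cc D_def by (auto simp: upt_rec)
  then obtain p where p: "p:set (if d = c then [0, 1, 2, 4, 5, 7] else [0..<9])" "D ! p = (x, y, z)" by auto
  have "p < 9 & (d = c --> p~:{3, 6, 8})" using p(1) by (auto split: if_splits)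
  moreover have "v = E p" unfolding E_def p(2) using xy(4) by simp
  ultimately show ?thesis by blast
 qed
 hence "ALL v:fst EG. EX p. p < 9 & (d = c --> p~:{3, 6, 8}) & v = E p" by blast
 hence "EX f. ALL v:fst EG. f v < 9 & (d = c --> f v~:{3, 6, 8}) & v = E (f v)" by (rule bchoice)
 then obtain f where f0: "ALL v:fst EG. f v < 9 & (d = c --> f v~:{3, 6, 8}) & v = E (f v)" by (rule exE)
 note f = bspec[OF f0]
 have finj: "inj_on f (fst EG)" by (rule inj_onI) (use f in metis)
 have disj: "(p, q):set g223 | (q, p):set g223"
  if z: "E p\<otimes>E q = \<zero>" and pq: "p < 9" "q < 9" "p~=q" for p q
 proof -
  obtain x y z where P: "D ! p = (x, y, z)" by (cases "D ! p") auto
  obtain x' y' z' where Q: "D ! q = (x', y', z')" by (cases "D ! q") auto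
  have lD: "length D = 9" unfolding D_def by simp
  have Dset: "set D <= corner a \<times> corner b \<times> corner c" unfolding D_def using za by auto
  have cs: "x : corner a" "y : corner b" "z : corner c" using Dset nth_mem[of p D] pq(1) lD P by auto
  have cs': "x' : corner a" "y' : corner b" "z' : corner c" using Dset nth_mem[of q D] pq(2) lD Q by auto
  have pr: "x\<otimes>x' = \<zero>" "y\<otimes>y' = \<zero>" "z\<otimes>z' = \<zero>" using el_prod_zero[OF o cs cs'] z unfolding E_def P Q by auto
  have "~(x = a & x' = a)" "~(y = b & y' = b)" using pr ab F(1,2) by auto
  moreover have "~(z~=\<zero> & z'~=\<zero>)" using pr(3) cs(3) cs'(3) ab F(3) dc dd d unfolding cc by auto
  ultimately have N: "~(fst (D ! p) = a & fst (D ! q) = a)" "~(fst (snd (D ! p)) = b & fst (snd (D ! q)) = b)"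
   "~(snd (snd (D ! p))~=\<zero> & snd (snd (D ! q))~=\<zero>)" unfolding P Q by auto
  have p9: "p = 0 | p = 1 | p = 2 | p = 3 | p = 4 | p = 5 | p = 6 | p = 7 | p = 8" using pq(1) by linarith
  have q9: "q = 0 | q = 1 | q = 2 | q = 3 | q = 4 | q = 5 | q = 6 | q = 7 | q = 8" using pq(2) by linarith
  show ?thesis using p9 q9 N pq(3) ab d unfolding D_def g223_def by (elim disjE) simp_all
 qed
 show ?thesis
 proof (rule line_graph_from_ilg[OF S EG_graph_like finj])
  fix e assume "e:snd EG"
  then obtain v w where vw: "e = {v, w}" "v:fst EG" "w:fst EG" "v~=w" "nilp (v\<otimes>w)" unfolding EG_edge by blast
  have fne: "f v~=f w" using finj vw unfolding inj_on_def by blast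
  have "v : carrier R" "w : carrier R" using vw unfolding EG_vertex by auto
  hence "v\<otimes>w = \<zero>" using red vw(5) unfolding reduced_def by simp
  hence "E (f v)\<otimes>E (f w) = \<zero>" using f[OF vw(2)] f[OF vw(3)] by metis
  hence g: "(f v, f w):set g223 | (f w, f v):set g223" using disj fne f[OF vw(2), THEN conjunct1] f[OF vw(3), THEN conjunct1] by blast
  have 6: "(p, q):set g222" if "(p, q):set g223" "p~:{3, 6, 8}" "q~:{3, 6, 8}" for p q
   using that unfolding g222_def g223_def by auto
  have "(f v, f w):set es | (f w, f v):set es"
  proof (cases "d = c")
   case True
   hence "f v~:{3, 6, 8}" "f w~:{3, 6, 8}" using f[OF vw(2)] f[OF vw(3)] by blast+
   thus ?thesis using g 6 es True by auto
  qed (use g es in simp)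
  thus "EX (p, q):set es. f ` e = {p, q}"
  unfolding vw(1) by auto
 qed
qed

definition three_fields :: bool where
 "three_fields \<longleftrightarrow> (EX a b c. orth3 a b c & card (corner a) = 2 & card (corner b) = 2 & card (corner c) = 3)"

lemma noz_prime:
 assumes e: "idem e" and p: "Factorial_Ring.prime (card (corner e))"
 shows "noz (corner e)"
proof -
 let ?Z = "residue_ring (int (card (corner e)))"
 note rf = residue_ring_facts[OF prime_gt_1_nat[OF p]]
 obtain h where h: "h:ring_iso ?Z (cring_at e)" using prime_order_iso[OF cring_cring_at[OF e] p] by auto
 have b: "bij_betw h (carrier ?Z) (corner e)" using ring_iso_memE(5)[OF h] by simp
 have h0: "h 0 = \<zero>" using ring_hom_zero[of h ?Z "cring_at e"] h rf(1,3) cring_cring_at[OF e] unfolding ring_iso_def by (auto dest: cring.axioms(1))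
 have z: "0 : carrier ?Z" using cring.cring_simprules(2)[OF rf(1)] rf(3) by simp
 show ?thesis
  unfolding noz_def
 proof (intro ballI impI)
  fix x y assume "x : corner e" "y : corner e" and xy: "x\<otimes>y = \<zero>"
  then obtain i j where ij: "i : carrier ?Z" "x = h i" "j : carrier ?Z" "y = h j" using b unfolding bij_betw_def by blast
  have "h (i\<otimes>\<^bsub>?Z\<^esub> j) = h 0" using ring_iso_memE(2)[OF h ij(1,3)] ij xy h0 by simp
  hence "i\<otimes>\<^bsub>?Z\<^esub> j = 0" using b ij z cring.cring_simprules(5)[OF rf(1)] unfolding bij_betw_def inj_on_def by blast
  thus "x = \<zero> | y = \<zero>" using residue_ring_noz[OF p ij(1,3)] rf(3) ij h0 by auto
 qed
qed

lemma card2_corner: assumes "idem e" "e~=\<zero>" "card (corner e) = 2" shows "corner e = {\<zero>, e}"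
proof -
 have "{\<zero>, e} <= corner e" using assms unfolding corner_def by auto
 thus ?thesis using card_subset_eq[OF finite_corner, of "{\<zero>, e}" e] assms by simp
qed

lemma card3_corner: assumes "idem e" "e~=\<zero>" "card (corner e) = 3"
 obtains d where "d~=\<zero>" "d~=e" "corner e = {\<zero>, e, d}"
proof -
 have s: "{\<zero>, e} <= corner e" using assms unfolding corner_def by auto
 have "card (corner e-{\<zero>, e}) = 1" using s assms by (simp add: card_Diff_subset)
 then obtain d where "corner e-{\<zero>, e} = {d}" by (rule card_1_singletonE)
 thus ?thesis using that[of d] s by auto
qed

lemma three_fields_genus_2: assumes three_fields shows "genus LG = 2"
proof -
 obtain a b c where o: "orth3 a b c" and k: "card (corner a) = 2" "card (corner b) = 2" "card (corner c) = 3"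
  using assms unfolding three_fields_def by blast
 have nz: "a~=\<zero>" "b~=\<zero>" "c~=\<zero>" using k corner_zero by auto
 note F = o_facts[OF o]
 have z: "noz (corner a)" "noz (corner b)" "noz (corner c)" by (rule noz_prime; use F k in simp)+
 obtain d where d: "d~=\<zero>" "d ~= c" "corner c = {\<zero>, c, d}" by (rule card3_corner[OF F(3) nz(3) k(3)])
 have "LG_on 2"
  by (rule triple_upper[OF o nz reduced_noz[OF o z] card2_corner[OF F(1) nz(1) k(1)] card2_corner[OF F(2) nz(2) k(2)] d(3,1) refl])
   (use d(2) drawable_G11 in simp)
 moreover have "~LG_on k" if "k<=1" for k by (rule dstar_contained[OF o nz _ that]) (use k in simp)
 ultimately show ?thesis unfolding genus_eq_2 by simp
qed

lemma three_factors_genus: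
 assumes o: "orth3 a b c" and nz: "a~=\<zero>" "b~=\<zero>" "c~=\<zero>" and r: reduced and g: "genus LG = 2"
 shows three_fields
proof -
 have d2: "LG_on 2" and d1: "~LG_on 1" using g unfolding genus_eq_2 by auto
 note F = o_facts[OF o]
 have p: "orth3 b a c" "orth3 a c b" "orth3 c a b" "orth3 b c a" using orth3_perm o by blast+
 have "~4 <= card (corner a)" "~4 <= card (corner b)" "~4 <= card (corner c)"
  using g224_contained[OF o nz] g224_contained[OF p(2) nz(1,3,2)] g224_contained[OF p(4) nz(2,3,1)] d2 by blast+
 hence le3: "card (corner a)<=3" "card (corner b)<=3" "card (corner c)<=3" by linarith+
 have ge2: "2 <= card (corner a)" "2 <= card (corner b)" "2 <= card (corner c)" using card_corner_ge2 F nz by auto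
 have two: "~(3 <= card (corner b) & 3 <= card (corner c))" "~(3 <= card (corner a) & 3 <= card (corner c))" "~(3 <= card (corner a) & 3 <= card (corner b))"
  using g233_contained[OF o nz] g233_contained[OF p(1) nz(2,1,3)] g233_contained[OF p(3) nz(3,1,2)] d2 by auto
 have "~(card (corner a) = 2 & card (corner b) = 2 & card (corner c) = 2)"
 proof
  assume k: "card (corner a) = 2 & card (corner b) = 2 & card (corner c) = 2"
  have "LG_on 1"
   by (rule triple_upper[OF o nz r card2_corner[OF F(1) nz(1)] card2_corner[OF F(2) nz(2)], of c g222])
    (insert k card2_corner[OF F(3) nz(3)] nz drawable_few_edges[of g222], simp_all add: g222_def)
  thus False using d1 by blast
 qed
 moreover have "card (corner a) = 2 | card (corner a) = 3" "card (corner b) = 2 | card (corner b) = 3" "card (corner c) = 2 | card (corner c) = 3"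
  using le3 ge2 by linarith+
 moreover have two3: "card (corner b) = 3 ==> card (corner c) = 3 ==> False" "card (corner a) = 3 ==> card (corner c) = 3 ==> False"
  "card (corner a) = 3 ==> card (corner b) = 3 ==> False" using two by simp_all
 ultimately consider "card (corner a) = 2" "card (corner b) = 2" "card (corner c) = 3" | "card (corner a) = 2" "card (corner c) = 2" "card (corner b) = 3"
  | "card (corner b) = 2" "card (corner c) = 2" "card (corner a) = 3"
  using two3 by blast
 thus ?thesis
 proof cases
  case 1
  thus ?thesis unfolding three_fields_def using o by blast
 next
  case 2
  thus ?thesis unfolding three_fields_def using p(2) by blast
 next
  case 3
  thus ?thesis unfolding three_fields_def using p(4) by blast
 qed
qed

text \<open>The ring is reduced by \<open>nilp_genus\<close>. A nontrivial idempotent gives two corners; both are fields, or one of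
them splits again and there are three factors.\<close>

theorem genus_LG_eq_2:
 assumes nl: "~local_ring R"
 shows "genus LG = 2 \<longleftrightarrow> two_fields 4 5 | two_fields 3 7 | two_fields 2 9 | three_fields"
proof
 assume "two_fields 4 5 | two_fields 3 7 | two_fields 2 9 | three_fields"
 thus "genus LG = 2" using two_fields_genus_2 three_fields_genus_2 by blast
next
 assume g: "genus LG = 2"
 have d2: "LG_on 2" and d1: "~LG_on 1" using g unfolding genus_eq_2 by auto
 obtain e where e: "idem e" "e~=\<zero>" "e~=\<one>" using nonlocal_idem[OF nl] by blast
 define e' where "e' = \<one>\<ominus>e"
 have o: "orth3 e e' \<zero>" unfolding e'_def by (rule orth_pair[OF e(1)])
 note F = o_facts[OF o]
 have e'0: "e'~=\<zero>" using F(10) e by auto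
 have r: reduced
  unfolding reduced_def
 proof (intro ballI impI)
  fix n assume n: "n : carrier R" "nilp n"
  have "e\<otimes>n = \<zero>"
  using nilp_genus[OF orth3_perm(1)[OF o] e'0 e(2) cornerI[OF F(1) n(1)]] nilp_mult[OF n(1) _ n(2), of e] m_comm[OF n(1), of e] F(1) d1 d2 ccontr by auto
  moreover have "e'\<otimes>n = \<zero>"
  using nilp_genus[OF o e(2) e'0 cornerI[OF F(2) n(1)]] nilp_mult[OF n(1) _ n(2), of e'] m_comm[OF n(1), of e'] F(2) d1 d2 ccontr by auto
  ultimately show "n = \<zero>" using el_decomp[OF o n(1)] n(1) unfolding el_def by simp
 qed
 \<comment> \<open>The idempotents \<open>f\<close>, \<open>e1 - f\<close> and \<open>e2\<close> are orthogonal.\<close>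
 have split: three_fields if f: "idem f" "f : corner e1" "f~=\<zero>" "f~=e1" and o1: "orth3 e1 e2 \<zero>" "e1~=\<zero>" "e2~=\<zero>" for f e1 e2
 proof (rule three_factors_genus[OF _ f(3) _ o1(3) r g])
  note G = o_facts[OF o1(1)]
  have c: "f : carrier R" "e1 : carrier R" "e1\<otimes>e1 = e1" "e1\<otimes>f = f" "f\<otimes>e1 = f" "f\<otimes>f = f" using f G cornerD[OF f(2)] m_comm[of f e1] by auto
  have 1: "f\<otimes>(e1\<ominus>f) = \<zero>" using c by (simp add: minus_eq r_distr r_minus r_neg)
  have "(e1\<ominus>f)\<otimes>(e1\<ominus>f) = e1\<otimes>(e1\<ominus>f)\<ominus>f\<otimes>(e1\<ominus>f)" using c by (simp add: minus_eq l_distr l_minus)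
  also have "\<dots> = e1\<ominus>f" unfolding 1 using c by (simp add: minus_eq r_distr r_minus)
  finally have 2: "(e1\<ominus>f)\<otimes>(e1\<ominus>f) = e1\<ominus>f" .
  have "e1\<ominus>f : corner e1" unfolding minus_eq by (rule corner_closed(2)[OF c(2) corner_unit corner_closed(3)[OF c(2) f(2) f(2)]]) (use G in simp)
  hence 3: "f\<otimes>e2 = \<zero>" "(e1\<ominus>f)\<otimes>e2 = \<zero>" using corner_orth[of e1 e2 _ e2] corner_unit[of e2] G f(2) by auto
  have 4: "f\<oplus>(e1\<ominus>f)\<oplus>e2 = \<one>" using c G by (simp add: minus_eq a_lcomm[of f] r_neg)
  show "orth3 f (e1\<ominus>f) e2" unfolding orth3_def using f(1) c 1 2 3 4 G by simp
  show "e1\<ominus>f~=\<zero>" using f(4) c by simp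
 qed
 show "two_fields 4 5 | two_fields 3 7 | two_fields 2 9 | three_fields"
 proof (cases three_fields)
  case False
  have "noz (corner e)" using noz_or_split[OF r F(1)] split[OF _ _ _ _ o e(2) e'0] False by blast
  moreover have "noz (corner e')" using noz_or_split[OF r F(2)] split[OF _ _ _ _ orth3_perm(1)[OF o] e'0 e(2)] False by blast
  ultimately have tf: "two_fields (card (corner e)) (card (corner e'))" unfolding two_fields_def using o e(2) e'0 by blast
  show ?thesis
  proof (cases "card (corner e) <= card (corner e')")
   case True
   from two_fields_genus[OF tf g True] show ?thesis using tf by auto
  next
   case F: False
   from two_fields_genus[OF two_fields_sym[OF tf] g] show ?thesis using two_fields_sym[OF tf] F by auto
  qed
 qed simp
qed

section \<open>Products of fields\<close>

lemma two_fields_of_iso: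
 assumes i: "R \<simeq> RDirProd S T" and S: "ring S" "\<one>\<^bsub>S\<^esub>~=\<zero>\<^bsub>S\<^esub>" and T: "ring T" "\<one>\<^bsub>T\<^esub>~=\<zero>\<^bsub>T\<^esub>"
  and nS: "!!x y. x : carrier S ==> y : carrier S ==> x\<otimes>\<^bsub>S\<^esub> y = \<zero>\<^bsub>S\<^esub> ==> x = \<zero>\<^bsub>S\<^esub> | y = \<zero>\<^bsub>S\<^esub>"
  and nT: "!!x y. x : carrier T ==> y : carrier T ==> x\<otimes>\<^bsub>T\<^esub> y = \<zero>\<^bsub>T\<^esub> ==> x = \<zero>\<^bsub>T\<^esub> | y = \<zero>\<^bsub>T\<^esub>"
 shows "two_fields (card (carrier S)) (card (carrier T))"
proof -
 interpret S: ring S by (rule S(1))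
 interpret T: ring T by (rule T(1))
 let ?W = "RDirProd S T"
 have W: "ring ?W" by (rule RDirProd_ring[OF S(1) T(1)])
 obtain h where "h:ring_iso R ?W" using i unfolding is_ring_iso_def by blast
 then obtain g where g: "g:ring_iso ?W R" using ring_iso_set_sym[OF ring_axioms] by blast
 have sm: "carrier ?W = carrier S \<times> carrier T" "!!x y x' y'. (x, y)\<otimes>\<^bsub>?W\<^esub> (x', y') = (x\<otimes>\<^bsub>S\<^esub> x', y\<otimes>\<^bsub>T\<^esub> y')"
  "!!x y x' y'. (x, y)\<oplus>\<^bsub>?W\<^esub> (x', y') = (x\<oplus>\<^bsub>S\<^esub> x', y\<oplus>\<^bsub>T\<^esub> y')" "\<one>\<^bsub>?W\<^esub> = (\<one>\<^bsub>S\<^esub>, \<one>\<^bsub>T\<^esub>)" "\<zero>\<^bsub>?W\<^esub> = (\<zero>\<^bsub>S\<^esub>, \<zero>\<^bsub>T\<^esub>)"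
  by (simp_all add: RDirProd_def DirProd_def monoid.defs)
 have g0: "g (\<zero>\<^bsub>S\<^esub>, \<zero>\<^bsub>T\<^esub>) = \<zero>" using ring_hom_zero[of g ?W R] g W ring_axioms unfolding ring_iso_def sm(5) by blast
 have ginj: "inj_on g (carrier S \<times> carrier T)" using g unfolding ring_iso_def bij_betw_def sm(1) by blast
 let ?u = "(\<one>\<^bsub>S\<^esub>, \<zero>\<^bsub>T\<^esub>)" and ?v = "(\<zero>\<^bsub>S\<^esub>, \<one>\<^bsub>T\<^esub>)"
 have o: "orth3 (g ?u) (g ?v) \<zero>"
  using iso_orth3[OF g W, of ?u ?v "(\<zero>\<^bsub>S\<^esub>, \<zero>\<^bsub>T\<^esub>)"] unfolding g0 sm by simp
 have ku: "{y : carrier ?W. ?u\<otimes>\<^bsub>?W\<^esub> y = y} = carrier S\<times>{\<zero>\<^bsub>T\<^esub>}" unfolding sm(1) by (auto simp: sm(2))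
 have kv: "{y : carrier ?W. ?v\<otimes>\<^bsub>?W\<^esub> y = y} = {\<zero>\<^bsub>S\<^esub>} \<times> carrier T" unfolding sm(1) by (auto simp: sm(2))
 have u: "?u : carrier ?W" "?u\<otimes>\<^bsub>?W\<^esub> ?u = ?u" and v: "?v : carrier ?W" "?v\<otimes>\<^bsub>?W\<^esub> ?v = ?v" by (simp_all add: sm)
 have "noz (corner (g ?u))"
 proof (rule iso_corner(3)[OF g W u])
  fix x y assume xy: "x : carrier ?W" "y : carrier ?W" "?u\<otimes>\<^bsub>?W\<^esub> x = x" "?u\<otimes>\<^bsub>?W\<^esub> y = y" "x\<otimes>\<^bsub>?W\<^esub> y = \<zero>\<^bsub>?W\<^esub>"
  then obtain s t where "x = (s, \<zero>\<^bsub>T\<^esub>)" "y = (t, \<zero>\<^bsub>T\<^esub>)" "s : carrier S" "t : carrier S" using ku by blast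
  thus "x = \<zero>\<^bsub>?W\<^esub> | y = \<zero>\<^bsub>?W\<^esub>" using nS[of s t] xy(5) by (simp add: sm)
 qed
 moreover have "noz (corner (g ?v))"
 proof (rule iso_corner(3)[OF g W v])
  fix x y assume xy: "x : carrier ?W" "y : carrier ?W" "?v\<otimes>\<^bsub>?W\<^esub> x = x" "?v\<otimes>\<^bsub>?W\<^esub> y = y" "x\<otimes>\<^bsub>?W\<^esub> y = \<zero>\<^bsub>?W\<^esub>"
  then obtain s t where "x = (\<zero>\<^bsub>S\<^esub>, s)" "y = (\<zero>\<^bsub>S\<^esub>, t)" "s : carrier T" "t : carrier T" using kv by blast
  thus "x = \<zero>\<^bsub>?W\<^esub> | y = \<zero>\<^bsub>?W\<^esub>" using nT[of s t] xy(5) by (simp add: sm)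
 qed
 moreover have "card (corner (g ?u)) = card (carrier S)" "card (corner (g ?v)) = card (carrier T)"
  using iso_corner(2)[OF g W u] iso_corner(2)[OF g W v] unfolding ku kv by (simp_all add: card_cartesian_product)
 moreover have "g ?u~=\<zero>" "g ?v~=\<zero>"
  unfolding g0[symmetric] using inj_on_eq_iff[OF ginj, of ?u "(\<zero>\<^bsub>S\<^esub>, \<zero>\<^bsub>T\<^esub>)"] inj_on_eq_iff[OF ginj, of ?v "(\<zero>\<^bsub>S\<^esub>, \<zero>\<^bsub>T\<^esub>)"] S T by auto
 ultimately show ?thesis unfolding two_fields_def using o by blast
qed

lemma three_fields_of_iso:
 assumes i: "R \<simeq> RDirProd (residue_ring 2) (RDirProd (residue_ring 2) (residue_ring 3))"
 shows three_fields
proof -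
 let ?A = "residue_ring 2" and ?B = "residue_ring 3"
 let ?W = "RDirProd ?A (RDirProd ?A ?B)"
 have AB: "cring ?A" "cring ?B" using residue_ring_facts(1)[of 2] residue_ring_facts(1)[of 3] by simp_all
 have W: "ring ?W" by (intro RDirProd_ring cring.axioms(1) AB)
 obtain h where "h:ring_iso R ?W" using i unfolding is_ring_iso_def by blast
 then obtain g where g: "g:ring_iso ?W R" using ring_iso_set_sym[OF ring_axioms] by blast
 have cr: "{0..1::int} = {0, 1}" "{0..2::int} = {0, 1, 2}" by auto
 have cW: "carrier ?W = {0, 1}\<times>{0, 1}\<times>{0, 1, 2}" by (simp add: RDirProd_def DirProd_def monoid.defs residue_ring_def cr)
 have sm: "!!x y z x' y' z'. (x, y, z)\<otimes>\<^bsub>?W\<^esub> (x', y', z') = (x * x' mod 2, y * y' mod 2, z * z' mod 3)"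
  "!!x y z x' y' z'. (x, y, z)\<oplus>\<^bsub>?W\<^esub> (x', y', z') = ((x+x') mod 2, (y+y') mod 2, (z+z') mod 3)" "\<one>\<^bsub>?W\<^esub> = (1, 1, 1)" "\<zero>\<^bsub>?W\<^esub> = (0, 0, 0)"
  by (simp_all add: RDirProd_def DirProd_def monoid.defs residue_ring_def)
 let ?u = "(1, 0, 0)" and ?v = "(0, 1, 0)" and ?w = "(0, 0, 1)"
 have o: "orth3 (g ?u) (g ?v) (g ?w)" by (rule iso_orth3[OF g W]) (simp_all add: sm cW)
 have k: "{y : carrier ?W. ?u\<otimes>\<^bsub>?W\<^esub> y = y} = {(0, 0, 0), (1, 0, 0)}" "{y : carrier ?W. ?v\<otimes>\<^bsub>?W\<^esub> y = y} = {(0, 0, 0), (0, 1, 0)}"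
  "{y : carrier ?W. ?w\<otimes>\<^bsub>?W\<^esub> y = y} = {(0, 0, 0), (0, 0, 1), (0, 0, 2)}" unfolding cW by (auto simp: sm)
 have u: "?u : carrier ?W" "?u\<otimes>\<^bsub>?W\<^esub> ?u = ?u" and v: "?v : carrier ?W" "?v\<otimes>\<^bsub>?W\<^esub> ?v = ?v" and w: "?w : carrier ?W" "?w\<otimes>\<^bsub>?W\<^esub> ?w = ?w"
  by (simp_all add: sm cW)
 have "card (corner (g ?u)) = 2" "card (corner (g ?v)) = 2" "card (corner (g ?w)) = 3"
  using iso_corner(2)[OF g W u] iso_corner(2)[OF g W v] iso_corner(2)[OF g W w] unfolding k by simp_all
 thus ?thesis unfolding three_fields_def using o by blast
qed

lemma cring_at_prime:
 assumes "idem e" "Factorial_Ring.prime p" "card (corner e) = p"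
 obtains h where "h:ring_iso (cring_at e) (residue_ring (int p))"
proof -
 obtain g where g: "g:ring_iso (residue_ring (int p)) (cring_at e)" using prime_order_iso[OF cring_cring_at[OF assms(1)] assms(2)] assms(3) by auto
 have "ring (residue_ring (int p))" using residue_ring_facts(1)[OF prime_gt_1_nat[OF assms(2)]] by (rule cring.axioms(1))
 from ring_iso_set_sym[OF this g] show ?thesis by (rule that)
qed

lemma iso_of_two_fields:
 assumes tf: "two_fields m p"
 shows "Factorial_Ring.prime p ==> EX K :: int ring. is_finite_field m K & R \<simeq> RDirProd K (residue_ring (int p))"
  "Factorial_Ring.prime m ==> EX K :: int ring. is_finite_field p K & R \<simeq> RDirProd (residue_ring (int m)) K"
  "Factorial_Ring.prime m ==> Factorial_Ring.prime p ==> R \<simeq> RDirProd (residue_ring (int m)) (residue_ring (int p))"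
proof -
 obtain a b where ab: "orth3 a b \<zero>" "a~=\<zero>" "b~=\<zero>" "noz (corner a)" "noz (corner b)" "card (corner a) = m" "card (corner b) = p"
  using tf unfolding two_fields_def by blast
 note F = o_facts[OF ab(1)]
 note s = split2_iso[OF ab(1)]
 have iso: "R \<simeq> RDirProd S T" if "f:ring_iso (cring_at a) S" "g:ring_iso (cring_at b) T" for f g S T
  using ring_iso_set_trans[OF s RDirProd_iso6[OF that]] unfolding is_ring_iso_def by blast
 obtain K1 :: "int ring" and k1 where K1: "is_finite_field m K1" "k1:ring_iso (cring_at a) K1"
  using field_as_int_ring[OF field_cring_at[OF F(1) ab(2,4)], of m] finite_corner ab(6) by auto
 obtain K2 :: "int ring" and k2 where K2: "is_finite_field p K2" "k2:ring_iso (cring_at b) K2"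
  using field_as_int_ring[OF field_cring_at[OF F(2) ab(3,5)], of p] finite_corner ab(7) by auto
 show "EX K :: int ring. is_finite_field m K & R \<simeq> RDirProd K (residue_ring (int p))" if p: "Factorial_Ring.prime p"
 using iso[OF K1(2)] K1(1) cring_at_prime[OF F(2) p ab(7)] by blast
 show "EX K :: int ring. is_finite_field p K & R \<simeq> RDirProd (residue_ring (int m)) K" if m: "Factorial_Ring.prime m"
 using iso[OF _ K2(2)] K2(1) cring_at_prime[OF F(1) m ab(6)] by blast
 show "R \<simeq> RDirProd (residue_ring (int m)) (residue_ring (int p))" if m: "Factorial_Ring.prime m" and p: "Factorial_Ring.prime p"
 proof -
  obtain h where h: "h:ring_iso (cring_at a) (residue_ring (int m))" by (rule cring_at_prime[OF F(1) m ab(6)])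
  obtain h' where "h':ring_iso (cring_at b) (residue_ring (int p))" by (rule cring_at_prime[OF F(2) p ab(7)])
  thus ?thesis using iso[OF h] by blast
 qed
qed

lemma iso_of_three_fields:
 assumes three_fields
 shows "R \<simeq> RDirProd (residue_ring 2) (RDirProd (residue_ring 2) (residue_ring 3))"
proof -
 obtain a b c where o: "orth3 a b c" and k: "card (corner a) = 2" "card (corner b) = 2" "card (corner c) = 3" using assms unfolding three_fields_def by blast
 note F = o_facts[OF o]
 obtain f where f: "f:ring_iso (cring_at a) (residue_ring 2)" using cring_at_prime[OF F(1) two_is_prime_nat k(1)] by auto
 obtain g where g: "g:ring_iso (cring_at b) (residue_ring 2)" using cring_at_prime[OF F(2) two_is_prime_nat k(2)] by auto
 have "Factorial_Ring.prime (3::nat)" by simp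
 then obtain h where h: "h:ring_iso (cring_at c) (residue_ring 3)" using cring_at_prime[OF F(3) _ k(3)] by auto
 show ?thesis using ring_iso_set_trans[OF split3_iso[OF o] RDirProd_iso6[OF f RDirProd_iso6[OF g h]]] unfolding is_ring_iso_def by blast
qed

lemma two_fields_residue:
 assumes "R \<simeq> RDirProd S (residue_ring (int p))" "field S" "Factorial_Ring.prime p"
 shows "two_fields (card (carrier S)) p"
proof -
 interpret S: field S by (rule assms(2))
 note rf = residue_ring_facts[OF prime_gt_1_nat[OF assms(3)]]
 have "two_fields (card (carrier S)) (card (carrier (residue_ring (int p))))"
  by (rule two_fields_of_iso[OF assms(1) S.ring_axioms _ cring.axioms(1)[OF rf(1)]])
   (use S.integral residue_ring_noz[OF assms(3)] rf(3,4) in auto)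
 thus ?thesis unfolding rf(2) .
qed

theorem genus_2_classification:
 assumes nl: "~local_ring R"
 shows "genus LG = 2 \<longleftrightarrow>
 (EX F4 :: int ring. is_finite_field 4 F4 & R \<simeq> RDirProd F4 (residue_ring 5)) |
 R \<simeq> RDirProd (residue_ring 3) (residue_ring 7) |
 (EX F9 :: int ring. is_finite_field 9 F9 & R \<simeq> RDirProd (residue_ring 2) F9) |
 R \<simeq> RDirProd (residue_ring 2) (RDirProd (residue_ring 2) (residue_ring 3))"
proof -
 have pr: "Factorial_Ring.prime (2::nat)" "Factorial_Ring.prime (3::nat)" "Factorial_Ring.prime (5::nat)" "Factorial_Ring.prime (7::nat)" by simp_all
 have "two_fields 4 5 \<longleftrightarrow> (EX F4 :: int ring. is_finite_field 4 F4 & R \<simeq> RDirProd F4 (residue_ring 5))"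
  using iso_of_two_fields(1)[of 4 5] two_fields_residue[of _ 5] pr unfolding is_finite_field_def by fastforce
 moreover have "two_fields 3 7 \<longleftrightarrow> R \<simeq> RDirProd (residue_ring 3) (residue_ring 7)"
  using iso_of_two_fields(3)[of 3 7] two_fields_residue[of "residue_ring 3" 7] residue_field[of 3] residue_ring_facts(2)[of 3] pr by auto
 moreover have "two_fields 2 9 \<longleftrightarrow> (EX F9 :: int ring. is_finite_field 9 F9 & R \<simeq> RDirProd (residue_ring 2) F9)"
 proof
  assume "two_fields 2 9"
  from iso_of_two_fields(2)[OF this pr(1)] show "EX F9 :: int ring. is_finite_field 9 F9 & R \<simeq> RDirProd (residue_ring 2) F9" by simp
 next
  assume "EX F9 :: int ring. is_finite_field 9 F9 & R \<simeq> RDirProd (residue_ring 2) F9"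
  then obtain K :: "int ring" where K: "field K" "card (carrier K) = 9" "R \<simeq> RDirProd (residue_ring 2) K" unfolding is_finite_field_def by blast
  have "(%(x, y). (y, x)):ring_iso (RDirProd (residue_ring 2) K) (RDirProd K (residue_ring 2))" by (rule RDirProd_iso1)
  hence "R \<simeq> RDirProd K (residue_ring (int 2))" using K(3) ring_iso_set_trans unfolding is_ring_iso_def by fastforce
  from two_fields_residue[OF this K(1) pr(1)] show "two_fields 2 9" unfolding K(2) by (rule two_fields_sym)
 qed
 moreover have "three_fields \<longleftrightarrow> R \<simeq> RDirProd (residue_ring 2) (RDirProd (residue_ring 2) (residue_ring 3))"
  using three_fields_of_iso iso_of_three_fields by blast
 ultimately show ?thesis unfolding genus_LG_eq_2[OF nl] by simp
qed

end

theorem theorem4p7: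
  fixes A :: "('a, 'b) ring_scheme"
  assumes "cring A"
    and "\<one>\<^bsub>A\<^esub> \<noteq> \<zero>\<^bsub>A\<^esub>"
    and "finite (carrier A)"
    and "\<not> local_ring A"
  shows "genus (line_graph (essential_graph A)) = 2 \<longleftrightarrow>
      (\<exists>F4 :: int ring. is_finite_field 4 F4 \<and> A \<simeq> RDirProd F4 (residue_ring 5)) \<or>
      A \<simeq> RDirProd (residue_ring 3) (residue_ring 7) \<or>
      (\<exists>F9 :: int ring. is_finite_field 9 F9 \<and> A \<simeq> RDirProd (residue_ring 2) F9) \<or>
      A \<simeq> RDirProd (residue_ring 2) (RDirProd (residue_ring 2) (residue_ring 3))"
proof -
 interpret finite_cring A
  by (intro finite_cring.intro finite_cring_axioms.intro) (use assms in auto)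
 show ?thesis by (rule genus_2_classification[OF assms(4)])
qed

end
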